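(* Let $(\mathcal{B},\mathcal{L},\theta,\mathcal{I}_\alpha;\mathcal{J})$ be a relative generalized Boolean dynamical system and let $I$ be an ideal of $C^*(\mathcal{B},\mathcal{L},\theta,\mathcal{I}_\alpha;\mathcal{J})$. Then there is a surjective $*$-homomorphism $$\phi_I:C^*(\mathcal{B}/\mathcal{H}_I,\mathcal{L},\theta,[\mathcal{I}_\alpha];[\mathcal{S}_I])\to C^*(\mathcal{B},\mathcal{L},\theta,\mathcal{I}_\alpha;\mathcal{J})/I$$ such that $\phi_I(p_{[A]})=p_A+I$ for all $A\in\mathcal{B}$ and $\phi_I(s_{\alpha,[B]})=s_{\alpha,B}+I$ for all $\alpha\in\mathcal{L}$, $B\in\mathcal{I}_\alpha$. Moreover, the following are equivalent: (1) $I$ is gauge-invariant; (2) $\phi_I$ is an isomorphism; (3) $I=I_{(\mathcal{H}_I,\mathcal{S}_I)}$.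
   Context: A Boolean algebra $\mathcal{B}$ (not necessarily unital) is a distributive lattice $(\mathcal{B},\cap,\cup)$ with least element $\emptyset$ and relative complements $A\setminus B$, satisfying $(A\cap B)\cup(A\setminus B)=A$ and $(A\cap B)\cap(A\setminus B)=\emptyset$. Write $A\subseteq B$ iff $A\cap B=A$. An ideal of $\mathcal{B}$ is a non-empty subset closed under finite unions and under intersection with arbitrary elements of $\mathcal{B}$. A Boolean dynamical system $(\mathcal{B},\mathcal{L},\theta)$ is a Boolean algebra $\mathcal{B}$, a set $\mathcal{L}$, and maps $\theta_\alpha:\mathcal{B}\to\mathcal{B}$ ($\alpha\in\mathcal{L}$) preserving $\cap,\cup,\setminus$ and $\emptyset$. For $A\in\mathcal{B}$ let $\Delta_A=\{\alpha\in\mathcal{L}:\theta_\alpha(A)\ne\emptyset\}$ and $\lambda_A=|\Delta_A|$. $A$ is regular if $0<\lambda_B<\infty$ for every $\emptyset\neq B\subseteq A$; $\mathcal{B}_{reg}$ is the ideal of regular elements (so $\emptyset\in\mathcal{B}_{reg}$). Let $\mathcal{R}_\alpha=\{A\in\mathcal{B}:A\subseteq\theta_\alpha(B)\text{ for some }B\in\mathcal{B}\}$. A relative generalized Boolean dynamical system $(\mathcal{B},\mathcal{L},\theta,\mathcal{I}_\alpha;\mathcal{J})$ consists of a Boolean dynamical system, ideals $\mathcal{I}_\alpha$ of $\mathcal{B}$ with $\mathcal{R}_\alpha\subseteq\mathcal{I}_\alpha$ ($\alpha\in\mathcal{L}$), and an ideal $\mathcal{J}$ of $\mathcal{B}_{reg}$.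 A $(\mathcal{B},\mathcal{L},\theta,\mathcal{I}_\alpha;\mathcal{J})$-representation in a $C^*$-algebra is a family of projections $\{P_A:A\in\mathcal{B}\}$ and partial isometries $\{S_{\alpha,B}:\alpha\in\mathcal{L},B\in\mathcal{I}_\alpha\}$ such that (i) $P_\emptyset=0$, $P_{A\cap A'}=P_AP_{A'}$, $P_{A\cup A'}=P_A+P_{A'}-P_{A\cap A'}$; (ii) $P_AS_{\alpha,B}=S_{\alpha,B}P_{\theta_\alpha(A)}$; (iii) $S_{\alpha,B}^*S_{\alpha',B'}=\delta_{\alpha,\alpha'}P_{B\cap B'}$; (iv) $P_A=\sum_{\alpha\in\Delta_A}S_{\alpha,\theta_\alpha(A)}S_{\alpha,\theta_\alpha(A)}^*$ for all $A\in\mathcal{J}$. $C^*(\mathcal{B},\mathcal{L},\theta,\mathcal{I}_\alpha;\mathcal{J})$ is the $C^*$-algebra generated by a universal such representation $\{p_A,s_{\alpha,B}\}$. Its gauge action is the strongly continuous action $\gamma$ of $\mathbb{T}$ with $\gamma_z(p_A)=p_A$, $\gamma_z(s_{\alpha,B})=zs_{\alpha,B}$. Ideals of $C^*$-algebras are closed and two-sided; an ideal $I$ is gauge-invariant if $\gamma_z(I)\subseteq I$ for all $z\in\mathbb{T}$. An ideal $\mathcal{H}$ of $\mathcal{B}$ is hereditary if $\theta_\alpha(A)\in\mathcal{H}$ for all $A\in\mathcal{H}$, $\alpha\in\mathcal{L}$; it is $\mathcal{J}$-saturated if $A\in\mathcal{H}$ whenever $A\in\mathcal{J}$ and $\theta_\alpha(A)\in\mathcal{H}$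 for all $\alpha\in\Delta_A$. For a hereditary ideal $\mathcal{H}$, $\mathcal{B}/\mathcal{H}$ is the Boolean algebra of classes $[A]$ for the relation $A\sim B$ iff $A\cup A'=B\cup B'$ for some $A',B'\in\mathcal{H}$, with the induced operations, and $\theta_\alpha([A])=[\theta_\alpha(A)]$ makes $(\mathcal{B}/\mathcal{H},\mathcal{L},\theta)$ a Boolean dynamical system. Let $\mathcal{B}_{\mathcal{H}}=\{A\in\mathcal{B}:[A]\in(\mathcal{B}/\mathcal{H})_{reg}\}$, an ideal of $\mathcal{B}$, and $\Delta_{[A]}=\{\alpha\in\mathcal{L}:\theta_\alpha(A)\notin\mathcal{H}\}$. For $\mathcal{H}$ a hereditary $\mathcal{J}$-saturated ideal of $\mathcal{B}$ and $\mathcal{S}$ an ideal of $\mathcal{B}_{\mathcal{H}}$ with $\mathcal{H}\cup\mathcal{J}\subseteq\mathcal{S}$, $I_{(\mathcal{H},\mathcal{S})}$ is the ideal of $C^*(\mathcal{B},\mathcal{L},\theta,\mathcal{I}_\alpha;\mathcal{J})$ generated by $\{p_A-\sum_{\alpha\in\Delta_{[A]}}s_{\alpha,\theta_\alpha(A)}s_{\alpha,\theta_\alpha(A)}^*:A\in\mathcal{S}\}$. For an ideal $I$ of $C^*(\mathcal{B},\mathcal{L},\theta,\mathcal{I}_\alpha;\mathcal{J})$: $\mathcal{H}_I=\{A\in\mathcal{B}:p_A\in I\}$, which is a hereditary $\mathcal{J}$-saturated ideal of $\mathcal{B}$, and $\mathcal{S}_I=\{A\in\mathcal{B}_{\mathcal{H}_I}:p_A-\sum_{\alpha\in\Delta_{[A]}}s_{\alpha,\theta_\alpha(A)}s_{\alpha,\theta_\alpha(A)}^*\in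 I\}$ (with $[A]$ the class in $\mathcal{B}/\mathcal{H}_I$), which is an ideal of $\mathcal{B}_{\mathcal{H}_I}$ containing $\mathcal{H}_I\cup\mathcal{J}$. Put $[\mathcal{I}_\alpha]=\{[A]\in\mathcal{B}/\mathcal{H}_I:A\in\mathcal{I}_\alpha\}$ and $[\mathcal{S}_I]=\{[A]\in\mathcal{B}/\mathcal{H}_I:A\in\mathcal{S}_I\}$; $\{p_{[A]},s_{\alpha,[B]}\}$ denotes the universal $(\mathcal{B}/\mathcal{H}_I,\mathcal{L},\theta,[\mathcal{I}_\alpha];[\mathcal{S}_I])$-representation. *)

theory Defs
  imports "HOL-Analysis.Analysis" "HOL-Algebra.Module" "HOL-Algebra.QuotRing"
    "HOL-Algebra.Algebraic_Closure_Type"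
begin

section \<open>Boolean dynamical systems\<close>

record 'b gba = "'b partial_object" +
  meet_b :: "'b \<Rightarrow> 'b \<Rightarrow> 'b" (infixl \<open>\<^bold>\<inter>\<index>\<close> 70)
  join_b :: "'b \<Rightarrow> 'b \<Rightarrow> 'b" (infixl \<open>\<^bold>\<union>\<index>\<close> 65)
  diff_b :: "'b \<Rightarrow> 'b \<Rightarrow> 'b" (infixl \<open>\<^bold>-\<index>\<close> 67)
  bot_b :: 'b (\<open>\<^bold>\<emptyset>\<index>\<close>)

locale gba =
  fixes B (structure)
  assumes bot_closed: "\<^bold>\<emptyset> \<in> carrier B"
    and meet_closed: "\<lbrakk>x \<in> carrier B; y \<in> carrier B\<rbrakk> \<Longrightarrow> x \<^bold>\<inter> y \<in> carrier B"
    and join_closed: "\<lbrakk>x \<in> carrier B; y \<in> carrier B\<rbrakk> \<Longrightarrow> x \<^bold>\<union> y \<in> carrier B"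
    and diff_closed: "\<lbrakk>x \<in> carrier B; y \<in> carrier B\<rbrakk> \<Longrightarrow> x \<^bold>- y \<in> carrier B"
    and meet_comm: "\<lbrakk>x \<in> carrier B; y \<in> carrier B\<rbrakk> \<Longrightarrow> x \<^bold>\<inter> y = y \<^bold>\<inter> x"
    and join_comm: "\<lbrakk>x \<in> carrier B; y \<in> carrier B\<rbrakk> \<Longrightarrow> x \<^bold>\<union> y = y \<^bold>\<union> x"
    and meet_assoc: "\<lbrakk>x \<in> carrier B; y \<in> carrier B; z \<in> carrier B\<rbrakk>
      \<Longrightarrow> (x \<^bold>\<inter> y) \<^bold>\<inter> z = x \<^bold>\<inter> (y \<^bold>\<inter> z)"
    and join_assoc: "\<lbrakk>x \<in> carrier B; y \<in> carrier B; z \<in> carrier B\<rbrakk>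
      \<Longrightarrow> (x \<^bold>\<union> y) \<^bold>\<union> z = x \<^bold>\<union> (y \<^bold>\<union> z)"
    and meet_join_absorb: "\<lbrakk>x \<in> carrier B; y \<in> carrier B\<rbrakk> \<Longrightarrow> x \<^bold>\<inter> (x \<^bold>\<union> y) = x"
    and join_meet_absorb: "\<lbrakk>x \<in> carrier B; y \<in> carrier B\<rbrakk> \<Longrightarrow> x \<^bold>\<union> (x \<^bold>\<inter> y) = x"
    and meet_join_distrib: "\<lbrakk>x \<in> carrier B; y \<in> carrier B; z \<in> carrier B\<rbrakk>
      \<Longrightarrow> x \<^bold>\<inter> (y \<^bold>\<union> z) = (x \<^bold>\<inter> y) \<^bold>\<union> (x \<^bold>\<inter> z)"
    and bot_least: "x \<in> carrier B \<Longrightarrow> \<^bold>\<emptyset> \<^bold>\<inter> x = \<^bold>\<emptyset>"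
    and meet_join_diff: "\<lbrakk>x \<in> carrier B; y \<in> carrier B\<rbrakk> \<Longrightarrow> (x \<^bold>\<inter> y) \<^bold>\<union> (x \<^bold>- y) = x"
    and meet_meet_diff: "\<lbrakk>x \<in> carrier B; y \<in> carrier B\<rbrakk> \<Longrightarrow> (x \<^bold>\<inter> y) \<^bold>\<inter> (x \<^bold>- y) = \<^bold>\<emptyset>"

definition le_b :: "('b, 'm) gba_scheme \<Rightarrow> 'b \<Rightarrow> 'b \<Rightarrow> bool" (infix \<open>\<^bold>\<subseteq>\<index>\<close> 50)
  where "x \<^bold>\<subseteq>\<^bsub>B\<^esub> y \<longleftrightarrow> x \<^bold>\<inter>\<^bsub>B\<^esub> y = x"

definition gba_ideal :: "'b set \<Rightarrow> ('b, 'm) gba_scheme \<Rightarrow> bool"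
  where "gba_ideal K B \<longleftrightarrow> K \<subseteq> carrier B \<and> K \<noteq> {}
    \<and> (\<forall>x\<in>K. \<forall>y\<in>K. x \<^bold>\<union>\<^bsub>B\<^esub> y \<in> K) \<and> (\<forall>x\<in>K. \<forall>y\<in>carrier B. x \<^bold>\<inter>\<^bsub>B\<^esub> y \<in> K)"

record ('b, 'l) bds = "'b gba" +
  labels :: "'l set"
  act :: "'l \<Rightarrow> 'b \<Rightarrow> 'b"

locale bds = gba B for B :: "('b, 'l, 'm) bds_scheme" (structure) +
  assumes act_closed: "\<lbrakk>\<alpha> \<in> labels B; x \<in> carrier B\<rbrakk> \<Longrightarrow> act B \<alpha> x \<in> carrier B"
    and act_meet: "\<lbrakk>\<alpha> \<in> labels B; x \<in> carrier B; y \<in> carrier B\<rbrakk>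
      \<Longrightarrow> act B \<alpha> (x \<^bold>\<inter> y) = act B \<alpha> x \<^bold>\<inter> act B \<alpha> y"
    and act_join: "\<lbrakk>\<alpha> \<in> labels B; x \<in> carrier B; y \<in> carrier B\<rbrakk>
      \<Longrightarrow> act B \<alpha> (x \<^bold>\<union> y) = act B \<alpha> x \<^bold>\<union> act B \<alpha> y"
    and act_diff: "\<lbrakk>\<alpha> \<in> labels B; x \<in> carrier B; y \<in> carrier B\<rbrakk>
      \<Longrightarrow> act B \<alpha> (x \<^bold>- y) = act B \<alpha> x \<^bold>- act B \<alpha> y"
    and act_bot: "\<alpha> \<in> labels B \<Longrightarrow> act B \<alpha> \<^bold>\<emptyset> = \<^bold>\<emptyset>"

definition Delta :: "('b, 'l, 'm) bds_scheme \<Rightarrow> 'b \<Rightarrow> 'l set"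
  where "Delta B x = {\<alpha> \<in> labels B. act B \<alpha> x \<noteq> \<^bold>\<emptyset>\<^bsub>B\<^esub>}"

definition regs :: "('b, 'l, 'm) bds_scheme \<Rightarrow> 'b set"
  where "regs B = {x \<in> carrier B. \<forall>y\<in>carrier B. y \<noteq> \<^bold>\<emptyset>\<^bsub>B\<^esub> \<and> y \<^bold>\<subseteq>\<^bsub>B\<^esub> x
    \<longrightarrow> finite (Delta B y) \<and> 0 < card (Delta B y)}"

definition act_range :: "('b, 'l, 'm) bds_scheme \<Rightarrow> 'l \<Rightarrow> 'b set"
  where "act_range B \<alpha> = {x \<in> carrier B. \<exists>y\<in>carrier B. x \<^bold>\<subseteq>\<^bsub>B\<^esub> act B \<alpha> y}"

text \<open>\<open>\<J>\<close> is an ideal of the Boolean algebra of regular elements, hence the change of carrier.\<close>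

definition rel_gbds :: "('b, 'l, 'm) bds_scheme \<Rightarrow> ('l \<Rightarrow> 'b set) \<Rightarrow> 'b set \<Rightarrow> bool"
  where "rel_gbds B \<I> \<J> \<longleftrightarrow> bds B
    \<and> (\<forall>\<alpha>\<in>labels B. gba_ideal (\<I> \<alpha>) B \<and> act_range B \<alpha> \<subseteq> \<I> \<alpha>)
    \<and> gba_ideal \<J> (B\<lparr>carrier := regs B\<rparr>)"

subsection \<open>Quotients\<close>

definition quot_rel :: "('b, 'm) gba_scheme \<Rightarrow> 'b set \<Rightarrow> ('b \<times> 'b) set"
  where "quot_rel B H = {(x, y). x \<in> carrier B \<and> y \<in> carrier B
    \<and> (\<exists>x'\<in>H. \<exists>y'\<in>H. x \<^bold>\<union>\<^bsub>B\<^esub> x' = y \<^bold>\<union>\<^bsub>B\<^esub> y')}"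

definition qclass :: "('b, 'm) gba_scheme \<Rightarrow> 'b set \<Rightarrow> 'b \<Rightarrow> 'b set"
  where "qclass B H x = quot_rel B H `` {x}"

text \<open>For a hereditary ideal \<open>H\<close> the classes below do not depend on the representatives, so each
  union is the union of copies of a single class.\<close>

definition quot_bds :: "('b, 'l, 'm) bds_scheme \<Rightarrow> 'b set \<Rightarrow> ('b set, 'l) bds"
  where "quot_bds B H =
    \<lparr>carrier = carrier B // quot_rel B H,
     meet_b = (\<lambda>U V. \<Union>x\<in>U. \<Union>y\<in>V. qclass B H (x \<^bold>\<inter>\<^bsub>B\<^esub> y)),
     join_b = (\<lambda>U V. \<Union>x\<in>U. \<Union>y\<in>V. qclass B H (x \<^bold>\<union>\<^bsub>B\<^esub> y)),
     diff_b = (\<lambda>U V. \<Union>x\<in>U. \<Union>y\<in>V. qclass B H (x \<^bold>-\<^bsub>B\<^esub> y)),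
     bot_b = qclass B H \<^bold>\<emptyset>\<^bsub>B\<^esub>,
     labels = labels B,
     act = (\<lambda>\<alpha> U. \<Union>x\<in>U. qclass B H (act B \<alpha> x))\<rparr>"

definition quot_regs :: "('b, 'l, 'm) bds_scheme \<Rightarrow> 'b set \<Rightarrow> 'b set"
  where "quot_regs B H = {x \<in> carrier B. qclass B H x \<in> regs (quot_bds B H)}"

definition quot_Delta :: "('b, 'l, 'm) bds_scheme \<Rightarrow> 'b set \<Rightarrow> 'b \<Rightarrow> 'l set"
  where "quot_Delta B H x = {\<alpha> \<in> labels B. act B \<alpha> x \<notin> H}"

section \<open>C*-algebras\<close>

text \<open>C*-algebras need not be unital: the field \<^const>\<open>one\<close> inherited from \<^typ>\<open>'a ring\<close> is never
  constrained. It is kept so that cosets, quotients and finite sums of HOL-Algebra apply.\<close>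

record 'a cstar_alg = "(complex, 'a) module" +
  adj :: "'a \<Rightarrow> 'a" (\<open>(_\<^sup>\<star>\<index>)\<close> [1000] 1000)
  nrm :: "'a \<Rightarrow> real"

text \<open>\<^locale>\<open>Metric_space\<close> asks for symmetry and nonnegativity off the carrier as well.\<close>

definition cdist :: "('a, 'm) cstar_alg_scheme \<Rightarrow> 'a \<Rightarrow> 'a \<Rightarrow> real"
  where "cdist A x y =
    (if x \<in> carrier A \<and> y \<in> carrier A then nrm A (x \<ominus>\<^bsub>A\<^esub> y) else 0)"

abbreviation ctop :: "('a, 'm) cstar_alg_scheme \<Rightarrow> 'a topology"
  where "ctop A \<equiv> Metric_space.mtopology (carrier A) (cdist A)"

locale cstar_algebra =
  module "ring_of_type_algebra :: complex ring" A
  for A :: "('a, 'm) cstar_alg_scheme" (structure) +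
  assumes mult_closed: "\<lbrakk>x \<in> carrier A; y \<in> carrier A\<rbrakk> \<Longrightarrow> x \<otimes> y \<in> carrier A"
    and mult_assoc: "\<lbrakk>x \<in> carrier A; y \<in> carrier A; z \<in> carrier A\<rbrakk>
      \<Longrightarrow> (x \<otimes> y) \<otimes> z = x \<otimes> (y \<otimes> z)"
    and mult_l_distr: "\<lbrakk>x \<in> carrier A; y \<in> carrier A; z \<in> carrier A\<rbrakk>
      \<Longrightarrow> (x \<oplus> y) \<otimes> z = x \<otimes> z \<oplus> y \<otimes> z"
    and mult_r_distr: "\<lbrakk>x \<in> carrier A; y \<in> carrier A; z \<in> carrier A\<rbrakk>
      \<Longrightarrow> z \<otimes> (x \<oplus> y) = z \<otimes> x \<oplus> z \<otimes> y"
    and smult_mult_l: "\<lbrakk>x \<in> carrier A; y \<in> carrier A\<rbrakk> \<Longrightarrow> (c \<odot> x) \<otimes> y = c \<odot> (x \<otimes> y)"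
    and smult_mult_r: "\<lbrakk>x \<in> carrier A; y \<in> carrier A\<rbrakk> \<Longrightarrow> x \<otimes> (c \<odot> y) = c \<odot> (x \<otimes> y)"
    and adj_closed: "x \<in> carrier A \<Longrightarrow> x\<^sup>\<star> \<in> carrier A"
    and adj_adj: "x \<in> carrier A \<Longrightarrow> x\<^sup>\<star>\<^sup>\<star> = x"
    and adj_add: "\<lbrakk>x \<in> carrier A; y \<in> carrier A\<rbrakk> \<Longrightarrow> (x \<oplus> y)\<^sup>\<star> = x\<^sup>\<star> \<oplus> y\<^sup>\<star>"
    and adj_smult: "x \<in> carrier A \<Longrightarrow> (c \<odot> x)\<^sup>\<star> = cnj c \<odot> x\<^sup>\<star>"
    and adj_mult: "\<lbrakk>x \<in> carrier A; y \<in> carrier A\<rbrakk> \<Longrightarrow> (x \<otimes> y)\<^sup>\<star> = y\<^sup>\<star> \<otimes> x\<^sup>\<star>"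
    and nrm_nonneg: "x \<in> carrier A \<Longrightarrow> 0 \<le> nrm A x"
    and nrm_eq_0: "x \<in> carrier A \<Longrightarrow> nrm A x = 0 \<longleftrightarrow> x = \<zero>"
    and nrm_triangle: "\<lbrakk>x \<in> carrier A; y \<in> carrier A\<rbrakk> \<Longrightarrow> nrm A (x \<oplus> y) \<le> nrm A x + nrm A y"
    and nrm_smult: "x \<in> carrier A \<Longrightarrow> nrm A (c \<odot> x) = cmod c * nrm A x"
    and nrm_mult: "\<lbrakk>x \<in> carrier A; y \<in> carrier A\<rbrakk> \<Longrightarrow> nrm A (x \<otimes> y) \<le> nrm A x * nrm A y"
    and nrm_cstar: "x \<in> carrier A \<Longrightarrow> nrm A (x\<^sup>\<star> \<otimes> x) = (nrm A x)\<^sup>2"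
    and complete: "Metric_space.mcomplete (carrier A) (cdist A)"

definition cstar_hom ::
    "('a, 'm) cstar_alg_scheme \<Rightarrow> ('c, 'n) cstar_alg_scheme \<Rightarrow> ('a \<Rightarrow> 'c) \<Rightarrow> bool"
  where "cstar_hom A C \<phi> \<longleftrightarrow> \<phi> \<in> carrier A \<rightarrow> carrier C
    \<and> (\<forall>x\<in>carrier A. \<forall>y\<in>carrier A. \<phi> (x \<oplus>\<^bsub>A\<^esub> y) = \<phi> x \<oplus>\<^bsub>C\<^esub> \<phi> y)
    \<and> (\<forall>c. \<forall>x\<in>carrier A. \<phi> (c \<odot>\<^bsub>A\<^esub> x) = c \<odot>\<^bsub>C\<^esub> \<phi> x)
    \<and> (\<forall>x\<in>carrier A. \<forall>y\<in>carrier A. \<phi> (x \<otimes>\<^bsub>A\<^esub> y) = \<phi> x \<otimes>\<^bsub>C\<^esub> \<phi> y)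
    \<and> (\<forall>x\<in>carrier A. \<phi> (x\<^sup>\<star>\<^bsub>A\<^esub>) = (\<phi> x)\<^sup>\<star>\<^bsub>C\<^esub>)"

definition cstar_iso ::
    "('a, 'm) cstar_alg_scheme \<Rightarrow> ('c, 'n) cstar_alg_scheme \<Rightarrow> ('a \<Rightarrow> 'c) \<Rightarrow> bool"
  where "cstar_iso A C \<phi> \<longleftrightarrow> cstar_hom A C \<phi> \<and> bij_betw \<phi> (carrier A) (carrier C)"

definition cstar_subalg :: "'a set \<Rightarrow> ('a, 'm) cstar_alg_scheme \<Rightarrow> bool"
  where "cstar_subalg D A \<longleftrightarrow> additive_subgroup D A
    \<and> (\<forall>c. \<forall>x\<in>D. c \<odot>\<^bsub>A\<^esub> x \<in> D) \<and> (\<forall>x\<in>D. \<forall>y\<in>D. x \<otimes>\<^bsub>A\<^esub> y \<in> D)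
    \<and> (\<forall>x\<in>D. x\<^sup>\<star>\<^bsub>A\<^esub> \<in> D) \<and> closedin (ctop A) D"

definition cstar_gen :: "('a, 'm) cstar_alg_scheme \<Rightarrow> 'a set \<Rightarrow> 'a set"
  where "cstar_gen A U = \<Inter>{D. cstar_subalg D A \<and> U \<subseteq> D}"

definition cstar_ideal :: "'a set \<Rightarrow> ('a, 'm) cstar_alg_scheme \<Rightarrow> bool"
  where "cstar_ideal I A \<longleftrightarrow> additive_subgroup I A
    \<and> (\<forall>c. \<forall>x\<in>I. c \<odot>\<^bsub>A\<^esub> x \<in> I)
    \<and> (\<forall>x\<in>I. \<forall>a\<in>carrier A. a \<otimes>\<^bsub>A\<^esub> x \<in> I \<and> x \<otimes>\<^bsub>A\<^esub> a \<in> I)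
    \<and> closedin (ctop A) I"

definition cstar_ideal_gen :: "('a, 'm) cstar_alg_scheme \<Rightarrow> 'a set \<Rightarrow> 'a set"
  where "cstar_ideal_gen A U = \<Inter>{I. cstar_ideal I A \<and> U \<subseteq> I}"

definition cstar_quot :: "('a, 'm) cstar_alg_scheme \<Rightarrow> 'a set \<Rightarrow> 'a set cstar_alg"
  where "cstar_quot A I =
    \<lparr>carrier = carrier (A Quot I),
     monoid.mult = monoid.mult (A Quot I),
     one = one (A Quot I),
     zero = zero (A Quot I),
     add = add (A Quot I),
     smult = (\<lambda>c U. \<Union>x\<in>U. I +>\<^bsub>A\<^esub> (c \<odot>\<^bsub>A\<^esub> x)),
     adj = (\<lambda>U. \<Union>x\<in>U. I +>\<^bsub>A\<^esub> (x\<^sup>\<star>\<^bsub>A\<^esub>)),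
     nrm = (\<lambda>U. INF x\<in>U. nrm A x)\<rparr>"

section \<open>Representations and the universal C*-algebra\<close>

definition bds_rep :: "('b, 'l, 'm) bds_scheme \<Rightarrow> ('l \<Rightarrow> 'b set) \<Rightarrow> 'b set
    \<Rightarrow> ('a, 'n) cstar_alg_scheme \<Rightarrow> ('b \<Rightarrow> 'a) \<Rightarrow> ('l \<Rightarrow> 'b \<Rightarrow> 'a) \<Rightarrow> bool"
  where "bds_rep B \<I> \<J> A P S \<longleftrightarrow>
    (\<forall>x\<in>carrier B. P x \<in> carrier A \<and> (P x)\<^sup>\<star>\<^bsub>A\<^esub> = P x \<and> P x \<otimes>\<^bsub>A\<^esub> P x = P x)
  \<and> (\<forall>\<alpha>\<in>labels B. \<forall>y\<in>\<I> \<alpha>. S \<alpha> y \<in> carrier A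
        \<and> S \<alpha> y \<otimes>\<^bsub>A\<^esub> (S \<alpha> y)\<^sup>\<star>\<^bsub>A\<^esub> \<otimes>\<^bsub>A\<^esub> S \<alpha> y = S \<alpha> y)
  \<and> P \<^bold>\<emptyset>\<^bsub>B\<^esub> = \<zero>\<^bsub>A\<^esub>
  \<and> (\<forall>x\<in>carrier B. \<forall>y\<in>carrier B. P (x \<^bold>\<inter>\<^bsub>B\<^esub> y) = P x \<otimes>\<^bsub>A\<^esub> P y)
  \<and> (\<forall>x\<in>carrier B. \<forall>y\<in>carrier B.
        P (x \<^bold>\<union>\<^bsub>B\<^esub> y) = P x \<oplus>\<^bsub>A\<^esub> P y \<ominus>\<^bsub>A\<^esub> P (x \<^bold>\<inter>\<^bsub>B\<^esub> y))
  \<and> (\<forall>x\<in>carrier B. \<forall>\<alpha>\<in>labels B. \<forall>y\<in>\<I> \<alpha>.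
        P x \<otimes>\<^bsub>A\<^esub> S \<alpha> y = S \<alpha> y \<otimes>\<^bsub>A\<^esub> P (act B \<alpha> x))
  \<and> (\<forall>\<alpha>\<in>labels B. \<forall>y\<in>\<I> \<alpha>. \<forall>\<beta>\<in>labels B. \<forall>z\<in>\<I> \<beta>.
        (S \<alpha> y)\<^sup>\<star>\<^bsub>A\<^esub> \<otimes>\<^bsub>A\<^esub> S \<beta> z = (if \<alpha> = \<beta> then P (y \<^bold>\<inter>\<^bsub>B\<^esub> z) else \<zero>\<^bsub>A\<^esub>))
  \<and> (\<forall>x\<in>\<J>. P x =
        (\<Oplus>\<^bsub>A\<^esub>\<alpha>\<in>Delta B x. S \<alpha> (act B \<alpha> x) \<otimes>\<^bsub>A\<^esub> (S \<alpha> (act B \<alpha> x))\<^sup>\<star>\<^bsub>A\<^esub>))"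

definition rep_gens :: "('b, 'l, 'm) bds_scheme \<Rightarrow> ('l \<Rightarrow> 'b set)
    \<Rightarrow> ('b \<Rightarrow> 'a) \<Rightarrow> ('l \<Rightarrow> 'b \<Rightarrow> 'a) \<Rightarrow> 'a set"
  where "rep_gens B \<I> P S = P ` carrier B \<union> {S \<alpha> y | \<alpha> y. \<alpha> \<in> labels B \<and> y \<in> \<I> \<alpha>}"

text \<open>HOL cannot quantify over types inside a definition, so the universal property below refers to
  C*-algebras carried by one fixed type: sequences of formal *-polynomials in the generators.
  That type is large enough. A C*-algebra generated by a representation is the closure of the values
  of such polynomials, so it injects into this type by choosing approximating sequences. The lemma
  \<open>universal_rep_lift\<close> at the end of this theory derives the universal property for
  C*-algebras over every type.\<close>

datatype ('b, 'l) star_poly =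
    Zero
  | Proj 'b
  | Piso 'l 'b
  | Add "('b, 'l) star_poly" "('b, 'l) star_poly"
  | Scale complex "('b, 'l) star_poly"
  | Mult "('b, 'l) star_poly" "('b, 'l) star_poly"
  | Adj "('b, 'l) star_poly"

definition universal_rep :: "('b, 'l, 'm) bds_scheme \<Rightarrow> ('l \<Rightarrow> 'b set) \<Rightarrow> 'b set
    \<Rightarrow> 'a cstar_alg \<Rightarrow> ('b \<Rightarrow> 'a) \<Rightarrow> ('l \<Rightarrow> 'b \<Rightarrow> 'a) \<Rightarrow> bool"
  where "universal_rep B \<I> \<J> A p s \<longleftrightarrow>
    cstar_algebra A \<and> bds_rep B \<I> \<J> A p s
  \<and> cstar_gen A (rep_gens B \<I> p s) = carrier A
  \<and> (\<forall>(C :: (nat \<Rightarrow> ('b, 'l) star_poly) cstar_alg) P S.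
        cstar_algebra C \<and> bds_rep B \<I> \<J> C P S \<longrightarrow>
        (\<exists>\<phi>. cstar_hom A C \<phi> \<and> (\<forall>x\<in>carrier B. \<phi> (p x) = P x)
            \<and> (\<forall>\<alpha>\<in>labels B. \<forall>y\<in>\<I> \<alpha>. \<phi> (s \<alpha> y) = S \<alpha> y)))"

definition gauge_action :: "('b, 'l, 'm) bds_scheme \<Rightarrow> ('l \<Rightarrow> 'b set)
    \<Rightarrow> 'a cstar_alg \<Rightarrow> ('b \<Rightarrow> 'a) \<Rightarrow> ('l \<Rightarrow> 'b \<Rightarrow> 'a) \<Rightarrow> (complex \<Rightarrow> 'a \<Rightarrow> 'a) \<Rightarrow> bool"
  where "gauge_action B \<I> A p s \<gamma> \<longleftrightarrow>
    (\<forall>z\<in>sphere 0 1. cstar_iso A A (\<gamma> z))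
  \<and> (\<forall>x\<in>carrier A. \<gamma> 1 x = x)
  \<and> (\<forall>z\<in>sphere 0 1. \<forall>w\<in>sphere 0 1. \<forall>x\<in>carrier A. \<gamma> (z * w) x = \<gamma> z (\<gamma> w x))
  \<and> (\<forall>x\<in>carrier A. continuous_map (top_of_set (sphere 0 1)) (ctop A) (\<lambda>z. \<gamma> z x))
  \<and> (\<forall>z\<in>sphere 0 1. \<forall>x\<in>carrier B. \<gamma> z (p x) = p x)
  \<and> (\<forall>z\<in>sphere 0 1. \<forall>\<alpha>\<in>labels B. \<forall>y\<in>\<I> \<alpha>. \<gamma> z (s \<alpha> y) = z \<odot>\<^bsub>A\<^esub> s \<alpha> y)"

definition gauge_invariant :: "(complex \<Rightarrow> 'a \<Rightarrow> 'a) \<Rightarrow> 'a set \<Rightarrow> bool"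
  where "gauge_invariant \<gamma> I \<longleftrightarrow> (\<forall>z\<in>sphere 0 1. \<gamma> z ` I \<subseteq> I)"

section \<open>Ideals of the universal C*-algebra and of the system\<close>

definition gap_proj :: "('b, 'l, 'm) bds_scheme \<Rightarrow> ('a, 'n) cstar_alg_scheme
    \<Rightarrow> ('b \<Rightarrow> 'a) \<Rightarrow> ('l \<Rightarrow> 'b \<Rightarrow> 'a) \<Rightarrow> 'b set \<Rightarrow> 'b \<Rightarrow> 'a"
  where "gap_proj B A p s H x = p x \<ominus>\<^bsub>A\<^esub>
    (\<Oplus>\<^bsub>A\<^esub>\<alpha>\<in>quot_Delta B H x. s \<alpha> (act B \<alpha> x) \<otimes>\<^bsub>A\<^esub> (s \<alpha> (act B \<alpha> x))\<^sup>\<star>\<^bsub>A\<^esub>)"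

definition ideal_of_pair :: "('b, 'l, 'm) bds_scheme \<Rightarrow> ('a, 'n) cstar_alg_scheme
    \<Rightarrow> ('b \<Rightarrow> 'a) \<Rightarrow> ('l \<Rightarrow> 'b \<Rightarrow> 'a) \<Rightarrow> 'b set \<Rightarrow> 'b set \<Rightarrow> 'a set"
  where "ideal_of_pair B A p s H S = cstar_ideal_gen A (gap_proj B A p s H ` S)"

definition H_of :: "('b, 'm) gba_scheme \<Rightarrow> ('b \<Rightarrow> 'a) \<Rightarrow> 'a set \<Rightarrow> 'b set"
  where "H_of B p I = {x \<in> carrier B. p x \<in> I}"

definition S_of :: "('b, 'l, 'm) bds_scheme \<Rightarrow> ('a, 'n) cstar_alg_scheme
    \<Rightarrow> ('b \<Rightarrow> 'a) \<Rightarrow> ('l \<Rightarrow> 'b \<Rightarrow> 'a) \<Rightarrow> 'a set \<Rightarrow> 'b set"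
  where "S_of B A p s I =
    {x \<in> quot_regs B (H_of B p I). gap_proj B A p s (H_of B p I) x \<in> I}"

section \<open>The universal property over arbitrary types\<close>

context cstar_algebra
begin

lemma cscalar [simp]: "c \<in> carrier (ring_of_type_algebra :: complex ring)"
  by (simp add: ring_of_type_algebra_def)

lemma zero_smult_c [simp]: "x \<in> carrier A \<Longrightarrow> 0 \<odot> x = \<zero>"
  using smult_l_null[of x] by (simp add: ring_of_type_algebra_def)

lemma one_smult_c [simp]: "x \<in> carrier A \<Longrightarrow> 1 \<odot> x = x"
  using smult_one[of x] by (simp add: ring_of_type_algebra_def)

lemma smult_closed_c [simp]: "x \<in> carrier A \<Longrightarrow> c \<odot> x \<in> carrier A"
  by (simp add: smult_closed)

lemma smult_zero_c [simp]: "c \<odot> \<zero> = \<zero>"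
  using smult_r_null by simp

lemma smult_add_c: "x \<in> carrier A \<Longrightarrow> (c + d) \<odot> x = c \<odot> x \<oplus> d \<odot> x"
  using smult_l_distr[of c d x] by (simp add: ring_of_type_algebra_def)

lemma smult_mult_c: "x \<in> carrier A \<Longrightarrow> (c * d) \<odot> x = c \<odot> (d \<odot> x)"
  using smult_assoc1[of c d x] by (simp add: ring_of_type_algebra_def)

lemma smult_r_distr_c:
  "\<lbrakk>x \<in> carrier A; y \<in> carrier A\<rbrakk> \<Longrightarrow> c \<odot> (x \<oplus> y) = c \<odot> x \<oplus> c \<odot> y"
  by (simp add: smult_r_distr)

lemma neg_smult: "x \<in> carrier A \<Longrightarrow> \<ominus> x = (-1) \<odot> x"
proof -
  assume x: "x \<in> carrier A"
  have "(-1) \<odot> x \<oplus> x = (-1 + 1) \<odot> x"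
    using smult_add_c[OF x, of "-1" 1] x by simp
  also have "\<dots> = \<zero>" using x by simp
  finally show ?thesis using x M.minus_equality smult_closed_c by metis
qed

lemma nrm_neg: "x \<in> carrier A \<Longrightarrow> nrm A (\<ominus> x) = nrm A x"
  by (simp add: neg_smult nrm_smult)

lemma nrm_minus_commute:
  assumes "x \<in> carrier A" "y \<in> carrier A"
  shows "nrm A (x \<ominus> y) = nrm A (y \<ominus> x)"
proof -
  have "\<ominus> (x \<ominus> y) = y \<ominus> x"
    using assms by (simp add: a_minus_def M.minus_add M.a_comm)
  then show ?thesis using nrm_neg[of "x \<ominus> y"] assms by simp
qed

lemma minus_split:
  assumes "x \<in> carrier A" "y \<in> carrier A" "z \<in> carrier A"
  shows "x \<ominus> z = (x \<ominus> y) \<oplus> (y \<ominus> z)"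
  using assms by (simp add: a_minus_def M.a_assoc M.r_neg1)

lemma minus_triangle:
  assumes "x \<in> carrier A" "y \<in> carrier A" "z \<in> carrier A"
  shows "nrm A (x \<ominus> z) \<le> nrm A (x \<ominus> y) + nrm A (y \<ominus> z)"
  using nrm_triangle[of "x \<ominus> y" "y \<ominus> z"] assms by (simp flip: minus_split)

lemma minus_eq_zero_iff:
  assumes "x \<in> carrier A" "y \<in> carrier A"
  shows "x \<ominus> y = \<zero> \<longleftrightarrow> x = y"
  using assms M.minus_equality M.minus_minus M.r_neg unfolding a_minus_def
  by (metis M.a_inv_closed)

lemma add_minus_add:
  assumes "x \<in> carrier A" "y \<in> carrier A" "u \<in> carrier A" "v \<in> carrier A"
  shows "(x \<oplus> y) \<ominus> (u \<oplus> v) = (x \<ominus> u) \<oplus> (y \<ominus> v)"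
  using assms by (simp add: a_minus_def M.minus_add M.a_ac)

lemma smult_minus:
  assumes "x \<in> carrier A" "y \<in> carrier A"
  shows "c \<odot> x \<ominus> c \<odot> y = c \<odot> (x \<ominus> y)"
proof -
  have "(-1) \<odot> (c \<odot> y) = c \<odot> ((-1) \<odot> y)"
    using assms by (simp flip: smult_mult_c)
  then show ?thesis
    using assms by (simp add: a_minus_def neg_smult smult_r_distr_c)
qed

lemma adj_minus:
  assumes "x \<in> carrier A" "y \<in> carrier A"
  shows "x\<^sup>\<star> \<ominus> y\<^sup>\<star> = (x \<ominus> y)\<^sup>\<star>"
  using assms by (simp add: a_minus_def neg_smult adj_closed adj_add adj_smult)

lemma mult_minus_r:
  assumes "x \<in> carrier A" "y \<in> carrier A" "z \<in> carrier A"
  shows "z \<otimes> x \<ominus> z \<otimes> y = z \<otimes> (x \<ominus> y)"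
  using assms by (simp add: a_minus_def neg_smult mult_closed mult_r_distr smult_mult_r)

lemma mult_minus_l:
  assumes "x \<in> carrier A" "y \<in> carrier A" "z \<in> carrier A"
  shows "x \<otimes> z \<ominus> y \<otimes> z = (x \<ominus> y) \<otimes> z"
  using assms by (simp add: a_minus_def neg_smult mult_closed mult_l_distr smult_mult_l)

lemma nrm_adj: assumes "x \<in> carrier A" shows "nrm A (x\<^sup>\<star>) = nrm A x"
proof -
  have le: "nrm A y \<le> nrm A (y\<^sup>\<star>)" if y: "y \<in> carrier A" for y
  proof (cases "nrm A y = 0")
    case True then show ?thesis using y by (simp add: nrm_nonneg adj_closed)
  next
    case False
    have "nrm A y * nrm A y \<le> nrm A (y\<^sup>\<star>) * nrm A y"
      using nrm_mult[of "y\<^sup>\<star>" y] nrm_cstar[OF y] y by (simp add: adj_closed power2_eq_square)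
    then show ?thesis using False nrm_nonneg[OF y] by simp
  qed
  from le[OF assms] le[OF adj_closed[OF assms]] show ?thesis
    using assms by (simp add: adj_adj)
qed

lemma metric: "Metric_space (carrier A) (cdist A)"
proof
  show "0 \<le> cdist A x y" for x y
    by (simp add: cdist_def nrm_nonneg)
  show "cdist A x y = cdist A y x" for x y
    by (auto simp: cdist_def nrm_minus_commute)
  show "(cdist A x y = 0) = (x = y)" if "x \<in> carrier A" "y \<in> carrier A" for x y
    using that by (simp add: cdist_def nrm_eq_0 minus_eq_zero_iff)
  show "cdist A x z \<le> cdist A x y + cdist A y z"
    if "x \<in> carrier A" "y \<in> carrier A" "z \<in> carrier A" for x y z
    using that by (simp add: cdist_def minus_triangle)
qed

lemma closedin_approx_iff:
  "closedin (ctop A) D \<longleftrightarrow> D \<subseteq> carrier A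
    \<and> (\<forall>x\<in>carrier A. (\<forall>\<epsilon>>0. \<exists>d\<in>D. nrm A (x \<ominus> d) < \<epsilon>) \<longrightarrow> x \<in> D)"
proof -
  interpret MS: Metric_space "carrier A" "cdist A" by (rule metric)
  show ?thesis
    unfolding MS.closedin_metric disjnt_iff MS.in_mball
    by (auto simp: cdist_def subset_iff) (metis not_less)+
qed

lemma approx_closure_subalg:
  assumes E: "E \<subseteq> carrier A" "\<zero> \<in> E"
    and add: "\<And>x y. \<lbrakk>x \<in> E; y \<in> E\<rbrakk> \<Longrightarrow> x \<oplus> y \<in> E"
    and smult: "\<And>c x. x \<in> E \<Longrightarrow> c \<odot> x \<in> E"
    and mult: "\<And>x y. \<lbrakk>x \<in> E; y \<in> E\<rbrakk> \<Longrightarrow> x \<otimes> y \<in> E"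
    and adj: "\<And>x. x \<in> E \<Longrightarrow> x\<^sup>\<star> \<in> E"
  defines "D \<equiv> {x \<in> carrier A. \<forall>\<epsilon>>0. \<exists>e\<in>E. nrm A (x \<ominus> e) < \<epsilon>}"
  shows "cstar_subalg D A" "E \<subseteq> D"
proof -
  have car: "x \<in> carrier A" if "x \<in> E" for x using E that by auto
  have Dcar: "x \<in> carrier A" if "x \<in> D" for x using that by (simp add: D_def)
  have get: "\<exists>e\<in>E. nrm A (x \<ominus> e) < \<epsilon>" if "x \<in> D" "\<epsilon> > 0" for x \<epsilon>
    using that by (simp add: D_def)
  show ED: "E \<subseteq> D"
  proof
    fix x assume "x \<in> E"
    then have "nrm A (x \<ominus> x) = 0" using nrm_eq_0 minus_eq_zero_iff car by simp
    then show "x \<in> D" using \<open>x \<in> E\<close> car unfolding D_def by force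
  qed
  have Dadd: "x \<oplus> y \<in> D" if x: "x \<in> D" and y: "y \<in> D" for x y
    unfolding D_def
  proof (intro CollectI conjI allI impI)
    show "x \<oplus> y \<in> carrier A" using Dcar x y by simp
    fix \<epsilon> :: real assume "\<epsilon> > 0"
    then obtain u v where uv: "u \<in> E" "v \<in> E" "nrm A (x \<ominus> u) < \<epsilon>/2" "nrm A (y \<ominus> v) < \<epsilon>/2"
      using get[OF x] get[OF y] by (meson half_gt_zero)
    have "nrm A ((x \<oplus> y) \<ominus> (u \<oplus> v)) < \<epsilon>"
      using nrm_triangle[of "x \<ominus> u" "y \<ominus> v"] uv Dcar x y car by (simp add: add_minus_add)
    then show "\<exists>e\<in>E. nrm A ((x \<oplus> y) \<ominus> e) < \<epsilon>" using add uv by blast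
  qed
  have Dsm: "c \<odot> x \<in> D" if x: "x \<in> D" for c x
    unfolding D_def
  proof (intro CollectI conjI allI impI)
    show "c \<odot> x \<in> carrier A" using Dcar x by simp
    fix \<epsilon> :: real assume "\<epsilon> > 0"
    then have "\<epsilon> / (cmod c + 1) > 0"
      by (simp add: add_nonneg_pos)
    then obtain u where u: "u \<in> E" "nrm A (x \<ominus> u) < \<epsilon> / (cmod c + 1)"
      using get[OF x] by blast
    have "nrm A (c \<odot> x \<ominus> c \<odot> u) = cmod c * nrm A (x \<ominus> u)"
      using u Dcar x car by (simp add: smult_minus nrm_smult)
    also have "\<dots> \<le> (cmod c + 1) * nrm A (x \<ominus> u)"
      using u Dcar x car by (intro mult_right_mono) (auto simp: nrm_nonneg)
    also have "\<dots> < \<epsilon>" using u(2) by (simp add: pos_less_divide_eq add_nonneg_pos mult.commute)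
    finally show "\<exists>e\<in>E. nrm A (c \<odot> x \<ominus> e) < \<epsilon>" using smult u by blast
  qed
  have Dmu: "x \<otimes> y \<in> D" if x: "x \<in> D" and y: "y \<in> D" for x y
    unfolding D_def
  proof (intro CollectI conjI allI impI)
    show "x \<otimes> y \<in> carrier A" using Dcar x y mult_closed by simp
    fix \<epsilon> :: real assume e: "\<epsilon> > 0"
    have xc: "x \<in> carrier A" "y \<in> carrier A" using x y Dcar by auto
    define K where "K = nrm A x + nrm A y + 1"
    have K: "K > 0" "nrm A x \<le> K" using nrm_nonneg xc by (auto simp: K_def add_nonneg_pos)
    have "\<epsilon> / (2 * K) > 0" using e K by simp
    then obtain v where v: "v \<in> E" "nrm A (y \<ominus> v) < \<epsilon> / (2 * K)"
      using get[OF y] by blast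
    define L where "L = nrm A v + 1"
    have L: "L > 0" "nrm A v \<le> L" using nrm_nonneg car v by (auto simp: L_def add_nonneg_pos)
    have "\<epsilon> / (2 * L) > 0" using e L by simp
    then obtain u where u: "u \<in> E" "nrm A (x \<ominus> u) < \<epsilon> / (2 * L)"
      using get[OF x] by blast
    have c: "u \<in> carrier A" "v \<in> carrier A" using u v car by auto
    have "nrm A (x \<otimes> y \<ominus> u \<otimes> v) \<le> nrm A (x \<otimes> y \<ominus> x \<otimes> v) + nrm A (x \<otimes> v \<ominus> u \<otimes> v)"
      using xc c by (intro minus_triangle) (auto simp: mult_closed)
    also have "\<dots> \<le> nrm A x * nrm A (y \<ominus> v) + nrm A (x \<ominus> u) * nrm A v"
      using xc c nrm_mult[of x "y \<ominus> v"] nrm_mult[of "x \<ominus> u" v]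
      by (simp add: mult_minus_r mult_minus_l)
    also have "\<dots> \<le> K * nrm A (y \<ominus> v) + nrm A (x \<ominus> u) * L"
      using xc c K L by (intro add_mono mult_mono) (auto simp: nrm_nonneg)
    also have "\<dots> < \<epsilon> / 2 + \<epsilon> / 2"
      using u(2) v(2) K L by (intro add_strict_mono) (simp_all add: field_simps)
    finally show "\<exists>e\<in>E. nrm A (x \<otimes> y \<ominus> e) < \<epsilon>" using mult u v by auto
  qed
  have Dadj: "x\<^sup>\<star> \<in> D" if x: "x \<in> D" for x
    unfolding D_def
  proof (intro CollectI conjI allI impI)
    show "x\<^sup>\<star> \<in> carrier A" using Dcar x adj_closed by simp
    fix \<epsilon> :: real assume "\<epsilon> > 0"
    then obtain u where u: "u \<in> E" "nrm A (x \<ominus> u) < \<epsilon>" using get[OF x] by blast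
    then have "nrm A (x\<^sup>\<star> \<ominus> u\<^sup>\<star>) < \<epsilon>" using x Dcar car by (simp add: adj_minus nrm_adj)
    then show "\<exists>e\<in>E. nrm A (x\<^sup>\<star> \<ominus> e) < \<epsilon>" using adj u by blast
  qed
  have "closedin (ctop A) D"
    unfolding closedin_approx_iff
  proof (intro conjI ballI impI)
    show "D \<subseteq> carrier A" using Dcar by auto
    fix x assume x: "x \<in> carrier A" and appr: "\<forall>\<epsilon>>0. \<exists>d\<in>D. nrm A (x \<ominus> d) < \<epsilon>"
    show "x \<in> D" unfolding D_def
    proof (intro CollectI conjI allI impI x)
      fix \<epsilon> :: real assume "\<epsilon> > 0"
      then obtain d where d: "d \<in> D" "nrm A (x \<ominus> d) < \<epsilon> / 2"
        using appr half_gt_zero by blast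
      then obtain e where e: "e \<in> E" "nrm A (d \<ominus> e) < \<epsilon> / 2"
        using get[of d "\<epsilon>/2"] \<open>\<epsilon> > 0\<close> by auto
      have "nrm A (x \<ominus> e) < \<epsilon>"
        using minus_triangle[of x d e] x d e Dcar car by simp
      then show "\<exists>e\<in>E. nrm A (x \<ominus> e) < \<epsilon>" using e by blast
    qed
  qed
  moreover have "additive_subgroup D A"
  proof
    show "D \<subseteq> carrier (add_monoid A)" using Dcar by auto
    show "x \<otimes>\<^bsub>add_monoid A\<^esub> y \<in> D" if "x \<in> D" "y \<in> D" for x y
      using Dadd that by simp
    show "\<one>\<^bsub>add_monoid A\<^esub> \<in> D" using E ED by auto
    show "inv\<^bsub>add_monoid A\<^esub> x \<in> D" if "x \<in> D" for x
      using Dsm[OF that, of "-1"] neg_smult[OF Dcar[OF that]] by (simp add: a_inv_def)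
  qed
  ultimately show "cstar_subalg D A"
    using Dsm Dmu Dadj unfolding cstar_subalg_def by auto
qed

end

text \<open>Transport of a C*-subalgebra \<open>D\<close> of \<open>C\<close> along a map that is injective on \<open>D\<close>.\<close>

definition transp :: "('c, 'm) cstar_alg_scheme \<Rightarrow> 'c set \<Rightarrow> ('c \<Rightarrow> 'd) \<Rightarrow> 'd cstar_alg"
  where "transp C D f = (let g = inv_into D f in
    \<lparr>carrier = f ` D,
     monoid.mult = (\<lambda>u v. f (g u \<otimes>\<^bsub>C\<^esub> g v)),
     one = f \<zero>\<^bsub>C\<^esub>,
     zero = f \<zero>\<^bsub>C\<^esub>,
     add = (\<lambda>u v. f (g u \<oplus>\<^bsub>C\<^esub> g v)),
     smult = (\<lambda>c u. f (c \<odot>\<^bsub>C\<^esub> g u)),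
     adj = (\<lambda>u. f ((g u)\<^sup>\<star>\<^bsub>C\<^esub>)),
     nrm = (\<lambda>u. nrm C (g u))\<rparr>)"

locale cstar_transport = cstar_algebra C for C :: "('c, 'm) cstar_alg_scheme" (structure) +
  fixes D :: "'c set" and f :: "'c \<Rightarrow> 'd"
  assumes sub: "cstar_subalg D C" and inj: "inj_on f D"
begin

abbreviation "E \<equiv> transp C D f"

lemma D_carrier: "x \<in> D \<Longrightarrow> x \<in> carrier C"
  using sub additive_subgroup.a_subset unfolding cstar_subalg_def by blast

lemma D_closed [simp]:
  "\<zero> \<in> D"
  "\<lbrakk>x \<in> D; y \<in> D\<rbrakk> \<Longrightarrow> x \<oplus> y \<in> D"
  "x \<in> D \<Longrightarrow> c \<odot> x \<in> D"
  "\<lbrakk>x \<in> D; y \<in> D\<rbrakk> \<Longrightarrow> x \<otimes> y \<in> D"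
  "x \<in> D \<Longrightarrow> x\<^sup>\<star> \<in> D"
  using sub unfolding cstar_subalg_def
  by (auto simp: additive_subgroup.zero_closed additive_subgroup.a_closed)

lemma D_neg [simp]: "x \<in> D \<Longrightarrow> \<ominus> x \<in> D"
  by (simp add: neg_smult D_carrier)

lemma D_minus [simp]: "\<lbrakk>x \<in> D; y \<in> D\<rbrakk> \<Longrightarrow> x \<ominus> y \<in> D"
  by (simp add: a_minus_def)

lemma f_eq_iff [simp]: "\<lbrakk>x \<in> D; y \<in> D\<rbrakk> \<Longrightarrow> f x = f y \<longleftrightarrow> x = y"
  using inj by (auto dest: inj_onD)

lemma E_simps [simp]:
  "carrier E = f ` D"
  "\<zero>\<^bsub>E\<^esub> = f \<zero>"
  "\<lbrakk>x \<in> D; y \<in> D\<rbrakk> \<Longrightarrow> f x \<oplus>\<^bsub>E\<^esub> f y = f (x \<oplus> y)"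
  "x \<in> D \<Longrightarrow> c \<odot>\<^bsub>E\<^esub> f x = f (c \<odot> x)"
  "\<lbrakk>x \<in> D; y \<in> D\<rbrakk> \<Longrightarrow> f x \<otimes>\<^bsub>E\<^esub> f y = f (x \<otimes> y)"
  "x \<in> D \<Longrightarrow> (f x)\<^sup>\<star>\<^bsub>E\<^esub> = f (x\<^sup>\<star>)"
  "x \<in> D \<Longrightarrow> nrm E (f x) = nrm C x"
  using inj by (simp_all add: transp_def Let_def)

lemma E_group: "abelian_group E"
proof (rule abelian_groupI)
  show "\<exists>y\<in>carrier E. y \<oplus>\<^bsub>E\<^esub> x = \<zero>\<^bsub>E\<^esub>" if x: "x \<in> carrier E" for x
  proof -
    obtain a where a: "x = f a" "a \<in> D" using x by auto
    then have "f (\<ominus> a) \<oplus>\<^bsub>E\<^esub> x = \<zero>\<^bsub>E\<^esub>" by (simp add: M.l_neg D_carrier)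
    then show ?thesis using a by auto
  qed
qed (auto simp: M.a_ac D_carrier)

lemma E_neg [simp]:
  assumes "x \<in> D" shows "\<ominus>\<^bsub>E\<^esub> (f x) = f (\<ominus> x)"
proof -
  interpret EG: abelian_group E by (rule E_group)
  have "f (\<ominus> x) \<oplus>\<^bsub>E\<^esub> f x = \<zero>\<^bsub>E\<^esub>" using assms by (simp add: M.l_neg D_carrier)
  then show ?thesis using EG.minus_equality assms by auto
qed

lemma E_minus [simp]: "\<lbrakk>x \<in> D; y \<in> D\<rbrakk> \<Longrightarrow> f x \<ominus>\<^bsub>E\<^esub> f y = f (x \<ominus> y)"
  by (simp add: a_minus_def[of E] a_minus_def[of C])

lemma E_cdist [simp]: "\<lbrakk>x \<in> D; y \<in> D\<rbrakk> \<Longrightarrow> cdist E (f x) (f y) = cdist C x y"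
  by (simp add: cdist_def D_carrier)

lemma E_finsum:
  assumes "finite F" "\<And>i. i \<in> F \<Longrightarrow> h i \<in> D"
  shows "finsum C h F \<in> D \<and> f (finsum C h F) = finsum E (\<lambda>i. f (h i)) F"
proof -
  interpret EG: abelian_group E by (rule E_group)
  show ?thesis using assms
  proof (induction F)
    case empty then show ?case by simp
  next
    case (insert i F)
    have 1: "finsum C h (insert i F) = h i \<oplus> finsum C h F"
      using insert by (intro M.finsum_insert) (auto intro: D_carrier)
    have 2: "finsum E (\<lambda>i. f (h i)) (insert i F) = f (h i) \<oplus>\<^bsub>E\<^esub> finsum E (\<lambda>i. f (h i)) F"
      using insert by (intro EG.finsum_insert) auto
    have "finsum C h F \<in> D" and "f (finsum C h F) = finsum E (\<lambda>i. f (h i)) F"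
      using insert by auto
    moreover have "h i \<in> D" using insert by simp
    ultimately show ?case unfolding 1 2 by (metis D_closed(2) E_simps(3))
  qed
qed

lemma E_metric: "Metric_space (carrier E) (cdist E)"
proof -
  interpret MS: Metric_space "carrier C" "cdist C" by (rule metric)
  show ?thesis
  proof
    show "0 \<le> cdist E u v" for u v
      using MS.nonneg by (cases "u \<in> f ` D \<and> v \<in> f ` D") (auto simp: cdist_def[of E] nrm_nonneg D_carrier)
    show "cdist E u v = cdist E v u" for u v
    proof (cases "u \<in> f ` D \<and> v \<in> f ` D")
      case True then show ?thesis using MS.commute by auto
    qed (auto simp: cdist_def[of E])
    show "cdist E u w \<le> cdist E u v + cdist E v w"
      if "u \<in> carrier E" "v \<in> carrier E" "w \<in> carrier E" for u v w
      using that MS.triangle by (auto simp: D_carrier)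
  qed (auto simp: D_carrier)
qed

lemma E_complete: "Metric_space.mcomplete (carrier E) (cdist E)"
proof -
  interpret MS: Metric_space "carrier C" "cdist C" by (rule metric)
  interpret ME: Metric_space "carrier E" "cdist E" by (rule E_metric)
  show ?thesis unfolding ME.mcomplete_def
  proof (intro allI impI)
    fix \<sigma> assume S: "ME.MCauchy \<sigma>"
    then have "range \<sigma> \<subseteq> f ` D" unfolding ME.MCauchy_def by simp
    then have "\<forall>n. \<exists>x\<in>D. \<sigma> n = f x" by blast
    then obtain \<tau> where \<tau>: "\<And>n. \<tau> n \<in> D" "\<And>n. \<sigma> n = f (\<tau> n)" by metis
    have "MS.MCauchy \<tau>"
      using S \<tau> unfolding ME.MCauchy_def MS.MCauchy_def by (auto simp: D_carrier)
    then obtain l where l: "limitin MS.mtopology \<tau> l sequentially"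
      using complete unfolding MS.mcomplete_def by blast
    have "l \<in> D"
      using sub limitin_closedin[OF l, of D] \<tau> unfolding cstar_subalg_def by auto
    have "limitin ME.mtopology \<sigma> (f l) sequentially"
      using l \<open>l \<in> D\<close> \<tau> unfolding ME.limit_metric_sequentially MS.limit_metric_sequentially
      by simp meson
    then show "\<exists>x. limitin ME.mtopology \<sigma> x sequentially" by blast
  qed
qed

lemma E_cstar: "cstar_algebra E"
proof -
  interpret EG: abelian_group E by (rule E_group)
  have "module (ring_of_type_algebra :: complex ring) E"
    by (rule moduleI[OF R.is_cring E_group])
      (auto simp: D_carrier smult_add_c smult_mult_c smult_r_distr_c ring_of_type_algebra_def)
  then show ?thesis
    using E_complete
    by (intro cstar_algebra.intro cstar_algebra_axioms.intro)
      (auto simp: D_carrier mult_assoc mult_l_distr mult_r_distr smult_mult_l smult_mult_r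
        adj_adj adj_add adj_smult adj_mult nrm_nonneg nrm_eq_0 nrm_triangle nrm_smult nrm_mult
        nrm_cstar)
qed

lemma E_hom: "cstar_hom E C (inv_into D f)"
  unfolding cstar_hom_def using inj by (auto simp: D_carrier)

end

lemma cstar_hom_comp:
  "\<lbrakk>cstar_hom A C \<phi>; cstar_hom C D \<psi>\<rbrakk> \<Longrightarrow> cstar_hom A D (\<lambda>x. \<psi> (\<phi> x))"
  by (auto simp: cstar_hom_def Pi_iff)

fun poly_val :: "('c, 'm) cstar_alg_scheme \<Rightarrow> ('b \<Rightarrow> 'c) \<Rightarrow> ('l \<Rightarrow> 'b \<Rightarrow> 'c)
    \<Rightarrow> ('b, 'l) star_poly \<Rightarrow> 'c"
  where
    "poly_val C P S Zero = \<zero>\<^bsub>C\<^esub>"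
  | "poly_val C P S (Proj x) = (if P x \<in> carrier C then P x else \<zero>\<^bsub>C\<^esub>)"
  | "poly_val C P S (Piso \<alpha> x) = (if S \<alpha> x \<in> carrier C then S \<alpha> x else \<zero>\<^bsub>C\<^esub>)"
  | "poly_val C P S (Add u v) = poly_val C P S u \<oplus>\<^bsub>C\<^esub> poly_val C P S v"
  | "poly_val C P S (Scale c u) = c \<odot>\<^bsub>C\<^esub> poly_val C P S u"
  | "poly_val C P S (Mult u v) = poly_val C P S u \<otimes>\<^bsub>C\<^esub> poly_val C P S v"
  | "poly_val C P S (Adj u) = (poly_val C P S u)\<^sup>\<star>\<^bsub>C\<^esub>"

lemma universal_rep_lift:
  fixes C :: "('c, 'm) cstar_alg_scheme"
  assumes G: "rel_gbds B \<I> \<J>" and A: "universal_rep B \<I> \<J> A p s"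
    and C: "cstar_algebra C" and rep: "bds_rep B \<I> \<J> C P S"
  shows "\<exists>\<phi>. cstar_hom A C \<phi> \<and> (\<forall>x\<in>carrier B. \<phi> (p x) = P x)
    \<and> (\<forall>\<alpha>\<in>labels B. \<forall>y\<in>\<I> \<alpha>. \<phi> (s \<alpha> y) = S \<alpha> y)"
proof -
  interpret C: cstar_algebra C by (rule C)
  interpret B: bds B using G by (simp add: rel_gbds_def)
  let ?v = "poly_val C P S"
  have v: "?v u \<in> carrier C" for u
    by (induction u) (auto simp: C.mult_closed C.adj_closed)
  define D where "D = {x \<in> carrier C. \<forall>\<epsilon>>0. \<exists>e\<in>range ?v. nrm C (x \<ominus>\<^bsub>C\<^esub> e) < \<epsilon>}"
  have z: "\<zero>\<^bsub>C\<^esub> \<in> range ?v" by (rule range_eqI[of _ _ Zero]) simp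
  have ops: "x \<oplus>\<^bsub>C\<^esub> y \<in> range ?v" "c \<odot>\<^bsub>C\<^esub> x \<in> range ?v" "x \<otimes>\<^bsub>C\<^esub> y \<in> range ?v"
    "x\<^sup>\<star>\<^bsub>C\<^esub> \<in> range ?v" if xy: "x \<in> range ?v" "y \<in> range ?v" for x y c
  proof -
    obtain u w where uw: "x = ?v u" "y = ?v w" using xy by blast
    show "x \<oplus>\<^bsub>C\<^esub> y \<in> range ?v" by (rule range_eqI[of _ _ "Add u w"]) (simp add: uw)
    show "c \<odot>\<^bsub>C\<^esub> x \<in> range ?v" by (rule range_eqI[of _ _ "Scale c u"]) (simp add: uw)
    show "x \<otimes>\<^bsub>C\<^esub> y \<in> range ?v" by (rule range_eqI[of _ _ "Mult u w"]) (simp add: uw)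
    show "x\<^sup>\<star>\<^bsub>C\<^esub> \<in> range ?v" by (rule range_eqI[of _ _ "Adj u"]) (simp add: uw)
  qed
  have sub: "cstar_subalg D C" and vD: "range ?v \<subseteq> D"
    unfolding D_def 
    by (intro C.approx_closure_subalg; (rule z ops; assumption?)?; use v in blast)+
  define f where "f x = (\<lambda>n. SOME u. nrm C (x \<ominus>\<^bsub>C\<^esub> ?v u) < 1 / real (Suc n))" for x
  have f: "nrm C (x \<ominus>\<^bsub>C\<^esub> ?v (f x n)) < 1 / real (Suc n)" if "x \<in> D" for x n
  proof -
    have "\<exists>u. nrm C (x \<ominus>\<^bsub>C\<^esub> ?v u) < 1 / real (Suc n)"
      using that unfolding D_def by force
    then show ?thesis unfolding f_def by (rule someI_ex)
  qed
  have inj: "inj_on f D"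
  proof (rule inj_onI)
    fix x y assume xy: "x \<in> D" "y \<in> D" "f x = f y"
    have c: "x \<in> carrier C" "y \<in> carrier C" using xy by (auto simp: D_def)
    have "nrm C (x \<ominus>\<^bsub>C\<^esub> y) \<le> \<epsilon>" if e: "\<epsilon> > 0" for \<epsilon>
    proof -
      obtain n where n: "1 / real (Suc n) < \<epsilon> / 2"
        using reals_Archimedean[of "\<epsilon> / 2"] e unfolding inverse_eq_divide by auto
      have "nrm C (x \<ominus>\<^bsub>C\<^esub> y)
          \<le> nrm C (x \<ominus>\<^bsub>C\<^esub> ?v (f x n)) + nrm C (?v (f x n) \<ominus>\<^bsub>C\<^esub> y)"
        using c v by (intro C.minus_triangle)
      also have "nrm C (?v (f x n) \<ominus>\<^bsub>C\<^esub> y) = nrm C (y \<ominus>\<^bsub>C\<^esub> ?v (f y n))"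
        using xy(3) c v by (simp add: C.nrm_minus_commute)
      finally show ?thesis using f[OF xy(1), of n] f[OF xy(2), of n] n by linarith
    qed
    then have "nrm C (x \<ominus>\<^bsub>C\<^esub> y) = 0"
      using C.nrm_nonneg[of "x \<ominus>\<^bsub>C\<^esub> y"] c
      by (meson C.M.minus_closed dense_ge dual_order.antisym)
    then show "x = y" using c by (simp add: C.nrm_eq_0 C.minus_eq_zero_iff)
  qed
  interpret T: cstar_transport C D f using sub inj by unfold_locales
  have P: "P x \<in> D" if "x \<in> carrier B" for x
  proof -
    have "?v (Proj x) = P x" using rep that by (simp add: bds_rep_def)
    then show ?thesis using vD by (metis rangeI subsetD)
  qed
  have S: "S \<alpha> y \<in> D" if "\<alpha> \<in> labels B" "y \<in> \<I> \<alpha>" for \<alpha> y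
  proof -
    have "?v (Piso \<alpha> y) = S \<alpha> y" using rep that by (simp add: bds_rep_def)
    then show ?thesis using vD by (metis rangeI subsetD)
  qed
  have I_sub: "y \<in> carrier B" if "\<alpha> \<in> labels B" "y \<in> \<I> \<alpha>" for \<alpha> y
    using G that by (auto simp: rel_gbds_def gba_ideal_def)
  have idem: "x \<^bold>\<inter>\<^bsub>B\<^esub> x = x" if "x \<in> carrier B" for x
    using B.meet_join_absorb[of x "x \<^bold>\<inter>\<^bsub>B\<^esub> x"] B.join_meet_absorb[of x x] that
    by (simp add: B.meet_closed)
  have act_I: "act B \<alpha> x \<in> \<I> \<alpha>" if "\<alpha> \<in> labels B" "x \<in> carrier B" for \<alpha> x
  proof -
    have "act B \<alpha> x \<in> act_range B \<alpha>"
      unfolding act_range_def le_b_def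
      using that idem[OF B.act_closed[OF that]] B.act_closed[OF that] by blast
    then show ?thesis using G that by (auto simp: rel_gbds_def)
  qed
  have J: "x \<in> carrier B \<and> finite (Delta B x)" if "x \<in> \<J>" for x
  proof -
    have r: "x \<in> regs B" using G that by (auto simp: rel_gbds_def gba_ideal_def)
    show ?thesis
    proof (cases "x = \<^bold>\<emptyset>\<^bsub>B\<^esub>")
      case True
      then have "Delta B x = {}" using B.act_bot by (auto simp: Delta_def)
      then show ?thesis using True B.bot_closed by simp
    next
      case False then show ?thesis using r idem by (auto simp: regs_def le_b_def)
    qed
  qed
  have sum: "f (P x) = (\<Oplus>\<^bsub>T.E\<^esub>\<alpha>\<in>Delta B x. f (S \<alpha> (act B \<alpha> x) \<otimes>\<^bsub>C\<^esub> (S \<alpha> (act B \<alpha> x))\<^sup>\<star>\<^bsub>C\<^esub>))"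
    if "x \<in> \<J>" for x
  proof -
    have "P x = (\<Oplus>\<^bsub>C\<^esub>\<alpha>\<in>Delta B x. S \<alpha> (act B \<alpha> x) \<otimes>\<^bsub>C\<^esub> (S \<alpha> (act B \<alpha> x))\<^sup>\<star>\<^bsub>C\<^esub>)"
      using rep that by (simp add: bds_rep_def)
    then show ?thesis
      using T.E_finsum[of "Delta B x" "\<lambda>\<alpha>. S \<alpha> (act B \<alpha> x) \<otimes>\<^bsub>C\<^esub> (S \<alpha> (act B \<alpha> x))\<^sup>\<star>\<^bsub>C\<^esub>"]
        J[OF that] S act_I by (auto simp: Delta_def)
  qed
  have "f (P x) = (\<Oplus>\<^bsub>T.E\<^esub>\<alpha>\<in>Delta B x.
      f (S \<alpha> (act B \<alpha> x)) \<otimes>\<^bsub>T.E\<^esub> (f (S \<alpha> (act B \<alpha> x)))\<^sup>\<star>\<^bsub>T.E\<^esub>)" if "x \<in> \<J>" for x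
    unfolding sum[OF that]
  proof (rule abelian_monoid.finsum_cong')
    show "abelian_monoid T.E" using T.E_group abelian_group.axioms(1) by blast
  qed (use J[OF that] S act_I in \<open>auto simp: Delta_def\<close>)
  then have "bds_rep B \<I> \<J> T.E (\<lambda>x. f (P x)) (\<lambda>\<alpha> y. f (S \<alpha> y))"
    using rep P S I_sub unfolding bds_rep_def
    by (simp add: B.bot_closed B.meet_closed B.join_closed B.act_closed)
  then obtain \<phi> where \<phi>: "cstar_hom A T.E \<phi>" "\<forall>x\<in>carrier B. \<phi> (p x) = f (P x)"
    "\<forall>\<alpha>\<in>labels B. \<forall>y\<in>\<I> \<alpha>. \<phi> (s \<alpha> y) = f (S \<alpha> y)"
    using A T.E_cstar unfolding universal_rep_def by blast
  have "cstar_hom A C (\<lambda>x. inv_into D f (\<phi> x))"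
    using \<phi>(1) T.E_hom by (rule cstar_hom_comp)
  then show ?thesis using \<phi>(2,3) P S inj by (intro exI[of _ "\<lambda>x. inv_into D f (\<phi> x)"]) simp
qed

end

theory Submission imports Defs begin

text \<open>Let \<open>K = I\<^sub>(\<^sub>H\<^sub>,\<^sub>S\<^sub>)\<close> be the ideal generated by the gaps \<open>p\<^sub>A - \<Sum> s\<^sub>\<alpha> s\<^sub>\<alpha>\<^sup>\<star>\<close> with \<open>A\<close> in \<open>S\<^sub>I\<close>. Both
  universal properties together identify the algebra of the quotient system with \<open>A / K\<close>, and
  since \<open>K \<subseteq> I\<close> the map \<open>\<phi>\<^sub>I\<close> becomes the quotient map \<open>A / K \<rightarrow> A / I\<close>. It is onto, and it is
  injective iff \<open>K = I\<close>. The gauge action fixes the generators of \<open>K\<close>, so \<open>K\<close> is gauge-invariant.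

  Conversely, the gauge action descends to \<open>A / I\<close> for a gauge-invariant \<open>I\<close>, while \<open>\<phi>\<^sub>I\<close> kills no
  nonzero projection \<open>p\<^sub>[\<^sub>A\<^sub>]\<close> and no gap of a regular element outside \<open>[S\<^sub>I]\<close>. Such a homomorphism
  is isometric. On the linear span of words \<open>s\<^sub>\<mu> p\<^sub>A s\<^sub>\<nu>\<^sup>\<star>\<close> with \<open>\<mu>\<close>, \<open>\<nu>\<close> of equal length it is bounded
  below, by induction on the length, because the compressions \<open>s\<^sub>\<alpha>\<^sup>\<star> x s\<^sub>\<beta>\<close> shorten the words and
  what they do not see is a combination of gaps. For the span of all words with length difference
  at most \<open>d\<close> the homogeneous components are controlled by averaging over the gauge action, and the
  constant is linear in \<open>d\<close>. Since \<open>\<parallel>a\<parallel>\<close> can be read off from the norms of the powers of \<open>a\<^sup>\<star> a\<close>, such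
  bounds improve to the constant \<open>1\<close>.\<close>

section \<open>Formal linear combinations of atoms in an algebra without unit\<close>

section \<open>Linear identities\<close>

text \<open>Spectra, states and square roots are avoided throughout. Fixed points of contractions
  supply the few elements that functional calculus would give, and an identity of the form |y + i w|
  = |y - i w| = |x| supplies their norm bounds. As there is no unit, an element such as 1 - k occurs
  only applied to some x, as \<open>x \<ominus> k \<otimes> x\<close>.

  The obstacle in the uniqueness part is that the set of labels may be infinite and that the ideals
  \<open>\<I> \<alpha>\<close> may lack a largest element, so no projection collects all ranges.
  Every estimate is made for a finite set F of labels, and gaps are taken relative to F instead of
  relative to the labels that the element sees. The price is a constant depending on F and on the
  word length. It is harmless because it does not depend on the power to which an element is raised.

  The two nondegeneracy hypotheses on \<phi> enter at a single place: together they show that a gap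
  relative to F is killed by \<phi> only if it is zero already.\<close>

context cstar_algebra
begin

declare mult_closed [simp] adj_closed [simp] adj_adj [simp] nrm_nonneg [simp]

lemma zero_mult [simp]: "x \<in> carrier A \<Longrightarrow> \<zero> \<otimes> x = \<zero>"
  using smult_mult_l[of x x 0] by simp

lemma mult_zero [simp]: "x \<in> carrier A \<Longrightarrow> x \<otimes> \<zero> = \<zero>"
  using smult_mult_r[of x x 0] by simp

lemma adj_zero [simp]: "\<zero>\<^sup>\<star> = \<zero>"
  using adj_smult[of \<zero> 0] by simp

lemma nrm_zero [simp]: "nrm A \<zero> = 0"
  by (simp add: nrm_eq_0)

text \<open>\<open>F f\<close> is the value of the expression when each atom x is replaced by the
  number \<open>f x\<close>. The function f is arbitrary rather than linear, so distinct atoms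
  behave as independent indeterminates and F records the formal combination.\<close>

inductive lin :: "'a \<Rightarrow> (('a \<Rightarrow> complex) \<Rightarrow> complex) \<Rightarrow> bool" where
  lin_zero: "lin \<zero> (\<lambda>f. 0)"
| lin_atom: "x \<in> carrier A \<Longrightarrow> lin x (\<lambda>f. f x)"
| lin_add: "\<lbrakk>lin t F; lin u G\<rbrakk> \<Longrightarrow> lin (t \<oplus> u) (\<lambda>f. F f + G f)"
| lin_smult: "lin t F \<Longrightarrow> lin (c \<odot> t) (\<lambda>f. c * F f)"

lemma lin_carrier: "lin t F \<Longrightarrow> t \<in> carrier A"
  by (induction rule: lin.induct) auto

lemma lin_neg: "lin t F \<Longrightarrow> lin (\<ominus> t) (\<lambda>f. - F f)"
  using lin_smult[of t F "-1"] by (simp add: neg_smult lin_carrier)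

lemma lin_minus: "\<lbrakk>lin t F; lin u G\<rbrakk> \<Longrightarrow> lin (t \<ominus> u) (\<lambda>f. F f - G f)"
  using lin_add[OF _ lin_neg] by (simp add: a_minus_def)

text \<open>Expanding both factors bilinearly makes products of atoms the new atoms, whence the
  nested evaluation.\<close>

lemma lin_mult:
  assumes "lin t F" "lin u G"
  shows "lin (t \<otimes> u) (\<lambda>f. F (\<lambda>x. G (\<lambda>y. f (x \<otimes> y))))"
  using assms
proof (induction rule: lin.induct)
  case (lin_atom x)
  from lin_atom(2,1) show ?case
    by (induction rule: lin.induct)
      (auto simp: mult_r_distr smult_mult_r lin_carrier intro: lin.intros)
qed (auto simp: mult_l_distr smult_mult_l lin_carrier intro: lin.intros)

text \<open>The outer conjugation is meant for the coefficients; the inner one cancels it on the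
  values of f.\<close>

lemma lin_adj:
  assumes "lin t F"
  shows "lin (t\<^sup>\<star>) (\<lambda>f. cnj (F (\<lambda>x. cnj (f (x\<^sup>\<star>)))))"
  using assms
  by (induction rule: lin.induct) (auto simp: adj_add adj_smult lin_carrier intro: lin.intros)

primrec lcomb :: "(complex \<times> 'a) list \<Rightarrow> 'a" where
  "lcomb [] = \<zero>"
| "lcomb (p # ps) = fst p \<odot> snd p \<oplus> lcomb ps"

lemma lcomb_closed: "snd ` set ps \<subseteq> carrier A \<Longrightarrow> lcomb ps \<in> carrier A"
  by (induction ps) auto

lemma lcomb_append:
  "\<lbrakk>snd ` set ps \<subseteq> carrier A; snd ` set qs \<subseteq> carrier A\<rbrakk>
    \<Longrightarrow> lcomb (ps @ qs) = lcomb ps \<oplus> lcomb qs"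
  by (induction ps) (auto simp: lcomb_closed M.a_assoc)

lemma lcomb_smult:
  "snd ` set ps \<subseteq> carrier A \<Longrightarrow> lcomb (map (\<lambda>p. (c * fst p, snd p)) ps) = c \<odot> lcomb ps"
  by (induction ps) (auto simp: lcomb_closed smult_r_distr_c smult_mult_c)

lemma lcomb_split:
  "\<lbrakk>snd ` set ps \<subseteq> carrier A; x \<in> carrier A\<rbrakk> \<Longrightarrow> lcomb ps =
    (\<Sum>p\<leftarrow>ps. if snd p = x then fst p else 0) \<odot> x \<oplus> lcomb (filter (\<lambda>p. snd p \<noteq> x) ps)"
proof (induction ps)
  case (Cons p ps)
  have "lcomb (filter (\<lambda>p. snd p \<noteq> x) ps) \<in> carrier A"
    using Cons.prems by (intro lcomb_closed) auto
  then show ?case using Cons by (auto simp: smult_add_c M.a_ac)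
qed auto

text \<open>Testing with the indicator function of one atom shows that its coefficients, spread over
  the list, add up to 0. Removing every occurrence of that atom leaves a shorter list.\<close>

lemma lcomb_zero:
  "\<lbrakk>snd ` set ps \<subseteq> carrier A; \<And>f :: 'a \<Rightarrow> complex. (\<Sum>p\<leftarrow>ps. fst p * f (snd p)) = 0\<rbrakk> \<Longrightarrow> lcomb ps = \<zero>"
proof (induction ps rule: length_induct)
  case (1 ps)
  show ?case
  proof (cases ps)
    case (Cons p qs)
    define x where "x = snd p"
    let ?r = "filter (\<lambda>p. snd p \<noteq> x) ps"
    have x: "x \<in> carrier A" using 1 Cons by (auto simp: x_def)
    have f: "(\<Sum>p\<leftarrow>ps. fst p * (if snd p = x then 1 else 0)) =
        (\<Sum>p\<leftarrow>ps. if snd p = x then fst p else 0)"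
      by (intro arg_cong[where f = sum_list] map_cong) auto
    \<comment> \<open>Resetting f to 0 at x carries the hypothesis over to the shortened
      list.\<close>
    have "(\<Sum>p\<leftarrow>?r. fst p * f (snd p)) = (\<Sum>p\<leftarrow>ps. fst p * (f(x := 0)) (snd p))" for f :: "'a \<Rightarrow> complex"
      by (induction ps) auto
    then have r: "\<And>f. (\<Sum>p\<leftarrow>?r. fst p * f (snd p)) = 0" using "1.prems"(2) by simp
    have l: "length ?r < length ps"
      using Cons by (simp add: x_def less_Suc_eq_le)
    have "lcomb ?r = \<zero>"
      using "1.prems"(1) by (intro "1.IH"[rule_format, OF l _ r]) auto
    then show ?thesis
      using lcomb_split[OF "1.prems"(1) x] "1.prems"(2)[of "\<lambda>y. if y = x then 1 else 0"] f x by simp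
  qed simp
qed

lemma lin_lcomb:
  "lin t F \<Longrightarrow> \<exists>ps. snd ` set ps \<subseteq> carrier A \<and> t = lcomb ps
    \<and> F = (\<lambda>f. \<Sum>p\<leftarrow>ps. fst p * f (snd p))"
proof (induction rule: lin.induct)
  case lin_zero then show ?case by (intro exI[of _ "[]"]) auto
next
  case (lin_atom x) then show ?case by (intro exI[of _ "[(1, x)]"]) auto
next
  case (lin_add t F u G)
  then obtain ps qs where "snd ` set ps \<subseteq> carrier A" "t = lcomb ps"
    "F = (\<lambda>f. \<Sum>p\<leftarrow>ps. fst p * f (snd p))" "snd ` set qs \<subseteq> carrier A" "u = lcomb qs"
    "G = (\<lambda>f. \<Sum>p\<leftarrow>qs. fst p * f (snd p))" by blast
  then show ?case by (intro exI[of _ "ps @ qs"]) (auto simp: lcomb_append)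
next
  case (lin_smult t F c)
  then obtain ps where "snd ` set ps \<subseteq> carrier A" "t = lcomb ps"
    "F = (\<lambda>f. \<Sum>p\<leftarrow>ps. fst p * f (snd p))" by blast
  then show ?case
    by (intro exI[of _ "map (\<lambda>p. (c * fst p, snd p)) ps"])
      (auto simp: lcomb_smult o_def sum_list_const_mult mult.assoc)
qed

text \<open>Reduces a linear identity in \<open>A\<close> to a polynomial identity in the complex numbers
  \<open>f x\<close>, where \<open>x\<close> runs over the atoms and \<open>f\<close> is arbitrary.\<close>

lemma lin_eqI:
  assumes "lin t F" "lin u G" "\<And>f. F f = G f"
  shows "t = u"
proof -
  obtain ps where "snd ` set ps \<subseteq> carrier A" "t \<ominus> u = lcomb ps"
    "\<And>f. F f - G f = (\<Sum>p\<leftarrow>ps. fst p * f (snd p))"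
    using lin_lcomb[OF lin_minus[OF assms(1,2)]] by metis
  then have "t \<ominus> u = \<zero>" using lcomb_zero[of ps] assms(3) by simp
  then show ?thesis using assms(1,2) by (simp add: minus_eq_zero_iff lin_carrier)
qed

text \<open>These structural rules are tried before \<open>lin_atom\<close>, so only terms that are
  not sums, differences, scalar multiples, products or adjoints become atoms. The remaining goal is
  an equation between complex numbers whose atoms are products; \<open>mult_assoc\<close>,
  \<open>adj_mult\<close> and the commutation rules at hand bring them to a common form.\<close>

lemmas lin_rules = lin_zero lin_neg lin_minus lin_add lin_smult lin_mult lin_adj

lemma minus_zero_right [simp]: "x \<in> carrier A \<Longrightarrow> x \<ominus> \<zero> = x"
  by (rule lin_eqI, (rule lin_rules | (rule lin_atom, simp; fail))+) simp

lemma minus_self [simp]: "x \<in> carrier A \<Longrightarrow> x \<ominus> x = \<zero>"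
  by (rule lin_eqI, (rule lin_rules | (rule lin_atom, simp; fail))+) simp

end

section \<open>Closed subsets, contractions and norm bounds without functional calculus\<close>

section \<open>Elementary C*-algebra theory\<close>

lemma closedin_equalizer:
  assumes A: "cstar_algebra A" and C: "cstar_algebra C"
    and f: "\<And>x. x \<in> carrier A \<Longrightarrow> f x \<in> carrier C" and g: "\<And>x. x \<in> carrier A \<Longrightarrow> g x \<in> carrier C"
    and fl: "\<And>x y. \<lbrakk>x \<in> carrier A; y \<in> carrier A\<rbrakk> \<Longrightarrow> nrm C (f x \<ominus>\<^bsub>C\<^esub> f y) \<le> K * nrm A (x \<ominus>\<^bsub>A\<^esub> y)"
    and gl: "\<And>x y. \<lbrakk>x \<in> carrier A; y \<in> carrier A\<rbrakk> \<Longrightarrow> nrm C (g x \<ominus>\<^bsub>C\<^esub> g y) \<le> L * nrm A (x \<ominus>\<^bsub>A\<^esub> y)"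
  shows "closedin (ctop A) {x \<in> carrier A. f x = g x}"
proof -
  interpret A: cstar_algebra A by (rule A)
  interpret C: cstar_algebra C by (rule C)
  show ?thesis unfolding A.closedin_approx_iff
  proof (intro conjI ballI impI)
    fix x assume x: "x \<in> carrier A"
      and ap: "\<forall>\<epsilon>>0. \<exists>d\<in>{x \<in> carrier A. f x = g x}. nrm A (x \<ominus>\<^bsub>A\<^esub> d) < \<epsilon>"
    \<comment> \<open>The Lipschitz constants may be negative; absolute values and the summand 1
      make the divisor M positive.\<close>
    define M where "M = \<bar>K\<bar> + \<bar>L\<bar> + 1"
    have "nrm C (f x \<ominus>\<^bsub>C\<^esub> g x) \<le> \<epsilon>" if e: "\<epsilon> > 0" for \<epsilon>
    proof -
      have M: "M > 0" by (simp add: M_def add_nonneg_pos)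
      then obtain d where d: "d \<in> carrier A" "f d = g d" "nrm A (x \<ominus>\<^bsub>A\<^esub> d) < \<epsilon> / M"
        using ap e by (metis (mono_tags, lifting) divide_pos_pos mem_Collect_eq)
      have "nrm C (f x \<ominus>\<^bsub>C\<^esub> g x) \<le> nrm C (f x \<ominus>\<^bsub>C\<^esub> f d) + nrm C (f d \<ominus>\<^bsub>C\<^esub> g x)"
        using f g x d by (intro C.minus_triangle) auto
      also have "nrm C (f d \<ominus>\<^bsub>C\<^esub> g x) = nrm C (g x \<ominus>\<^bsub>C\<^esub> g d)"
        using d f g x by (simp add: C.nrm_minus_commute)
      also have "nrm C (f x \<ominus>\<^bsub>C\<^esub> f d) + nrm C (g x \<ominus>\<^bsub>C\<^esub> g d) \<le>
          \<bar>K\<bar> * nrm A (x \<ominus>\<^bsub>A\<^esub> d) + \<bar>L\<bar> * nrm A (x \<ominus>\<^bsub>A\<^esub> d)"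
        using fl[OF x d(1)] gl[OF x d(1)] A.nrm_nonneg[of "x \<ominus>\<^bsub>A\<^esub> d"] x d
        by (intro add_mono; meson A.M.minus_closed abs_ge_self mult_right_mono order_trans)
      also have "\<dots> \<le> M * nrm A (x \<ominus>\<^bsub>A\<^esub> d)"
        using x d by (simp add: M_def algebra_simps)
      also have "\<dots> \<le> \<epsilon>" using d(3) M by (simp add: pos_less_divide_eq mult.commute)
      finally show ?thesis .
    qed
    then have "nrm C (f x \<ominus>\<^bsub>C\<^esub> g x) = 0"
      using f g x by (meson C.M.minus_closed C.nrm_nonneg antisym dense_ge)
    then show "x \<in> {x \<in> carrier A. f x = g x}" using f g x by (simp add: C.nrm_eq_0 C.minus_eq_zero_iff)
  qed auto
qed

lemma cstar_subalgI:
  assumes "cstar_algebra A" "closedin (ctop A) D" "\<zero>\<^bsub>A\<^esub> \<in> D"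
    and "\<And>x y. \<lbrakk>x \<in> D; y \<in> D\<rbrakk> \<Longrightarrow> x \<oplus>\<^bsub>A\<^esub> y \<in> D"
    and sm: "\<And>c x. x \<in> D \<Longrightarrow> c \<odot>\<^bsub>A\<^esub> x \<in> D"
    and "\<And>x y. \<lbrakk>x \<in> D; y \<in> D\<rbrakk> \<Longrightarrow> x \<otimes>\<^bsub>A\<^esub> y \<in> D"
    and "\<And>x. x \<in> D \<Longrightarrow> x\<^sup>\<star>\<^bsub>A\<^esub> \<in> D"
  shows "cstar_subalg D A"
proof -
  interpret cstar_algebra A by fact
  have D: "D \<subseteq> carrier A" using assms(2) by (simp add: closedin_approx_iff)
  have "additive_subgroup D A"
  proof
    show "inv\<^bsub>add_monoid A\<^esub> x \<in> D" if "x \<in> D" for x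
      using sm[OF that, of "-1"] neg_smult[of x] that D by (auto simp: a_inv_def)
  qed (use assms D in auto)
  then show ?thesis using assms by (simp add: cstar_subalg_def)
qed

lemma cstar_idealI:
  assumes "cstar_algebra A" "closedin (ctop A) D" "\<zero>\<^bsub>A\<^esub> \<in> D"
    and "\<And>x y. \<lbrakk>x \<in> D; y \<in> D\<rbrakk> \<Longrightarrow> x \<oplus>\<^bsub>A\<^esub> y \<in> D"
    and sm: "\<And>c x. x \<in> D \<Longrightarrow> c \<odot>\<^bsub>A\<^esub> x \<in> D"
    and "\<And>x a. \<lbrakk>x \<in> D; a \<in> carrier A\<rbrakk> \<Longrightarrow> x \<otimes>\<^bsub>A\<^esub> a \<in> D"
    and "\<And>x a. \<lbrakk>x \<in> D; a \<in> carrier A\<rbrakk> \<Longrightarrow> a \<otimes>\<^bsub>A\<^esub> x \<in> D"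
  shows "cstar_ideal D A"
proof -
  interpret cstar_algebra A by fact
  have D: "D \<subseteq> carrier A" using assms(2) by (simp add: closedin_approx_iff)
  have "additive_subgroup D A"
  proof
    show "inv\<^bsub>add_monoid A\<^esub> x \<in> D" if "x \<in> D" for x
      using sm[OF that, of "-1"] neg_smult[of x] that D by (auto simp: a_inv_def)
  qed (use assms D in auto)
  then show ?thesis using assms by (simp add: cstar_ideal_def)
qed

context cstar_algebra
begin

lemma nrm_minus_le: "\<lbrakk>x \<in> carrier A; y \<in> carrier A\<rbrakk> \<Longrightarrow> nrm A (x \<ominus> y) \<le> nrm A x + nrm A y"
  using nrm_triangle[of x "\<ominus> y"] by (simp add: a_minus_def nrm_neg)

lemma nrm_selfadj_square:
  "\<lbrakk>x \<in> carrier A; x\<^sup>\<star> = x\<rbrakk> \<Longrightarrow> nrm A (x \<otimes> x) = (nrm A x)\<^sup>2"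
  using nrm_cstar[of x] by simp

lemma closedin_nrm_le: "closedin (ctop A) {x \<in> carrier A. nrm A x \<le> r}"
  unfolding closedin_approx_iff
proof (intro conjI ballI impI)
  fix x assume x: "x \<in> carrier A"
    and ap: "\<forall>\<epsilon>>0. \<exists>d\<in>{x \<in> carrier A. nrm A x \<le> r}. nrm A (x \<ominus> d) < \<epsilon>"
  have "nrm A x \<le> r + \<epsilon>" if e: "\<epsilon> > 0" for \<epsilon>
  proof -
    obtain d where d: "d \<in> carrier A" "nrm A d \<le> r" "nrm A (x \<ominus> d) < \<epsilon>" using ap e by auto
    have "x = (x \<ominus> d) \<oplus> d"
      using x d by (simp add: a_minus_def M.a_assoc M.l_neg)
    then have "nrm A x \<le> nrm A (x \<ominus> d) + nrm A d"
      using nrm_triangle[of "x \<ominus> d" d] x d by simp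
    then show ?thesis using d by linarith
  qed
  then show "x \<in> {x \<in> carrier A. nrm A x \<le> r}" using x by (simp add: field_le_epsilon)
qed auto

text \<open>Banach's theorem on a closed set S. Whatever closed condition is built into S, such as
  selfadjointness, commutation with a fixed element or membership in a closed ideal, is inherited by
  the solution.\<close>

lemma contraction_fixpoint:
  assumes S: "closedin (ctop A) S" "S \<noteq> {}" and T: "\<And>x. x \<in> S \<Longrightarrow> T x \<in> S"
    and "\<kappa> < 1" and con: "\<And>x y. \<lbrakk>x \<in> S; y \<in> S\<rbrakk> \<Longrightarrow> nrm A (T x \<ominus> T y) \<le> \<kappa> * nrm A (x \<ominus> y)"
  shows "\<exists>x\<in>S. T x = x"
proof -
  have sub: "S \<subseteq> carrier A" using S(1) by (simp add: closedin_approx_iff)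
  interpret MS: Metric_space "carrier A" "cdist A" by (rule metric)
  interpret Submetric "carrier A" "cdist A" S using sub by unfold_locales
  have "sub.mcomplete" using closedin_mcomplete_imp_mcomplete S(1) complete by blast
  then show ?thesis
    by (rule sub.Banach_fixedpoint_thm[of T \<kappa>]) (use assms sub in \<open>auto simp: cdist_def subset_iff\<close>)
qed

text \<open>Here \<open>k = 1 - sqrt (1 - h\<^sup>2)\<close>, so that \<open>h + i (1 - k)\<close> acts as a unitary; this replaces the
  functional calculus below.\<close>

lemma selfadj_complement:
  assumes h [simp]: "h \<in> carrier A" and hs [simp]: "h\<^sup>\<star> = h" and h1: "nrm A h < 1"
  obtains k where "k \<in> carrier A" "k\<^sup>\<star> = k" "k \<otimes> h = h \<otimes> k" "h \<otimes> h = k \<oplus> k \<ominus> k \<otimes> k"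
proof -
  define r where "r = (nrm A h)\<^sup>2"
  have r: "0 \<le> r" "r < 1" using h1 by (auto simp: r_def power_less_one_iff)
  define S where "S = {k \<in> carrier A. k\<^sup>\<star> = k} \<inter> {k \<in> carrier A. k \<otimes> h = h \<otimes> k}
    \<inter> {k \<in> carrier A. nrm A k \<le> r}"
  \<comment> \<open>A fixed point solves 2 k = h^2 + k^2. The ball of radius r = |h|^2 is preserved
    since (r + r^2) / 2 <= r, and r itself is the contraction constant there.\<close>
  define T where "T k = (1/2) \<odot> (h \<otimes> h \<oplus> k \<otimes> k)" for k
  have "closedin (ctop A) {k \<in> carrier A. k\<^sup>\<star> = k}"
    by (rule closedin_equalizer[OF cstar_algebra_axioms cstar_algebra_axioms, where K=1 and L=1])
      (auto simp: adj_minus nrm_adj)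
  moreover have "closedin (ctop A) {k \<in> carrier A. k \<otimes> h = h \<otimes> k}"
    by (rule closedin_equalizer[OF cstar_algebra_axioms cstar_algebra_axioms,
        where K="nrm A h" and L="nrm A h"])
      (auto simp: mult_minus_l mult_minus_r mult.commute intro: order_trans[OF nrm_mult])
  ultimately have S: "closedin (ctop A) S"
    unfolding S_def by (intro closedin_Int closedin_nrm_le)
  have z: "\<zero> \<in> S" using r by (simp add: S_def)
  have "\<exists>k\<in>S. T k = k"
  proof (rule contraction_fixpoint[OF S])
    show "S \<noteq> {}" using z by blast
    fix k assume "k \<in> S"
    then have k [simp]: "k \<in> carrier A" "k\<^sup>\<star> = k" "k \<otimes> h = h \<otimes> k" "nrm A k \<le> r"
      by (auto simp: S_def)
    have k2: "k \<otimes> (h \<otimes> x) = h \<otimes> (k \<otimes> x)" if "x \<in> carrier A" for x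
      using that by (metis h k(1,3) mult_assoc)
    have "nrm A (T k) \<le> 1/2 * (nrm A (h \<otimes> h) + nrm A (k \<otimes> k))"
      using nrm_triangle[of "h \<otimes> h" "k \<otimes> k"] by (simp add: T_def nrm_smult)
    also have "\<dots> \<le> 1/2 * (r + r\<^sup>2)" using power_mono[OF k(4), of 2]
      by (simp add: nrm_selfadj_square r_def)
    also have "\<dots> \<le> r" using r mult_left_le[of r r] by (simp add: power2_eq_square)
    finally have 1: "nrm A (T k) \<le> r" .
    have 2: "T k \<otimes> h = h \<otimes> T k" unfolding T_def
      by (rule lin_eqI, (rule lin_rules | (rule lin_atom, simp; fail))+)
        (simp add: mult_assoc k2 algebra_simps)
    have "(T k)\<^sup>\<star> = T k" unfolding T_def
      by (rule lin_eqI, (rule lin_rules | (rule lin_atom, simp; fail))+)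
        (simp add: adj_mult algebra_simps)
    then show "T k \<in> S" using 1 2 by (simp add: S_def T_def)
    fix l assume "l \<in> S"
    then have l [simp]: "l \<in> carrier A" "nrm A l \<le> r" by (auto simp: S_def)
    \<comment> \<open>The factorization k^2 - l^2 = k (k - l) + (k - l) l holds although k and l
      need not commute.\<close>
    have "T k \<ominus> T l = (1/2) \<odot> (k \<otimes> (k \<ominus> l) \<oplus> (k \<ominus> l) \<otimes> l)" unfolding T_def
      by (rule lin_eqI, (rule lin_rules | (rule lin_atom, simp; fail))+)
        (simp add: algebra_simps)
    then have "nrm A (T k \<ominus> T l) \<le> 1/2 * (nrm A (k \<otimes> (k \<ominus> l)) + nrm A ((k \<ominus> l) \<otimes> l))"
      using nrm_triangle[of "k \<otimes> (k \<ominus> l)" "(k \<ominus> l) \<otimes> l"] by (simp add: nrm_smult)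
    also have "\<dots> \<le> 1/2 * (nrm A k * nrm A (k \<ominus> l) + nrm A (k \<ominus> l) * nrm A l)"
      using nrm_mult[of k "k \<ominus> l"] nrm_mult[of "k \<ominus> l" l] by simp
    also have "\<dots> \<le> 1/2 * (r * nrm A (k \<ominus> l) + nrm A (k \<ominus> l) * r)"
      by (intro mult_left_mono add_mono mult_right_mono) auto
    finally show "nrm A (T k \<ominus> T l) \<le> r * nrm A (k \<ominus> l)" by simp
  qed (use r in auto)
  then obtain k where k: "k \<in> S" "T k = k" by blast
  then have [simp]: "k \<in> carrier A" by (simp add: S_def)
  have "k \<oplus> k \<ominus> k \<otimes> k = T k \<oplus> T k \<ominus> k \<otimes> k" using k by simp
  also have "\<dots> = h \<otimes> h" unfolding T_def
    by (rule lin_eqI, (rule lin_rules | (rule lin_atom, simp; fail))+) (simp add: algebra_simps)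
  finally show thesis using that[of k] k by (auto simp: S_def)
qed

text \<open>The cross terms of y + i w and y - i w cancel by \<open>c\<close>, so both have the norm
  of x, and y is their mean.\<close>

lemma nrm_le_of_sum_squares:
  assumes [simp]: "x \<in> carrier A" "y \<in> carrier A" "w \<in> carrier A"
    and c: "y\<^sup>\<star> \<otimes> w = w\<^sup>\<star> \<otimes> y" and s: "y\<^sup>\<star> \<otimes> y \<oplus> w\<^sup>\<star> \<otimes> w = x\<^sup>\<star> \<otimes> x"
  shows "nrm A y \<le> nrm A x"
proof -
  have sq: "nrm A (y \<oplus> c \<odot> w) = nrm A x" if "c = \<i> \<or> c = -\<i>" for c
  proof -
    have "(y \<oplus> c \<odot> w)\<^sup>\<star> \<otimes> (y \<oplus> c \<odot> w) = y\<^sup>\<star> \<otimes> y \<oplus> w\<^sup>\<star> \<otimes> w"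
      by (rule lin_eqI, (rule lin_rules | (rule lin_atom, simp; fail))+)
        (use that c in \<open>auto simp: algebra_simps\<close>)
    then have "(nrm A (y \<oplus> c \<odot> w))\<^sup>2 = (nrm A x)\<^sup>2" using s by (simp flip: nrm_cstar)
    then show ?thesis by (simp add: power2_eq_iff_nonneg)
  qed
  have "y = (1/2) \<odot> ((y \<oplus> \<i> \<odot> w) \<oplus> (y \<oplus> (-\<i>) \<odot> w))"
    by (rule lin_eqI, (rule lin_rules | (rule lin_atom, simp; fail))+) (simp add: algebra_simps)
  then have "nrm A y \<le> 1/2 * (nrm A (y \<oplus> \<i> \<odot> w) + nrm A (y \<oplus> (-\<i>) \<odot> w))"
    using nrm_triangle[of "y \<oplus> \<i> \<odot> w" "y \<oplus> (-\<i>) \<odot> w"]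
    by (metis (no_types, lifting) M.a_closed abs_numeral assms(2,3) divide_numeral_1 mult_left_mono
      nrm_smult norm_divide norm_numeral norm_one numeral_One smult_closed_c zero_le_divide_1_iff zero_le_numeral)
  then show ?thesis by (simp add: sq)
qed

text \<open>From h^2 = 2 k - k^2 one gets h^2 + (1 - k)^2 = 1. Applied to x this is the sum of
  squares required by \<open>nrm_le_of_sum_squares\<close>, used once with h x in the first place
  and once with x - k x.\<close>

lemma complement_contractive:
  assumes [simp]: "h \<in> carrier A" "h\<^sup>\<star> = h" "k \<in> carrier A" "k\<^sup>\<star> = k" "x \<in> carrier A"
    and kh: "k \<otimes> h = h \<otimes> k" and hh: "h \<otimes> h = k \<oplus> k \<ominus> k \<otimes> k"
  shows "nrm A (h \<otimes> x) \<le> nrm A x" "nrm A (x \<ominus> k \<otimes> x) \<le> nrm A x"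
proof -
  have k2: "k \<otimes> (h \<otimes> x) = h \<otimes> (k \<otimes> x)" if "x \<in> carrier A" for x
    using that kh by (metis assms(1,3) mult_assoc)
  have c: "(h \<otimes> x)\<^sup>\<star> \<otimes> (x \<ominus> k \<otimes> x) = (x \<ominus> k \<otimes> x)\<^sup>\<star> \<otimes> (h \<otimes> x)"
    by (rule lin_eqI, (rule lin_rules | (rule lin_atom, simp; fail))+)
      (simp add: mult_assoc adj_mult k2 algebra_simps)
  have "(h \<otimes> x)\<^sup>\<star> \<otimes> (h \<otimes> x) = x\<^sup>\<star> \<otimes> ((h \<otimes> h) \<otimes> x)" by (simp add: mult_assoc adj_mult)
  then have s: "(h \<otimes> x)\<^sup>\<star> \<otimes> (h \<otimes> x) = x\<^sup>\<star> \<otimes> ((k \<oplus> k \<ominus> k \<otimes> k) \<otimes> x)" by (simp add: hh)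
  have s: "(h \<otimes> x)\<^sup>\<star> \<otimes> (h \<otimes> x) \<oplus> (x \<ominus> k \<otimes> x)\<^sup>\<star> \<otimes> (x \<ominus> k \<otimes> x) = x\<^sup>\<star> \<otimes> x"
    unfolding s
    by (rule lin_eqI, (rule lin_rules | (rule lin_atom, simp; fail))+)
      (simp add: mult_assoc adj_mult algebra_simps)
  show "nrm A (h \<otimes> x) \<le> nrm A x" by (rule nrm_le_of_sum_squares[OF _ _ _ c s]) auto
  have "(x \<ominus> k \<otimes> x)\<^sup>\<star> \<otimes> (x \<ominus> k \<otimes> x) \<oplus> (h \<otimes> x)\<^sup>\<star> \<otimes> (h \<otimes> x) = x\<^sup>\<star> \<otimes> x"
    using s by (simp add: M.a_comm)
  then show "nrm A (x \<ominus> k \<otimes> x) \<le> nrm A x" using c by (intro nrm_le_of_sum_squares) auto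
qed

end

section \<open>Contractivity of homomorphisms\<close>

locale star_hom = A: cstar_algebra A + C: cstar_algebra C
  for A :: "('a, 'm) cstar_alg_scheme" and C :: "('c, 'n) cstar_alg_scheme" +
  fixes \<phi> :: "'a \<Rightarrow> 'c"
  assumes hom: "cstar_hom A C \<phi>"
begin

lemma hom_closed [simp]: "x \<in> carrier A \<Longrightarrow> \<phi> x \<in> carrier C"
  and hom_add: "\<lbrakk>x \<in> carrier A; y \<in> carrier A\<rbrakk> \<Longrightarrow> \<phi> (x \<oplus>\<^bsub>A\<^esub> y) = \<phi> x \<oplus>\<^bsub>C\<^esub> \<phi> y"
  and hom_smult: "x \<in> carrier A \<Longrightarrow> \<phi> (c \<odot>\<^bsub>A\<^esub> x) = c \<odot>\<^bsub>C\<^esub> \<phi> x"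
  and hom_mult: "\<lbrakk>x \<in> carrier A; y \<in> carrier A\<rbrakk> \<Longrightarrow> \<phi> (x \<otimes>\<^bsub>A\<^esub> y) = \<phi> x \<otimes>\<^bsub>C\<^esub> \<phi> y"
  and hom_adj: "x \<in> carrier A \<Longrightarrow> \<phi> (x\<^sup>\<star>\<^bsub>A\<^esub>) = (\<phi> x)\<^sup>\<star>\<^bsub>C\<^esub>"
  using hom by (auto simp: cstar_hom_def)

lemma hom_zero [simp]: "\<phi> \<zero>\<^bsub>A\<^esub> = \<zero>\<^bsub>C\<^esub>"
  using hom_smult[of "\<zero>\<^bsub>A\<^esub>" 0] by simp

lemma hom_neg: "x \<in> carrier A \<Longrightarrow> \<phi> (\<ominus>\<^bsub>A\<^esub> x) = \<ominus>\<^bsub>C\<^esub> \<phi> x"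
  by (simp add: A.neg_smult C.neg_smult hom_smult)

lemma hom_minus: "\<lbrakk>x \<in> carrier A; y \<in> carrier A\<rbrakk> \<Longrightarrow> \<phi> (x \<ominus>\<^bsub>A\<^esub> y) = \<phi> x \<ominus>\<^bsub>C\<^esub> \<phi> y"
  by (simp add: a_minus_def hom_add hom_neg)

lemma hom_finsum:
  "\<lbrakk>finite F; \<And>i. i \<in> F \<Longrightarrow> h i \<in> carrier A\<rbrakk> \<Longrightarrow> \<phi> (finsum A h F) = finsum C (\<lambda>i. \<phi> (h i)) F"
proof (induction F rule: finite_induct)
  case (insert i F)
  then have "\<phi> (finsum A h (insert i F)) = \<phi> (h i \<oplus>\<^bsub>A\<^esub> finsum A h F)"
    by (subst A.M.finsum_insert) auto
  also have "\<dots> = \<phi> (h i) \<oplus>\<^bsub>C\<^esub> finsum C (\<lambda>i. \<phi> (h i)) F"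
    using insert by (subst hom_add) auto
  also have "\<dots> = finsum C (\<lambda>i. \<phi> (h i)) (insert i F)"
    using insert by (subst C.M.finsum_insert) auto
  finally show ?case .
qed simp

text \<open>The relation h^2 = 2 k - k^2 is purely algebraic, so \<phi> carries it to the target and
  makes \<phi> h contractive there as soon as |h| < 1. Scaling settles selfadjoint elements, and the
  C*-identity reduces the general case to them.\<close>

lemma nrm_le: assumes x: "x \<in> carrier A" shows "nrm C (\<phi> x) \<le> nrm A x"
proof -
  have 1: "nrm C (\<phi> h) \<le> 1"
    if h: "h \<in> carrier A" "h\<^sup>\<star>\<^bsub>A\<^esub> = h" "nrm A h < 1" for h
  proof -
    obtain k where k: "k \<in> carrier A" "k\<^sup>\<star>\<^bsub>A\<^esub> = k" "k \<otimes>\<^bsub>A\<^esub> h = h \<otimes>\<^bsub>A\<^esub> k"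
      "h \<otimes>\<^bsub>A\<^esub> h = k \<oplus>\<^bsub>A\<^esub> k \<ominus>\<^bsub>A\<^esub> k \<otimes>\<^bsub>A\<^esub> k" by (rule A.selfadj_complement[OF h])
    \<comment> \<open>The element on which \<phi> h acts is \<phi> h itself, so the bound reads
      |\<phi> h|^2 <= |\<phi> h|.\<close>
    have "nrm C (\<phi> h \<otimes>\<^bsub>C\<^esub> \<phi> h) \<le> nrm C (\<phi> h)"
    proof (rule C.complement_contractive(1))
      show "(\<phi> h)\<^sup>\<star>\<^bsub>C\<^esub> = \<phi> h" "(\<phi> k)\<^sup>\<star>\<^bsub>C\<^esub> = \<phi> k" "\<phi> k \<otimes>\<^bsub>C\<^esub> \<phi> h = \<phi> h \<otimes>\<^bsub>C\<^esub> \<phi> k"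
        using h k by (metis hom_adj hom_mult)+
      have "\<phi> (h \<otimes>\<^bsub>A\<^esub> h) = \<phi> (k \<oplus>\<^bsub>A\<^esub> k \<ominus>\<^bsub>A\<^esub> k \<otimes>\<^bsub>A\<^esub> k)" using k by simp
      then show "\<phi> h \<otimes>\<^bsub>C\<^esub> \<phi> h = \<phi> k \<oplus>\<^bsub>C\<^esub> \<phi> k \<ominus>\<^bsub>C\<^esub> \<phi> k \<otimes>\<^bsub>C\<^esub> \<phi> k"
        using h(1) k(1) by (simp add: hom_mult hom_minus hom_add)
    qed (use h k in auto)
    moreover have "(\<phi> h)\<^sup>\<star>\<^bsub>C\<^esub> = \<phi> h" using h by (metis hom_adj)
    ultimately have "nrm C (\<phi> h) * nrm C (\<phi> h) \<le> 1 * nrm C (\<phi> h)"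
      using h by (simp add: C.nrm_selfadj_square power2_eq_square)
    then show ?thesis
      using C.nrm_nonneg[of "\<phi> h"] h
        mult_right_le_imp_le[of "nrm C (\<phi> h)" "nrm C (\<phi> h)" 1] by fastforce
  qed
  have 2: "nrm C (\<phi> h) \<le> nrm A h" if h: "h \<in> carrier A" "h\<^sup>\<star>\<^bsub>A\<^esub> = h" for h
  proof (rule dense_ge)
    fix c assume c: "nrm A h < c"
    then have c0: "c > 0" using A.nrm_nonneg[OF h(1)] by linarith
    have "nrm C (\<phi> (complex_of_real (1/c) \<odot>\<^bsub>A\<^esub> h)) \<le> 1"
      using h c c0 by (intro 1) (simp_all add: A.adj_smult A.nrm_smult norm_divide)
    then show "nrm C (\<phi> h) \<le> c"
      using h c0 by (simp add: hom_smult C.nrm_smult norm_divide field_simps)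
  qed
  have "nrm C (\<phi> (x\<^sup>\<star>\<^bsub>A\<^esub> \<otimes>\<^bsub>A\<^esub> x)) \<le> nrm A (x\<^sup>\<star>\<^bsub>A\<^esub> \<otimes>\<^bsub>A\<^esub> x)"
    using x by (intro 2) (auto simp: A.adj_mult)
  then have "(nrm C (\<phi> x))\<^sup>2 \<le> (nrm A x)\<^sup>2"
    using x by (simp add: hom_mult hom_adj A.nrm_cstar C.nrm_cstar)
  then show ?thesis using x by (simp add: power2_le_iff_abs_le)
qed

end

text \<open>The elements on which two homomorphisms agree form a C*-subalgebra; contractivity is
  what makes it closed.\<close>

lemma star_hom_eq_on_gens:
  assumes "star_hom A C \<phi>" "star_hom A C \<psi>" and gen: "cstar_gen A U = carrier A"
    and eq: "\<And>x. x \<in> U \<Longrightarrow> \<phi> x = \<psi> x" and U: "U \<subseteq> carrier A" and "x \<in> carrier A"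
  shows "\<phi> x = \<psi> x"
proof -
  interpret f: star_hom A C \<phi> by fact
  interpret g: star_hom A C \<psi> by fact
  have cl: "closedin (ctop A) {x \<in> carrier A. \<phi> x = \<psi> x}"
    by (rule closedin_equalizer[OF f.A.cstar_algebra_axioms f.C.cstar_algebra_axioms,
        where K=1 and L=1])
      (auto simp: f.nrm_le g.nrm_le
        simp flip: f.hom_minus g.hom_minus)
  have "cstar_subalg {x \<in> carrier A. \<phi> x = \<psi> x} A"
    by (rule cstar_subalgI[OF f.A.cstar_algebra_axioms cl])
      (auto simp: f.hom_add g.hom_add f.hom_smult g.hom_smult f.hom_mult g.hom_mult f.hom_adj g.hom_adj)
  then have "cstar_gen A U \<subseteq> {x \<in> carrier A. \<phi> x = \<psi> x}"
    unfolding cstar_gen_def using eq U by blast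
  then show ?thesis using gen assms(6) by auto
qed

section \<open>Approximate units of closed ideals\<close>

section \<open>Closed ideals and quotients\<close>

lemma (in abelian_group) additive_subgroup_abelian:
  "additive_subgroup I G \<Longrightarrow> abelian_subgroup I G"
  using abelian_subgroupI3 abelian_group_axioms by blast

locale closed_ideal = cstar_algebra A for A :: "('a, 'm) cstar_alg_scheme" (structure) +
  fixes I :: "'a set"
  assumes ideal: "cstar_ideal I A"
begin

sublocale abelian_subgroup I A
  using ideal M.additive_subgroup_abelian by (simp add: cstar_ideal_def)

lemma I_smult [simp]: "x \<in> I \<Longrightarrow> c \<odot> x \<in> I"
  and I_mult_l [simp]: "\<lbrakk>x \<in> I; a \<in> carrier A\<rbrakk> \<Longrightarrow> a \<otimes> x \<in> I"
  and I_mult_r [simp]: "\<lbrakk>x \<in> I; a \<in> carrier A\<rbrakk> \<Longrightarrow> x \<otimes> a \<in> I"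
  and I_closedin: "closedin (ctop A) I"
  using ideal by (auto simp: cstar_ideal_def)

lemma I_approx: "\<lbrakk>x \<in> carrier A; \<And>\<epsilon>. \<epsilon> > 0 \<Longrightarrow> \<exists>d\<in>I. nrm A (x \<ominus> d) < \<epsilon>\<rbrakk> \<Longrightarrow> x \<in> I"
  using I_closedin by (simp add: closedin_approx_iff)

lemma I_minus [simp]: "\<lbrakk>x \<in> I; y \<in> I\<rbrakk> \<Longrightarrow> x \<ominus> y \<in> I"
  by (simp add: a_minus_def)

text \<open>\<open>e = j\<^sup>2 / (1 + j\<^sup>2)\<close>, obtained as the fixed point of \<open>e \<mapsto> (j\<^sup>2 + m (1 - h\<^sup>2) e) / (m + 1)\<close>
  where \<open>m h\<^sup>2 = j\<^sup>2\<close> and \<open>m\<close> is so large that \<open>\<parallel>h\<parallel> < 1\<close>.\<close>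

lemma ideal_resolvent:
  assumes jI: "j \<in> I" and js [simp]: "j\<^sup>\<star> = j"
  obtains e where "e \<in> I" "e\<^sup>\<star> = e" "e \<otimes> j = j \<otimes> e" "e = j \<otimes> j \<ominus> (j \<otimes> j) \<otimes> e"
proof -
  have j [simp]: "j \<in> carrier A" using jI by simp
  \<comment> \<open>The summand 1 forces |j| < sqrt m, so that h = j / sqrt m has norm below 1 even
    for j = 0; l = m + 1 is the denominator of the iteration.\<close>
  define m where "m = 1 + (nrm A j)\<^sup>2"
  define l where "l = m + 1"
  have m: "m \<ge> 1" by (simp add: m_def)
  define L where "L = complex_of_real (1 / l)"
  have [simp]: "cnj L = L" by (simp add: L_def)
  have "complex_of_real l * L = complex_of_real (l * (1 / l))" by (simp only: L_def of_real_mult)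
  also have "l * (1 / l) = 1" using m by (simp add: l_def)
  finally have L: "complex_of_real l * L = 1" by simp
  define h where "h = complex_of_real (1 / sqrt m) \<odot> j"
  have [simp]: "h \<in> carrier A" "h\<^sup>\<star> = h" by (simp_all add: h_def adj_smult)
  have "nrm A h = nrm A j / sqrt m" using m by (simp add: h_def nrm_smult norm_divide)
  also have "\<dots> < 1"
    using m real_less_rsqrt[of "nrm A j" m] by (subst divide_less_eq_1_pos) (auto simp: m_def add_pos_nonneg)
  finally obtain k where k [simp]: "k \<in> carrier A" "k\<^sup>\<star> = k" "k \<otimes> h = h \<otimes> k"
    and hh: "h \<otimes> h = k \<oplus> k \<ominus> k \<otimes> k"
    using selfadj_complement[of h] by auto
  have jj: "j \<otimes> j = complex_of_real m \<odot> (h \<otimes> h)"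
  proof -
    have "complex_of_real m * (complex_of_real (1 / sqrt m) * complex_of_real (1 / sqrt m)) = 1"
      using m by (simp flip: of_real_mult)
    then show ?thesis
      by (simp add: h_def smult_mult_l smult_mult_r flip: smult_mult_c)
  qed
  \<comment> \<open>Since 1 - h^2 = (1 - k)^2, the map is the contraction 1 - k applied
    twice.\<close>
  have contr: "nrm A (d \<ominus> h \<otimes> (h \<otimes> d)) \<le> nrm A d" if d [simp]: "d \<in> carrier A" for d
  proof -
    have "d \<ominus> h \<otimes> (h \<otimes> d) = d \<ominus> (k \<oplus> k \<ominus> k \<otimes> k) \<otimes> d" by (simp add: mult_assoc flip: hh)
    also have "\<dots> = (d \<ominus> k \<otimes> d) \<ominus> k \<otimes> (d \<ominus> k \<otimes> d)"
      by (rule lin_eqI, (rule lin_rules | (rule lin_atom, simp; fail))+)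
        (simp add: mult_assoc algebra_simps)
    also have "nrm A \<dots> \<le> nrm A (d \<ominus> k \<otimes> d)"
      by (rule complement_contractive(2)[OF _ _ _ _ _ k(3) hh]) auto
    also have "\<dots> \<le> nrm A d" by (rule complement_contractive(2)[OF _ _ _ _ _ k(3) hh]) auto
    finally show ?thesis .
  qed
  \<comment> \<open>The equation e = j^2 - j^2 e, after adding m e to both sides and dividing by l =
    m + 1. The map e -> m e - j^2 e is m times the contraction 1 - h^2, so T contracts by m /
    l.\<close>
  define T where "T e = L \<odot> (j \<otimes> j \<oplus> (complex_of_real m \<odot> e \<ominus> (j \<otimes> j) \<otimes> e))" for e
  define S where "S = I \<inter> {e \<in> carrier A. e\<^sup>\<star> = e} \<inter> {e \<in> carrier A. e \<otimes> j = j \<otimes> e}"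
  have "closedin (ctop A) {k \<in> carrier A. k\<^sup>\<star> = k}"
    by (rule closedin_equalizer[OF cstar_algebra_axioms cstar_algebra_axioms, where K=1 and L=1])
      (auto simp: adj_minus nrm_adj)
  moreover have "closedin (ctop A) {k \<in> carrier A. k \<otimes> j = j \<otimes> k}"
    by (rule closedin_equalizer[OF cstar_algebra_axioms cstar_algebra_axioms,
        where K="nrm A j" and L="nrm A j"])
      (auto simp: mult_minus_l mult_minus_r mult.commute intro: order_trans[OF nrm_mult])
  ultimately have S: "closedin (ctop A) S"
    unfolding S_def by (intro closedin_Int I_closedin)
  have "\<exists>e\<in>S. T e = e"
  proof (rule contraction_fixpoint[OF S])
    have "\<zero> \<in> S" by (simp add: S_def)
    then show "S \<noteq> {}" by blast
    show "m / l < 1" using m by (simp add: l_def)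
    fix e assume "e \<in> S"
    then have e [simp]: "e \<in> I" "e \<in> carrier A" "e\<^sup>\<star> = e" "e \<otimes> j = j \<otimes> e" by (auto simp: S_def)
    have e2: "e \<otimes> (j \<otimes> x) = j \<otimes> (e \<otimes> x)" if "x \<in> carrier A" for x
      using that by (metis e(2,4) j mult_assoc)
    have 1: "T e \<in> I" using jI by (simp add: T_def)
    have 2: "T e \<otimes> j = j \<otimes> T e" unfolding T_def
      by (rule lin_eqI, (rule lin_rules | (rule lin_atom, simp; fail))+)
        (simp add: mult_assoc e2 algebra_simps)
    have "(T e)\<^sup>\<star> = T e" unfolding T_def
      by (rule lin_eqI, (rule lin_rules | (rule lin_atom, simp; fail))+)
        (simp add: adj_mult e2 mult_assoc algebra_simps)
    then show "T e \<in> S" using 1 2 by (simp add: S_def)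
    fix d assume "d \<in> S"
    then have d [simp]: "d \<in> carrier A" by (auto simp: S_def)
    have "T e \<ominus> T d = L \<odot> (complex_of_real m \<odot> ((e \<ominus> d) \<ominus> h \<otimes> (h \<otimes> (e \<ominus> d))))"
      unfolding T_def jj
      by (rule lin_eqI, (rule lin_rules | (rule lin_atom, simp; fail))+)
        (simp add: mult_assoc algebra_simps)
    then have "nrm A (T e \<ominus> T d) = m / l * nrm A ((e \<ominus> d) \<ominus> h \<otimes> (h \<otimes> (e \<ominus> d)))"
      using m by (simp add: nrm_smult l_def L_def norm_divide del: of_real_add)
    then show "nrm A (T e \<ominus> T d) \<le> m / l * nrm A (e \<ominus> d)"
      using contr[of "e \<ominus> d"] m by (simp add: l_def divide_right_mono)
  qed
  then obtain e where e: "e \<in> S" "T e = e" by blast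
  then have [simp]: "e \<in> carrier A" by (simp add: S_def)
  have "e = complex_of_real l \<odot> e \<ominus> complex_of_real m \<odot> e"
    by (rule lin_eqI, (rule lin_rules | (rule lin_atom, simp; fail))+)
      (simp add: l_def algebra_simps)
  also have "complex_of_real l \<odot> e = complex_of_real l \<odot> T e" using e by simp
  also have "\<dots> = j \<otimes> j \<oplus> (complex_of_real m \<odot> e \<ominus> (j \<otimes> j) \<otimes> e)"
    by (simp add: T_def L flip: smult_mult_c)
  also have "\<dots> \<ominus> complex_of_real m \<odot> e = j \<otimes> j \<ominus> (j \<otimes> j) \<otimes> e"
    by (rule lin_eqI, (rule lin_rules | (rule lin_atom, simp; fail))+) (simp add: algebra_simps)
  finally show thesis using that[of e] e by (auto simp: S_def)
qed

text \<open>Put i = N j and e = i^2 / (1 + i^2). Then w = i - i e, which is i / (1 + i^2), satisfies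
  w^2 = e - e^2, hence (2 w)^2 + (1 - 2 e)^2 = 1. By the sum of squares argument both 2 w and 1 - 2
  e are contractive. The second gives the bound for 1 - e, the mean of 1 and 1 - 2 e; the first
  bounds w = N (j - j e), so j - j e has norm at most 1 / N.\<close>

lemma approximate_unit:
  assumes jI: "j \<in> I" and js: "j\<^sup>\<star> = j" and \<epsilon>: "\<epsilon> > 0"
  obtains e where "e \<in> I" "e\<^sup>\<star> = e" "\<And>x. x \<in> carrier A \<Longrightarrow> nrm A (x \<ominus> e \<otimes> x) \<le> nrm A x"
    "nrm A (j \<ominus> j \<otimes> e) < \<epsilon>"
proof -
  obtain N :: nat where N: "1 / \<epsilon> < real N" using reals_Archimedean2 by blast
  moreover have "0 < 1 / \<epsilon>" using \<epsilon> by simp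
  ultimately have N0: "N > 0" using \<epsilon> by (metis less_trans of_nat_0_less_iff)
  have jc [simp]: "j \<in> carrier A" using jI by simp
  define i where "i = of_nat N \<odot> j"
  have iI: "i \<in> I" and iss [simp]: "i\<^sup>\<star> = i" and i [simp]: "i \<in> carrier A"
    using jI js by (auto simp: i_def adj_smult)
  obtain e where eI: "e \<in> I" and e [simp]: "e\<^sup>\<star> = e" "e \<otimes> i = i \<otimes> e"
    and eq: "e = i \<otimes> i \<ominus> (i \<otimes> i) \<otimes> e"
    using ideal_resolvent[OF iI] by auto
  have [simp]: "e \<in> carrier A" using eI by simp
  have e2: "e \<otimes> (i \<otimes> x) = i \<otimes> (e \<otimes> x)" if "x \<in> carrier A" for x
    using that by (metis e(2) i \<open>e \<in> carrier A\<close> mult_assoc)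
  define w where "w = i \<ominus> i \<otimes> e"
  have [simp]: "w \<in> carrier A" by (simp add: w_def)
  have [simp]: "w\<^sup>\<star> = w" unfolding w_def
    by (rule lin_eqI, (rule lin_rules | (rule lin_atom, simp; fail))+) (simp add: adj_mult)
  have we: "e \<otimes> w = w \<otimes> e" unfolding w_def
    by (rule lin_eqI, (rule lin_rules | (rule lin_atom, simp; fail))+) (simp add: mult_assoc e2)
  have we2: "e \<otimes> (w \<otimes> x) = w \<otimes> (e \<otimes> x)" if "x \<in> carrier A" for x
    using that by (metis we \<open>w \<in> carrier A\<close> \<open>e \<in> carrier A\<close> mult_assoc)
  have "w \<otimes> w = (i \<otimes> i \<ominus> (i \<otimes> i) \<otimes> e) \<ominus> (i \<otimes> i \<ominus> (i \<otimes> i) \<otimes> e) \<otimes> e" unfolding w_def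
    by (rule lin_eqI, (rule lin_rules | (rule lin_atom, simp; fail))+)
      (simp add: mult_assoc e2 algebra_simps)
  then have ww: "w \<otimes> w = e \<ominus> e \<otimes> e" by (simp flip: eq)
  have bounds: "nrm A ((2 :: complex) \<odot> (w \<otimes> x)) \<le> nrm A x"
    "nrm A (x \<ominus> (2 :: complex) \<odot> (e \<otimes> x)) \<le> nrm A x" if x [simp]: "x \<in> carrier A" for x
  proof -
    let ?y = "(2 :: complex) \<odot> (w \<otimes> x)" and ?v = "x \<ominus> (2 :: complex) \<odot> (e \<otimes> x)"
    have c: "?y\<^sup>\<star> \<otimes> ?v = ?v\<^sup>\<star> \<otimes> ?y"
      by (rule lin_eqI, (rule lin_rules | (rule lin_atom, simp; fail))+)
        (simp add: mult_assoc adj_mult we2 algebra_simps)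
    have "?y\<^sup>\<star> \<otimes> ?y = (4 :: complex) \<odot> (x\<^sup>\<star> \<otimes> ((w \<otimes> w) \<otimes> x))"
      by (simp add: mult_assoc adj_mult adj_smult smult_mult_l smult_mult_r flip: smult_mult_c)
    then have s: "?y\<^sup>\<star> \<otimes> ?y \<oplus> ?v\<^sup>\<star> \<otimes> ?v = (4 :: complex) \<odot> (x\<^sup>\<star> \<otimes> ((e \<ominus> e \<otimes> e) \<otimes> x)) \<oplus> ?v\<^sup>\<star> \<otimes> ?v"
      by (simp add: ww)
    have s: "?y\<^sup>\<star> \<otimes> ?y \<oplus> ?v\<^sup>\<star> \<otimes> ?v = x\<^sup>\<star> \<otimes> x" unfolding s
      by (rule lin_eqI, (rule lin_rules | (rule lin_atom, simp; fail))+)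
        (simp add: mult_assoc adj_mult algebra_simps)
    show "nrm A ?y \<le> nrm A x" by (rule nrm_le_of_sum_squares[OF _ _ _ c s]) auto
    have "?v\<^sup>\<star> \<otimes> ?v \<oplus> ?y\<^sup>\<star> \<otimes> ?y = x\<^sup>\<star> \<otimes> x" using s by (simp add: M.a_comm)
    then show "nrm A ?v \<le> nrm A x" using c by (intro nrm_le_of_sum_squares) auto
  qed
  have 1: "nrm A (x \<ominus> e \<otimes> x) \<le> nrm A x" if x [simp]: "x \<in> carrier A" for x
  proof -
    have "x \<ominus> e \<otimes> x = (1/2) \<odot> (x \<oplus> (x \<ominus> (2 :: complex) \<odot> (e \<otimes> x)))"
      by (rule lin_eqI, (rule lin_rules | (rule lin_atom, simp; fail))+) (simp add: algebra_simps)
    then have "nrm A (x \<ominus> e \<otimes> x) \<le> 1/2 * (nrm A x + nrm A (x \<ominus> (2 :: complex) \<odot> (e \<otimes> x)))"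
      using nrm_triangle[of x "x \<ominus> (2 :: complex) \<odot> (e \<otimes> x)"] by (simp add: nrm_smult)
    then show ?thesis using bounds(2)[OF x] by simp
  qed
  have "2 * (nrm A w)\<^sup>2 \<le> nrm A w"
    using bounds(1)[of w] by (simp add: nrm_smult nrm_selfadj_square)
  then have w: "nrm A w \<le> 1"
    by (smt (verit, best) power2_eq_square mult_le_cancel_right1 nrm_nonneg \<open>w \<in> carrier A\<close>)
  have "w = of_nat N \<odot> (j \<ominus> j \<otimes> e)" unfolding w_def i_def
    by (rule lin_eqI, (rule lin_rules | (rule lin_atom, simp; fail))+) (simp add: algebra_simps)
  then have "real N * nrm A (j \<ominus> j \<otimes> e) \<le> 1" using w by (simp add: nrm_smult)
  then have "nrm A (j \<ominus> j \<otimes> e) \<le> 1 / real N" using N0 by (simp add: field_simps)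
  also have "\<dots> < \<epsilon>" using N N0 \<epsilon> by (simp add: field_simps)
  finally show thesis using that eI 1 by simp
qed

text \<open>The definition of an ideal does not mention the adjoint. With an approximate unit e of
  I, the elements \<open>e \<otimes> x\<^sup>\<star>\<close> lie in I and converge to
  \<open>x\<^sup>\<star>\<close>, because x - x e tends to 0.\<close>

lemma I_adj [simp]: assumes xI: "x \<in> I" shows "x\<^sup>\<star> \<in> I"
proof (rule I_approx)
  have x [simp]: "x \<in> carrier A" using xI by simp
  fix \<epsilon> :: real assume "\<epsilon> > 0"
  then have e0: "\<epsilon>\<^sup>2 > 0" by simp
  have "x\<^sup>\<star> \<otimes> x \<in> I" "(x\<^sup>\<star> \<otimes> x)\<^sup>\<star> = x\<^sup>\<star> \<otimes> x" using xI by (auto simp: adj_mult)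
  \<comment> \<open>The approximate unit belongs to the selfadjoint element
    \<open>x\<^sup>\<star> \<otimes> x\<close>; the tolerance is squared because the C*-identity
    squares the norm of x - x e.\<close>
  from approximate_unit[OF this e0] obtain e where e: "e \<in> I" "e\<^sup>\<star> = e" "\<And>x. x \<in> carrier A \<Longrightarrow> nrm A (x \<ominus> e \<otimes> x) \<le> nrm A x"
    "nrm A (x\<^sup>\<star> \<otimes> x \<ominus> (x\<^sup>\<star> \<otimes> x) \<otimes> e) < \<epsilon>\<^sup>2" by blast
  have [simp]: "e \<in> carrier A" using e by simp
  let ?j = "x\<^sup>\<star> \<otimes> x \<ominus> (x\<^sup>\<star> \<otimes> x) \<otimes> e"
  have "(x \<ominus> x \<otimes> e)\<^sup>\<star> \<otimes> (x \<ominus> x \<otimes> e) = ?j \<ominus> e \<otimes> ?j"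
    by (rule lin_eqI, (rule lin_rules | (rule lin_atom, simp; fail))+)
      (simp add: mult_assoc adj_mult e(2) algebra_simps)
  then have "(nrm A (x \<ominus> x \<otimes> e))\<^sup>2 \<le> nrm A ?j"
    using e(3)[of ?j] by (simp flip: nrm_cstar)
  then have "nrm A (x \<ominus> x \<otimes> e) < \<epsilon>"
    using e(4) \<open>\<epsilon> > 0\<close> by (meson le_less_trans less_eq_real_def power_less_imp_less_base)
  moreover have "x\<^sup>\<star> \<ominus> e \<otimes> x\<^sup>\<star> = (x \<ominus> x \<otimes> e)\<^sup>\<star>"
    by (rule lin_eqI, (rule lin_rules | (rule lin_atom, simp; fail))+) (simp add: adj_mult e(2))
  ultimately show "\<exists>d\<in>I. nrm A (x\<^sup>\<star> \<ominus> d) < \<epsilon>"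
    using e(1) by (intro bexI[of _ "e \<otimes> x\<^sup>\<star>"]) (auto simp: nrm_adj)
qed (use xI in auto)


section \<open>The quotient by a closed ideal as a C*-algebra\<close>

lemma coset_eq_iff:
  assumes "x \<in> carrier A" "y \<in> carrier A"
  shows "I +> x = I +> y \<longleftrightarrow> x \<ominus> y \<in> I"
proof -
  have "I +> x = I +> y \<longleftrightarrow> x \<in> I +> y"
    using assms a_repr_independence' a_rcos_self by blast
  also have "\<dots> \<longleftrightarrow> x \<ominus> y \<in> I"
    using assms M.abelian_group_axioms a_rcos_module[of y x] by (simp add: a_minus_def)
  finally show ?thesis .
qed

lemma mem_coset_iff: "x \<in> carrier A \<Longrightarrow> u \<in> I +> x \<longleftrightarrow> (\<exists>i\<in>I. u = x \<oplus> i)"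
  by (auto simp: a_r_coset_def' M.a_comm)

lemma quot_carrier [simp]: "carrier (cstar_quot A I) = (+>) I ` carrier A"
  by (auto simp: cstar_quot_def FactRing_def A_RCOSETS_def')

lemma quot_add [simp]:
  "\<lbrakk>x \<in> carrier A; y \<in> carrier A\<rbrakk> \<Longrightarrow> (I +> x) \<oplus>\<^bsub>cstar_quot A I\<^esub> (I +> y) = I +> (x \<oplus> y)"
  by (simp add: cstar_quot_def FactRing_def a_rcos_sum)

text \<open>The operations of \<open>cstar_quot\<close> are unions over all representatives; once
  the choice is seen not to matter, one representative suffices.\<close>

lemma UN_coset:
  assumes "x \<in> carrier A" "\<And>i. i \<in> I \<Longrightarrow> g (x \<oplus> i) = V"
  shows "(\<Union>u\<in>I +> x. g u) = V"
proof -
  have "\<forall>u\<in>I +> x. g u = V" using assms by (auto simp: mem_coset_iff)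
  moreover have "x \<in> I +> x" using assms(1) by (rule a_rcos_self)
  ultimately show ?thesis by blast
qed

lemma quot_mult [simp]:
  assumes [simp]: "x \<in> carrier A" "y \<in> carrier A"
  shows "(I +> x) \<otimes>\<^bsub>cstar_quot A I\<^esub> (I +> y) = I +> (x \<otimes> y)"
proof -
  have "I +> ((x \<oplus> i) \<otimes> (y \<oplus> j)) = I +> (x \<otimes> y)" if [simp]: "i \<in> I" "j \<in> I" for i j
  proof -
    have "(x \<oplus> i) \<otimes> (y \<oplus> j) \<ominus> x \<otimes> y = x \<otimes> j \<oplus> i \<otimes> (y \<oplus> j)"
      by (rule lin_eqI, (rule lin_rules | (rule lin_atom, simp; fail))+) (simp add: algebra_simps)
    then show ?thesis by (simp add: coset_eq_iff)
  qed
  then have "(\<Union>u\<in>I +> x. \<Union>v\<in>I +> y. I +> (u \<otimes> v)) = I +> (x \<otimes> y)"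
    by (intro UN_coset) auto
  then show ?thesis by (simp add: cstar_quot_def FactRing_def rcoset_mult_def)
qed

lemma quot_smult [simp]:
  assumes [simp]: "x \<in> carrier A"
  shows "c \<odot>\<^bsub>cstar_quot A I\<^esub> (I +> x) = I +> (c \<odot> x)"
proof -
  have "I +> (c \<odot> (x \<oplus> i)) = I +> (c \<odot> x)" if [simp]: "i \<in> I" for i
  proof -
    have "c \<odot> (x \<oplus> i) \<ominus> c \<odot> x = c \<odot> i"
      by (rule lin_eqI, (rule lin_rules | (rule lin_atom, simp; fail))+) (simp add: algebra_simps)
    then show ?thesis by (simp add: coset_eq_iff)
  qed
  then show ?thesis by (simp add: cstar_quot_def UN_coset)
qed

lemma quot_adj [simp]:
  assumes [simp]: "x \<in> carrier A"
  shows "(I +> x)\<^sup>\<star>\<^bsub>cstar_quot A I\<^esub> = I +> (x\<^sup>\<star>)"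
proof -
  have "I +> ((x \<oplus> i)\<^sup>\<star>) = I +> (x\<^sup>\<star>)" if [simp]: "i \<in> I" for i
  proof -
    have "(x \<oplus> i)\<^sup>\<star> \<ominus> x\<^sup>\<star> = i\<^sup>\<star>"
      by (rule lin_eqI, (rule lin_rules | (rule lin_atom, simp; fail))+) (simp add: algebra_simps)
    then show ?thesis by (simp add: coset_eq_iff)
  qed
  then show ?thesis by (simp add: cstar_quot_def UN_coset)
qed

lemma coset_of_mem: "x \<in> I \<Longrightarrow> I +> x = I +> \<zero>"
  by (simp add: coset_eq_iff)

lemma quot_zero: "\<zero>\<^bsub>cstar_quot A I\<^esub> = I +> \<zero>"
  by (simp add: cstar_quot_def FactRing_def M.a_coset_add_zero a_subset)

lemma quot_eq_zero_iff: "x \<in> carrier A \<Longrightarrow> I +> x = \<zero>\<^bsub>cstar_quot A I\<^esub> \<longleftrightarrow> x \<in> I"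
  by (simp add: quot_zero coset_eq_iff)

lemma quot_nrm: "nrm (cstar_quot A I) U = (INF u\<in>U. nrm A u)"
  by (simp add: cstar_quot_def)

lemma quot_nrm_le:
  assumes "x \<in> carrier A" "i \<in> I"
  shows "nrm (cstar_quot A I) (I +> x) \<le> nrm A (x \<oplus> i)"
  unfolding quot_nrm
proof (rule cINF_lower)
  show "bdd_below (nrm A ` (I +> x))"
    using assms by (intro bdd_belowI[of _ 0]) (auto simp: mem_coset_iff)
qed (use assms in \<open>auto simp: mem_coset_iff\<close>)

lemma quot_nrm_le0: "x \<in> carrier A \<Longrightarrow> nrm (cstar_quot A I) (I +> x) \<le> nrm A x"
  using quot_nrm_le[of x \<zero>] by simp

lemma quot_nrm_approx:
  assumes x: "x \<in> carrier A" and N: "nrm (cstar_quot A I) (I +> x) < r"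
  obtains i where "i \<in> I" "nrm A (x \<oplus> i) < r"
proof -
  have "nrm A ` (I +> x) \<noteq> {}" using a_rcos_self[OF x] by blast
  moreover have "bdd_below (nrm A ` (I +> x))"
    using x by (intro bdd_belowI[of _ 0]) (auto simp: mem_coset_iff)
  ultimately have "\<exists>u\<in>I +> x. nrm A u < r"
    using N unfolding quot_nrm by (simp add: cInf_less_iff)
  then show thesis using that x by (auto simp: mem_coset_iff)
qed

lemma quot_nrm_nonneg: "x \<in> carrier A \<Longrightarrow> 0 \<le> nrm (cstar_quot A I) (I +> x)"
  unfolding quot_nrm
  by (rule cINF_greatest) (use a_rcos_self in blast, auto simp: mem_coset_iff)

lemma quot_abelian_group: "abelian_group (cstar_quot A I)"
proof (rule abelian_groupI)
  show "\<exists>v\<in>carrier (cstar_quot A I). v \<oplus>\<^bsub>cstar_quot A I\<^esub> U = \<zero>\<^bsub>cstar_quot A I\<^esub>"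
    if U: "U \<in> carrier (cstar_quot A I)" for U
  proof -
    obtain x where "U = I +> x" "x \<in> carrier A" using U by auto
    then show ?thesis by (intro bexI[of _ "I +> \<ominus> x"]) (auto simp: M.l_neg quot_zero)
  qed
qed (auto simp: quot_zero M.a_ac)

lemma quot_uminus [simp]:
  assumes "x \<in> carrier A" shows "\<ominus>\<^bsub>cstar_quot A I\<^esub> (I +> x) = I +> (\<ominus> x)"
proof -
  interpret Q: abelian_group "cstar_quot A I" by (rule quot_abelian_group)
  have "(I +> \<ominus> x) \<oplus>\<^bsub>cstar_quot A I\<^esub> (I +> x) = \<zero>\<^bsub>cstar_quot A I\<^esub>"
    using assms by (simp add: M.l_neg quot_zero)
  then show ?thesis using Q.minus_equality assms by auto
qed

lemma quot_minus [simp]: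
  "\<lbrakk>x \<in> carrier A; y \<in> carrier A\<rbrakk> \<Longrightarrow> (I +> x) \<ominus>\<^bsub>cstar_quot A I\<^esub> (I +> y) = I +> (x \<ominus> y)"
  by (simp add: a_minus_def[of "cstar_quot A I"] a_minus_def[of A])

lemma quot_nrm_triangle:
  assumes [simp]: "x \<in> carrier A" "y \<in> carrier A"
  shows "nrm (cstar_quot A I) (I +> (x \<oplus> y))
    \<le> nrm (cstar_quot A I) (I +> x) + nrm (cstar_quot A I) (I +> y)" (is "?N (x \<oplus> y) \<le> ?N x + ?N y")
proof (rule field_le_epsilon)
  fix \<epsilon> :: real assume "\<epsilon> > 0"
  obtain i where i [simp]: "i \<in> I" and i2: "nrm A (x \<oplus> i) < ?N x + \<epsilon> / 2"
    by (rule quot_nrm_approx[of x "?N x + \<epsilon> / 2"]) (use \<open>\<epsilon> > 0\<close> in auto)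
  obtain j where j [simp]: "j \<in> I" and j2: "nrm A (y \<oplus> j) < ?N y + \<epsilon> / 2"
    by (rule quot_nrm_approx[of y "?N y + \<epsilon> / 2"]) (use \<open>\<epsilon> > 0\<close> in auto)
  have "?N (x \<oplus> y) \<le> nrm A ((x \<oplus> y) \<oplus> (i \<oplus> j))" by (intro quot_nrm_le) auto
  also have "(x \<oplus> y) \<oplus> (i \<oplus> j) = (x \<oplus> i) \<oplus> (y \<oplus> j)" by (simp add: M.a_ac)
  also have "nrm A \<dots> \<le> nrm A (x \<oplus> i) + nrm A (y \<oplus> j)" by (intro nrm_triangle) auto
  finally show "?N (x \<oplus> y) \<le> ?N x + ?N y + \<epsilon>" using i2 j2 by linarith
qed

lemma quot_nrm_smult:
  assumes [simp]: "x \<in> carrier A"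
  shows "nrm (cstar_quot A I) (I +> (c \<odot> x)) = cmod c * nrm (cstar_quot A I) (I +> x)"
    (is "?N (c \<odot> x) = _ * ?N x")
proof -
  have le: "?N (c \<odot> x) \<le> cmod c * ?N x" if x [simp]: "x \<in> carrier A" for c x
  proof (cases "c = 0")
    case True
    then show ?thesis using quot_nrm_le0[of \<zero>] by simp
  next
    case False
    show ?thesis
    proof (rule field_le_epsilon)
      fix \<epsilon> :: real assume "\<epsilon> > 0"
      then have "?N x < ?N x + \<epsilon> / cmod c" using False by simp
      then obtain i where i: "i \<in> I" "nrm A (x \<oplus> i) < ?N x + \<epsilon> / cmod c"
        by (rule quot_nrm_approx[OF x])
      have "?N (c \<odot> x) \<le> nrm A (c \<odot> x \<oplus> c \<odot> i)" using i by (intro quot_nrm_le) auto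
      also have "\<dots> = cmod c * nrm A (x \<oplus> i)" using i by (simp add: nrm_smult flip: smult_r_distr_c)
      also have "\<dots> \<le> cmod c * (?N x + \<epsilon> / cmod c)" using i by (intro mult_left_mono) auto
      finally show "?N (c \<odot> x) \<le> cmod c * ?N x + \<epsilon>" using False by (simp add: algebra_simps)
    qed
  qed
  show ?thesis
  proof (cases "c = 0")
    case True
    then show ?thesis using quot_nrm_le0[of \<zero>] quot_nrm_nonneg[of \<zero>] by simp
  next
    case False
    have "cmod c * ?N x = cmod c * ?N (inverse c \<odot> (c \<odot> x))" using False by (simp flip: smult_mult_c)
    also have "\<dots> \<le> cmod c * (cmod (inverse c) * ?N (c \<odot> x))" by (intro mult_left_mono le) auto
    also have "\<dots> = ?N (c \<odot> x)" using False by (simp add: norm_inverse)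
    finally show ?thesis using le[of x c] by simp
  qed
qed

lemma quot_nrm_mult:
  assumes [simp]: "x \<in> carrier A" "y \<in> carrier A"
  shows "nrm (cstar_quot A I) (I +> (x \<otimes> y))
    \<le> nrm (cstar_quot A I) (I +> x) * nrm (cstar_quot A I) (I +> y)" (is "?N (x \<otimes> y) \<le> ?N x * ?N y")
proof -
  have le: "?N (x \<otimes> y) \<le> (?N x + \<epsilon>) * (?N y + \<epsilon>)" if e: "\<epsilon> > 0" for \<epsilon>
  proof -
    obtain i where i [simp]: "i \<in> I" and i2: "nrm A (x \<oplus> i) < ?N x + \<epsilon>"
      by (rule quot_nrm_approx[of x "?N x + \<epsilon>"]) (use e in auto)
    obtain j where j [simp]: "j \<in> I" and j2: "nrm A (y \<oplus> j) < ?N y + \<epsilon>"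
      by (rule quot_nrm_approx[of y "?N y + \<epsilon>"]) (use e in auto)
    have "?N (x \<otimes> y) \<le> nrm A (x \<otimes> y \<oplus> (x \<otimes> j \<oplus> i \<otimes> (y \<oplus> j)))" by (intro quot_nrm_le) auto
    also have "x \<otimes> y \<oplus> (x \<otimes> j \<oplus> i \<otimes> (y \<oplus> j)) = (x \<oplus> i) \<otimes> (y \<oplus> j)"
      by (rule lin_eqI, (rule lin_rules | (rule lin_atom, simp; fail))+) (simp add: algebra_simps)
    also have "nrm A \<dots> \<le> nrm A (x \<oplus> i) * nrm A (y \<oplus> j)" by (intro nrm_mult) auto
    also have "\<dots> \<le> (?N x + \<epsilon>) * (?N y + \<epsilon>)"
      using i2 j2 e quot_nrm_nonneg[of x] by (intro mult_mono) auto
    finally show ?thesis .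
  qed
  have "((\<lambda>\<epsilon>. (?N x + \<epsilon>) * (?N y + \<epsilon>)) \<longlongrightarrow> (?N x + 0) * (?N y + 0)) (at_right 0)"
    by (intro tendsto_intros)
  moreover have "eventually (\<lambda>\<epsilon>. ?N (x \<otimes> y) \<le> (?N x + \<epsilon>) * (?N y + \<epsilon>)) (at_right 0)"
    using le by (auto simp: eventually_at_right_less intro: eventually_mono[OF eventually_at_right_less])
  ultimately have "?N (x \<otimes> y) \<le> (?N x + 0) * (?N y + 0)"
    by (rule tendsto_lowerbound) simp
  then show ?thesis by simp
qed

lemma quot_nrm_adj_le:
  assumes [simp]: "x \<in> carrier A"
  shows "nrm (cstar_quot A I) (I +> (x\<^sup>\<star>)) \<le> nrm (cstar_quot A I) (I +> x)"
proof (rule field_le_epsilon)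
  fix \<epsilon> :: real assume "\<epsilon> > 0"
  then have "nrm (cstar_quot A I) (I +> x) < nrm (cstar_quot A I) (I +> x) + \<epsilon>" by simp
  then obtain i where i: "i \<in> I" "nrm A (x \<oplus> i) < nrm (cstar_quot A I) (I +> x) + \<epsilon>"
    by (rule quot_nrm_approx[OF assms])
  have "nrm (cstar_quot A I) (I +> (x\<^sup>\<star>)) \<le> nrm A (x\<^sup>\<star> \<oplus> i\<^sup>\<star>)" using i by (intro quot_nrm_le) auto
  also have "\<dots> = nrm A (x \<oplus> i)" using i by (simp add: nrm_adj flip: adj_add)
  finally show "nrm (cstar_quot A I) (I +> (x\<^sup>\<star>)) \<le> nrm (cstar_quot A I) (I +> x) + \<epsilon>" using i by simp
qed

text \<open>For the lower bound a perturbation of \<open>x\<^sup>\<star> \<otimes> x\<close> by i in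
  I must be turned into a perturbation of x. With j the selfadjoint part of i and e an approximate
  unit for j, z = x - x e lies in the coset of x, and \<open>z\<^sup>\<star> \<otimes> z\<close> is
  (1 - e) s (1 - e) - (1 - e) j (1 - e) for s =
  \<open>x\<^sup>\<star> \<otimes> x \<oplus> j\<close>. The first term has at most the norm of s
  and the second is small.\<close>

lemma quot_nrm_cstar:
  assumes [simp]: "x \<in> carrier A"
  shows "nrm (cstar_quot A I) (I +> (x\<^sup>\<star> \<otimes> x)) = (nrm (cstar_quot A I) (I +> x))\<^sup>2"
    (is "?N (x\<^sup>\<star> \<otimes> x) = _")
proof (rule antisym)
  have "?N (x\<^sup>\<star> \<otimes> x) \<le> ?N (x\<^sup>\<star>) * ?N x" by (rule quot_nrm_mult) auto
  also have "\<dots> \<le> ?N x * ?N x"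
    using quot_nrm_adj_le[of x] quot_nrm_nonneg by (intro mult_right_mono) auto
  finally show "?N (x\<^sup>\<star> \<otimes> x) \<le> (?N x)\<^sup>2" by (simp add: power2_eq_square)
  show "(?N x)\<^sup>2 \<le> ?N (x\<^sup>\<star> \<otimes> x)"
  proof (rule field_le_epsilon)
    fix \<epsilon> :: real assume e0: "\<epsilon> > 0"
    obtain i where i [simp]: "i \<in> I" and i2: "nrm A (x\<^sup>\<star> \<otimes> x \<oplus> i) < ?N (x\<^sup>\<star> \<otimes> x) + \<epsilon> / 2"
      by (rule quot_nrm_approx[of "x\<^sup>\<star> \<otimes> x" "?N (x\<^sup>\<star> \<otimes> x) + \<epsilon> / 2"]) (use e0 in auto)
    define y where "y = x\<^sup>\<star> \<otimes> x \<oplus> i"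
    \<comment> \<open>Symmetrizing stays in I by \<open>I_adj\<close>, and s, the selfadjoint part
      of y, is no longer than y.\<close>
    define j where "j = (1/2) \<odot> (i \<oplus> i\<^sup>\<star>)"
    define s where "s = x\<^sup>\<star> \<otimes> x \<oplus> j"
    have [simp]: "j \<in> I" "j \<in> carrier A" "s \<in> carrier A" "y \<in> carrier A"
      by (auto simp: j_def s_def y_def)
    have "s = (1/2) \<odot> (y \<oplus> y\<^sup>\<star>)" unfolding s_def j_def y_def
      by (rule lin_eqI, (rule lin_rules | (rule lin_atom, simp; fail))+)
        (simp add: adj_mult algebra_simps)
    then have s: "nrm A s \<le> nrm A y"
      using nrm_triangle[of y "y\<^sup>\<star>"] by (simp add: nrm_smult nrm_adj)
    have js: "j\<^sup>\<star> = j" by (simp add: j_def adj_smult adj_add M.a_comm)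
    obtain e where e: "e \<in> I" "e\<^sup>\<star> = e" "\<And>x. x \<in> carrier A \<Longrightarrow> nrm A (x \<ominus> e \<otimes> x) \<le> nrm A x"
      "nrm A (j \<ominus> j \<otimes> e) < \<epsilon> / 2"
      using approximate_unit[OF _ js, of "\<epsilon> / 2"] e0 by auto
    have [simp]: "e \<in> carrier A" using e by simp
    have e': "nrm A (x \<ominus> x \<otimes> e) \<le> nrm A x" if [simp]: "x \<in> carrier A" for x
    proof -
      have "x \<ominus> x \<otimes> e = (x\<^sup>\<star> \<ominus> e \<otimes> x\<^sup>\<star>)\<^sup>\<star>"
        by (rule lin_eqI, (rule lin_rules | (rule lin_atom, simp; fail))+) (simp add: adj_mult e(2))
      then show ?thesis using e(3)[of "x\<^sup>\<star>"] by (simp add: nrm_adj)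
    qed
    define z where "z = x \<ominus> x \<otimes> e"
    have [simp]: "z \<in> carrier A" by (simp add: z_def)
    have zz: "z\<^sup>\<star> \<otimes> z = ((s \<ominus> s \<otimes> e) \<ominus> e \<otimes> (s \<ominus> s \<otimes> e)) \<ominus> ((j \<ominus> j \<otimes> e) \<ominus> e \<otimes> (j \<ominus> j \<otimes> e))"
      unfolding z_def s_def
      by (rule lin_eqI, (rule lin_rules | (rule lin_atom, simp; fail))+)
        (simp add: adj_mult e(2) mult_assoc algebra_simps)
    have "nrm A (z\<^sup>\<star> \<otimes> z) \<le> nrm A ((s \<ominus> s \<otimes> e) \<ominus> e \<otimes> (s \<ominus> s \<otimes> e)) + nrm A ((j \<ominus> j \<otimes> e) \<ominus> e \<otimes> (j \<ominus> j \<otimes> e))"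
      unfolding zz by (intro nrm_minus_le) auto
    also have "\<dots> \<le> nrm A s + nrm A (j \<ominus> j \<otimes> e)"
      using e(3)[of "s \<ominus> s \<otimes> e"] e(3)[of "j \<ominus> j \<otimes> e"] e'[of s] by (intro add_mono) auto
    also have "\<dots> \<le> ?N (x\<^sup>\<star> \<otimes> x) + \<epsilon>" using s i2 e(4) by (simp add: y_def)
    finally have "(nrm A z)\<^sup>2 \<le> ?N (x\<^sup>\<star> \<otimes> x) + \<epsilon>" by (simp add: nrm_cstar)
    moreover have "z = x \<oplus> \<ominus> (x \<otimes> e)" by (simp add: z_def a_minus_def)
    then have "?N x \<le> nrm A z" using quot_nrm_le[of x "\<ominus> (x \<otimes> e)"] e(1) by simp
    then have "(?N x)\<^sup>2 \<le> (nrm A z)\<^sup>2" using quot_nrm_nonneg[of x] by (intro power_mono) auto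
    ultimately show "(?N x)\<^sup>2 \<le> ?N (x\<^sup>\<star> \<otimes> x) + \<epsilon>" by linarith
  qed
qed

lemma quot_nrm_eq_0:
  assumes x: "x \<in> carrier A"
  shows "nrm (cstar_quot A I) (I +> x) = 0 \<longleftrightarrow> x \<in> I"
proof
  assume N: "nrm (cstar_quot A I) (I +> x) = 0"
  show "x \<in> I"
  proof (rule I_approx[OF x])
    fix \<epsilon> :: real assume "\<epsilon> > 0"
    with N have "nrm (cstar_quot A I) (I +> x) < \<epsilon>" by simp
    then obtain i where i: "i \<in> I" "nrm A (x \<oplus> i) < \<epsilon>" by (rule quot_nrm_approx[OF x])
    then show "\<exists>d\<in>I. nrm A (x \<ominus> d) < \<epsilon>"
      using x by (intro bexI[of _ "\<ominus> i"]) (auto simp: a_minus_def)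
  qed
next
  assume xI: "x \<in> I"
  show "nrm (cstar_quot A I) (I +> x) = 0"
    unfolding coset_of_mem[OF xI] using quot_nrm_le0[of \<zero>] quot_nrm_nonneg[of \<zero>] by simp
qed

lemma quot_nrm_eq_zero:
  "x \<in> carrier A \<Longrightarrow> nrm (cstar_quot A I) (I +> x) = 0 \<longleftrightarrow> I +> x = \<zero>\<^bsub>cstar_quot A I\<^esub>"
  by (simp add: quot_nrm_eq_0 quot_eq_zero_iff)

text \<open>Proved directly from the seminorm properties, since completeness must be stated before
  the quotient is known to be a C*-algebra.\<close>

lemma quot_metric: "Metric_space (carrier (cstar_quot A I)) (cdist (cstar_quot A I))"
proof
  show "0 \<le> cdist (cstar_quot A I) U V" for U V
    by (auto simp: cdist_def quot_nrm_nonneg)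
  have "nrm (cstar_quot A I) (I +> (x \<ominus> y)) = nrm (cstar_quot A I) (I +> (y \<ominus> x))"
    if [simp]: "x \<in> carrier A" "y \<in> carrier A" for x y
  proof -
    have "x \<ominus> y = (-1) \<odot> (y \<ominus> x)"
      by (rule lin_eqI, (rule lin_rules | (rule lin_atom, simp; fail))+) (simp add: algebra_simps)
    then show ?thesis by (simp add: quot_nrm_smult)
  qed
  then show "cdist (cstar_quot A I) U V = cdist (cstar_quot A I) V U" for U V
    by (auto simp: cdist_def)
  show "cdist (cstar_quot A I) U V = 0 \<longleftrightarrow> U = V"
    if "U \<in> carrier (cstar_quot A I)" "V \<in> carrier (cstar_quot A I)" for U V
  proof -
    obtain x y where "U = I +> x" "V = I +> y" "x \<in> carrier A" "y \<in> carrier A"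
      using \<open>U \<in> _\<close> \<open>V \<in> _\<close> by auto
    then show ?thesis by (simp add: cdist_def quot_nrm_eq_0 coset_eq_iff)
  qed
  show "cdist (cstar_quot A I) U W \<le> cdist (cstar_quot A I) U V + cdist (cstar_quot A I) V W"
    if "U \<in> carrier (cstar_quot A I)" "V \<in> carrier (cstar_quot A I)" "W \<in> carrier (cstar_quot A I)"
    for U V W
  proof -
    obtain x y z where [simp]: "U = I +> x" "V = I +> y" "W = I +> z"
      "x \<in> carrier A" "y \<in> carrier A" "z \<in> carrier A" using \<open>U \<in> _\<close> \<open>V \<in> _\<close> \<open>W \<in> _\<close> by auto
    show ?thesis
      using quot_nrm_triangle[of "x \<ominus> y" "y \<ominus> z"] minus_split[of x y z] by (simp add: cdist_def)
  qed
qed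

lemma geometric_Cauchy:
  assumes x: "\<And>n. x n \<in> carrier A" and d: "\<And>n. nrm A (x (Suc n) \<ominus> x n) < (1/2)^n"
  obtains l where "limitin (ctop A) x l sequentially"
proof -
  interpret MS: Metric_space "carrier A" "cdist A" by (rule metric)
  \<comment> \<open>The exact value of the geometric sum, and not just its bound 2 (1/2)^n, keeps
    the induction closed.\<close>
  have d2: "nrm A (x (n + k) \<ominus> x n) \<le> 2 * (1/2)^n - 2 * (1/2)^(n + k)" for n k
  proof (induction k)
    case 0
    then show ?case using x minus_eq_zero_iff[of "x n" "x n"] by simp
  next
    case (Suc k)
    have "nrm A (x (n + Suc k) \<ominus> x n) \<le> nrm A (x (Suc (n + k)) \<ominus> x (n + k)) + nrm A (x (n + k) \<ominus> x n)"
      using x minus_triangle[of "x (n + Suc k)" "x (n + k)" "x n"] by simp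
    also have "\<dots> \<le> (1/2)^(n + k) + (2 * (1/2)^n - 2 * (1/2)^(n + k))"
      using d[of "n + k"] Suc by simp
    finally show ?case by simp
  qed
  have "MS.MCauchy x"
    unfolding MS.MCauchy_def
  proof (intro conjI allI impI)
    show "range x \<subseteq> carrier A" using x by auto
    fix \<epsilon> :: real assume "\<epsilon> > 0"
    then obtain N where N: "(1/2)^N < \<epsilon> / 4" using real_arch_pow_inv[of "\<epsilon> / 4" "1/2"] by auto
    have b: "nrm A (x n \<ominus> x N) < \<epsilon> / 2" if "N \<le> n" for n
    proof -
      have "nrm A (x n \<ominus> x N) \<le> 2 * (1/2)^N - 2 * (1/2)^n" using d2[of N "n - N"] that by simp
      also have "\<dots> \<le> 2 * (1/2)^N" by simp
      finally show ?thesis using N by linarith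
    qed
    have "cdist A (x n) (x n') < \<epsilon>" if "N \<le> n" "N \<le> n'" for n n'
      using minus_triangle[of "x n" "x N" "x n'"] nrm_minus_commute[of "x N" "x n'"] x b[OF that(1)] b[OF that(2)]
      by (simp add: cdist_def)
    then show "\<exists>N. \<forall>n n'. N \<le> n \<longrightarrow> N \<le> n' \<longrightarrow> cdist A (x n) (x n') < \<epsilon>" by blast
  qed
  then show thesis using complete that unfolding MS.mcomplete_def by blast
qed

text \<open>A subsequence with consecutive distances below 2^-n is lifted to A step by step,
  correcting each representative by an element of I so that the lifts are equally close. Their limit
  projects to a limit of the subsequence, hence of the Cauchy sequence.\<close>

lemma quot_complete:
  "Metric_space.mcomplete (carrier (cstar_quot A I)) (cdist (cstar_quot A I))"
proof -
  interpret MS: Metric_space "carrier A" "cdist A" by (rule metric)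
  interpret MQ: Metric_space "carrier (cstar_quot A I)" "cdist (cstar_quot A I)" by (rule quot_metric)
  let ?d = "cdist (cstar_quot A I)"
  show ?thesis unfolding MQ.mcomplete_def
  proof (intro allI impI)
    fix \<sigma> assume S: "MQ.MCauchy \<sigma>"
    then have \<sigma>: "\<And>n. \<sigma> n \<in> (+>) I ` carrier A" unfolding MQ.MCauchy_def by auto
    have "\<forall>k. \<exists>N. \<forall>n n'. N \<le> n \<longrightarrow> N \<le> n' \<longrightarrow> ?d (\<sigma> n) (\<sigma> n') < (1/2)^k"
      using S unfolding MQ.MCauchy_def by auto
    then obtain N where N: "\<And>k n n'. \<lbrakk>N k \<le> n; N k \<le> n'\<rbrakk> \<Longrightarrow> ?d (\<sigma> n) (\<sigma> n') < (1/2)^k" by metis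
    \<comment> \<open>A strictly increasing index that dominates N; the \<open>Suc\<close> secures
      strictness even where N vanishes.\<close>
    define r where "r n = (\<Sum>k\<le>n. Suc (N k))" for n
    have r: "strict_mono r" by (rule strict_monoI_Suc) (simp add: r_def)
    have rN: "N n \<le> r n" for n unfolding r_def by (cases n) auto
    have dr: "?d (\<sigma> (r n)) (\<sigma> (r (Suc n))) < (1/2)^n" for n
      using rN[of n] r strict_monoD[OF r, of n "Suc n"] by (intro N) auto
    define P where "P n x \<longleftrightarrow> x \<in> carrier A \<and> I +> x = \<sigma> (r n)" for n x
    have "\<exists>x. \<forall>n. P n (x n) \<and> nrm A (x (Suc n) \<ominus> x n) < (1/2)^n"
    proof (rule dependent_nat_choice)
      show "\<exists>x. P 0 x" using \<sigma>[of "r 0"] unfolding P_def by (metis imageE)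
      fix x n assume "P n x"
      then have x [simp]: "x \<in> carrier A" "I +> x = \<sigma> (r n)" by (auto simp: P_def)
      obtain y where y [simp]: "y \<in> carrier A" "\<sigma> (r (Suc n)) = I +> y" using \<sigma> by blast
      have "nrm (cstar_quot A I) (I +> (y \<ominus> x)) < (1/2)^n"
        using dr[of n] MQ.commute[of "\<sigma> (r n)" "\<sigma> (r (Suc n))"]
        by (simp add: cdist_def flip: x(2))
      then obtain i where i: "i \<in> I" "nrm A ((y \<ominus> x) \<oplus> i) < (1/2)^n"
        using quot_nrm_approx[of "y \<ominus> x"] by auto
      have "(y \<oplus> i) \<ominus> x = (y \<ominus> x) \<oplus> i" using i by (simp add: a_minus_def M.a_ac)
      moreover have "y \<oplus> i \<ominus> y = i"
        using i by (simp add: a_minus_def M.a_comm[of y i] M.a_assoc M.r_neg)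
      then have "I +> (y \<oplus> i) = I +> y" using i by (simp add: coset_eq_iff)
      ultimately show "\<exists>y. P (Suc n) y \<and> nrm A (y \<ominus> x) < (1/2)^n"
        using i by (intro exI[of _ "y \<oplus> i"]) (simp add: P_def)
    qed
    then obtain x where x: "\<And>n. x n \<in> carrier A" "\<And>n. I +> x n = \<sigma> (r n)"
      "\<And>n. nrm A (x (Suc n) \<ominus> x n) < (1/2)^n" unfolding P_def by blast
    obtain l where l: "limitin (ctop A) x l sequentially" using geometric_Cauchy x by metis
    have lc [simp]: "l \<in> carrier A" using l MS.limitin_mspace by blast
    have "limitin MQ.mtopology (\<sigma> \<circ> r) (I +> l) sequentially"
      unfolding MQ.limit_metric_sequentially
    proof (intro conjI allI impI)
      fix \<epsilon> :: real assume "\<epsilon> > 0"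
      then obtain M where M: "\<And>n. n \<ge> M \<Longrightarrow> cdist A (x n) l < \<epsilon>"
        using l unfolding MS.limit_metric_sequentially by blast
      have "(\<sigma> \<circ> r) n \<in> carrier (cstar_quot A I) \<and> ?d ((\<sigma> \<circ> r) n) (I +> l) < \<epsilon>" if "n \<ge> M" for n
        using M[OF that] x(1)[of n] quot_nrm_le0[of "x n \<ominus> l"] by (simp add: cdist_def flip: x(2))
      then show "\<exists>M. \<forall>n\<ge>M. (\<sigma> \<circ> r) n \<in> carrier (cstar_quot A I) \<and> ?d ((\<sigma> \<circ> r) n) (I +> l) < \<epsilon>" by blast
    qed auto
    then show "\<exists>x. limitin MQ.mtopology \<sigma> x sequentially"
      using MQ.MCauchy_convergent_subsequence[OF S r] by blast
  qed
qed

lemma quot_cstar_algebra: "cstar_algebra (cstar_quot A I)"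
proof -
  have "module (ring_of_type_algebra :: complex ring) (cstar_quot A I)"
    by (rule moduleI[OF R.is_cring quot_abelian_group])
      (auto simp: smult_add_c smult_mult_c smult_r_distr_c ring_of_type_algebra_def)
  moreover have nz: "nrm (cstar_quot A I) \<zero>\<^bsub>cstar_quot A I\<^esub> = 0"
    using quot_nrm_eq_0[of \<zero>] by (simp add: quot_zero)
  ultimately show ?thesis
    using quot_complete
    by (intro cstar_algebra.intro cstar_algebra_axioms.intro)
      (auto simp: mult_assoc mult_l_distr mult_r_distr smult_mult_l smult_mult_r
        adj_add adj_smult adj_mult quot_nrm_nonneg quot_nrm_triangle quot_nrm_smult
        quot_nrm_mult quot_nrm_cstar quot_nrm_eq_zero nz)
qed

lemma quot_map_hom: "star_hom A (cstar_quot A I) ((+>) I)"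
  using quot_cstar_algebra
  by (intro star_hom.intro star_hom_axioms.intro) (auto simp: cstar_algebra_axioms cstar_hom_def)

lemma hom_factor:
  assumes "star_hom A C \<psi>" and ker: "\<And>x. x \<in> I \<Longrightarrow> \<psi> x = \<zero>\<^bsub>C\<^esub>"
  obtains \<eta> where "star_hom (cstar_quot A I) C \<eta>" "\<And>x. x \<in> carrier A \<Longrightarrow> \<eta> (I +> x) = \<psi> x"
proof -
  interpret h: star_hom A C \<psi> by fact
  define \<eta> where "\<eta> U = \<psi> (SOME x. x \<in> U)" for U
  have \<eta>: "\<eta> (I +> x) = \<psi> x" if x: "x \<in> carrier A" for x
  proof -
    have "(SOME u. u \<in> I +> x) \<in> I +> x" using a_rcos_self[OF x] by (rule someI)
    then obtain i where "i \<in> I" "(SOME u. u \<in> I +> x) = x \<oplus> i" using x by (auto simp: mem_coset_iff)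
    then show ?thesis using x ker by (simp add: \<eta>_def h.hom_add)
  qed
  have "star_hom (cstar_quot A I) C \<eta>"
    using quot_cstar_algebra
    by (intro star_hom.intro star_hom_axioms.intro)
      (auto simp: h.C.cstar_algebra_axioms cstar_hom_def \<eta> h.hom_add h.hom_mult h.hom_smult h.hom_adj)
  then show thesis using that \<eta> by blast
qed

end

section \<open>Norm estimates from powers, orthogonality and the circle action\<close>

section \<open>Linear spans, orthogonal sums and homogeneous components\<close>

text \<open>A factor growing at most linearly in the exponent is lost on taking roots: for x = M / r
  < 1 the sequence (a + b n) x^n tends to 0. Only exponents 2^k are assumed, as repeated squaring is
  what the C*-identity controls.\<close>

lemma bounded_power_ratio:
  fixes r M a b :: real
  assumes M: "0 \<le> M" "0 \<le> r" and le: "\<And>k::nat. r ^ (2^k) \<le> (a + b * 2^k) * M ^ (2^k)"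
  shows "r \<le> M"
proof (rule ccontr)
  assume "\<not> r \<le> M"
  then have r: "r > 0" "M < r" using M by auto
  define x where "x = M / r"
  have x: "0 \<le> x" "x < 1" using M r by (auto simp: x_def)
  have "(\<lambda>n. a * x ^ n + b * (of_nat n * x ^ n)) \<longlonglongrightarrow> a * 0 + b * 0"
    using x by (intro tendsto_intros LIMSEQ_realpow_zero powser_times_n_limit_0) auto
  then have "(\<lambda>n. a * x ^ n + b * (of_nat n * x ^ n)) \<longlonglongrightarrow> 0" by simp
  then have "eventually (\<lambda>n. a * x ^ n + b * (of_nat n * x ^ n) < 1) sequentially"
    by (rule order_tendstoD) simp
  then obtain N where N: "\<And>n. n \<ge> N \<Longrightarrow> a * x ^ n + b * (of_nat n * x ^ n) < 1"
    by (auto simp: eventually_sequentially)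
  \<comment> \<open>The limit gives the estimate for all large n, and n = 2^N is an index of that
    kind to which the hypothesis applies.\<close>
  have "N < 2^N" by (rule less_exp)
  then have "(a + b * 2^N) * x ^ (2^N) < 1" using N[of "2^N"] by (simp add: algebra_simps)
  then have "(a + b * 2^N) * M ^ (2^N) < r ^ (2^N)"
    using r by (simp add: x_def power_divide field_simps)
  then show False using le[of N] by simp
qed

context cstar_algebra
begin

lemma finsum_additive:
  assumes "finite F" "\<And>i. i \<in> F \<Longrightarrow> h i \<in> carrier A"
    and T: "\<And>x. x \<in> carrier A \<Longrightarrow> T x \<in> carrier A" "T \<zero> = \<zero>"
      "\<And>x y. \<lbrakk>x \<in> carrier A; y \<in> carrier A\<rbrakk> \<Longrightarrow> T (x \<oplus> y) = T x \<oplus> T y"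
  shows "T (finsum A h F) = finsum A (\<lambda>i. T (h i)) F"
  using assms(1,2)
proof (induction F rule: finite_induct)
  case (insert i F)
  then have "finsum A h F \<in> carrier A" by (intro M.finsum_closed) auto
  then show ?case using insert T by (subst (1 2) M.finsum_insert) auto
qed (simp add: T)

lemma finsum_in [simp]: "(\<And>i. i \<in> F \<Longrightarrow> h i \<in> carrier A) \<Longrightarrow> finsum A h F \<in> carrier A"
  by (intro M.finsum_closed) auto

lemma finsum_mult_l:
  "\<lbrakk>finite F; \<And>i. i \<in> F \<Longrightarrow> h i \<in> carrier A; a \<in> carrier A\<rbrakk>
    \<Longrightarrow> a \<otimes> finsum A h F = finsum A (\<lambda>i. a \<otimes> h i) F"
  by (rule finsum_additive) (auto simp: mult_r_distr)

lemma finsum_mult_r: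
  "\<lbrakk>finite F; \<And>i. i \<in> F \<Longrightarrow> h i \<in> carrier A; a \<in> carrier A\<rbrakk>
    \<Longrightarrow> finsum A h F \<otimes> a = finsum A (\<lambda>i. h i \<otimes> a) F"
  by (rule finsum_additive[where T="\<lambda>x. x \<otimes> a"]) (auto simp: mult_l_distr)

lemma finsum_adj:
  "\<lbrakk>finite F; \<And>i. i \<in> F \<Longrightarrow> h i \<in> carrier A\<rbrakk> \<Longrightarrow> (finsum A h F)\<^sup>\<star> = finsum A (\<lambda>i. (h i)\<^sup>\<star>) F"
  by (rule finsum_additive) (auto simp: adj_add)

lemma nrm_finsum:
  "\<lbrakk>finite F; \<And>i. i \<in> F \<Longrightarrow> h i \<in> carrier A\<rbrakk> \<Longrightarrow> nrm A (finsum A h F) \<le> (\<Sum>i\<in>F. nrm A (h i))"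
proof (induction F rule: finite_induct)
  case (insert i F)
  then have "nrm A (finsum A h (insert i F)) \<le> nrm A (h i) + nrm A (finsum A h F)"
    by (subst M.finsum_insert) (auto intro!: nrm_triangle)
  then show ?case using insert by fastforce
qed simp

lemma finsum_mono_neutral:
  assumes "finite G" "F \<subseteq> G" "\<And>i. i \<in> F \<Longrightarrow> h i \<in> carrier A" "\<And>i. i \<in> G - F \<Longrightarrow> h i = \<zero>"
  shows "finsum A h F = finsum A h G"
proof (rule M.add.finprod_mono_neutral_cong_left)
  have "h i \<in> carrier A" if "i \<in> G" for i
    using assms(3,4)[of i] that by (cases "i \<in> F") auto
  then show "h \<in> G \<rightarrow> carrier A" by blast
qed (use assms in auto)

lemma finsum_eqI:
  "\<lbrakk>\<And>i. i \<in> F \<Longrightarrow> h i = g i; \<And>i. i \<in> F \<Longrightarrow> g i \<in> carrier A\<rbrakk> \<Longrightarrow> finsum A h F = finsum A g F"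
  by (intro M.finsum_cong') auto

lemma star_cancel: "\<lbrakk>x \<in> carrier A; x\<^sup>\<star> \<otimes> x = \<zero>\<rbrakk> \<Longrightarrow> x = \<zero>"
  using nrm_cstar[of x] by (simp add: nrm_eq_0)

text \<open>One term is added at a time, so that induction on the span peels off a single generator
  with its coefficient.\<close>

inductive_set lspan :: "'a set \<Rightarrow> 'a set" for U :: "'a set" where
  lspan_zero [simp]: "\<zero> \<in> lspan U"
| lspan_step: "\<lbrakk>x \<in> lspan U; m \<in> U\<rbrakk> \<Longrightarrow> x \<oplus> c \<odot> m \<in> lspan U"

lemma lspan_carrier: "\<lbrakk>x \<in> lspan U; U \<subseteq> carrier A\<rbrakk> \<Longrightarrow> x \<in> carrier A"
  by (induction rule: lspan.induct) auto

lemma lspan_base: "\<lbrakk>x \<in> U; U \<subseteq> carrier A\<rbrakk> \<Longrightarrow> x \<in> lspan U"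
  using lspan_step[OF lspan_zero, of x U 1] by auto

lemma lspan_mono: "U \<subseteq> Y \<Longrightarrow> lspan U \<subseteq> lspan Y"
proof
  fix x assume "U \<subseteq> Y" "x \<in> lspan U"
  from this(2,1) show "x \<in> lspan Y" by (induction rule: lspan.induct) (auto intro: lspan_step)
qed

lemma lspan_add:
  assumes "y \<in> lspan U" "x \<in> lspan U" and U: "U \<subseteq> carrier A"
  shows "x \<oplus> y \<in> lspan U"
  using assms(1)
proof (induction rule: lspan.induct)
  case lspan_zero
  then show ?case using assms lspan_carrier[of x U] by simp
next
  case (lspan_step y m c)
  then have "x \<oplus> (y \<oplus> c \<odot> m) = (x \<oplus> y) \<oplus> c \<odot> m"
    using U assms(2) lspan_carrier by (subst M.a_assoc) auto
  then show ?case using lspan_step by (auto intro: lspan.lspan_step)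
qed

text \<open>The function g acts on coefficients: the identity for multiplications, conjugation for
  the adjoint, which is only conjugate linear.\<close>

lemma lspan_linear:
  assumes "x \<in> lspan U" and U: "U \<subseteq> carrier A" "Y \<subseteq> carrier A"
    and T: "T \<zero> = \<zero>" "\<And>x m c. \<lbrakk>x \<in> carrier A; m \<in> U\<rbrakk> \<Longrightarrow> T (x \<oplus> c \<odot> m) = T x \<oplus> g c \<odot> T m"
    and TX: "\<And>m. m \<in> U \<Longrightarrow> T m \<in> lspan Y"
    and S: "\<And>c y. y \<in> lspan Y \<Longrightarrow> c \<odot> y \<in> lspan Y"
  shows "T x \<in> lspan Y"
  using assms(1)
proof (induction rule: lspan.induct)
  case (lspan_step x m c)
  then show ?case using T lspan_carrier[of x U] U TX S by (auto intro: lspan_add)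
qed (simp add: T)

lemma lspan_smult:
  assumes "x \<in> lspan U" and U: "U \<subseteq> carrier A"
  shows "c \<odot> x \<in> lspan U"
  using assms(1)
proof (induction rule: lspan.induct)
  case (lspan_step x m d)
  then have "c \<odot> (x \<oplus> d \<odot> m) = c \<odot> x \<oplus> (c * d) \<odot> m"
    using U lspan_carrier[of x U] by (auto simp: smult_r_distr_c smult_mult_c)
  then show ?case using lspan_step by (auto intro: lspan.lspan_step)
qed simp

lemma lspan_mult_r:
  assumes "x \<in> lspan U" "U \<subseteq> carrier A" "Y \<subseteq> carrier A" "a \<in> carrier A"
    and "\<And>m. m \<in> U \<Longrightarrow> m \<otimes> a \<in> lspan Y"
  shows "x \<otimes> a \<in> lspan Y"
  using assms by (intro lspan_linear[where T="\<lambda>x. x \<otimes> a" and g="\<lambda>c. c", of x U])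
    (auto simp: mult_l_distr smult_mult_l subset_iff intro: lspan_smult)

lemma lspan_mult_l:
  assumes "x \<in> lspan U" "U \<subseteq> carrier A" "Y \<subseteq> carrier A" "a \<in> carrier A"
    and "\<And>m. m \<in> U \<Longrightarrow> a \<otimes> m \<in> lspan Y"
  shows "a \<otimes> x \<in> lspan Y"
  using assms by (intro lspan_linear[where T="\<lambda>x. a \<otimes> x" and g="\<lambda>c. c", of x U])
    (auto simp: mult_r_distr smult_mult_r subset_iff intro: lspan_smult)

lemma lspan_mult:
  assumes x: "x \<in> lspan U" and y: "y \<in> lspan Y"
    and c: "U \<subseteq> carrier A" "Y \<subseteq> carrier A" "Z \<subseteq> carrier A"
    and m: "\<And>m m'. \<lbrakk>m \<in> U; m' \<in> Y\<rbrakk> \<Longrightarrow> m \<otimes> m' \<in> lspan Z"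
  shows "x \<otimes> y \<in> lspan Z"
proof (rule lspan_mult_r[OF x c(1,3)])
  show "y \<in> carrier A" using lspan_carrier[OF y c(2)] .
  show "m \<otimes> y \<in> lspan Z" if "m \<in> U" for m
    using that c m by (intro lspan_mult_l[OF y c(2,3)]) auto
qed

lemma lspan_adj:
  assumes "x \<in> lspan U" "U \<subseteq> carrier A" "Y \<subseteq> carrier A" "\<And>m. m \<in> U \<Longrightarrow> m\<^sup>\<star> \<in> lspan Y"
  shows "x\<^sup>\<star> \<in> lspan Y"
  using assms by (intro lspan_linear[where T="\<lambda>x. x\<^sup>\<star>" and g=cnj, of x U])
    (auto simp: adj_add adj_smult subset_iff intro: lspan_smult)

lemma lspan_finsum:
  "\<lbrakk>finite F; \<And>i. i \<in> F \<Longrightarrow> h i \<in> lspan U; U \<subseteq> carrier A\<rbrakk> \<Longrightarrow> finsum A h F \<in> lspan U"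
proof (induction F rule: finite_induct)
  case (insert i F)
  then show ?case
    using lspan_carrier[of _ U] by (subst M.finsum_insert) (auto intro!: lspan_add)
qed simp

text \<open>The power with exponent 2^k. Starting from x itself avoids a zeroth power, for which a
  unit would be required.\<close>

primrec iter_square :: "'a \<Rightarrow> nat \<Rightarrow> 'a" where
  "iter_square x 0 = x"
| "iter_square x (Suc k) = iter_square x k \<otimes> iter_square x k"

lemma iter_square_closed [simp]: "x \<in> carrier A \<Longrightarrow> iter_square x k \<in> carrier A"
  by (induction k) auto

lemma iter_square_adj: "\<lbrakk>x \<in> carrier A; x\<^sup>\<star> = x\<rbrakk> \<Longrightarrow> (iter_square x k)\<^sup>\<star> = iter_square x k"
  by (induction k) (auto simp: adj_mult)

lemma nrm_iter_square:
  "\<lbrakk>x \<in> carrier A; x\<^sup>\<star> = x\<rbrakk> \<Longrightarrow> nrm A (iter_square x k) = nrm A x ^ (2^k)"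
  by (induction k) (auto simp: nrm_selfadj_square iter_square_adj mult.commute simp flip: power_mult)

lemma iter_square_prod_zero:
  assumes [simp]: "x \<in> carrier A" "y \<in> carrier A" and "x \<otimes> y = \<zero>"
  shows "iter_square x k \<otimes> iter_square y k = \<zero>"
proof (induction k)
  case (Suc k)
  let ?x = "iter_square x k" and ?y = "iter_square y k"
  have "?x \<otimes> ?x \<otimes> (?y \<otimes> ?y) = ?x \<otimes> (?x \<otimes> ?y) \<otimes> ?y" by (simp add: mult_assoc)
  then show ?case using Suc by simp
qed (use assms in simp)

lemma iter_square_orth_sum:
  assumes [simp]: "x \<in> carrier A" "y \<in> carrier A" and o: "x \<otimes> y = \<zero>" "y \<otimes> x = \<zero>"
  shows "iter_square (x \<oplus> y) k = iter_square x k \<oplus> iter_square y k"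
proof (induction k)
  case (Suc k)
  then show ?case
    using iter_square_prod_zero[of x y k] iter_square_prod_zero[of y x k] o
    by (simp add: mult_l_distr mult_r_distr M.a_ac)
qed simp

text \<open>The hypothesis on \<open>u\<^sup>\<star> \<otimes> v\<close> removes the cross terms
  from the square of u + v, and that on \<open>u \<otimes> v\<^sup>\<star>\<close> makes x and y
  orthogonal. Powers of x + y are then sums of powers, bounded with a factor 2 that disappears under
  roots.\<close>

lemma nrm_orth_sum:
  assumes [simp]: "u \<in> carrier A" "v \<in> carrier A" and o: "u\<^sup>\<star> \<otimes> v = \<zero>" "u \<otimes> v\<^sup>\<star> = \<zero>"
    and M: "nrm A u \<le> M" "nrm A v \<le> M"
  shows "nrm A (u \<oplus> v) \<le> M"
proof -
  have M0: "0 \<le> M" using order_trans[OF nrm_nonneg M(1)] by simp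
  define x y where "x = u\<^sup>\<star> \<otimes> u" and "y = v\<^sup>\<star> \<otimes> v"
  have [simp]: "x \<in> carrier A" "y \<in> carrier A" "x\<^sup>\<star> = x" "y\<^sup>\<star> = y"
    by (auto simp: x_def y_def adj_mult)
  have o': "v\<^sup>\<star> \<otimes> u = \<zero>" "v \<otimes> u\<^sup>\<star> = \<zero>"
    using o by (metis adj_adj adj_closed adj_mult adj_zero assms(1,2))+
  have xy: "x \<otimes> y = \<zero>" "y \<otimes> x = \<zero>"
  proof -
    have "x \<otimes> y = u\<^sup>\<star> \<otimes> (u \<otimes> v\<^sup>\<star>) \<otimes> v" "y \<otimes> x = v\<^sup>\<star> \<otimes> (v \<otimes> u\<^sup>\<star>) \<otimes> u"
      by (simp_all add: x_def y_def mult_assoc)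
    then show "x \<otimes> y = \<zero>" "y \<otimes> x = \<zero>" by (simp_all add: o o')
  qed
  have s: "(u \<oplus> v)\<^sup>\<star> \<otimes> (u \<oplus> v) = x \<oplus> y"
    using o o' by (simp add: adj_add mult_l_distr mult_r_distr x_def y_def)
  have "nrm A (x \<oplus> y) \<le> M\<^sup>2"
  proof (rule bounded_power_ratio[where a=2 and b=0])
    fix k
    have "nrm A (x \<oplus> y) ^ 2^k = nrm A (iter_square (x \<oplus> y) k)"
      by (simp add: nrm_iter_square adj_add)
    also have "\<dots> \<le> nrm A (iter_square x k) + nrm A (iter_square y k)"
      using nrm_triangle by (simp add: iter_square_orth_sum xy)
    also have "\<dots> = (nrm A u ^ 2) ^ 2^k + (nrm A v ^ 2) ^ 2^k"
      by (simp add: nrm_iter_square) (simp add: x_def y_def nrm_cstar)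
    also have "\<dots> \<le> (M\<^sup>2) ^ 2^k + (M\<^sup>2) ^ 2^k"
      using M by (intro add_mono power_mono) auto
    finally show "nrm A (x \<oplus> y) ^ 2^k \<le> (2 + 0 * 2^k) * (M\<^sup>2) ^ 2^k" by simp
  qed auto
  then have "(nrm A (u \<oplus> v))\<^sup>2 \<le> M\<^sup>2" by (simp add: s flip: nrm_cstar)
  then show ?thesis using M0 by (rule power2_le_imp_le)
qed

text \<open>Averaging over \<open>1\<close> and a point \<open>z\<close> of the circle with \<open>z\<^sup>l\<^sup>-\<^sup>j = -1\<close> removes the component
  of degree \<open>l\<close> and keeps that of degree \<open>j\<close>; no integral over the circle is needed.\<close>

lemma homogeneous_component_nrm_le:
  fixes T :: "int set"
  assumes "finite T" and \<gamma>: "\<And>z. z \<in> sphere 0 1 \<Longrightarrow> star_hom A A (\<gamma> z)"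
    and "j \<notin> T" "\<And>k. k \<in> insert j T \<Longrightarrow> y k \<in> carrier A"
    and "\<And>k z. \<lbrakk>k \<in> insert j T; z \<in> sphere 0 1\<rbrakk> \<Longrightarrow> \<gamma> z (y k) = z powi k \<odot> y k"
  shows "nrm A (y j) \<le> nrm A (y j \<oplus> finsum A y T)"
  using assms(1,3-)
proof (induction T arbitrary: y rule: finite_induct)
  case (insert l T)
  \<comment> \<open>The difference l - j may be negative; dividing pi by it covers both
    signs.\<close>
  define z where "z = cis (pi / of_int (l - j))"
  have lj: "l - j \<noteq> 0" using insert by auto
  have z: "z \<in> sphere 0 1" "z \<noteq> 0" by (auto simp: z_def)
  have zlj: "z powi (l - j) = -1"
    using lj by (simp add: z_def cis_power_int)
  interpret g: star_hom A A "\<gamma> z" using \<gamma> z by blast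
  define R where "R x = (1/2) \<odot> (x \<oplus> z powi (-j) \<odot> \<gamma> z x)" for x
  have Rc: "R x \<in> carrier A" if "x \<in> carrier A" for x using that by (simp add: R_def)
  have Radd: "R (x \<oplus> x') = R x \<oplus> R x'" if "x \<in> carrier A" "x' \<in> carrier A" for x x'
    unfolding R_def g.hom_add[OF that]
    by (rule lin_eqI, (rule lin_rules | (rule lin_atom, simp add: that; fail))+)
      (simp add: algebra_simps)
  have R0: "R \<zero> = \<zero>" by (simp add: R_def)
  have Rnrm: "nrm A (R x) \<le> nrm A x" if "x \<in> carrier A" for x
  proof -
    have "nrm A (R x) \<le> 1/2 * (nrm A x + nrm A (z powi (-j) \<odot> \<gamma> z x))"
      using that nrm_triangle[of x "z powi (-j) \<odot> \<gamma> z x"] by (simp add: R_def nrm_smult)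
    then show ?thesis
      using g.nrm_le[OF that] z that by (simp add: nrm_smult norm_power_int)
  qed
  have Ry: "R (y k) = ((1 + z powi (k - j)) / 2) \<odot> y k" if "k \<in> insert j (insert l T)" for k
  proof -
    have [simp]: "y k \<in> carrier A" using insert that by blast
    have "z powi (-j) * z powi k = z powi (k - j)"
      using z(2) by (simp flip: power_int_add)
    then have "z powi (-j) \<odot> \<gamma> z (y k) = z powi (k - j) \<odot> y k"
      using insert.prems(3)[OF that z(1)] by (simp flip: smult_mult_c)
    then have "R (y k) = (1/2) \<odot> (y k \<oplus> z powi (k - j) \<odot> y k)" by (simp add: R_def)
    also have "\<dots> = ((1 + z powi (k - j)) / 2) \<odot> y k"
      by (rule lin_eqI, (rule lin_rules | (rule lin_atom, simp; fail))+)
        (simp add: algebra_simps add_divide_distrib)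
    finally show ?thesis .
  qed
  have yc: "y k \<in> carrier A" if "k = j \<or> k = l \<or> k \<in> T" for k using insert that by blast
  have Rj: "R (y j) = y j" using Ry[of j] yc by simp
  have Rl: "R (y l) = \<zero>" using Ry[of l] yc zlj by simp
  \<comment> \<open>The components other than l are merely rescaled by R, hence still homogeneous,
    and the induction hypothesis applies to the family \<open>R (y k)\<close>.\<close>
  have "nrm A (R (y j)) \<le> nrm A (R (y j) \<oplus> finsum A (\<lambda>k. R (y k)) T)"
  proof (rule insert.IH[of "\<lambda>k. R (y k)"])
    show "\<gamma> w (R (y k)) = w powi k \<odot> R (y k)" if k: "k \<in> insert j T" and w: "w \<in> sphere 0 1" for k w
    proof -
      interpret h: star_hom A A "\<gamma> w" using \<gamma> w by blast
      have "k \<in> insert j (insert l T)" using k by blast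
      then show ?thesis
        using insert.prems(3)[of k w] w yc[of k] k
        by (auto simp: Ry h.hom_smult mult.commute simp flip: smult_mult_c)
    qed
  qed (use insert Rc in auto)
  also have "R (y j) \<oplus> finsum A (\<lambda>k. R (y k)) T = R (y j \<oplus> finsum A y (insert l T))"
  proof -
    have "R (finsum A y (insert l T)) = finsum A (\<lambda>k. R (y k)) (insert l T)"
      using insert yc Rc Radd R0 by (intro finsum_additive) auto
    also have "\<dots> = finsum A (\<lambda>k. R (y k)) T"
      using insert yc Rc by (subst M.finsum_insert) (auto simp: Rl)
    finally show ?thesis using yc by (subst Radd) auto
  qed
  also have "nrm A \<dots> \<le> nrm A (y j \<oplus> finsum A y (insert l T))" using yc by (intro Rnrm) auto
  finally show ?case by (simp add: Rj)
qed simp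

end

section \<open>Range projections and gaps in a representation\<close>

section \<open>Representations of Boolean dynamical systems\<close>

context gba
begin

lemma meet_idem [simp]: "x \<in> carrier B \<Longrightarrow> x \<^bold>\<inter> x = x"
  using meet_join_absorb[of x "x \<^bold>\<inter> x"] join_meet_absorb[of x x] by (simp add: meet_closed)

lemma meet_bot [simp]: "x \<in> carrier B \<Longrightarrow> x \<^bold>\<inter> \<^bold>\<emptyset> = \<^bold>\<emptyset>"
  using bot_least[of x] meet_comm[of x "\<^bold>\<emptyset>"] bot_closed by simp

lemma join_bot [simp]: "x \<in> carrier B \<Longrightarrow> x \<^bold>\<union> \<^bold>\<emptyset> = x"
  using join_meet_absorb[of x "\<^bold>\<emptyset>"] bot_closed by simp

lemma diff_meet_self: "\<lbrakk>x \<in> carrier B; y \<in> carrier B\<rbrakk> \<Longrightarrow> (x \<^bold>- y) \<^bold>\<inter> x = x \<^bold>- y"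
  using meet_join_absorb[of "x \<^bold>- y" "x \<^bold>\<inter> y"] meet_join_diff[of x y]
    join_comm[of "x \<^bold>- y" "x \<^bold>\<inter> y"] by (simp add: diff_closed meet_closed)

lemma join_meet_self: "\<lbrakk>x \<in> carrier B; y \<in> carrier B\<rbrakk> \<Longrightarrow> (x \<^bold>\<union> y) \<^bold>\<inter> x = x"
  using meet_join_absorb[of x y] meet_comm[of x "x \<^bold>\<union> y"] by (simp add: join_closed)

lemma join_meet_self2: "\<lbrakk>x \<in> carrier B; y \<in> carrier B\<rbrakk> \<Longrightarrow> (y \<^bold>\<union> x) \<^bold>\<inter> x = x"
  using join_meet_self[of x y] by (simp add: join_comm)

lemma meet_self_left: "\<lbrakk>x \<in> carrier B; y \<in> carrier B\<rbrakk> \<Longrightarrow> x \<^bold>\<inter> (x \<^bold>\<inter> y) = x \<^bold>\<inter> y"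
  by (metis meet_assoc meet_idem)

end

locale bds_representation = cstar_algebra A + B: bds B
  for A :: "('a, 'm) cstar_alg_scheme" (structure) and B :: "('b, 'l, 'n) bds_scheme" +
  fixes \<I> :: "'l \<Rightarrow> 'b set" and \<J> :: "'b set" and P :: "'b \<Rightarrow> 'a" and S :: "'l \<Rightarrow> 'b \<Rightarrow> 'a"
  assumes sys: "rel_gbds B \<I> \<J>" and rep: "bds_rep B \<I> \<J> A P S"
begin

declare B.meet_closed [simp] B.join_closed [simp] B.diff_closed [simp] B.bot_closed [simp]
  B.act_closed [simp]

lemma I_carrier: "\<lbrakk>\<alpha> \<in> labels B; y \<in> \<I> \<alpha>\<rbrakk> \<Longrightarrow> y \<in> carrier B"
  and I_meet: "\<lbrakk>\<alpha> \<in> labels B; y \<in> \<I> \<alpha>; x \<in> carrier B\<rbrakk> \<Longrightarrow> y \<^bold>\<inter>\<^bsub>B\<^esub> x \<in> \<I> \<alpha>"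
  and I_join: "\<lbrakk>\<alpha> \<in> labels B; y \<in> \<I> \<alpha>; x \<in> \<I> \<alpha>\<rbrakk> \<Longrightarrow> y \<^bold>\<union>\<^bsub>B\<^esub> x \<in> \<I> \<alpha>"
  using sys by (auto simp: rel_gbds_def gba_ideal_def)

lemma I_nonempty: "\<alpha> \<in> labels B \<Longrightarrow> \<I> \<alpha> \<noteq> {}"
  using sys by (auto simp: rel_gbds_def gba_ideal_def)

lemma act_I [simp]: assumes "\<alpha> \<in> labels B" "x \<in> carrier B" shows "act B \<alpha> x \<in> \<I> \<alpha>"
proof -
  have "act B \<alpha> x \<in> act_range B \<alpha>"
    unfolding act_range_def le_b_def using assms by (auto intro!: bexI[of _ x])
  then show ?thesis using sys assms by (auto simp: rel_gbds_def)
qed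

lemma P_closed [simp]: "x \<in> carrier B \<Longrightarrow> P x \<in> carrier A"
  and P_adj [simp]: "x \<in> carrier B \<Longrightarrow> (P x)\<^sup>\<star> = P x"
  and P_idem [simp]: "x \<in> carrier B \<Longrightarrow> P x \<otimes> P x = P x"
  and S_closed [simp]: "\<lbrakk>\<alpha> \<in> labels B; y \<in> \<I> \<alpha>\<rbrakk> \<Longrightarrow> S \<alpha> y \<in> carrier A"
  and P_bot [simp]: "P \<^bold>\<emptyset>\<^bsub>B\<^esub> = \<zero>"
  and P_meet: "\<lbrakk>x \<in> carrier B; y \<in> carrier B\<rbrakk> \<Longrightarrow> P (x \<^bold>\<inter>\<^bsub>B\<^esub> y) = P x \<otimes> P y"
  and P_join: "\<lbrakk>x \<in> carrier B; y \<in> carrier B\<rbrakk> \<Longrightarrow> P (x \<^bold>\<union>\<^bsub>B\<^esub> y) = P x \<oplus> P y \<ominus> P (x \<^bold>\<inter>\<^bsub>B\<^esub> y)"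
  and P_S: "\<lbrakk>x \<in> carrier B; \<alpha> \<in> labels B; y \<in> \<I> \<alpha>\<rbrakk> \<Longrightarrow> P x \<otimes> S \<alpha> y = S \<alpha> y \<otimes> P (act B \<alpha> x)"
  and S_S: "\<lbrakk>\<alpha> \<in> labels B; y \<in> \<I> \<alpha>; \<beta> \<in> labels B; z \<in> \<I> \<beta>\<rbrakk>
    \<Longrightarrow> (S \<alpha> y)\<^sup>\<star> \<otimes> S \<beta> z = (if \<alpha> = \<beta> then P (y \<^bold>\<inter>\<^bsub>B\<^esub> z) else \<zero>)"
  and P_sum: "x \<in> \<J> \<Longrightarrow> P x = (\<Oplus>\<alpha>\<in>Delta B x. S \<alpha> (act B \<alpha> x) \<otimes> (S \<alpha> (act B \<alpha> x))\<^sup>\<star>)"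
  using rep unfolding bds_rep_def by blast+

lemma P_commute: "\<lbrakk>x \<in> carrier B; y \<in> carrier B\<rbrakk> \<Longrightarrow> P x \<otimes> P y = P y \<otimes> P x"
  using P_meet[of x y] P_meet[of y x] B.meet_comm[of x y] by simp

lemma P_diff: assumes "x \<in> carrier B" "y \<in> carrier B"
  shows "P (x \<^bold>-\<^bsub>B\<^esub> y) = P x \<ominus> P x \<otimes> P y"
proof -
  have "P x = P ((x \<^bold>\<inter>\<^bsub>B\<^esub> y) \<^bold>\<union>\<^bsub>B\<^esub> (x \<^bold>-\<^bsub>B\<^esub> y))" using assms by (simp add: B.meet_join_diff)
  also have "\<dots> = P x \<otimes> P y \<oplus> P (x \<^bold>-\<^bsub>B\<^esub> y)"
    using assms by (subst P_join) (auto simp: B.meet_meet_diff P_meet)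
  finally have "P x \<ominus> P x \<otimes> P y = P x \<otimes> P y \<oplus> P (x \<^bold>-\<^bsub>B\<^esub> y) \<ominus> P x \<otimes> P y" by simp
  also have "\<dots> = P (x \<^bold>-\<^bsub>B\<^esub> y)"
    by (rule lin_eqI, (rule lin_rules | (rule lin_atom, simp add: assms; fail))+) simp
  finally show ?thesis by simp
qed

lemma S_star_P: assumes "x \<in> carrier B" "\<alpha> \<in> labels B" "y \<in> \<I> \<alpha>"
  shows "(S \<alpha> y)\<^sup>\<star> \<otimes> P x = P (act B \<alpha> x) \<otimes> (S \<alpha> y)\<^sup>\<star>"
proof -
  have "(S \<alpha> y)\<^sup>\<star> \<otimes> P x = (P x \<otimes> S \<alpha> y)\<^sup>\<star>" using assms by (simp add: adj_mult)
  then show ?thesis using assms by (simp add: P_S adj_mult)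
qed

text \<open>Not among the defining relations. For the difference d of the two sides, relation (iii)
  evaluates all four terms of \<open>d\<^sup>\<star> \<otimes> d\<close> to projections that cancel,
  and the C*-identity gives d = 0.\<close>

lemma S_restrict: assumes "x \<in> carrier B" "\<alpha> \<in> labels B" "y \<in> \<I> \<alpha>"
  shows "S \<alpha> y \<otimes> P x = S \<alpha> (y \<^bold>\<inter>\<^bsub>B\<^esub> x)"
proof -
  note [simp] = assms I_carrier[OF assms(2,3)] I_meet[OF assms(2,3,1)]
  let ?d = "S \<alpha> y \<otimes> P x \<ominus> S \<alpha> (y \<^bold>\<inter>\<^bsub>B\<^esub> x)"
  have "?d\<^sup>\<star> \<otimes> ?d = P x \<otimes> ((S \<alpha> y)\<^sup>\<star> \<otimes> S \<alpha> y) \<otimes> P x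
      \<ominus> P x \<otimes> ((S \<alpha> y)\<^sup>\<star> \<otimes> S \<alpha> (y \<^bold>\<inter>\<^bsub>B\<^esub> x)) \<ominus> ((S \<alpha> (y \<^bold>\<inter>\<^bsub>B\<^esub> x))\<^sup>\<star> \<otimes> S \<alpha> y) \<otimes> P x
      \<oplus> (S \<alpha> (y \<^bold>\<inter>\<^bsub>B\<^esub> x))\<^sup>\<star> \<otimes> S \<alpha> (y \<^bold>\<inter>\<^bsub>B\<^esub> x)"
    by (rule lin_eqI, (rule lin_rules | (rule lin_atom, simp; fail))+)
      (simp add: mult_assoc adj_mult)
  also have "\<dots> = P x \<otimes> P y \<otimes> P x \<ominus> P x \<otimes> (P y \<otimes> P x) \<ominus> P y \<otimes> P x \<otimes> P x \<oplus> P y \<otimes> P x"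
    by (simp add: S_S B.meet_self_left B.meet_comm[of "y \<^bold>\<inter>\<^bsub>B\<^esub> x" y] P_meet)
  also have "\<dots> = \<zero>"
    by (rule lin_eqI, (rule lin_rules | (rule lin_atom, simp; fail))+)
      (simp add: mult_assoc)
  finally have "?d = \<zero>" by (rule star_cancel[rotated]) simp
  then show ?thesis by (simp add: minus_eq_zero_iff)
qed

text \<open>Both partial isometries absorb their source projections on the right, so only the common
  part of y and z survives in the middle.\<close>

lemma S_star: assumes "\<alpha> \<in> labels B" "y \<in> \<I> \<alpha>" "z \<in> \<I> \<alpha>"
  shows "S \<alpha> y \<otimes> (S \<alpha> z)\<^sup>\<star> = S \<alpha> (y \<^bold>\<inter>\<^bsub>B\<^esub> z) \<otimes> (S \<alpha> (y \<^bold>\<inter>\<^bsub>B\<^esub> z))\<^sup>\<star>"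
proof -
  note [simp] = assms I_carrier[OF assms(1,2)] I_carrier[OF assms(1,3)]
  have "S \<alpha> y \<otimes> (S \<alpha> z)\<^sup>\<star> = (S \<alpha> y \<otimes> P y) \<otimes> (S \<alpha> z \<otimes> P z)\<^sup>\<star>" by (simp add: S_restrict)
  also have "\<dots> = S \<alpha> y \<otimes> (P y \<otimes> P z) \<otimes> (S \<alpha> z)\<^sup>\<star>" by (simp add: adj_mult mult_assoc)
  also have "P y \<otimes> P z = (P y \<otimes> P z) \<otimes> (P y \<otimes> P z)" by (simp flip: P_meet)
  also have "S \<alpha> y \<otimes> ((P y \<otimes> P z) \<otimes> (P y \<otimes> P z)) \<otimes> (S \<alpha> z)\<^sup>\<star>
      = (S \<alpha> y \<otimes> (P y \<otimes> P z)) \<otimes> ((P y \<otimes> P z) \<otimes> (S \<alpha> z)\<^sup>\<star>)" by (simp add: mult_assoc)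
  also have "\<dots> = (S \<alpha> y \<otimes> (P y \<otimes> P z)) \<otimes> (S \<alpha> z \<otimes> (P z \<otimes> P y))\<^sup>\<star>"
    by (simp add: adj_mult mult_assoc)
  also have "S \<alpha> y \<otimes> (P y \<otimes> P z) = S \<alpha> (y \<^bold>\<inter>\<^bsub>B\<^esub> z)"
    by (simp add: S_restrict B.meet_self_left flip: P_meet)
  also have "S \<alpha> z \<otimes> (P z \<otimes> P y) = S \<alpha> (y \<^bold>\<inter>\<^bsub>B\<^esub> z)"
    using B.meet_comm[of z y] B.meet_self_left[of z y]
    by (simp add: S_restrict flip: P_meet)
  finally show ?thesis .
qed

lemma S_zero: "\<lbrakk>\<alpha> \<in> labels B; y \<in> \<I> \<alpha>; P y = \<zero>\<rbrakk> \<Longrightarrow> S \<alpha> y = \<zero>"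
  using I_carrier[of \<alpha> y] by (rule_tac star_cancel) (auto simp: S_S)

lemma nrm_P: "x \<in> carrier B \<Longrightarrow> nrm A (P x) \<le> 1"
  using nrm_selfadj_square[of "P x"]
  by (metis P_adj P_closed P_idem less_eq_real_def not_le nrm_nonneg power2_eq_square mult_right_cancel mult_1 zero_less_one)

lemma nrm_S: assumes "\<alpha> \<in> labels B" "y \<in> \<I> \<alpha>" shows "nrm A (S \<alpha> y) \<le> 1"
proof -
  have "(nrm A (S \<alpha> y))\<^sup>2 \<le> 1\<^sup>2"
    using assms nrm_P[of y] I_carrier[OF assms] nrm_cstar[of "S \<alpha> y"] by (simp add: S_S)
  then show ?thesis by (rule power2_le_imp_le) simp
qed

definition rproj :: "'l \<Rightarrow> 'b \<Rightarrow> 'a" where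
  "rproj \<alpha> x = S \<alpha> (act B \<alpha> x) \<otimes> (S \<alpha> (act B \<alpha> x))\<^sup>\<star>"

text \<open>The label set F is independent of x, so that gaps of different elements share one F and
  multiply like the elements themselves.\<close>

definition gap :: "'l set \<Rightarrow> 'b \<Rightarrow> 'a" where
  "gap F x = P x \<ominus> (\<Oplus>\<alpha>\<in>F. rproj \<alpha> x)"

lemma rproj_closed [simp]: "\<lbrakk>\<alpha> \<in> labels B; x \<in> carrier B\<rbrakk> \<Longrightarrow> rproj \<alpha> x \<in> carrier A"
  by (simp add: rproj_def)

lemma rproj_adj: "\<lbrakk>\<alpha> \<in> labels B; x \<in> carrier B\<rbrakk> \<Longrightarrow> (rproj \<alpha> x)\<^sup>\<star> = rproj \<alpha> x"
  by (simp add: rproj_def adj_mult)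

lemma rproj_zero: "\<lbrakk>\<alpha> \<in> labels B; x \<in> carrier B; P (act B \<alpha> x) = \<zero>\<rbrakk> \<Longrightarrow> rproj \<alpha> x = \<zero>"
  by (simp add: rproj_def S_zero)

lemma P_rproj: assumes [simp]: "\<alpha> \<in> labels B" "x \<in> carrier B" "y \<in> carrier B"
  shows "P x \<otimes> rproj \<alpha> y = rproj \<alpha> (x \<^bold>\<inter>\<^bsub>B\<^esub> y)"
proof -
  have "P x \<otimes> rproj \<alpha> y = (P x \<otimes> S \<alpha> (act B \<alpha> y)) \<otimes> (S \<alpha> (act B \<alpha> y))\<^sup>\<star>"
    by (simp add: rproj_def mult_assoc)
  also have "\<dots> = S \<alpha> (act B \<alpha> (y \<^bold>\<inter>\<^bsub>B\<^esub> x)) \<otimes> (S \<alpha> (act B \<alpha> y))\<^sup>\<star>"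
    by (simp add: P_S S_restrict B.act_meet)
  also have "\<dots> = S \<alpha> (act B \<alpha> ((y \<^bold>\<inter>\<^bsub>B\<^esub> x) \<^bold>\<inter>\<^bsub>B\<^esub> y)) \<otimes> (S \<alpha> (act B \<alpha> ((y \<^bold>\<inter>\<^bsub>B\<^esub> x) \<^bold>\<inter>\<^bsub>B\<^esub> y)))\<^sup>\<star>"
    by (subst S_star) (auto simp: B.act_meet[of \<alpha> "y \<^bold>\<inter>\<^bsub>B\<^esub> x" y])
  also have "(y \<^bold>\<inter>\<^bsub>B\<^esub> x) \<^bold>\<inter>\<^bsub>B\<^esub> y = x \<^bold>\<inter>\<^bsub>B\<^esub> y"
    using B.meet_comm[of x y] B.meet_comm[of "x \<^bold>\<inter>\<^bsub>B\<^esub> y" y] B.meet_self_left[of y x] by simp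
  finally show ?thesis by (simp add: rproj_def)
qed

lemma rproj_P: assumes [simp]: "\<alpha> \<in> labels B" "x \<in> carrier B" "y \<in> carrier B"
  shows "rproj \<alpha> x \<otimes> P y = rproj \<alpha> (x \<^bold>\<inter>\<^bsub>B\<^esub> y)"
proof -
  have "rproj \<alpha> x \<otimes> P y = (P y \<otimes> rproj \<alpha> x)\<^sup>\<star>" by (simp add: adj_mult rproj_adj)
  then show ?thesis by (simp add: P_rproj rproj_adj B.meet_comm)
qed

lemma rproj_rproj:
  assumes [simp]: "\<alpha> \<in> labels B" "\<beta> \<in> labels B" "x \<in> carrier B" "y \<in> carrier B"
  shows "rproj \<alpha> x \<otimes> rproj \<beta> y = (if \<alpha> = \<beta> then rproj \<alpha> (x \<^bold>\<inter>\<^bsub>B\<^esub> y) else \<zero>)"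
proof -
  have "rproj \<alpha> x \<otimes> rproj \<beta> y =
      S \<alpha> (act B \<alpha> x) \<otimes> ((S \<alpha> (act B \<alpha> x))\<^sup>\<star> \<otimes> S \<beta> (act B \<beta> y)) \<otimes> (S \<beta> (act B \<beta> y))\<^sup>\<star>"
    by (simp add: rproj_def mult_assoc)
  also have "\<dots> = (if \<alpha> = \<beta> then rproj \<alpha> (x \<^bold>\<inter>\<^bsub>B\<^esub> y) else \<zero>)"
  proof (cases "\<alpha> = \<beta>")
    case True
    have "S \<alpha> (act B \<alpha> x) \<otimes> P (act B \<alpha> x \<^bold>\<inter>\<^bsub>B\<^esub> act B \<alpha> y) = S \<alpha> (act B \<alpha> (x \<^bold>\<inter>\<^bsub>B\<^esub> y))"
      by (simp add: S_restrict B.meet_self_left B.act_meet)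
    moreover have "act B \<alpha> (x \<^bold>\<inter>\<^bsub>B\<^esub> y) \<^bold>\<inter>\<^bsub>B\<^esub> act B \<alpha> y = act B \<alpha> (x \<^bold>\<inter>\<^bsub>B\<^esub> y)"
      by (simp add: B.meet_assoc B.act_meet)
    ultimately show ?thesis
      using True S_star[of \<alpha> "act B \<alpha> (x \<^bold>\<inter>\<^bsub>B\<^esub> y)" "act B \<alpha> y"]
      by (simp add: S_S rproj_def)
  next
    case False then show ?thesis by (simp add: S_S)
  qed
  finally show ?thesis .
qed

context
  fixes F assumes F: "finite F" "F \<subseteq> labels B"
begin

lemma rproj_F [simp]: "\<lbrakk>\<alpha> \<in> F; x \<in> carrier B\<rbrakk> \<Longrightarrow> rproj \<alpha> x \<in> carrier A"
  using F by auto

lemma gap_closed [simp]: "x \<in> carrier B \<Longrightarrow> gap F x \<in> carrier A"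
  by (simp add: gap_def)

lemma gap_adj [simp]: "x \<in> carrier B \<Longrightarrow> (gap F x)\<^sup>\<star> = gap F x"
proof -
  assume x: "x \<in> carrier B"
  have "(\<Oplus>\<alpha>\<in>F. (rproj \<alpha> x)\<^sup>\<star>) = (\<Oplus>\<alpha>\<in>F. rproj \<alpha> x)"
    using F x by (intro finsum_eqI) (auto simp: rproj_adj)
  then show ?thesis using F x by (simp add: gap_def finsum_adj flip: adj_minus)
qed

lemma P_gap: assumes [simp]: "x \<in> carrier B" "y \<in> carrier B"
  shows "P x \<otimes> gap F y = gap F (x \<^bold>\<inter>\<^bsub>B\<^esub> y)"
proof -
  have "P x \<otimes> (\<Oplus>\<alpha>\<in>F. rproj \<alpha> y) = (\<Oplus>\<alpha>\<in>F. P x \<otimes> rproj \<alpha> y)"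
    using F by (intro finsum_mult_l) auto
  also have "\<dots> = (\<Oplus>\<alpha>\<in>F. rproj \<alpha> (x \<^bold>\<inter>\<^bsub>B\<^esub> y))"
    using F by (intro finsum_eqI) (auto simp: P_rproj)
  finally show ?thesis by (simp add: gap_def P_meet flip: mult_minus_r)
qed

lemma rproj_gap: assumes \<beta>: "\<beta> \<in> F" and [simp]: "x \<in> carrier B" "y \<in> carrier B"
  shows "rproj \<beta> x \<otimes> gap F y = \<zero>"
proof -
  have [simp]: "\<beta> \<in> labels B" using \<beta> F by auto
  have "rproj \<beta> x \<otimes> (\<Oplus>\<alpha>\<in>F. rproj \<alpha> y) = (\<Oplus>\<alpha>\<in>F. rproj \<beta> x \<otimes> rproj \<alpha> y)"
    using F by (intro finsum_mult_l) auto
  also have "\<dots> = (\<Oplus>\<alpha>\<in>F. if \<beta> = \<alpha> then rproj \<alpha> (x \<^bold>\<inter>\<^bsub>B\<^esub> y) else \<zero>)"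
    using F by (intro finsum_eqI) (auto simp: rproj_rproj)
  also have "\<dots> = rproj \<beta> (x \<^bold>\<inter>\<^bsub>B\<^esub> y)"
    using F \<beta> by (intro M.finsum_singleton) auto
  finally show ?thesis by (simp add: gap_def rproj_P flip: mult_minus_r)
qed

text \<open>Range projections with labels in F annihilate gaps relative to F, so the first gap acts
  on the second as P x does.\<close>

lemma gap_meet: assumes [simp]: "x \<in> carrier B" "y \<in> carrier B"
  shows "gap F x \<otimes> gap F y = gap F (x \<^bold>\<inter>\<^bsub>B\<^esub> y)"
proof -
  have "(\<Oplus>\<alpha>\<in>F. rproj \<alpha> x) \<otimes> gap F y = (\<Oplus>\<alpha>\<in>F. rproj \<alpha> x \<otimes> gap F y)"
    using F by (intro finsum_mult_r) auto
  also have "\<dots> = (\<Oplus>\<alpha>\<in>F. \<zero>)" using F by (intro finsum_eqI) (auto simp: rproj_gap)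
  also have "\<dots> = \<zero>" by (rule M.finsum_zero)
  finally have z: "(\<Oplus>\<alpha>\<in>F. rproj \<alpha> x) \<otimes> gap F y = \<zero>" .
  have "gap F x \<otimes> gap F y = P x \<otimes> gap F y \<ominus> (\<Oplus>\<alpha>\<in>F. rproj \<alpha> x) \<otimes> gap F y"
    by (subst gap_def) (simp add: mult_minus_l)
  then show ?thesis by (simp add: z P_gap)
qed

lemma gap_diff: assumes [simp]: "x \<in> carrier B" "y \<in> carrier B"
  shows "gap F (x \<^bold>-\<^bsub>B\<^esub> y) = gap F x \<ominus> gap F (x \<^bold>\<inter>\<^bsub>B\<^esub> y)"
proof -
  have "gap F (x \<^bold>-\<^bsub>B\<^esub> y) = P (x \<^bold>-\<^bsub>B\<^esub> y) \<otimes> gap F x" by (simp add: P_gap B.diff_meet_self)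
  also have "\<dots> = P x \<otimes> gap F x \<ominus> P x \<otimes> P y \<otimes> gap F x" by (simp add: P_diff mult_minus_l)
  also have "P x \<otimes> P y \<otimes> gap F x = gap F (x \<^bold>\<inter>\<^bsub>B\<^esub> y)"
    using B.meet_comm[of y x] B.meet_self_left[of x y] by (simp add: mult_assoc P_gap)
  finally show ?thesis by (simp add: P_gap)
qed

text \<open>Of the range projections only the one with label \<beta> meets S \<beta> y, and it acts
  there exactly as P x. Consequently gaps relative to F annihilate every word whose first letter is
  in F.\<close>

lemma gap_S:
  assumes \<beta>: "\<beta> \<in> F" and [simp]: "x \<in> carrier B" and y [simp]: "y \<in> \<I> \<beta>"
  shows "gap F x \<otimes> S \<beta> y = \<zero>"
proof -
  have [simp]: "\<beta> \<in> labels B" using \<beta> F by auto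
  have [simp]: "y \<in> carrier B" using I_carrier[of \<beta> y] by simp
  have e: "rproj \<alpha> x \<otimes> S \<beta> y = (if \<beta> = \<alpha> then S \<beta> (y \<^bold>\<inter>\<^bsub>B\<^esub> act B \<beta> x) else \<zero>)"
    if "\<alpha> \<in> F" for \<alpha>
  proof -
    have [simp]: "\<alpha> \<in> labels B" using that F by auto
    have "rproj \<alpha> x \<otimes> S \<beta> y = S \<alpha> (act B \<alpha> x) \<otimes> ((S \<alpha> (act B \<alpha> x))\<^sup>\<star> \<otimes> S \<beta> y)"
      by (simp add: rproj_def mult_assoc)
    then show ?thesis
      using B.meet_comm[of y "act B \<alpha> x"] by (simp add: S_S S_restrict B.meet_self_left)
  qed
  have "(\<Oplus>\<alpha>\<in>F. rproj \<alpha> x) \<otimes> S \<beta> y = (\<Oplus>\<alpha>\<in>F. rproj \<alpha> x \<otimes> S \<beta> y)"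
    using F by (intro finsum_mult_r) auto
  also have "\<dots> = (\<Oplus>\<alpha>\<in>F. if \<beta> = \<alpha> then S \<beta> (y \<^bold>\<inter>\<^bsub>B\<^esub> act B \<beta> x) else \<zero>)"
    using F I_meet[of \<beta> y] by (intro finsum_eqI) (auto simp: e)
  also have "\<dots> = S \<beta> (y \<^bold>\<inter>\<^bsub>B\<^esub> act B \<beta> x)"
    using F \<beta> I_meet[of \<beta> y] M.finsum_singleton[of \<beta> F "\<lambda>\<alpha>. S \<beta> (y \<^bold>\<inter>\<^bsub>B\<^esub> act B \<beta> x)"] by auto
  also have "\<dots> = P x \<otimes> S \<beta> y" by (simp add: P_S S_restrict)
  finally have "(\<Oplus>\<alpha>\<in>F. rproj \<alpha> x) \<otimes> S \<beta> y = P x \<otimes> S \<beta> y" .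
  then show ?thesis
    by (simp add: gap_def flip: mult_minus_l)
qed

end

text \<open>A label missing from F is not subtracted, and compression by its partial isometry
  recovers the projection of \<open>act B \<beta> x\<close>. A homomorphism that kills the gap must
  therefore kill this projection too.\<close>

lemma S_star_gap_S:
  assumes F: "finite F" "F \<subseteq> labels B" and [simp]: "\<beta> \<in> labels B" "x \<in> carrier B" and \<beta>: "\<beta> \<notin> F"
  shows "(S \<beta> (act B \<beta> x))\<^sup>\<star> \<otimes> gap F x \<otimes> S \<beta> (act B \<beta> x) = P (act B \<beta> x)"
proof -
  have [simp]: "gap F x \<in> carrier A" using F by (rule gap_closed) simp
  have z: "rproj \<alpha> x \<otimes> S \<beta> (act B \<beta> x) = \<zero>" if "\<alpha> \<in> F" for \<alpha>
  proof -
    have [simp]: "\<alpha> \<in> labels B" "\<alpha> \<noteq> \<beta>" using that F \<beta> by auto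
    show ?thesis by (simp add: rproj_def mult_assoc S_S)
  qed
  have "(\<Oplus>\<alpha>\<in>F. rproj \<alpha> x) \<otimes> S \<beta> (act B \<beta> x) = (\<Oplus>\<alpha>\<in>F. rproj \<alpha> x \<otimes> S \<beta> (act B \<beta> x))"
    using F by (intro finsum_mult_r) auto
  also have "\<dots> = (\<Oplus>\<alpha>\<in>F. \<zero>)" by (intro finsum_eqI) (auto simp: z)
  also have "\<dots> = \<zero>" by (rule M.finsum_zero)
  finally have "(\<Oplus>\<alpha>\<in>F. rproj \<alpha> x) \<otimes> S \<beta> (act B \<beta> x) = \<zero>" .
  then have "gap F x \<otimes> S \<beta> (act B \<beta> x) = P x \<otimes> S \<beta> (act B \<beta> x)"
    using rproj_F[OF F] by (simp add: gap_def flip: mult_minus_l)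
  then show ?thesis
    by (simp add: mult_assoc P_S S_restrict S_S)
qed

end

section \<open>Isometry on combinations of gaps\<close>

section \<open>Gauge-invariant uniqueness\<close>

context gba
begin

lemma le_of_join_le:
  assumes "x \<in> carrier B" "y \<in> carrier B" "z \<in> carrier B" "(x \<^bold>\<union> y) \<^bold>\<inter> z = x \<^bold>\<union> y"
  shows "x \<^bold>\<inter> z = x" "y \<^bold>\<inter> z = y"
proof -
  show "x \<^bold>\<inter> z = x"
    using assms meet_join_absorb[of x y] meet_assoc[of x "x \<^bold>\<union> y" z] by (simp add: join_closed)
  show "y \<^bold>\<inter> z = y"
    using assms meet_join_absorb[of y x] join_comm[of x y] meet_assoc[of y "x \<^bold>\<union> y" z]
    by (simp add: join_closed)
qed

end

context cstar_algebra
begin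

lemma projection_nrm:
  assumes "x \<in> carrier A" "x\<^sup>\<star> = x" "x \<otimes> x = x"
  shows "nrm A x \<le> 1" "x \<noteq> \<zero> \<Longrightarrow> nrm A x = 1"
proof -
  have "nrm A x = nrm A x * nrm A x"
    using nrm_selfadj_square[of x] assms by (simp add: power2_eq_square)
  then have "nrm A x = 0 \<or> nrm A x = 1" by auto
  then show "nrm A x \<le> 1" "x \<noteq> \<zero> \<Longrightarrow> nrm A x = 1" using assms by (auto simp: nrm_eq_0)
qed

end

text \<open>The maps \<gamma> z act on the target and are tied to the grading of A only through the
  images of the generators. \<open>P_inj\<close> says that no nonzero element of B is lost;
  \<open>gap_J\<close> says that relation (iv) holds in the target only for those regular elements
  for which it is imposed in A.\<close>

locale gauge_representation = bds_representation A B \<I> \<J> P S + h: star_hom A C \<phi>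
  for A :: "('a, 'm) cstar_alg_scheme" (structure) and B :: "('b, 'l, 'n) bds_scheme"
    and \<I> :: "'l \<Rightarrow> 'b set" and \<J> :: "'b set" and P :: "'b \<Rightarrow> 'a" and S :: "'l \<Rightarrow> 'b \<Rightarrow> 'a"
    and C :: "('c, 'k) cstar_alg_scheme" and \<phi> :: "'a \<Rightarrow> 'c" +
  fixes \<gamma> :: "complex \<Rightarrow> 'c \<Rightarrow> 'c"
  assumes gen: "cstar_gen A (rep_gens B \<I> P S) = carrier A"
    and gauge_hom: "z \<in> sphere 0 1 \<Longrightarrow> star_hom C C (\<gamma> z)"
    and gauge_P: "\<lbrakk>z \<in> sphere 0 1; x \<in> carrier B\<rbrakk> \<Longrightarrow> \<gamma> z (\<phi> (P x)) = \<phi> (P x)"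
    and gauge_S: "\<lbrakk>z \<in> sphere 0 1; \<alpha> \<in> labels B; y \<in> \<I> \<alpha>\<rbrakk>
      \<Longrightarrow> \<gamma> z (\<phi> (S \<alpha> y)) = z \<odot>\<^bsub>C\<^esub> \<phi> (S \<alpha> y)"
    and P_inj: "\<lbrakk>x \<in> carrier B; \<phi> (P x) = \<zero>\<^bsub>C\<^esub>\<rbrakk> \<Longrightarrow> x = \<^bold>\<emptyset>\<^bsub>B\<^esub>"
    and gap_J: "\<lbrakk>x \<in> regs B; \<phi> (gap (Delta B x) x) = \<zero>\<^bsub>C\<^esub>\<rbrakk> \<Longrightarrow> x \<in> \<J>"
begin

text \<open>Every y below x has gap F y = P y (gap F x), which is killed as well. By compression, y
  then sees only labels in F, and it sees at least one if nonempty, since otherwise its gap is P y.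
  So x is regular, its gap relative to F is the one relative to its own labels, \<open>gap_J\<close>
  puts x into \<J>, and relation (iv) makes the gap vanish.\<close>

lemma gap_kernel:
  assumes F: "finite F" "F \<subseteq> labels B" and x [simp]: "x \<in> carrier B"
    and z: "\<phi> (gap F x) = \<zero>\<^bsub>C\<^esub>"
  shows "gap F x = \<zero>"
proof -
  note [simp] = gap_closed[OF F]
  have D: "Delta B y \<subseteq> F" if [simp]: "y \<in> carrier B" and y: "\<phi> (gap F y) = \<zero>\<^bsub>C\<^esub>" for y
  proof
    fix \<beta> assume b: "\<beta> \<in> Delta B y"
    then have [simp]: "\<beta> \<in> labels B" by (simp add: Delta_def)
    show "\<beta> \<in> F"
    proof (rule ccontr)
      assume "\<beta> \<notin> F"
      then have "P (act B \<beta> y) = (S \<beta> (act B \<beta> y))\<^sup>\<star> \<otimes> gap F y \<otimes> S \<beta> (act B \<beta> y)"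
        using S_star_gap_S[OF F] by simp
      then have "\<phi> (P (act B \<beta> y)) = \<zero>\<^bsub>C\<^esub>" by (simp add: h.hom_mult y)
      then show False using b P_inj[of "act B \<beta> y"] by (simp add: Delta_def)
    qed
  qed
  have neutral: "gap (Delta B y) y = gap F y"
    if [simp]: "y \<in> carrier B" and y: "\<phi> (gap F y) = \<zero>\<^bsub>C\<^esub>" for y
  proof -
    have "(\<Oplus>\<alpha>\<in>Delta B y. rproj \<alpha> y) = (\<Oplus>\<alpha>\<in>F. rproj \<alpha> y)"
    proof (rule finsum_mono_neutral[OF F(1) D[OF that]])
      show "rproj \<alpha> y = \<zero>" if "\<alpha> \<in> F - Delta B y" for \<alpha>
        using that F by (intro rproj_zero) (auto simp: Delta_def)
    qed (auto simp: Delta_def)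
    then show ?thesis by (simp add: gap_def)
  qed
  have "x \<in> regs B"
    unfolding regs_def
  proof (intro CollectI conjI ballI impI x)
    fix y assume [simp]: "y \<in> carrier B" and "y \<noteq> \<^bold>\<emptyset>\<^bsub>B\<^esub> \<and> y \<^bold>\<subseteq>\<^bsub>B\<^esub> x"
    then have y: "y \<noteq> \<^bold>\<emptyset>\<^bsub>B\<^esub>" "y \<^bold>\<inter>\<^bsub>B\<^esub> x = y" by (auto simp: le_b_def)
    have g: "\<phi> (gap F y) = \<zero>\<^bsub>C\<^esub>"
      using P_gap[OF F, of y x] y(2) z by (metis \<open>y \<in> carrier B\<close> h.hom_closed h.hom_mult P_closed gap_closed[OF F] h.C.mult_zero x)
    show "finite (Delta B y)" using D[OF _ g] F finite_subset by auto
    moreover have "Delta B y \<noteq> {}"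
    proof
      assume "Delta B y = {}"
      then have "gap F y = P y" using neutral[OF _ g] by (simp add: gap_def)
      then show False using P_inj[of y] g y by simp
    qed
    ultimately show "0 < card (Delta B y)" by (simp add: card_gt_0_iff)
  qed
  then have J: "x \<in> \<J>" using neutral[OF x z] z by (intro gap_J) auto
  have "(\<Oplus>\<alpha>\<in>Delta B x. rproj \<alpha> x) = P x" using P_sum[OF J] by (simp flip: rproj_def)
  then have "gap (Delta B x) x = \<zero>" by (simp add: gap_def)
  then show ?thesis using neutral[OF x z] by simp
qed

context
  fixes F assumes F: "finite F" "F \<subseteq> labels B"
begin

lemmas [simp] = gap_closed[OF F] gap_adj[OF F] gap_meet[OF F]

lemma gap_bot: "gap F \<^bold>\<emptyset>\<^bsub>B\<^esub> = \<zero>"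
proof -
  have "(\<Oplus>\<alpha>\<in>F. rproj \<alpha> \<^bold>\<emptyset>\<^bsub>B\<^esub>) = (\<Oplus>\<alpha>\<in>F. \<zero>)"
    using F by (intro finsum_eqI rproj_zero) (auto simp: B.act_bot)
  also have "\<dots> = \<zero>" by (rule M.finsum_zero)
  finally show ?thesis by (simp add: gap_def)
qed

lemma gap_span_carrier: "gap F ` carrier B \<subseteq> carrier A"
  by auto

lemma gap_span_commute:
  assumes "a \<in> lspan (gap F ` carrier B)" and [simp]: "x \<in> carrier B"
  shows "gap F x \<otimes> a = a \<otimes> gap F x"
  using assms(1)
proof (induction rule: lspan.induct)
  case (lspan_step a m c)
  then have "a \<in> carrier A" using lspan_carrier gap_span_carrier by blast
  then show ?case
    using lspan_step by (auto simp: mult_l_distr mult_r_distr smult_mult_l smult_mult_r B.meet_comm)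
qed simp

text \<open>The join of the finitely many elements involved yields a projection that acts as a unit
  on the combination.\<close>

lemma gap_span_support:
  "a \<in> lspan (gap F ` carrier B) \<Longrightarrow> \<exists>x\<in>carrier B. gap F x \<otimes> a = a"
proof (induction rule: lspan.induct)
  case lspan_zero
  show ?case by (rule bexI[of _ "\<^bold>\<emptyset>\<^bsub>B\<^esub>"]) simp_all
next
  case (lspan_step a m c)
  then obtain x y where [simp]: "x \<in> carrier B" "y \<in> carrier B"
    and x: "gap F x \<otimes> a = a" and y: "m = gap F y" by blast
  have [simp]: "a \<in> carrier A" using lspan_step lspan_carrier gap_span_carrier by blast
  have "gap F (x \<^bold>\<union>\<^bsub>B\<^esub> y) \<otimes> (gap F x \<otimes> a) = gap F x \<otimes> a"
    by (simp add: B.join_meet_self flip: mult_assoc)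
  moreover have "gap F (x \<^bold>\<union>\<^bsub>B\<^esub> y) \<otimes> gap F y = gap F y"
    by (simp add: B.join_meet_self2)
  ultimately have "gap F (x \<^bold>\<union>\<^bsub>B\<^esub> y) \<otimes> (a \<oplus> c \<odot> m) = a \<oplus> c \<odot> m"
    by (simp add: mult_r_distr smult_mult_r x y)
  then show ?case by (intro bexI[of _ "x \<^bold>\<union>\<^bsub>B\<^esub> y"]) auto
qed

text \<open>Cutting by each \<open>y\<close> in turn, into orthogonal pieces below and outside \<open>y\<close>, avoids
  rewriting the combination over disjoint elements.\<close>

lemma gap_span_isometric_aux:
  "\<lbrakk>a \<in> lspan (gap F ` carrier B); x \<in> carrier B\<rbrakk>
    \<Longrightarrow> nrm A (c \<odot> gap F x \<oplus> gap F x \<otimes> a) \<le> nrm C (\<phi> (c \<odot> gap F x \<oplus> gap F x \<otimes> a))"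
proof (induction arbitrary: x c rule: lspan.induct)
  case lspan_zero
  note [simp] = lspan_zero
  \<comment> \<open>A multiple of a single projection: its image either vanishes, and then so does
    the gap by \<open>gap_kernel\<close>, or has norm |c|.\<close>
  show ?case
  proof (cases "\<phi> (gap F x) = \<zero>\<^bsub>C\<^esub>")
    case True
    then show ?thesis using gap_kernel[OF F lspan_zero True] by simp
  next
    case False
    have "\<phi> (gap F x) \<otimes>\<^bsub>C\<^esub> \<phi> (gap F x) = \<phi> (gap F x)" "(\<phi> (gap F x))\<^sup>\<star>\<^bsub>C\<^esub> = \<phi> (gap F x)"
      by (simp_all flip: h.hom_mult h.hom_adj)
    then have "nrm C (\<phi> (gap F x)) = 1" using False by (intro h.C.projection_nrm(2)) auto
    moreover have "nrm A (gap F x) \<le> 1" by (intro projection_nrm) auto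
    ultimately show ?thesis
      by (simp add: h.hom_smult nrm_smult h.C.nrm_smult mult_left_le)
  qed
next
  case (lspan_step a m d)
  then obtain y where m: "m = gap F y" and [simp]: "y \<in> carrier B" by blast
  have [simp]: "a \<in> carrier A" using lspan_step lspan_carrier gap_span_carrier by blast
  note [simp] = \<open>x \<in> carrier B\<close>
  define g1 g2 where "g1 = gap F (x \<^bold>\<inter>\<^bsub>B\<^esub> y)" and "g2 = gap F (x \<^bold>-\<^bsub>B\<^esub> y)"
  have [simp]: "g1 \<in> carrier A" "g2 \<in> carrier A" "g1\<^sup>\<star> = g1" "g2\<^sup>\<star> = g2" "g1 \<otimes> g1 = g1" "g2 \<otimes> g2 = g2"
    by (auto simp: g1_def g2_def)
  have o: "g1 \<otimes> g2 = \<zero>" "g2 \<otimes> g1 = \<zero>"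
    using B.meet_meet_diff[of x y] B.meet_comm[of "x \<^bold>\<inter>\<^bsub>B\<^esub> y" "x \<^bold>-\<^bsub>B\<^esub> y"]
    by (auto simp: g1_def g2_def gap_bot)
  have o': "g1 \<otimes> (g2 \<otimes> b) = \<zero>" "g2 \<otimes> (g1 \<otimes> b) = \<zero>" "g1 \<otimes> (g1 \<otimes> b) = g1 \<otimes> b" "g2 \<otimes> (g2 \<otimes> b) = g2 \<otimes> b"
    if "b \<in> carrier A" for b using that o by (simp_all flip: mult_assoc)
  have gx: "gap F x = g1 \<oplus> g2"
  proof -
    have "g2 = gap F x \<ominus> g1" using gap_diff[OF F, of x y] by (simp add: g1_def g2_def)
    then have "g1 \<oplus> g2 = g1 \<oplus> (gap F x \<ominus> g1)" by simp
    also have "\<dots> = gap F x"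
      by (rule lin_eqI, (rule lin_rules | (rule lin_atom, simp; fail))+) simp
    finally show ?thesis by simp
  qed
  have gxy: "gap F x \<otimes> gap F y = g1" by (simp add: g1_def)
  have com: "a \<otimes> g1 = g1 \<otimes> a" "a \<otimes> g2 = g2 \<otimes> a"
    using gap_span_commute[OF lspan_step.hyps(1)] by (auto simp: g1_def g2_def)
  \<comment> \<open>Below y the new term is the scalar d and outside y it vanishes. The coefficient
    c carried through the induction absorbs it, so both pieces have the shape of the induction
    hypothesis with a shorter combination.\<close>
  define u v w where "u = (c + d) \<odot> g1 \<oplus> g1 \<otimes> a" and "v = c \<odot> g2 \<oplus> g2 \<otimes> a"
    and "w = c \<odot> gap F x \<oplus> gap F x \<otimes> (a \<oplus> d \<odot> m)"
  have [simp]: "u \<in> carrier A" "v \<in> carrier A" by (auto simp: u_def v_def)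
  have "w = c \<odot> gap F x \<oplus> (gap F x \<otimes> a \<oplus> d \<odot> (gap F x \<otimes> gap F y))"
    by (simp add: w_def m mult_r_distr smult_mult_r)
  also have "\<dots> = c \<odot> (g1 \<oplus> g2) \<oplus> ((g1 \<oplus> g2) \<otimes> a \<oplus> d \<odot> g1)" unfolding gxy unfolding gx ..
  also have "\<dots> = u \<oplus> v" unfolding u_def v_def
    by (rule lin_eqI, (rule lin_rules | (rule lin_atom, simp; fail))+) (simp add: algebra_simps)
  finally have w: "w = u \<oplus> v" .
  have gu: "g1 \<otimes> u = u" "g2 \<otimes> v = v" "g1 \<otimes> v = \<zero>" "g2 \<otimes> u = \<zero>"
    by (simp_all add: u_def v_def mult_r_distr smult_mult_r o o')
  have ug: "u \<otimes> g1 = u" "v \<otimes> g2 = v"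
    by (simp_all add: u_def v_def mult_l_distr smult_mult_l mult_assoc com o')
  have "u\<^sup>\<star> \<otimes> v = (g1 \<otimes> u)\<^sup>\<star> \<otimes> v" by (simp add: gu)
  also have "\<dots> = u\<^sup>\<star> \<otimes> (g1 \<otimes> v)" by (simp add: adj_mult mult_assoc)
  finally have o1: "u\<^sup>\<star> \<otimes> v = \<zero>" by (simp add: gu)
  have "u \<otimes> v\<^sup>\<star> = (u \<otimes> g1) \<otimes> (v \<otimes> g2)\<^sup>\<star>" by (simp add: ug)
  also have "\<dots> = u \<otimes> (g1 \<otimes> (g2 \<otimes> v\<^sup>\<star>))" by (simp add: adj_mult mult_assoc)
  finally have o2: "u \<otimes> v\<^sup>\<star> = \<zero>" by (simp add: o')
  have small: "nrm C (\<phi> (g \<otimes> w)) \<le> nrm C (\<phi> w)" if [simp]: "g \<in> carrier A" "nrm A g \<le> 1" for g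
  proof -
    have "nrm C (\<phi> (g \<otimes> w)) \<le> nrm C (\<phi> g) * nrm C (\<phi> w)"
      using h.C.nrm_mult[of "\<phi> g" "\<phi> w"] by (simp add: h.hom_mult w)
    also have "\<dots> \<le> 1 * nrm C (\<phi> w)"
      using order_trans[OF h.nrm_le that(2)] by (intro mult_right_mono) (auto simp: w)
    finally show ?thesis by simp
  qed
  have "nrm A u \<le> nrm C (\<phi> u)" unfolding u_def g1_def by (rule lspan_step.IH) simp
  also have "\<dots> = nrm C (\<phi> (g1 \<otimes> w))" by (simp add: w mult_r_distr gu)
  also have "\<dots> \<le> nrm C (\<phi> w)" by (intro small projection_nrm) auto
  finally have 1: "nrm A u \<le> nrm C (\<phi> w)" .
  have "nrm A v \<le> nrm C (\<phi> v)" unfolding v_def g2_def by (rule lspan_step.IH) simp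
  also have "\<dots> = nrm C (\<phi> (g2 \<otimes> w))" by (simp add: w mult_r_distr gu)
  also have "\<dots> \<le> nrm C (\<phi> w)" by (intro small projection_nrm) auto
  finally have 2: "nrm A v \<le> nrm C (\<phi> w)" .
  have "nrm A w \<le> nrm C (\<phi> w)"
    using nrm_orth_sum[OF _ _ o1 o2 1 2] by (simp add: w)
  then show ?case by (simp add: w_def)
qed

lemma gap_span_isometric:
  assumes a: "a \<in> lspan (gap F ` carrier B)"
  shows "nrm A a \<le> nrm C (\<phi> a)"
proof -
  obtain x where "x \<in> carrier B" "gap F x \<otimes> a = a" using gap_span_support[OF a] by blast
  moreover have "a \<in> carrier A" using lspan_carrier[OF a gap_span_carrier] .
  ultimately show ?thesis using gap_span_isometric_aux[OF a, of x 0] by simp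
qed

end

end

section \<open>Words of equal length on both sides\<close>

section \<open>The core and the polynomials\<close>

context bds_representation
begin

definition words :: "'l set \<Rightarrow> 'a set \<Rightarrow> 'a set" where
  "words F U = {S \<alpha> y \<otimes> m \<otimes> (S \<beta> z)\<^sup>\<star> | \<alpha> y m \<beta> z. \<alpha> \<in> F \<and> y \<in> \<I> \<alpha> \<and> m \<in> U \<and> \<beta> \<in> F \<and> z \<in> \<I> \<beta>}"

text \<open>Words with at most n letters from F on each side, equally many, built from the inside
  outwards. Each layer can thus be removed by one compression.\<close>

primrec core :: "'l set \<Rightarrow> nat \<Rightarrow> 'a set" where
  "core F 0 = P ` carrier B"
| "core F (Suc n) = P ` carrier B \<union> words F (core F n)"

lemma wordsI:
  "\<lbrakk>\<alpha> \<in> F; y \<in> \<I> \<alpha>; m \<in> U; \<beta> \<in> F; z \<in> \<I> \<beta>\<rbrakk> \<Longrightarrow> S \<alpha> y \<otimes> m \<otimes> (S \<beta> z)\<^sup>\<star> \<in> words F U"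
  unfolding words_def by blast

lemma words_mono: "\<lbrakk>F \<subseteq> G; U \<subseteq> V\<rbrakk> \<Longrightarrow> words F U \<subseteq> words G V"
  unfolding words_def by blast

lemma words_carrier: "\<lbrakk>F \<subseteq> labels B; U \<subseteq> carrier A\<rbrakk> \<Longrightarrow> words F U \<subseteq> carrier A"
  by (auto simp: words_def subset_iff)

lemma core_carrier: "F \<subseteq> labels B \<Longrightarrow> core F n \<subseteq> carrier A"
  by (induction n) (auto dest: words_carrier)

lemma P_core: "x \<in> carrier B \<Longrightarrow> P x \<in> core F n"
  by (cases n) auto

lemma core_mono: "\<lbrakk>F \<subseteq> G; n \<le> k\<rbrakk> \<Longrightarrow> core F n \<subseteq> core G k"
proof (induction n arbitrary: k)
  case 0 then show ?case using P_core by auto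
next
  case (Suc n)
  then obtain l where "k = Suc l" "n \<le> l" by (cases k) auto
  then show ?case using Suc words_mono[OF Suc.prems(1), of "core F n" "core G l"] by auto
qed

lemma core_adj: "\<lbrakk>F \<subseteq> labels B; m \<in> core F n\<rbrakk> \<Longrightarrow> m\<^sup>\<star> \<in> core F n"
proof (induction n arbitrary: m)
  case (Suc n)
  show ?case
  proof (cases "m \<in> P ` carrier B")
    case False
    then obtain \<alpha> y k \<beta> z where m: "m = S \<alpha> y \<otimes> k \<otimes> (S \<beta> z)\<^sup>\<star>" "\<alpha> \<in> F" "y \<in> \<I> \<alpha>"
      "k \<in> core F n" "\<beta> \<in> F" "z \<in> \<I> \<beta>" using Suc.prems by (auto simp: words_def)
    then have [simp]: "\<alpha> \<in> labels B" "\<beta> \<in> labels B" "k \<in> carrier A"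
      using Suc.prems core_carrier by auto
    have "m\<^sup>\<star> = S \<beta> z \<otimes> k\<^sup>\<star> \<otimes> (S \<alpha> y)\<^sup>\<star>" using m by (simp add: adj_mult mult_assoc)
    moreover have "k\<^sup>\<star> \<in> core F n" using Suc m by blast
    ultimately show ?thesis using m wordsI by simp
  qed auto
qed auto

lemma P_mult_core:
  "\<lbrakk>F \<subseteq> labels B; m \<in> core F n; x \<in> carrier B\<rbrakk> \<Longrightarrow> P x \<otimes> m \<in> core F n"
proof (induction n arbitrary: m x)
  case 0 then show ?case by (auto simp flip: P_meet)
next
  case (Suc n)
  show ?case
  proof (cases "m \<in> P ` carrier B")
    case True then show ?thesis using Suc.prems by (auto simp flip: P_meet)
  next
    case False
    then obtain \<alpha> y k \<beta> z where m: "m = S \<alpha> y \<otimes> k \<otimes> (S \<beta> z)\<^sup>\<star>" "\<alpha> \<in> F" "y \<in> \<I> \<alpha>"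
      "k \<in> core F n" "\<beta> \<in> F" "z \<in> \<I> \<beta>" using Suc.prems by (auto simp: words_def)
    then have [simp]: "\<alpha> \<in> labels B" "\<beta> \<in> labels B" "k \<in> carrier A"
      using Suc.prems core_carrier by auto
    have "P x \<otimes> m = (P x \<otimes> S \<alpha> y) \<otimes> k \<otimes> (S \<beta> z)\<^sup>\<star>" using m Suc.prems by (simp add: mult_assoc)
    also have "\<dots> = S \<alpha> y \<otimes> (P (act B \<alpha> x) \<otimes> k) \<otimes> (S \<beta> z)\<^sup>\<star>"
      using m Suc.prems by (simp add: mult_assoc P_S)
    moreover have "P (act B \<alpha> x) \<otimes> k \<in> core F n" using m Suc by simp
    ultimately show ?thesis using m wordsI by simp
  qed
qed

lemma core_mult_P:
  assumes "F \<subseteq> labels B" "m \<in> core F n" "x \<in> carrier B"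
  shows "m \<otimes> P x \<in> core F n"
proof -
  have c: "m \<in> carrier A" using assms core_carrier by blast
  have "(P x \<otimes> m\<^sup>\<star>)\<^sup>\<star> \<in> core F n" using assms by (intro core_adj P_mult_core) auto
  then show ?thesis using c assms by (simp add: adj_mult)
qed

text \<open>The adjacent outer letters either kill the product or leave a projection by relation
  (iii); the projection is absorbed by the inner word, and the induction multiplies inner
  words.\<close>

lemma core_mult:
  "\<lbrakk>F \<subseteq> labels B; m \<in> core F n; k \<in> core F n\<rbrakk> \<Longrightarrow> m \<otimes> k = \<zero> \<or> m \<otimes> k \<in> core F n"
proof (induction n arbitrary: m k)
  case 0 then show ?case by (auto simp flip: P_meet)
next
  case (Suc n)
  consider (a) x where "x \<in> carrier B" "m = P x" | (b) x where "x \<in> carrier B" "k = P x"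
    | (c) "m \<in> words F (core F n)" "k \<in> words F (core F n)" using Suc.prems by auto
  then show ?case
  proof cases
    case a then show ?thesis using P_mult_core[OF Suc.prems(1,3)] by auto
  next
    case b then show ?thesis using core_mult_P[OF Suc.prems(1,2)] by auto
  next
    case c
    then obtain \<alpha> y a \<beta> z where m: "m = S \<alpha> y \<otimes> a \<otimes> (S \<beta> z)\<^sup>\<star>" "\<alpha> \<in> F" "y \<in> \<I> \<alpha>"
      "a \<in> core F n" "\<beta> \<in> F" "z \<in> \<I> \<beta>" by (auto simp: words_def)
    obtain \<alpha>' y' b \<beta>' z' where k: "k = S \<alpha>' y' \<otimes> b \<otimes> (S \<beta>' z')\<^sup>\<star>" "\<alpha>' \<in> F" "y' \<in> \<I> \<alpha>'"
      "b \<in> core F n" "\<beta>' \<in> F" "z' \<in> \<I> \<beta>'" using c by (auto simp: words_def)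
    have [simp]: "\<alpha> \<in> labels B" "\<beta> \<in> labels B" "\<alpha>' \<in> labels B" "\<beta>' \<in> labels B"
      "a \<in> carrier A" "b \<in> carrier A"
      using m k Suc.prems core_carrier by auto
    have mk: "m \<otimes> k = S \<alpha> y \<otimes> (a \<otimes> (((S \<beta> z)\<^sup>\<star> \<otimes> S \<alpha>' y') \<otimes> b)) \<otimes> (S \<beta>' z')\<^sup>\<star>"
      using m k by (simp add: mult_assoc)
    show ?thesis
    proof (cases "\<beta> = \<alpha>'")
      case False
      then show ?thesis unfolding mk using m k by (simp add: S_S)
    next
      case True
      have zy: "z \<^bold>\<inter>\<^bsub>B\<^esub> y' \<in> carrier B" using m k True I_carrier[of \<beta>] by simp
      let ?c = "P (z \<^bold>\<inter>\<^bsub>B\<^esub> y') \<otimes> b"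
      have mk': "m \<otimes> k = S \<alpha> y \<otimes> (a \<otimes> ?c) \<otimes> (S \<beta>' z')\<^sup>\<star>"
        unfolding mk using m k True by (simp add: S_S)
      have "?c \<in> core F n" using P_mult_core[OF Suc.prems(1) k(4) zy] .
      then have "a \<otimes> ?c = \<zero> \<or> a \<otimes> ?c \<in> core F n" using Suc m by blast
      then show ?thesis
      proof
        assume "a \<otimes> ?c = \<zero>"
        then show ?thesis unfolding mk' using m k by simp
      next
        assume "a \<otimes> ?c \<in> core F n"
        then show ?thesis unfolding mk' using m k wordsI by simp
      qed
    qed
  qed
qed

lemma core_lspan_mult:
  assumes F: "F \<subseteq> labels B" and "a \<in> lspan (core F n)" "b \<in> lspan (core F n)"
  shows "a \<otimes> b \<in> lspan (core F n)"
  using assms(2,3) core_carrier[OF F, of n] core_mult[OF F, of _ n]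
  by (intro lspan_mult[of a "core F n" b "core F n"]) (metis lspan_base lspan_zero)+

lemma core_lspan_adj:
  assumes F: "F \<subseteq> labels B" and "a \<in> lspan (core F n)"
  shows "a\<^sup>\<star> \<in> lspan (core F n)"
  using assms(2) core_carrier[OF F, of n] core_adj[OF F, of _ n]
  by (intro lspan_adj[of a "core F n"]) (auto intro: lspan_base)

text \<open>The compressing letters cancel the outer letters of each word up to projections, which
  the core of the lower level absorbs.\<close>

lemma compress_words:
  assumes F: "F \<subseteq> labels B" and w: "w \<in> lspan (words F (core F n))"
    and \<alpha>: "\<alpha> \<in> F" "y \<in> \<I> \<alpha>" and \<beta>: "\<beta> \<in> F" "z \<in> \<I> \<beta>"
  shows "(S \<alpha> y)\<^sup>\<star> \<otimes> w \<otimes> S \<beta> z \<in> lspan (core F n)"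
proof -
  have [simp]: "\<alpha> \<in> labels B" "\<beta> \<in> labels B" using F \<alpha> \<beta> by auto
  note wc = words_carrier[OF F core_carrier[OF F]]
  have *: "(S \<alpha> y)\<^sup>\<star> \<otimes> m \<otimes> S \<beta> z \<in> lspan (core F n)" if mw: "m \<in> words F (core F n)" for m
  proof -
    obtain \<alpha>' y' a \<beta>' z' where m: "m = S \<alpha>' y' \<otimes> a \<otimes> (S \<beta>' z')\<^sup>\<star>" "\<alpha>' \<in> F" "y' \<in> \<I> \<alpha>'"
      "a \<in> core F n" "\<beta>' \<in> F" "z' \<in> \<I> \<beta>'" using mw by (auto simp: words_def)
    have [simp]: "\<alpha>' \<in> labels B" "\<beta>' \<in> labels B" "a \<in> carrier A"
      using m F core_carrier by auto
    have e: "(S \<alpha> y)\<^sup>\<star> \<otimes> m \<otimes> S \<beta> z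
        = ((S \<alpha> y)\<^sup>\<star> \<otimes> S \<alpha>' y') \<otimes> a \<otimes> ((S \<beta>' z')\<^sup>\<star> \<otimes> S \<beta> z)"
      using m \<alpha> \<beta> by (simp add: mult_assoc)
    show ?thesis
    proof (cases "\<alpha> = \<alpha>' \<and> \<beta> = \<beta>'")
      case False
      then have "(S \<alpha> y)\<^sup>\<star> \<otimes> m \<otimes> S \<beta> z = \<zero>"
        unfolding e using m \<alpha> \<beta> I_carrier[of \<beta>] I_carrier[of \<alpha>] by (auto simp: S_S)
      then show ?thesis by simp
    next
      case True
      then have c: "y \<^bold>\<inter>\<^bsub>B\<^esub> y' \<in> carrier B" "z' \<^bold>\<inter>\<^bsub>B\<^esub> z \<in> carrier B"
        using m \<alpha> \<beta> I_carrier[of \<alpha>] I_carrier[of \<beta>] by auto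
      have "(S \<alpha> y)\<^sup>\<star> \<otimes> m \<otimes> S \<beta> z = P (y \<^bold>\<inter>\<^bsub>B\<^esub> y') \<otimes> a \<otimes> P (z' \<^bold>\<inter>\<^bsub>B\<^esub> z)"
        unfolding e using True m \<alpha> \<beta> by (simp add: S_S)
      also have "\<dots> \<in> core F n" using m c F by (intro core_mult_P P_mult_core) auto
      finally show ?thesis using core_carrier[OF F] by (intro lspan_base)
    qed
  qed
  have c: "w \<in> carrier A" using lspan_carrier[OF w wc] .
  have "(S \<alpha> y)\<^sup>\<star> \<otimes> w \<otimes> S \<beta> z = (S \<alpha> y)\<^sup>\<star> \<otimes> (w \<otimes> S \<beta> z)" using \<alpha> \<beta> c by (simp add: mult_assoc)
  have l: "(\<lambda>w. (S \<alpha> y)\<^sup>\<star> \<otimes> w \<otimes> S \<beta> z) w \<in> lspan (core F n)"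
  proof (rule lspan_linear[where g="\<lambda>c. c", OF w wc core_carrier[OF F]])
    show "(S \<alpha> y)\<^sup>\<star> \<otimes> (x \<oplus> c \<odot> m) \<otimes> S \<beta> z = (S \<alpha> y)\<^sup>\<star> \<otimes> x \<otimes> S \<beta> z \<oplus> c \<odot> ((S \<alpha> y)\<^sup>\<star> \<otimes> m \<otimes> S \<beta> z)"
      if "x \<in> carrier A" "m \<in> words F (core F n)" for x m c
    proof -
      have "m \<in> carrier A" using that(2) wc by blast
      then show ?thesis
        using that \<alpha> \<beta> by (simp add: mult_r_distr mult_l_distr smult_mult_r smult_mult_l)
    qed
  qed (use \<alpha> \<beta> * core_carrier[OF F] in \<open>auto intro: lspan_smult\<close>)
  then show ?thesis .
qed

text \<open>A local unit for words with letters in F. The indices Y \<alpha> must be chosen large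
  enough for the words at hand, as \<open>\<I> \<alpha>\<close> need not have a largest
  element.\<close>

definition range_sum :: "'l set \<Rightarrow> ('l \<Rightarrow> 'b) \<Rightarrow> 'a" where
  "range_sum F Y = (\<Oplus>\<alpha>\<in>F. S \<alpha> (Y \<alpha>) \<otimes> (S \<alpha> (Y \<alpha>))\<^sup>\<star>)"

context
  fixes F assumes F: "finite F" "F \<subseteq> labels B"
begin

lemma range_sum_closed [simp]: "(\<And>\<alpha>. \<alpha> \<in> F \<Longrightarrow> Y \<alpha> \<in> \<I> \<alpha>) \<Longrightarrow> range_sum F Y \<in> carrier A"
  unfolding range_sum_def using F by (intro finsum_in) auto

lemma range_sum_adj [simp]:
  assumes Y: "\<And>\<alpha>. \<alpha> \<in> F \<Longrightarrow> Y \<alpha> \<in> \<I> \<alpha>" shows "(range_sum F Y)\<^sup>\<star> = range_sum F Y"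
proof -
  have c: "S \<alpha> (Y \<alpha>) \<in> carrier A" if "\<alpha> \<in> F" for \<alpha> using that F Y by auto
  then show ?thesis
    unfolding range_sum_def using F
    by (subst finsum_adj) (auto simp: adj_mult intro!: finsum_eqI)
qed

lemma range_sum_S:
  assumes Y: "\<And>\<alpha>. \<alpha> \<in> F \<Longrightarrow> Y \<alpha> \<in> \<I> \<alpha>" and \<beta>: "\<beta> \<in> F" and y: "y \<in> \<I> \<beta>"
    and le: "y \<^bold>\<inter>\<^bsub>B\<^esub> Y \<beta> = y"
  shows "range_sum F Y \<otimes> S \<beta> y = S \<beta> y"
proof -
  have L [simp]: "\<alpha> \<in> labels B" "S \<alpha> (Y \<alpha>) \<in> carrier A" if "\<alpha> \<in> F" for \<alpha> using that F Y by auto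
  have [simp]: "\<beta> \<in> labels B" using \<beta> F by auto
  have [simp]: "y \<in> carrier B" "Y \<beta> \<in> carrier B" using I_carrier[of \<beta>] y Y[OF \<beta>] by auto
  have "range_sum F Y \<otimes> S \<beta> y = (\<Oplus>\<alpha>\<in>F. S \<alpha> (Y \<alpha>) \<otimes> (S \<alpha> (Y \<alpha>))\<^sup>\<star> \<otimes> S \<beta> y)"
    unfolding range_sum_def using F y by (intro finsum_mult_r) auto
  also have "\<dots> = (\<Oplus>\<alpha>\<in>F. if \<beta> = \<alpha> then S \<beta> y else \<zero>)"
  proof (rule finsum_eqI)
    fix \<alpha> assume \<alpha>: "\<alpha> \<in> F"
    have "S \<alpha> (Y \<alpha>) \<otimes> (S \<alpha> (Y \<alpha>))\<^sup>\<star> \<otimes> S \<beta> y = S \<alpha> (Y \<alpha>) \<otimes> ((S \<alpha> (Y \<alpha>))\<^sup>\<star> \<otimes> S \<beta> y)"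
      using \<alpha> y by (simp add: mult_assoc)
    also have "\<dots> = (if \<beta> = \<alpha> then S \<beta> y else \<zero>)"
      using \<alpha> \<beta> y Y le B.meet_comm[of "Y \<beta>" y] by (auto simp: S_S S_restrict)
    finally show "S \<alpha> (Y \<alpha>) \<otimes> (S \<alpha> (Y \<alpha>))\<^sup>\<star> \<otimes> S \<beta> y = (if \<beta> = \<alpha> then S \<beta> y else \<zero>)" .
  qed (use y in auto)
  also have "\<dots> = S \<beta> y" using F \<beta> y by (intro M.finsum_singleton) auto
  finally show ?thesis .
qed

lemma words_range_sum:
  assumes w: "w \<in> lspan (words F U)" and U: "U \<subseteq> carrier A"
  obtains Y where "\<And>\<alpha>. \<alpha> \<in> F \<Longrightarrow> Y \<alpha> \<in> \<I> \<alpha>" "range_sum F Y \<otimes> w = w" "w \<otimes> range_sum F Y = w"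
proof -
  \<comment> \<open>Each new summand enlarges Y. The claim is therefore made for all Z above Y, so
    that the earlier summands remain fixed by the larger sum.\<close>
  have "\<exists>Y. (\<forall>\<alpha>\<in>F. Y \<alpha> \<in> \<I> \<alpha>) \<and> (\<forall>Z. (\<forall>\<alpha>\<in>F. Z \<alpha> \<in> \<I> \<alpha> \<and> Y \<alpha> \<^bold>\<inter>\<^bsub>B\<^esub> Z \<alpha> = Y \<alpha>)
      \<longrightarrow> range_sum F Z \<otimes> w = w \<and> w \<otimes> range_sum F Z = w)"
    using w
  proof (induction rule: lspan.induct)
    case lspan_zero
    have "\<forall>\<alpha>\<in>F. \<exists>y. y \<in> \<I> \<alpha>" using F I_nonempty by blast
    then obtain Y where "\<forall>\<alpha>\<in>F. Y \<alpha> \<in> \<I> \<alpha>" by metis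
    then show ?case by (intro exI[of _ Y]) auto
  next
    case (lspan_step x m c)
    then obtain Y where Y: "\<And>\<alpha>. \<alpha> \<in> F \<Longrightarrow> Y \<alpha> \<in> \<I> \<alpha>"
      and Yx: "\<And>Z. (\<And>\<alpha>. \<alpha> \<in> F \<Longrightarrow> Z \<alpha> \<in> \<I> \<alpha> \<and> Y \<alpha> \<^bold>\<inter>\<^bsub>B\<^esub> Z \<alpha> = Y \<alpha>)
        \<Longrightarrow> range_sum F Z \<otimes> x = x \<and> x \<otimes> range_sum F Z = x" by blast
    obtain \<alpha> y a \<beta> z where m: "m = S \<alpha> y \<otimes> a \<otimes> (S \<beta> z)\<^sup>\<star>" "\<alpha> \<in> F" "y \<in> \<I> \<alpha>"
      "a \<in> U" "\<beta> \<in> F" "z \<in> \<I> \<beta>" using lspan_step by (auto simp: words_def)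
    have [simp]: "\<alpha> \<in> labels B" "\<beta> \<in> labels B" "a \<in> carrier A" using m F U by auto
    have xc [simp]: "x \<in> carrier A" using lspan_carrier[OF lspan_step.hyps(1)] words_carrier F U by auto
    have mc [simp]: "m \<in> carrier A" using m by simp
    define Y' where "Y' = Y(\<alpha> := Y \<alpha> \<^bold>\<union>\<^bsub>B\<^esub> y)"
    define Y'' where "Y'' = Y'(\<beta> := Y' \<beta> \<^bold>\<union>\<^bsub>B\<^esub> z)"
    have Y': "Y' \<delta> \<in> \<I> \<delta>" if "\<delta> \<in> F" for \<delta> using that Y m I_join by (auto simp: Y'_def)
    have Y'': "Y'' \<delta> \<in> \<I> \<delta>" if "\<delta> \<in> F" for \<delta> using that Y' m I_join by (auto simp: Y''_def)
    have "range_sum F Z \<otimes> (x \<oplus> c \<odot> m) = x \<oplus> c \<odot> m \<and> (x \<oplus> c \<odot> m) \<otimes> range_sum F Z = x \<oplus> c \<odot> m"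
      if Z: "\<forall>\<alpha>\<in>F. Z \<alpha> \<in> \<I> \<alpha> \<and> Y'' \<alpha> \<^bold>\<inter>\<^bsub>B\<^esub> Z \<alpha> = Y'' \<alpha>" for Z
    proof -
      have ZI: "\<And>\<alpha>. \<alpha> \<in> F \<Longrightarrow> Z \<alpha> \<in> \<I> \<alpha>" using Z by blast
      note [simp] = range_sum_closed[of Z, OF ZI] range_sum_adj[of Z, OF ZI]
      have car: "Y \<delta> \<in> carrier B" "Y' \<delta> \<in> carrier B" "Y'' \<delta> \<in> carrier B" "Z \<delta> \<in> carrier B"
        if "\<delta> \<in> F" for \<delta>
        using that F I_carrier[of \<delta>] Y Y' Y'' ZI by auto
      have yz: "y \<in> carrier B" "z \<in> carrier B" using m I_carrier[of \<alpha>] I_carrier[of \<beta>] by auto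
      have le': "Y' \<delta> \<^bold>\<inter>\<^bsub>B\<^esub> Z \<delta> = Y' \<delta>" if "\<delta> \<in> F" for \<delta>
        using that Z B.le_of_join_le[of "Y' \<delta>" z "Z \<delta>"] car yz by (cases "\<delta> = \<beta>") (auto simp: Y''_def)
      have lez: "z \<^bold>\<inter>\<^bsub>B\<^esub> Z \<beta> = z"
        using m Z B.le_of_join_le[of "Y' \<beta>" z "Z \<beta>"] car yz by (auto simp: Y''_def)
      have le: "Y \<delta> \<^bold>\<inter>\<^bsub>B\<^esub> Z \<delta> = Y \<delta>" if "\<delta> \<in> F" for \<delta>
        using that le'[of \<delta>] B.le_of_join_le[of "Y \<delta>" y "Z \<delta>"] car yz by (cases "\<delta> = \<alpha>") (auto simp: Y'_def)
      have ley: "y \<^bold>\<inter>\<^bsub>B\<^esub> Z \<alpha> = y"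
        using m le'[of \<alpha>] B.le_of_join_le[of "Y \<alpha>" y "Z \<alpha>"] car yz by (auto simp: Y'_def)
      have x: "range_sum F Z \<otimes> x = x" "x \<otimes> range_sum F Z = x" using Yx[of Z] ZI le by auto
      have s: "range_sum F Z \<otimes> S \<alpha> y = S \<alpha> y" "range_sum F Z \<otimes> S \<beta> z = S \<beta> z"
        using range_sum_S[of Z, OF ZI] m ley lez by auto
      have "range_sum F Z \<otimes> m = (range_sum F Z \<otimes> S \<alpha> y) \<otimes> a \<otimes> (S \<beta> z)\<^sup>\<star>"
        using m by (simp add: mult_assoc)
      then have m1: "range_sum F Z \<otimes> m = m" using s m by simp
      have "m \<otimes> range_sum F Z = S \<alpha> y \<otimes> a \<otimes> (range_sum F Z \<otimes> S \<beta> z)\<^sup>\<star>"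
        using m by (simp add: mult_assoc adj_mult)
      then have m2: "m \<otimes> range_sum F Z = m" using s m by simp
      show ?thesis using x m1 m2 by (simp add: mult_r_distr mult_l_distr smult_mult_l smult_mult_r)
    qed
    then show ?case using Y'' by (intro exI[of _ Y'']) blast
  qed
  then obtain Y where Y: "\<And>\<alpha>. \<alpha> \<in> F \<Longrightarrow> Y \<alpha> \<in> \<I> \<alpha>"
    and Yw: "(\<forall>\<alpha>\<in>F. Y \<alpha> \<in> \<I> \<alpha> \<and> Y \<alpha> \<^bold>\<inter>\<^bsub>B\<^esub> Y \<alpha> = Y \<alpha>)
      \<longrightarrow> range_sum F Y \<otimes> w = w \<and> w \<otimes> range_sum F Y = w" by blast
  have "Y \<alpha> \<^bold>\<inter>\<^bsub>B\<^esub> Y \<alpha> = Y \<alpha>" if "\<alpha> \<in> F" for \<alpha>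
    using B.meet_idem[of "Y \<alpha>"] I_carrier[of \<alpha> "Y \<alpha>"] Y that F by auto
  then show thesis using that[of Y] Y Yw by blast
qed

text \<open>Inserting the local unit on both sides splits w into one piece per pair of labels in F.
  Each piece is a compression of w multiplied by contractions.\<close>

lemma nrm_words_le:
  assumes w: "w \<in> lspan (words F U)" and U: "U \<subseteq> carrier A"
    and bound: "\<And>\<alpha> y \<beta> z. \<lbrakk>\<alpha> \<in> F; y \<in> \<I> \<alpha>; \<beta> \<in> F; z \<in> \<I> \<beta>\<rbrakk>
      \<Longrightarrow> nrm A ((S \<alpha> y)\<^sup>\<star> \<otimes> w \<otimes> S \<beta> z) \<le> M"
  shows "nrm A w \<le> real (card F) * (real (card F) * M)"
proof -
  obtain Y where Y: "\<And>\<alpha>. \<alpha> \<in> F \<Longrightarrow> Y \<alpha> \<in> \<I> \<alpha>"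
    and wY: "range_sum F Y \<otimes> w = w" "w \<otimes> range_sum F Y = w" using words_range_sum[OF w U] by blast
  have [simp]: "w \<in> carrier A" using lspan_carrier[OF w] words_carrier F U by auto
  have Sc [simp]: "S \<alpha> (Y \<alpha>) \<in> carrier A" if "\<alpha> \<in> F" for \<alpha> using that F Y by auto
  have S1: "nrm A (S \<alpha> (Y \<alpha>)) \<le> 1" if "\<alpha> \<in> F" for \<alpha> using that F Y nrm_S by auto
  have col: "nrm A ((S \<alpha> (Y \<alpha>))\<^sup>\<star> \<otimes> w) \<le> real (card F) * M" if \<alpha>: "\<alpha> \<in> F" for \<alpha>
  proof -
    let ?v = "(S \<alpha> (Y \<alpha>))\<^sup>\<star> \<otimes> w"
    have [simp]: "?v \<in> carrier A" using \<alpha> by simp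
    have "?v = ?v \<otimes> range_sum F Y" using \<alpha> wY Y by (simp add: mult_assoc)
    also have "\<dots> = (\<Oplus>\<beta>\<in>F. ?v \<otimes> (S \<beta> (Y \<beta>) \<otimes> (S \<beta> (Y \<beta>))\<^sup>\<star>))"
      unfolding range_sum_def using F \<alpha> by (intro finsum_mult_l) auto
    finally have "nrm A ?v \<le> (\<Sum>\<beta>\<in>F. nrm A (?v \<otimes> (S \<beta> (Y \<beta>) \<otimes> (S \<beta> (Y \<beta>))\<^sup>\<star>)))"
      using nrm_finsum[OF F(1), of "\<lambda>\<beta>. ?v \<otimes> (S \<beta> (Y \<beta>) \<otimes> (S \<beta> (Y \<beta>))\<^sup>\<star>)"] \<alpha> by simp
    also have "\<dots> \<le> (\<Sum>\<beta>\<in>F. M)"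
    proof (rule sum_mono)
      fix \<beta> assume \<beta>: "\<beta> \<in> F"
      have "nrm A (?v \<otimes> (S \<beta> (Y \<beta>) \<otimes> (S \<beta> (Y \<beta>))\<^sup>\<star>)) = nrm A ((?v \<otimes> S \<beta> (Y \<beta>)) \<otimes> (S \<beta> (Y \<beta>))\<^sup>\<star>)"
        using \<alpha> \<beta> by (simp add: mult_assoc)
      also have "\<dots> \<le> nrm A (?v \<otimes> S \<beta> (Y \<beta>)) * nrm A ((S \<beta> (Y \<beta>))\<^sup>\<star>)"
        using \<alpha> \<beta> by (intro nrm_mult) auto
      also have "\<dots> \<le> nrm A (?v \<otimes> S \<beta> (Y \<beta>)) * 1"
        using \<alpha> \<beta> S1 by (intro mult_left_mono) (auto simp: nrm_adj)
      also have "\<dots> \<le> M" using bound[OF \<alpha> Y[OF \<alpha>] \<beta> Y[OF \<beta>]] by simp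
      finally show "nrm A (?v \<otimes> (S \<beta> (Y \<beta>) \<otimes> (S \<beta> (Y \<beta>))\<^sup>\<star>)) \<le> M" .
    qed
    finally show ?thesis by simp
  qed
  have "w = (\<Oplus>\<alpha>\<in>F. (S \<alpha> (Y \<alpha>) \<otimes> (S \<alpha> (Y \<alpha>))\<^sup>\<star>) \<otimes> w)"
    using wY(1) unfolding range_sum_def using F by (subst (asm) finsum_mult_r) auto
  then have "nrm A w \<le> (\<Sum>\<alpha>\<in>F. nrm A ((S \<alpha> (Y \<alpha>) \<otimes> (S \<alpha> (Y \<alpha>))\<^sup>\<star>) \<otimes> w))"
    using nrm_finsum[OF F(1), of "\<lambda>\<alpha>. (S \<alpha> (Y \<alpha>) \<otimes> (S \<alpha> (Y \<alpha>))\<^sup>\<star>) \<otimes> w"] by simp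
  also have "\<dots> \<le> (\<Sum>\<alpha>\<in>F. real (card F) * M)"
  proof (rule sum_mono)
    fix \<alpha> assume \<alpha>: "\<alpha> \<in> F"
    have "nrm A ((S \<alpha> (Y \<alpha>) \<otimes> (S \<alpha> (Y \<alpha>))\<^sup>\<star>) \<otimes> w) \<le> nrm A (S \<alpha> (Y \<alpha>)) * nrm A ((S \<alpha> (Y \<alpha>))\<^sup>\<star> \<otimes> w)"
      using \<alpha> nrm_mult[of "S \<alpha> (Y \<alpha>)" "(S \<alpha> (Y \<alpha>))\<^sup>\<star> \<otimes> w"] by (simp add: mult_assoc)
    also have "\<dots> \<le> 1 * nrm A ((S \<alpha> (Y \<alpha>))\<^sup>\<star> \<otimes> w)"
      using \<alpha> S1 by (intro mult_right_mono) auto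
    finally show "nrm A ((S \<alpha> (Y \<alpha>) \<otimes> (S \<alpha> (Y \<alpha>))\<^sup>\<star>) \<otimes> w) \<le> real (card F) * M"
      using col[OF \<alpha>] by simp
  qed
  finally show ?thesis by simp
qed

text \<open>A projection P y is its gap relative to F plus range projections with labels in F, and
  the latter are words with one letter on each side.\<close>

lemma core_Suc_decomp:
  "a \<in> lspan (core F (Suc n)) \<Longrightarrow>
    \<exists>b\<in>lspan (gap F ` carrier B). \<exists>w\<in>lspan (words F (core F n)). a = b \<oplus> w"
proof (induction rule: lspan.induct)
  case lspan_zero
  show ?case by (rule bexI[of _ \<zero>], rule bexI[of _ \<zero>]) auto
next
  case (lspan_step x m c)
  have gc: "gap F ` carrier B \<subseteq> carrier A" using gap_closed[OF F] by blast
  note wc = words_carrier[OF F(2) core_carrier[OF F(2), of n]]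
  obtain b w where b: "b \<in> lspan (gap F ` carrier B)" and w: "w \<in> lspan (words F (core F n))"
    and x: "x = b \<oplus> w" using lspan_step by blast
  have [simp]: "b \<in> carrier A" "w \<in> carrier A" using lspan_carrier[OF b gc] lspan_carrier[OF w wc] by auto
  show ?case
  proof (cases "m \<in> words F (core F n)")
    case True
    then have "m \<in> carrier A" using wc by blast
    then have "x \<oplus> c \<odot> m = b \<oplus> (w \<oplus> c \<odot> m)" by (simp add: x M.a_assoc)
    then show ?thesis using b lspan.lspan_step[OF w True] by blast
  next
    case False
    then obtain y where m: "m = P y" and [simp]: "y \<in> carrier B" using lspan_step.hyps(2) by auto
    define r where "r = (\<Oplus>\<alpha>\<in>F. rproj \<alpha> y)"
    have rp: "rproj \<alpha> y \<in> words F (core F n)" if \<alpha>: "\<alpha> \<in> F" for \<alpha>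
    proof -
      have [simp]: "\<alpha> \<in> labels B" using \<alpha> F by blast
      have "rproj \<alpha> y = S \<alpha> (act B \<alpha> y) \<otimes> P (act B \<alpha> y) \<otimes> (S \<alpha> (act B \<alpha> y))\<^sup>\<star>"
        by (simp add: rproj_def S_restrict)
      also have "\<dots> \<in> words F (core F n)" using \<alpha> by (intro wordsI P_core) auto
      finally show ?thesis .
    qed
    then have r: "r \<in> lspan (words F (core F n))"
      unfolding r_def using F wc by (intro lspan_finsum) (auto intro: lspan_base)
    have [simp]: "r \<in> carrier A" "gap F y \<in> carrier A" using lspan_carrier[OF r wc] gap_closed[OF F] by auto
    have "gap F y = m \<ominus> r" by (simp add: gap_def r_def m)
    then have g: "b \<oplus> c \<odot> gap F y = b \<oplus> c \<odot> (m \<ominus> r)" by simp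
    have "x \<oplus> c \<odot> m = (b \<oplus> c \<odot> (m \<ominus> r)) \<oplus> (w \<oplus> c \<odot> r)" unfolding x m
      by (rule lin_eqI, (rule lin_rules | (rule lin_atom, simp; fail))+) (simp add: algebra_simps)
    then have "x \<oplus> c \<odot> m = (b \<oplus> c \<odot> gap F y) \<oplus> (w \<oplus> c \<odot> r)" by (simp only: g)
    moreover have "b \<oplus> c \<odot> gap F y \<in> lspan (gap F ` carrier B)" using b by (auto intro: lspan.lspan_step)
    moreover have "w \<oplus> c \<odot> r \<in> lspan (words F (core F n))"
      using w r wc by (intro lspan_add lspan_smult)
    ultimately show ?thesis by blast
  qed
qed

end

end

section \<open>Words graded by their length difference\<close>

context bds_representation
begin

text \<open>The indices count the letters on the left and on the right. Letters may be attached to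
  either end in any order, and no set of labels is fixed in advance; the gauge degree is i -
  j.\<close>

inductive mono :: "nat \<Rightarrow> nat \<Rightarrow> 'a \<Rightarrow> bool" where
  mono_P: "x \<in> carrier B \<Longrightarrow> mono 0 0 (P x)"
| mono_l: "\<lbrakk>mono i j m; \<alpha> \<in> labels B; y \<in> \<I> \<alpha>\<rbrakk> \<Longrightarrow> mono (Suc i) j (S \<alpha> y \<otimes> m)"
| mono_r: "\<lbrakk>mono i j m; \<alpha> \<in> labels B; y \<in> \<I> \<alpha>\<rbrakk> \<Longrightarrow> mono i (Suc j) (m \<otimes> (S \<alpha> y)\<^sup>\<star>)"

lemma mono_carrier [simp]: "mono i j m \<Longrightarrow> m \<in> carrier A"
  by (induction rule: mono.induct) auto

text \<open>Letters attached on the right do not interfere with those on the left, by associativity,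
  so the leftmost letter can be removed even if it was not attached last.\<close>

lemma mono_left:
  "mono (Suc i) j m \<Longrightarrow> \<exists>\<alpha> y k. \<alpha> \<in> labels B \<and> y \<in> \<I> \<alpha> \<and> mono i j k \<and> m = S \<alpha> y \<otimes> k"
proof (induction "Suc i" j m rule: mono.induct)
  case (mono_r j m \<alpha> y)
  then obtain \<beta> z k where k: "\<beta> \<in> labels B" "z \<in> \<I> \<beta>" "mono i j k" "m = S \<beta> z \<otimes> k" by blast
  have "m \<otimes> (S \<alpha> y)\<^sup>\<star> = S \<beta> z \<otimes> (k \<otimes> (S \<alpha> y)\<^sup>\<star>)" using k mono_r by (simp add: mult_assoc)
  then show ?case using k mono.mono_r[OF k(3) mono_r(3,4)] by blast
qed blast

lemma mono_right:
  "mono i (Suc j) m \<Longrightarrow> \<exists>\<alpha> y k. \<alpha> \<in> labels B \<and> y \<in> \<I> \<alpha> \<and> mono i j k \<and> m = k \<otimes> (S \<alpha> y)\<^sup>\<star>"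
proof (induction i "Suc j" m rule: mono.induct)
  case (mono_l i m \<alpha> y)
  then obtain \<beta> z k where k: "\<beta> \<in> labels B" "z \<in> \<I> \<beta>" "mono i j k" "m = k \<otimes> (S \<beta> z)\<^sup>\<star>" by blast
  have "S \<alpha> y \<otimes> m = (S \<alpha> y \<otimes> k) \<otimes> (S \<beta> z)\<^sup>\<star>" using k mono_l by (simp add: mult_assoc)
  then show ?case using k mono.mono_l[OF k(3) mono_l(3,4)] by blast
qed blast

text \<open>One letter is peeled off each end, and F collects the finitely many labels met.\<close>

lemma mono_core: "mono n n m \<Longrightarrow> \<exists>F. finite F \<and> F \<subseteq> labels B \<and> m \<in> core F n"
proof (induction n arbitrary: m)
  case 0
  from 0 have "\<exists>x\<in>carrier B. m = P x" by cases auto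
  then show ?case by (intro exI[of _ "{}"]) auto
next
  case (Suc n)
  obtain \<alpha> y k where k: "\<alpha> \<in> labels B" "y \<in> \<I> \<alpha>" "mono n (Suc n) k" "m = S \<alpha> y \<otimes> k"
    using mono_left[OF Suc.prems] by blast
  obtain \<beta> z l where l: "\<beta> \<in> labels B" "z \<in> \<I> \<beta>" "mono n n l" "k = l \<otimes> (S \<beta> z)\<^sup>\<star>"
    using mono_right[OF k(3)] by blast
  obtain F where F: "finite F" "F \<subseteq> labels B" "l \<in> core F n" using Suc.IH[OF l(3)] by blast
  let ?F = "insert \<alpha> (insert \<beta> F)"
  have "l \<in> core ?F n" using F(3) core_mono[of F ?F n n] by blast
  then have "S \<alpha> y \<otimes> l \<otimes> (S \<beta> z)\<^sup>\<star> \<in> words ?F (core ?F n)" using k l by (intro wordsI) auto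
  moreover have "m = S \<alpha> y \<otimes> l \<otimes> (S \<beta> z)\<^sup>\<star>" using k l by (simp add: mult_assoc)
  ultimately show ?case using F k l by (intro exI[of _ ?F]) auto
qed

lemma P_mult_mono: "\<lbrakk>mono i j m; x \<in> carrier B\<rbrakk> \<Longrightarrow> mono i j (P x \<otimes> m)"
proof (induction arbitrary: x rule: mono.induct)
  case (mono_P y)
  then show ?case by (auto simp flip: P_meet intro: mono.mono_P)
next
  case (mono_l i j m \<alpha> y)
  have "P x \<otimes> (S \<alpha> y \<otimes> m) = (P x \<otimes> S \<alpha> y) \<otimes> m" using mono_l by (simp add: mult_assoc)
  also have "\<dots> = S \<alpha> y \<otimes> (P (act B \<alpha> x) \<otimes> m)" using mono_l by (simp add: mult_assoc P_S)
  finally show ?case using mono_l mono.mono_l[OF mono_l.IH[of "act B \<alpha> x"]] by simp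
next
  case (mono_r i j m \<alpha> y)
  have "P x \<otimes> (m \<otimes> (S \<alpha> y)\<^sup>\<star>) = (P x \<otimes> m) \<otimes> (S \<alpha> y)\<^sup>\<star>" using mono_r by (simp add: mult_assoc)
  then show ?case using mono_r mono.mono_r[OF mono_r.IH[of x]] by simp
qed

lemma mono_adj: "mono i j m \<Longrightarrow> mono j i (m\<^sup>\<star>)"
proof (induction rule: mono.induct)
  case (mono_l i j m \<alpha> y)
  then have "(S \<alpha> y \<otimes> m)\<^sup>\<star> = m\<^sup>\<star> \<otimes> (S \<alpha> y)\<^sup>\<star>" by (simp add: adj_mult)
  then show ?case using mono_l mono.mono_r by simp
next
  case (mono_r i j m \<alpha> y)
  then have "(m \<otimes> (S \<alpha> y)\<^sup>\<star>)\<^sup>\<star> = S \<alpha> y \<otimes> m\<^sup>\<star>" by (simp add: adj_mult)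
  then show ?case using mono_r mono.mono_l by simp
qed (auto intro: mono.intros)

text \<open>The adjoint letter cancels a left letter if there is one, and otherwise passes through
  the projection and becomes a right letter. The lengths differ in the two cases, but the degree
  drops by 1 in both.\<close>

lemma S_star_mult_mono:
  "\<lbrakk>mono i j m; \<alpha> \<in> labels B; y \<in> \<I> \<alpha>\<rbrakk> \<Longrightarrow> (S \<alpha> y)\<^sup>\<star> \<otimes> m = \<zero>
    \<or> (\<exists>i' j'. int i' - int j' = int i - int j - 1 \<and> mono i' j' ((S \<alpha> y)\<^sup>\<star> \<otimes> m))"
proof (induction rule: mono.induct)
  case (mono_P x)
  have "mono 0 (Suc 0) (P (act B \<alpha> x) \<otimes> (S \<alpha> y)\<^sup>\<star>)" using mono_P by (intro mono.intros) auto
  then show ?case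
    using mono_P by (intro disjI2 exI[of _ 0] exI[of _ "Suc 0"]) (simp add: S_star_P)
next
  case (mono_l i j m \<beta> z)
  have e: "(S \<alpha> y)\<^sup>\<star> \<otimes> (S \<beta> z \<otimes> m) = ((S \<alpha> y)\<^sup>\<star> \<otimes> S \<beta> z) \<otimes> m"
    using mono_l by (simp add: mult_assoc)
  show ?case
  proof (cases "\<alpha> = \<beta>")
    case True
    then have "(S \<alpha> y)\<^sup>\<star> \<otimes> (S \<beta> z \<otimes> m) = P (y \<^bold>\<inter>\<^bsub>B\<^esub> z) \<otimes> m"
      unfolding e using mono_l by (simp add: S_S)
    moreover have "mono i j (P (y \<^bold>\<inter>\<^bsub>B\<^esub> z) \<otimes> m)"
      using mono_l True I_carrier[of \<alpha>] by (intro P_mult_mono) auto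
    ultimately show ?thesis by (intro disjI2 exI[of _ i] exI[of _ j]) simp
  next
    case False
    then show ?thesis unfolding e using mono_l by (simp add: S_S)
  qed
next
  case (mono_r i j m \<beta> z)
  have e: "(S \<alpha> y)\<^sup>\<star> \<otimes> (m \<otimes> (S \<beta> z)\<^sup>\<star>) = ((S \<alpha> y)\<^sup>\<star> \<otimes> m) \<otimes> (S \<beta> z)\<^sup>\<star>"
    using mono_r by (simp add: mult_assoc)
  from mono_r.IH[OF mono_r.prems] show ?case
  proof
    assume "(S \<alpha> y)\<^sup>\<star> \<otimes> m = \<zero>" then show ?thesis unfolding e using mono_r by simp
  next
    assume "\<exists>i' j'. int i' - int j' = int i - int j - 1 \<and> mono i' j' ((S \<alpha> y)\<^sup>\<star> \<otimes> m)"
    then obtain i' j' where ij: "int i' - int j' = int i - int j - 1" "mono i' j' ((S \<alpha> y)\<^sup>\<star> \<otimes> m)"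
      by blast
    then show ?thesis unfolding e using mono.mono_r[OF ij(2) mono_r(2,3)]
      by (intro disjI2 exI[of _ i'] exI[of _ "Suc j'"]) simp
  qed
qed

lemma mono_mult:
  "\<lbrakk>mono i j m; mono i' j' k\<rbrakk> \<Longrightarrow> m \<otimes> k = \<zero>
    \<or> (\<exists>p q. int p - int q = (int i - int j) + (int i' - int j') \<and> mono p q (m \<otimes> k))"
proof (induction arbitrary: i' j' k rule: mono.induct)
  case (mono_P x)
  then show ?case using P_mult_mono[OF mono_P(2,1)] by (intro disjI2 exI[of _ i'] exI[of _ j']) simp
next
  case (mono_l i j m \<alpha> y)
  have e: "(S \<alpha> y \<otimes> m) \<otimes> k = S \<alpha> y \<otimes> (m \<otimes> k)" using mono_l by (simp add: mult_assoc)
  from mono_l.IH[OF mono_l.prems] show ?case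
  proof
    assume "m \<otimes> k = \<zero>" then show ?thesis unfolding e using mono_l by simp
  next
    assume "\<exists>p q. int p - int q = (int i - int j) + (int i' - int j') \<and> mono p q (m \<otimes> k)"
    then obtain p q where pq: "int p - int q = (int i - int j) + (int i' - int j')" "mono p q (m \<otimes> k)"
      by blast
    then show ?thesis unfolding e using mono.mono_l[OF pq(2) mono_l(2,3)]
      by (intro disjI2 exI[of _ "Suc p"] exI[of _ q]) simp
  qed
next
  case (mono_r i j m \<alpha> y)
  have e: "(m \<otimes> (S \<alpha> y)\<^sup>\<star>) \<otimes> k = m \<otimes> ((S \<alpha> y)\<^sup>\<star> \<otimes> k)" using mono_r by (simp add: mult_assoc)
  from S_star_mult_mono[OF mono_r.prems mono_r(2,3)] show ?case
  proof
    assume "(S \<alpha> y)\<^sup>\<star> \<otimes> k = \<zero>" then show ?thesis unfolding e using mono_r by simp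
  next
    assume "\<exists>p q. int p - int q = int i' - int j' - 1 \<and> mono p q ((S \<alpha> y)\<^sup>\<star> \<otimes> k)"
    then obtain p q where pq: "int p - int q = int i' - int j' - 1" "mono p q ((S \<alpha> y)\<^sup>\<star> \<otimes> k)"
      by blast
    have s: "int i - int j + (int p - int q) = int i - int (Suc j) + (int i' - int j')" using pq by simp
    show ?thesis unfolding e using mono_r.IH[OF pq(2)] unfolding s .
  qed
qed

definition homog :: "int \<Rightarrow> 'a set" where
  "homog k = {m. \<exists>i j. k = int i - int j \<and> mono i j m}"

text \<open>Only the degree is bounded, not the length of the words: degrees add under
  multiplication, and their number decides the constant in \<open>polys_bound\<close>.\<close>

definition polys :: "nat \<Rightarrow> 'a set" where
  "polys d = lspan (\<Union>k\<in>{- int d..int d}. homog k)"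

lemma homog_carrier: "homog k \<subseteq> carrier A"
  by (auto simp: homog_def)

lemma homog_UN_carrier: "(\<Union>k\<in>T. homog k) \<subseteq> carrier A"
  using homog_carrier by blast

lemma homog_mult:
  assumes "m \<in> homog k" "n \<in> homog l" shows "m \<otimes> n = \<zero> \<or> m \<otimes> n \<in> homog (k + l)"
proof -
  obtain i j i' j' where "k = int i - int j" "mono i j m" "l = int i' - int j'" "mono i' j' n"
    using assms by (auto simp: homog_def)
  with mono_mult[of i j m i' j' n] show ?thesis unfolding homog_def by force
qed

lemma homog_adj: "m \<in> homog k \<Longrightarrow> m\<^sup>\<star> \<in> homog (- k)"
  using mono_adj unfolding homog_def by force

lemma polys_carrier: "polys d \<subseteq> carrier A"
  unfolding polys_def using lspan_carrier homog_UN_carrier by blast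

lemma polys_mono: "d \<le> e \<Longrightarrow> polys d \<subseteq> polys e"
  unfolding polys_def by (intro lspan_mono UN_mono) auto

lemma polys_smult: "a \<in> polys d \<Longrightarrow> c \<odot> a \<in> polys d"
  unfolding polys_def by (rule lspan_smult[OF _ homog_UN_carrier])

lemma polys_add: "\<lbrakk>a \<in> polys d; b \<in> polys d\<rbrakk> \<Longrightarrow> a \<oplus> b \<in> polys d"
  unfolding polys_def by (rule lspan_add[OF _ _ homog_UN_carrier])

lemma polys_mult:
  assumes "a \<in> polys d" "b \<in> polys e" shows "a \<otimes> b \<in> polys (d + e)"
  unfolding polys_def
proof (rule lspan_mult[OF assms[unfolded polys_def] homog_UN_carrier homog_UN_carrier homog_UN_carrier])
  fix m n assume "m \<in> (\<Union>k\<in>{- int d..int d}. homog k)" "n \<in> (\<Union>k\<in>{- int e..int e}. homog k)"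
  then obtain k l where kl: "m \<in> homog k" "n \<in> homog l" "k \<in> {- int d..int d}" "l \<in> {- int e..int e}"
    by blast
  then have kl': "k + l \<in> {- int (d + e)..int (d + e)}" by auto
  from homog_mult[OF kl(1,2)] show "m \<otimes> n \<in> lspan (\<Union>k\<in>{- int (d + e)..int (d + e)}. homog k)"
  proof
    assume "m \<otimes> n = \<zero>" then show ?thesis by simp
  next
    assume "m \<otimes> n \<in> homog (k + l)"
    then show ?thesis using kl' homog_UN_carrier by (intro lspan_base) auto
  qed
qed

lemma polys_adj: assumes "a \<in> polys d" shows "a\<^sup>\<star> \<in> polys d"
  unfolding polys_def
proof (rule lspan_adj[OF assms[unfolded polys_def] homog_UN_carrier homog_UN_carrier])
  fix m assume "m \<in> (\<Union>k\<in>{- int d..int d}. homog k)"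
  then obtain k where k: "m \<in> homog k" "- k \<in> {- int d..int d}" by auto
  show "m\<^sup>\<star> \<in> lspan (\<Union>k\<in>{- int d..int d}. homog k)"
    using homog_adj[OF k(1)] k(2) homog_UN_carrier by (intro lspan_base) auto
qed

text \<open>The degree bound grows in proportion to the exponent 2^k, which is the growth that
  \<open>bounded_power_ratio\<close> tolerates.\<close>

lemma polys_iter_square: "a \<in> polys d \<Longrightarrow> iter_square a k \<in> polys (d * 2^k)"
proof (induction k)
  case (Suc k)
  then show ?case using polys_mult[of "iter_square a k" "d * 2^k" "iter_square a k" "d * 2^k"]
    by (simp add: mult.assoc flip: mult_2_right mult_2) (simp add: mult.left_commute mult.commute)
qed simp

lemma polys_decomp:
  assumes "a \<in> polys d"
  obtains x where "\<And>k. x k \<in> lspan (homog k)" "a = finsum A x {- int d..int d}"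
proof -
  have "\<exists>x. (\<forall>k. x k \<in> lspan (homog k)) \<and> a = finsum A x {- int d..int d}"
    using assms unfolding polys_def
  proof (induction rule: lspan.induct)
    case lspan_zero
    show ?case by (intro exI[of _ "\<lambda>k. \<zero>"]) auto
  next
    case (lspan_step a m c)
    then obtain x where x: "\<And>k. x k \<in> lspan (homog k)" "a = finsum A x {- int d..int d}" by blast
    have xc [simp]: "x k \<in> carrier A" for k using lspan_carrier[OF x(1) homog_carrier] .
    obtain l where l: "l \<in> {- int d..int d}" "m \<in> homog l" using lspan_step by blast
    have mc [simp]: "m \<in> carrier A" using l homog_carrier by blast
    define T where "T = {- int d..int d} - {l}"
    have T: "{- int d..int d} = insert l T" "finite T" "l \<notin> T" using l by (auto simp: T_def)
    define x' where "x' = x(l := x l \<oplus> c \<odot> m)"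
    have "finsum A x' (insert l T) = x' l \<oplus> finsum A x' T"
      using T by (intro M.finsum_insert) (auto simp: x'_def)
    also have "finsum A x' T = finsum A x T" using T by (intro finsum_eqI) (auto simp: x'_def)
    also have "x' l \<oplus> finsum A x T = (x l \<oplus> finsum A x T) \<oplus> c \<odot> m"
      by (simp add: x'_def M.a_ac)
    also have "x l \<oplus> finsum A x T = finsum A x (insert l T)"
      using T by (intro M.finsum_insert[symmetric]) auto
    finally have "a \<oplus> c \<odot> m = finsum A x' {- int d..int d}" using x T by simp
    moreover have "x' k \<in> lspan (homog k)" for k
      using x(1) l(2) by (auto simp: x'_def intro: lspan.lspan_step)
    ultimately show ?case by blast
  qed
  then show thesis using that by blast
qed

text \<open>A single combination involves finitely many labels and bounded lengths, and
  \<open>core_mono\<close> places all its words in one level.\<close>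

lemma homog_zero_core:
  assumes "a \<in> lspan (homog 0)"
  obtains F n where "finite F" "F \<subseteq> labels B" "a \<in> lspan (core F n)"
proof -
  have "\<exists>F n. finite F \<and> F \<subseteq> labels B \<and> a \<in> lspan (core F n)"
    using assms
  proof (induction rule: lspan.induct)
    case lspan_zero
    show ?case by (intro exI[of _ "{}"] exI[of _ 0]) auto
  next
    case (lspan_step a m c)
    then obtain F n where F: "finite F" "F \<subseteq> labels B" "a \<in> lspan (core F n)" by blast
    obtain k where "mono k k m" using lspan_step.hyps(2) by (auto simp: homog_def)
    then obtain G where G: "finite G" "G \<subseteq> labels B" "m \<in> core G k" using mono_core by blast
    have "core F n \<subseteq> core (F \<union> G) (max n k)" "core G k \<subseteq> core (F \<union> G) (max n k)"
      by (rule core_mono; simp)+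
    then have "a \<in> lspan (core (F \<union> G) (max n k))" "m \<in> core (F \<union> G) (max n k)"
      using F G lspan_mono by blast+
    then have "a \<oplus> c \<odot> m \<in> lspan (core (F \<union> G) (max n k))" by (rule lspan.lspan_step)
    then show ?case using F G by (intro exI[of _ "F \<union> G"] exI[of _ "max n k"]) simp
  qed
  then show thesis using that by blast
qed

lemma polys_dense:
  assumes gen: "cstar_gen A (rep_gens B \<I> P S) = carrier A" and x: "x \<in> carrier A" and "\<epsilon> > 0"
  obtains d e where "e \<in> polys d" "nrm A (x \<ominus> e) < \<epsilon>"
proof -
  let ?E = "\<Union>d. polys d"
  let ?D = "{x \<in> carrier A. \<forall>\<epsilon>>0. \<exists>e\<in>?E. nrm A (x \<ominus> e) < \<epsilon>}"
  have E: "?E \<subseteq> carrier A" using polys_carrier by blast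
  have 0: "\<zero> \<in> ?E" by (auto simp: polys_def)
  have 1: "a \<oplus> b \<in> ?E" if ab: "a \<in> ?E" "b \<in> ?E" for a b
    proof -
      obtain d e where "a \<in> polys d" "b \<in> polys e" using ab by blast
      then have "a \<in> polys (max d e)" "b \<in> polys (max d e)"
        using polys_mono[of d "max d e"] polys_mono[of e "max d e"] by auto
      then have "a \<oplus> b \<in> polys (max d e)" by (rule polys_add)
      then show ?thesis by blast
    qed
  have 2: "c \<odot> a \<in> ?E" if "a \<in> ?E" for c a using that polys_smult by blast
  have 3: "a \<otimes> b \<in> ?E" if "a \<in> ?E" "b \<in> ?E" for a b using that polys_mult by blast
  have 4: "a\<^sup>\<star> \<in> ?E" if "a \<in> ?E" for a using that polys_adj by blast
  note cl = approx_closure_subalg[OF E 0 1 2 3 4]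
  have sub: "cstar_subalg ?D A" and ED: "?E \<subseteq> ?D" using cl by auto
  have "P x \<in> ?E" if "x \<in> carrier B" for x
  proof -
    have "P x \<in> homog 0" unfolding homog_def using mono_P[OF that] by auto
    then have "P x \<in> polys 0" unfolding polys_def using homog_UN_carrier by (intro lspan_base) auto
    then show ?thesis by blast
  qed
  moreover have "S \<alpha> y \<in> ?E" if "\<alpha> \<in> labels B" "y \<in> \<I> \<alpha>" for \<alpha> y
  proof -
    have y: "y \<in> carrier B" using I_carrier that by blast
    \<comment> \<open>Words contain an inner projection; S \<alpha> y is one because it absorbs its
      source projection P y.\<close>
    have "mono (Suc 0) 0 (S \<alpha> y \<otimes> P y)" using mono_l[OF mono_P[OF y]] that by simp
    then have "mono (Suc 0) 0 (S \<alpha> y)" using that y by (simp add: S_restrict)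
    then have "S \<alpha> y \<in> homog 1" unfolding homog_def by force
    then have "S \<alpha> y \<in> polys 1" unfolding polys_def using homog_UN_carrier by (intro lspan_base) auto
    then show ?thesis by blast
  qed
  ultimately have "rep_gens B \<I> P S \<subseteq> ?D" using ED unfolding rep_gens_def by blast
  then have "cstar_gen A (rep_gens B \<I> P S) \<subseteq> ?D" unfolding cstar_gen_def using sub by blast
  then have "x \<in> ?D" using gen x by blast
  then show thesis using \<open>\<epsilon> > 0\<close> that by blast
qed

end

section \<open>From lower bounds to isometry\<close>

context gauge_representation
begin

lemma hom_iter_square: "x \<in> carrier A \<Longrightarrow> \<phi> (iter_square x k) = h.C.iter_square (\<phi> x) k"
  by (induction k) (auto simp: h.hom_mult)

text \<open>By the C*-identity the \<open>2\<^sup>k\<close>-th power of \<open>a\<^sup>\<star> a\<close> has norm \<open>\<parallel>a\<parallel>\<close> to the power \<open>2\<^sup>k\<^sup>+\<^sup>1\<close>, so the factor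
  \<open>c + d 2\<^sup>k\<close> disappears on taking roots.\<close>

lemma isometric_of_power_bound:
  assumes a [simp]: "a \<in> carrier A"
    and le: "\<And>k. nrm A (iter_square (a\<^sup>\<star> \<otimes> a) k)
      \<le> (c + d * 2^k) * nrm C (\<phi> (iter_square (a\<^sup>\<star> \<otimes> a) k))"
  shows "nrm A a \<le> nrm C (\<phi> a)"
proof -
  have s: "(a\<^sup>\<star> \<otimes> a)\<^sup>\<star> = a\<^sup>\<star> \<otimes> a" "(\<phi> (a\<^sup>\<star> \<otimes> a))\<^sup>\<star>\<^bsub>C\<^esub> = \<phi> (a\<^sup>\<star> \<otimes> a)"
    by (simp_all add: adj_mult flip: h.hom_adj)
  have "nrm A (a\<^sup>\<star> \<otimes> a) \<le> nrm C (\<phi> (a\<^sup>\<star> \<otimes> a))"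
  proof (rule bounded_power_ratio[where a=c and b=d])
    show "nrm A (a\<^sup>\<star> \<otimes> a) ^ 2^k \<le> (c + d * 2^k) * nrm C (\<phi> (a\<^sup>\<star> \<otimes> a)) ^ 2^k" for k
      using le[of k] s by (simp add: nrm_iter_square hom_iter_square h.C.nrm_iter_square)
  qed auto
  then have "(nrm A a)\<^sup>2 \<le> (nrm C (\<phi> a))\<^sup>2"
    by (simp add: h.hom_mult h.hom_adj nrm_cstar h.C.nrm_cstar)
  then show ?thesis by (rule power2_le_imp_le) simp
qed

text \<open>Split a = b + w into gaps and words. A supporting gap annihilates w by
  \<open>gap_S\<close>, so b is that gap times a; hence |\<phi> b| <= |\<phi> a|, and b is
  controlled isometrically. Then |\<phi> w| <= 2 |\<phi> a|, and the compressions of w lie one level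
  lower, where the constant K is available. This gives the new constant: 1 for b, and for w the
  factor 2 K times the square of the number of labels.\<close>

lemma core_bound:
  assumes F: "finite F" "F \<subseteq> labels B"
  shows "\<exists>K\<ge>0. \<forall>a\<in>lspan (core F n). nrm A a \<le> K * nrm C (\<phi> a)"
proof (induction n)
  case 0
  have "gap {} x = P x" if "x \<in> carrier B" for x using that by (simp add: gap_def)
  \<comment> \<open>Relative to the empty label set a gap is the projection itself.\<close>
  then have "core F 0 = gap {} ` carrier B" by (auto simp: image_iff)
  then show ?case using gap_span_isometric[of "{}"] by (intro exI[of _ 1]) auto
next
  case (Suc n)
  then obtain K where K: "K \<ge> 0" "\<And>a. a \<in> lspan (core F n) \<Longrightarrow> nrm A a \<le> K * nrm C (\<phi> a)" by blast
  note gc = gap_span_carrier[OF F] and wc = words_carrier[OF F(2) core_carrier[OF F(2), of n]]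
  let ?c = "real (card F)"
  have "nrm A a \<le> (1 + ?c * (?c * (K * 2))) * nrm C (\<phi> a)" if a: "a \<in> lspan (core F (Suc n))" for a
  proof -
    obtain b w where b: "b \<in> lspan (gap F ` carrier B)" and w: "w \<in> lspan (words F (core F n))"
      and abw: "a = b \<oplus> w" using core_Suc_decomp[OF F a] by blast
    have [simp]: "b \<in> carrier A" "w \<in> carrier A" using lspan_carrier[OF b gc] lspan_carrier[OF w wc] by auto
    have ac [simp]: "a \<in> carrier A" by (simp add: abw)
    obtain x where x [simp]: "x \<in> carrier B" and xb: "gap F x \<otimes> b = b" using gap_span_support[OF F b] by blast
    have [simp]: "gap F x \<in> carrier A" using gap_closed[OF F] by simp
    \<comment> \<open>The span of the empty set is zero, so this membership extends the vanishing
      from words to their combinations.\<close>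
    have "gap F x \<otimes> w \<in> lspan {}"
    proof (rule lspan_mult_l[OF w wc])
      show "gap F x \<otimes> m \<in> lspan {}" if mw: "m \<in> words F (core F n)" for m
      proof -
        obtain \<alpha> y k \<beta> z where m: "m = S \<alpha> y \<otimes> k \<otimes> (S \<beta> z)\<^sup>\<star>" "\<alpha> \<in> F" "y \<in> \<I> \<alpha>"
          "k \<in> core F n" "\<beta> \<in> F" "z \<in> \<I> \<beta>" using mw by (auto simp: words_def)
        have [simp]: "\<alpha> \<in> labels B" "\<beta> \<in> labels B" "k \<in> carrier A" using m F core_carrier by auto
        have "gap F x \<otimes> m = (gap F x \<otimes> S \<alpha> y) \<otimes> (k \<otimes> (S \<beta> z)\<^sup>\<star>)" using m by (simp add: mult_assoc)
        then show ?thesis using m gap_S[OF F] by simp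
      qed
    qed auto
    then have xw: "gap F x \<otimes> w = \<zero>" by (cases rule: lspan.cases) auto
    have bx: "b = gap F x \<otimes> a" by (simp add: abw mult_r_distr xb xw)
    have "nrm C (\<phi> b) \<le> nrm C (\<phi> (gap F x)) * nrm C (\<phi> a)"
      using h.C.nrm_mult[of "\<phi> (gap F x)" "\<phi> a"] by (simp add: h.hom_mult flip: bx) (simp add: bx h.hom_mult)
    also have "\<dots> \<le> 1 * nrm C (\<phi> a)"
      using h.nrm_le[of "gap F x"] projection_nrm(1)[of "gap F x"] gap_adj[OF F] gap_meet[OF F]
      by (intro mult_right_mono) auto
    finally have bC: "nrm C (\<phi> b) \<le> nrm C (\<phi> a)" by simp
    have b1: "nrm A b \<le> nrm C (\<phi> a)" using gap_span_isometric[OF F b] bC by simp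
    have "w = a \<ominus> b" unfolding abw
      by (rule lin_eqI, (rule lin_rules | (rule lin_atom, simp; fail))+) simp
    then have wC: "nrm C (\<phi> w) \<le> 2 * nrm C (\<phi> a)"
      using h.C.nrm_minus_le[of "\<phi> a" "\<phi> b"] bC by (simp add: h.hom_minus)
    have "nrm A w \<le> ?c * (?c * (K * (2 * nrm C (\<phi> a))))"
    proof (rule nrm_words_le[OF F w core_carrier[OF F(2)]])
      fix \<alpha> y \<beta> z assume ab: "\<alpha> \<in> F" "y \<in> \<I> \<alpha>" "\<beta> \<in> F" "z \<in> \<I> \<beta>"
      have [simp]: "\<alpha> \<in> labels B" "\<beta> \<in> labels B" using ab F by auto
      have "nrm A ((S \<alpha> y)\<^sup>\<star> \<otimes> w \<otimes> S \<beta> z) \<le> K * nrm C (\<phi> ((S \<alpha> y)\<^sup>\<star> \<otimes> w \<otimes> S \<beta> z))"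
        using ab by (intro K(2) compress_words[OF F(2) w]) auto
      also have "nrm C (\<phi> ((S \<alpha> y)\<^sup>\<star> \<otimes> w \<otimes> S \<beta> z))
          \<le> nrm C (\<phi> ((S \<alpha> y)\<^sup>\<star> \<otimes> w)) * nrm C (\<phi> (S \<beta> z))"
        using ab h.C.nrm_mult[of "\<phi> ((S \<alpha> y)\<^sup>\<star> \<otimes> w)" "\<phi> (S \<beta> z)"] by (simp add: h.hom_mult)
      also have "\<dots> \<le> nrm C (\<phi> ((S \<alpha> y)\<^sup>\<star> \<otimes> w)) * 1"
        using ab h.nrm_le[of "S \<beta> z"] nrm_S[of \<beta> z] by (intro mult_left_mono) auto
      also have "nrm C (\<phi> ((S \<alpha> y)\<^sup>\<star> \<otimes> w)) \<le> nrm C (\<phi> ((S \<alpha> y)\<^sup>\<star>)) * nrm C (\<phi> w)"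
        using ab h.C.nrm_mult[of "\<phi> ((S \<alpha> y)\<^sup>\<star>)" "\<phi> w"] by (simp add: h.hom_mult)
      also have "\<dots> \<le> 1 * nrm C (\<phi> w)"
        using ab h.nrm_le[of "(S \<alpha> y)\<^sup>\<star>"] nrm_S[of \<alpha> y] by (intro mult_right_mono) (auto simp: nrm_adj)
      finally show "nrm A ((S \<alpha> y)\<^sup>\<star> \<otimes> w \<otimes> S \<beta> z) \<le> K * (2 * nrm C (\<phi> a))"
        using K(1) wC by (smt (verit, ccfv_SIG) mult_left_mono)
    qed
    moreover have "nrm A a \<le> nrm A b + nrm A w" unfolding abw by (intro nrm_triangle) auto
    ultimately show ?thesis using b1 by (simp add: algebra_simps)
  qed
  then show ?case using K(1) by (intro exI[of _ "1 + ?c * (?c * (K * 2))"]) auto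
qed

text \<open>The span of one level is closed under products and adjoints, so the constant K serves
  all powers at once and disappears under roots.\<close>

lemma core_isometric:
  assumes F: "finite F" "F \<subseteq> labels B" and a: "a \<in> lspan (core F n)"
  shows "nrm A a \<le> nrm C (\<phi> a)"
proof -
  obtain K where K: "\<And>a. a \<in> lspan (core F n) \<Longrightarrow> nrm A a \<le> K * nrm C (\<phi> a)"
    using core_bound[OF F, of n] by blast
  show ?thesis
  proof (rule isometric_of_power_bound[where c=K and d=0])
    show "a \<in> carrier A" using lspan_carrier[OF a core_carrier[OF F(2)]] .
    have "iter_square (a\<^sup>\<star> \<otimes> a) k \<in> lspan (core F n)" for k
      by (induction k) (use a F(2) in \<open>auto intro: core_lspan_mult core_lspan_adj\<close>)
    then show "nrm A (iter_square (a\<^sup>\<star> \<otimes> a) k) \<le> (K + 0 * 2^k) * nrm C (\<phi> (iter_square (a\<^sup>\<star> \<otimes> a) k))" for k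
      using K by simp
  qed
qed

lemma gauge_mono:
  assumes z: "z \<in> sphere 0 1"
  shows "mono i j m \<Longrightarrow> \<gamma> z (\<phi> m) = z powi (int i - int j) \<odot>\<^bsub>C\<^esub> \<phi> m"
proof (induction rule: mono.induct)
  case (mono_P x)
  then show ?case using gauge_P z by simp
next
  case (mono_l i j m \<alpha> y)
  interpret g: star_hom C C "\<gamma> z" using gauge_hom z by blast
  have z0: "z \<noteq> 0" using z by auto
  have "z * z powi (int i - int j) = z powi (int (Suc i) - int j)"
    using z0 power_int_add_1'[of z "int i - int j"] by (simp add: algebra_simps)
  then show ?case
    using mono_l gauge_S[OF z, of \<alpha> y]
    by (simp add: h.hom_mult g.hom_mult h.C.smult_mult_l h.C.smult_mult_r flip: h.C.smult_mult_c)
      (simp add: mult.commute)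
next
  case (mono_r i j m \<alpha> y)
  interpret g: star_hom C C "\<gamma> z" using gauge_hom z by blast
  have z0: "z \<noteq> 0" using z by auto
  \<comment> \<open>On the circle conjugation is inversion, so a right letter lowers the exponent by
    one.\<close>
  have "z * cnj z = 1" using z complex_norm_square[of z] by simp
  then have "cnj z = inverse z" by (metis inverse_unique)
  then have "cnj z * z powi (int i - int j) = z powi (int i - int (Suc j))"
    using z0 power_int_diff[of z "int i - int j" 1] by (simp add: algebra_simps divide_inverse)
  moreover have "\<gamma> z (\<phi> ((S \<alpha> y)\<^sup>\<star>)) = cnj z \<odot>\<^bsub>C\<^esub> \<phi> ((S \<alpha> y)\<^sup>\<star>)"
    using mono_r gauge_S[OF z, of \<alpha> y] by (simp add: h.hom_adj g.hom_adj h.C.adj_smult)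
  ultimately show ?case
    using mono_r
    by (simp add: h.hom_mult g.hom_mult h.C.smult_mult_l h.C.smult_mult_r flip: h.C.smult_mult_c)
qed

lemma gauge_homog:
  assumes z: "z \<in> sphere 0 1"
  shows "a \<in> lspan (homog k) \<Longrightarrow> \<gamma> z (\<phi> a) = z powi k \<odot>\<^bsub>C\<^esub> \<phi> a"
proof (induction rule: lspan.induct)
  interpret g: star_hom C C "\<gamma> z" using gauge_hom z by blast
  {
    case lspan_zero then show ?case by simp
  next
    case (lspan_step a m c)
    have [simp]: "a \<in> carrier A" "m \<in> carrier A"
      using lspan_step lspan_carrier homog_carrier by blast+
    have "\<gamma> z (\<phi> m) = z powi k \<odot>\<^bsub>C\<^esub> \<phi> m" using lspan_step gauge_mono[OF z] by (auto simp: homog_def)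
    then show ?case using lspan_step
      by (simp add: h.hom_add h.hom_smult g.hom_add g.hom_smult h.C.smult_r_distr_c mult.commute
        flip: h.C.smult_mult_c)
  }
qed

text \<open>For each homogeneous component the product
  \<open>(x k)\<^sup>\<star> \<otimes> x k\<close> has degree 0, where \<phi> is already isometric;
  by the C*-identity so is \<phi> on the component. Averaging in the target bounds its image by that
  of a, and there are 2 d + 1 components.\<close>

lemma polys_bound:
  assumes a: "a \<in> polys d"
  shows "nrm A a \<le> (2 * real d + 1) * nrm C (\<phi> a)"
proof -
  obtain x where x: "\<And>k. x k \<in> lspan (homog k)" and ax: "a = finsum A x {- int d..int d}"
    using polys_decomp[OF a] by blast
  have xc [simp]: "x k \<in> carrier A" for k using lspan_carrier[OF x homog_carrier] .
  have comp: "nrm A (x k) \<le> nrm C (\<phi> a)" if k: "k \<in> {- int d..int d}" for k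
  proof -
    define T where "T = {- int d..int d} - {k}"
    have T: "{- int d..int d} = insert k T" "finite T" "k \<notin> T" using k by (auto simp: T_def)
    have "(x k)\<^sup>\<star> \<otimes> x k \<in> lspan (homog 0)"
    proof (rule lspan_mult[OF _ x homog_carrier homog_carrier homog_carrier])
      show "(x k)\<^sup>\<star> \<in> lspan (homog (- k))"
        using lspan_base[OF homog_adj homog_carrier] by (intro lspan_adj[OF x homog_carrier homog_carrier])
      show "m \<otimes> m' \<in> lspan (homog 0)" if "m \<in> homog (- k)" "m' \<in> homog k" for m m'
        using homog_mult[OF that] lspan_base[OF _ homog_carrier] by auto
    qed
    then obtain F n where "finite F" "F \<subseteq> labels B" "(x k)\<^sup>\<star> \<otimes> x k \<in> lspan (core F n)"
      using homog_zero_core by blast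
    then have "nrm A ((x k)\<^sup>\<star> \<otimes> x k) \<le> nrm C (\<phi> ((x k)\<^sup>\<star> \<otimes> x k))" by (rule core_isometric)
    then have "(nrm A (x k))\<^sup>2 \<le> (nrm C (\<phi> (x k)))\<^sup>2"
      by (simp add: h.hom_mult h.hom_adj nrm_cstar h.C.nrm_cstar)
    then have "nrm A (x k) \<le> nrm C (\<phi> (x k))" by (rule power2_le_imp_le) simp
    also have "\<dots> \<le> nrm C (\<phi> (x k) \<oplus>\<^bsub>C\<^esub> finsum C (\<lambda>k. \<phi> (x k)) T)"
      by (rule h.C.homogeneous_component_nrm_le[OF T(2) gauge_hom T(3)])
        (auto simp: gauge_homog[OF _ x])
    also have "\<phi> (x k) \<oplus>\<^bsub>C\<^esub> finsum C (\<lambda>k. \<phi> (x k)) T = \<phi> a"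
      unfolding ax T(1) using T by (subst h.hom_finsum) (auto simp: h.C.M.finsum_insert)
    finally show ?thesis .
  qed
  have "nrm A a \<le> (\<Sum>k\<in>{- int d..int d}. nrm A (x k))" unfolding ax by (intro nrm_finsum) auto
  also have "\<dots> \<le> (\<Sum>k\<in>{- int d..int d}. nrm C (\<phi> a))" using comp by (intro sum_mono)
  also have "\<dots> = (2 * real d + 1) * nrm C (\<phi> a)" by (simp add: algebra_simps)
  finally show ?thesis .
qed

lemma polys_isometric:
  assumes a: "a \<in> polys d" shows "nrm A a \<le> nrm C (\<phi> a)"
\<comment> \<open>The element \<open>a\<^sup>\<star> \<otimes> a\<close> has degree at most 2 d and
  its power at most 2 d 2^k, which makes the constant of \<open>polys_bound\<close> equal to 1 + 4 d
  2^k.\<close>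
proof (rule isometric_of_power_bound[where c=1 and d="4 * real d"])
  show "a \<in> carrier A" using a polys_carrier by blast
  have "iter_square (a\<^sup>\<star> \<otimes> a) k \<in> polys ((d + d) * 2^k)" for k
    using a by (intro polys_iter_square polys_mult polys_adj)
  from polys_bound[OF this] show "nrm A (iter_square (a\<^sup>\<star> \<otimes> a) k)
      \<le> (1 + 4 * real d * 2^k) * nrm C (\<phi> (iter_square (a\<^sup>\<star> \<otimes> a) k))" for k
    by (simp add: algebra_simps)
qed

theorem isometric:
  assumes x [simp]: "x \<in> carrier A" shows "nrm A x \<le> nrm C (\<phi> x)"
proof (rule field_le_epsilon)
  fix \<epsilon> :: real assume "\<epsilon> > 0"
  then obtain d e where e: "e \<in> polys d" "nrm A (x \<ominus> e) < \<epsilon> / 2"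
    using polys_dense[OF gen x] half_gt_zero by metis
  have ec [simp]: "e \<in> carrier A" using e polys_carrier by blast
  have "nrm A x \<le> nrm A (x \<ominus> e) + nrm A e" using minus_triangle[of x e \<zero>] by simp
  also have "nrm A e \<le> nrm C (\<phi> e)" using polys_isometric[OF e(1)] .
  also have "nrm C (\<phi> e) \<le> nrm C (\<phi> e \<ominus>\<^bsub>C\<^esub> \<phi> x) + nrm C (\<phi> x)"
    using h.C.minus_triangle[of "\<phi> e" "\<phi> x" "\<zero>\<^bsub>C\<^esub>"] by simp
  also have "nrm C (\<phi> e \<ominus>\<^bsub>C\<^esub> \<phi> x) \<le> nrm A (x \<ominus> e)"
    using h.nrm_le[of "x \<ominus> e"] h.C.nrm_minus_commute[of "\<phi> e" "\<phi> x"] by (simp add: h.hom_minus)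
  finally show "nrm A x \<le> nrm C (\<phi> x) + \<epsilon>" using e by simp
qed

end

section \<open>The quotient Boolean dynamical system and the ideals H and S of an ideal N\<close>

section \<open>The quotient system\<close>

locale representation_ideal = bds_representation A B \<I> \<J> P S + N: closed_ideal A N
  for A :: "('a, 'm) cstar_alg_scheme" (structure) and B :: "('b, 'l, 'n) bds_scheme"
    and \<I> :: "'l \<Rightarrow> 'b set" and \<J> :: "'b set" and P :: "'b \<Rightarrow> 'a" and S :: "'l \<Rightarrow> 'b \<Rightarrow> 'a"
    and N :: "'a set"
begin

abbreviation "H \<equiv> H_of B P N"
abbreviation "cl \<equiv> qclass B H"
abbreviation "QB \<equiv> quot_bds B H"

lemma H_iff: "x \<in> H \<longleftrightarrow> x \<in> carrier B \<and> P x \<in> N"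
  by (simp add: H_of_def)

lemma H_carrier [simp]: "x \<in> H \<Longrightarrow> x \<in> carrier B"
  by (simp add: H_iff)

lemma bot_H [simp]: "\<^bold>\<emptyset>\<^bsub>B\<^esub> \<in> H"
  by (simp add: H_iff)

lemma meet_H: "\<lbrakk>x \<in> H; y \<in> carrier B\<rbrakk> \<Longrightarrow> x \<^bold>\<inter>\<^bsub>B\<^esub> y \<in> H"
  by (simp add: H_iff P_meet)

lemma meet_H2: "\<lbrakk>x \<in> H; y \<in> carrier B\<rbrakk> \<Longrightarrow> y \<^bold>\<inter>\<^bsub>B\<^esub> x \<in> H"
  by (simp add: H_iff P_meet)

lemma join_H_iff:
  assumes [simp]: "x \<in> carrier B" "y \<in> carrier B"
  shows "x \<^bold>\<union>\<^bsub>B\<^esub> y \<in> H \<longleftrightarrow> x \<in> H \<and> y \<in> H"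
proof
  assume xy: "x \<^bold>\<union>\<^bsub>B\<^esub> y \<in> H"
  show "x \<in> H \<and> y \<in> H"
    using meet_H[OF xy, of x] meet_H[OF xy, of y]
    by (simp add: B.join_meet_self B.join_meet_self2)
qed (auto simp: H_iff P_join P_meet)

text \<open>The compressing partial isometry depends on the join only. It serves x and y alike, so
  it compresses the difference of their projections to the difference of the projections of their
  images under \<alpha>.\<close>

lemma P_act: assumes [simp]: "\<alpha> \<in> labels B" "x \<in> carrier B" "y \<in> carrier B"
  shows "(S \<alpha> (act B \<alpha> (x \<^bold>\<union>\<^bsub>B\<^esub> y)))\<^sup>\<star> \<otimes> P x \<otimes> S \<alpha> (act B \<alpha> (x \<^bold>\<union>\<^bsub>B\<^esub> y)) = P (act B \<alpha> x)"
proof -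
  have "(S \<alpha> (act B \<alpha> (x \<^bold>\<union>\<^bsub>B\<^esub> y)))\<^sup>\<star> \<otimes> P x \<otimes> S \<alpha> (act B \<alpha> (x \<^bold>\<union>\<^bsub>B\<^esub> y))
      = P (act B \<alpha> x) \<otimes> P (act B \<alpha> (x \<^bold>\<union>\<^bsub>B\<^esub> y))"
    by (simp add: S_star_P mult_assoc S_S)
  also have "\<dots> = P (act B \<alpha> (x \<^bold>\<inter>\<^bsub>B\<^esub> (x \<^bold>\<union>\<^bsub>B\<^esub> y)))" by (simp only: B.act_meet P_meet assms B.act_closed B.join_closed)
  also have "\<dots> = P (act B \<alpha> x)" by (simp add: B.meet_join_absorb)
  finally show ?thesis .
qed

text \<open>Two elements are equivalent exactly if their projections agree modulo N.
  Well-definedness of the quotient operations thus becomes rewriting with cosets of projections. In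
  the backward direction the differences of x and y in both orders lie in H, and adding them
  completes x and y to the same join.\<close>

lemma class_rel_iff:
  assumes [simp]: "x \<in> carrier B" "y \<in> carrier B"
  shows "(x, y) \<in> quot_rel B H \<longleftrightarrow> P x \<ominus> P y \<in> N"
proof
  assume "(x, y) \<in> quot_rel B H"
  then obtain h k where [simp]: "h \<in> H" "k \<in> H" and hk: "x \<^bold>\<union>\<^bsub>B\<^esub> h = y \<^bold>\<union>\<^bsub>B\<^esub> k"
    by (auto simp: quot_rel_def)
  have [simp]: "P h \<in> N" "P k \<in> N" using \<open>h \<in> H\<close> \<open>k \<in> H\<close> unfolding H_iff by auto
  have e: "P x \<oplus> P h \<ominus> P x \<otimes> P h = P y \<oplus> P k \<ominus> P y \<otimes> P k"
    using arg_cong[OF hk, of P] by (simp add: P_join P_meet)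
  have "P x \<ominus> P y = ((P x \<oplus> P h \<ominus> P x \<otimes> P h) \<ominus> P y) \<ominus> P h \<oplus> P x \<otimes> P h"
    by (rule lin_eqI, (rule lin_rules | (rule lin_atom, simp; fail))+) (simp add: algebra_simps)
  also have "\<dots> = P k \<ominus> P y \<otimes> P k \<ominus> P h \<oplus> P x \<otimes> P h" unfolding e
    by (rule lin_eqI, (rule lin_rules | (rule lin_atom, simp; fail))+) (simp add: algebra_simps)
  also have "\<dots> \<in> N" by simp
  finally show "P x \<ominus> P y \<in> N" .
next
  assume a: "P x \<ominus> P y \<in> N"
  have "P (x \<^bold>-\<^bsub>B\<^esub> y) = P x \<otimes> (P x \<ominus> P y)" by (simp add: P_diff flip: mult_minus_r)
  then have 1: "x \<^bold>-\<^bsub>B\<^esub> y \<in> H" using a by (simp add: H_iff)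
  have "P (y \<^bold>-\<^bsub>B\<^esub> x) = (-1) \<odot> (P y \<otimes> (P x \<ominus> P y))"
    by (simp add: P_diff) (rule lin_eqI, (rule lin_rules | (rule lin_atom, simp; fail))+, simp)
  then have 2: "y \<^bold>-\<^bsub>B\<^esub> x \<in> H" using a by (simp add: H_iff)
  have "x \<^bold>\<union>\<^bsub>B\<^esub> (y \<^bold>-\<^bsub>B\<^esub> x) = (x \<^bold>\<union>\<^bsub>B\<^esub> (x \<^bold>\<inter>\<^bsub>B\<^esub> y)) \<^bold>\<union>\<^bsub>B\<^esub> (y \<^bold>-\<^bsub>B\<^esub> x)" by (simp add: B.join_meet_absorb)
  also have "\<dots> = x \<^bold>\<union>\<^bsub>B\<^esub> ((y \<^bold>\<inter>\<^bsub>B\<^esub> x) \<^bold>\<union>\<^bsub>B\<^esub> (y \<^bold>-\<^bsub>B\<^esub> x))" by (simp add: B.join_assoc B.meet_comm[of x y])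
  also have "\<dots> = x \<^bold>\<union>\<^bsub>B\<^esub> y" by (simp add: B.meet_join_diff)
  finally have x: "x \<^bold>\<union>\<^bsub>B\<^esub> (y \<^bold>-\<^bsub>B\<^esub> x) = x \<^bold>\<union>\<^bsub>B\<^esub> y" .
  have "y \<^bold>\<union>\<^bsub>B\<^esub> (x \<^bold>-\<^bsub>B\<^esub> y) = (y \<^bold>\<union>\<^bsub>B\<^esub> (y \<^bold>\<inter>\<^bsub>B\<^esub> x)) \<^bold>\<union>\<^bsub>B\<^esub> (x \<^bold>-\<^bsub>B\<^esub> y)" by (simp add: B.join_meet_absorb)
  also have "\<dots> = y \<^bold>\<union>\<^bsub>B\<^esub> ((x \<^bold>\<inter>\<^bsub>B\<^esub> y) \<^bold>\<union>\<^bsub>B\<^esub> (x \<^bold>-\<^bsub>B\<^esub> y))" by (simp add: B.join_assoc B.meet_comm[of y x])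
  also have "\<dots> = x \<^bold>\<union>\<^bsub>B\<^esub> y" by (simp add: B.meet_join_diff B.join_comm[of y x])
  finally have "x \<^bold>\<union>\<^bsub>B\<^esub> (y \<^bold>-\<^bsub>B\<^esub> x) = y \<^bold>\<union>\<^bsub>B\<^esub> (x \<^bold>-\<^bsub>B\<^esub> y)" using x by simp
  then show "(x, y) \<in> quot_rel B H" unfolding quot_rel_def using 1 2 by auto
qed

lemma mem_cl_iff: "x \<in> carrier B \<Longrightarrow> y \<in> cl x \<longleftrightarrow> y \<in> carrier B \<and> N +> P x = N +> P y"
  using class_rel_iff[of x y] N.coset_eq_iff[of "P x" "P y"]
  unfolding qclass_def by (auto simp: quot_rel_def)

lemma cl_eq_iff: "\<lbrakk>x \<in> carrier B; y \<in> carrier B\<rbrakk> \<Longrightarrow> cl x = cl y \<longleftrightarrow> N +> P x = N +> P y"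
  using mem_cl_iff[of x] mem_cl_iff[of y] by auto

lemma cl_eq_iff2: "\<lbrakk>x \<in> carrier B; y \<in> carrier B\<rbrakk> \<Longrightarrow> cl x = cl y \<longleftrightarrow> P x \<ominus> P y \<in> N"
  by (simp add: cl_eq_iff N.coset_eq_iff)

lemma cl_self: "x \<in> carrier B \<Longrightarrow> x \<in> cl x"
  by (simp add: mem_cl_iff)

lemma UN_cl:
  assumes "x \<in> carrier B" "\<And>x'. \<lbrakk>x' \<in> carrier B; N +> P x = N +> P x'\<rbrakk> \<Longrightarrow> g x' = V"
  shows "(\<Union>u\<in>cl x. g u) = V"
proof -
  have "\<forall>u\<in>cl x. g u = V" using assms by (auto simp: mem_cl_iff)
  moreover have "x \<in> cl x" using assms(1) by (rule cl_self)
  ultimately show ?thesis by blast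
qed

lemma quot_map_P:
  assumes [simp]: "x \<in> carrier B" "y \<in> carrier B"
  shows "N +> P (x \<^bold>\<inter>\<^bsub>B\<^esub> y) = (N +> P x) \<otimes>\<^bsub>cstar_quot A N\<^esub> (N +> P y)"
    and "N +> P (x \<^bold>\<union>\<^bsub>B\<^esub> y) = (N +> P x) \<oplus>\<^bsub>cstar_quot A N\<^esub> (N +> P y)
      \<ominus>\<^bsub>cstar_quot A N\<^esub> (N +> P x) \<otimes>\<^bsub>cstar_quot A N\<^esub> (N +> P y)"
    and "N +> P (x \<^bold>-\<^bsub>B\<^esub> y) = (N +> P x) \<ominus>\<^bsub>cstar_quot A N\<^esub> (N +> P x) \<otimes>\<^bsub>cstar_quot A N\<^esub> (N +> P y)"
  by (simp_all add: P_meet P_join P_diff)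

lemma QB_simps [simp]:
  "carrier QB = cl ` carrier B" "bot_b QB = cl \<^bold>\<emptyset>\<^bsub>B\<^esub>" "labels QB = labels B"
  by (auto simp: quot_bds_def quotient_def qclass_def)

lemma UN_cl2:
  assumes "x \<in> carrier B" "y \<in> carrier B" "\<And>u v. \<lbrakk>u \<in> carrier B; v \<in> carrier B; N +> P x = N +> P u; N +> P y = N +> P v\<rbrakk>
    \<Longrightarrow> g u v = V"
  shows "(\<Union>u\<in>cl x. \<Union>v\<in>cl y. g u v) = V"
  using assms by (intro UN_cl) auto

lemma QB_meet [simp]:
  assumes x: "x \<in> carrier B" and y: "y \<in> carrier B" shows "cl x \<^bold>\<inter>\<^bsub>QB\<^esub> cl y = cl (x \<^bold>\<inter>\<^bsub>B\<^esub> y)"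
proof -
  have "cl x \<^bold>\<inter>\<^bsub>QB\<^esub> cl y = (\<Union>u\<in>cl x. \<Union>v\<in>cl y. cl (u \<^bold>\<inter>\<^bsub>B\<^esub> v))" by (simp add: quot_bds_def)
  also have "\<dots> = cl (x \<^bold>\<inter>\<^bsub>B\<^esub> y)"
  proof (rule UN_cl2[OF x y])
    fix u v assume u: "u \<in> carrier B" and v: "v \<in> carrier B"
      and e: "N +> P x = N +> P u" "N +> P y = N +> P v"
    show "cl (u \<^bold>\<inter>\<^bsub>B\<^esub> v) = cl (x \<^bold>\<inter>\<^bsub>B\<^esub> y)"
      by (simp only: cl_eq_iff x y u v B.meet_closed quot_map_P(1) e)
  qed
  finally show ?thesis .
qed

lemma QB_join [simp]:
  assumes x: "x \<in> carrier B" and y: "y \<in> carrier B" shows "cl x \<^bold>\<union>\<^bsub>QB\<^esub> cl y = cl (x \<^bold>\<union>\<^bsub>B\<^esub> y)"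
proof -
  have "cl x \<^bold>\<union>\<^bsub>QB\<^esub> cl y = (\<Union>u\<in>cl x. \<Union>v\<in>cl y. cl (u \<^bold>\<union>\<^bsub>B\<^esub> v))" by (simp add: quot_bds_def)
  also have "\<dots> = cl (x \<^bold>\<union>\<^bsub>B\<^esub> y)"
  proof (rule UN_cl2[OF x y])
    fix u v assume u: "u \<in> carrier B" and v: "v \<in> carrier B"
      and e: "N +> P x = N +> P u" "N +> P y = N +> P v"
    show "cl (u \<^bold>\<union>\<^bsub>B\<^esub> v) = cl (x \<^bold>\<union>\<^bsub>B\<^esub> y)"
      by (simp only: cl_eq_iff x y u v B.join_closed quot_map_P(2) e)
  qed
  finally show ?thesis .
qed

lemma QB_diff [simp]:
  assumes x: "x \<in> carrier B" and y: "y \<in> carrier B" shows "cl x \<^bold>-\<^bsub>QB\<^esub> cl y = cl (x \<^bold>-\<^bsub>B\<^esub> y)"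
proof -
  have "cl x \<^bold>-\<^bsub>QB\<^esub> cl y = (\<Union>u\<in>cl x. \<Union>v\<in>cl y. cl (u \<^bold>-\<^bsub>B\<^esub> v))" by (simp add: quot_bds_def)
  also have "\<dots> = cl (x \<^bold>-\<^bsub>B\<^esub> y)"
  proof (rule UN_cl2[OF x y])
    fix u v assume u: "u \<in> carrier B" and v: "v \<in> carrier B"
      and e: "N +> P x = N +> P u" "N +> P y = N +> P v"
    show "cl (u \<^bold>-\<^bsub>B\<^esub> v) = cl (x \<^bold>-\<^bsub>B\<^esub> y)"
      by (simp only: cl_eq_iff x y u v B.diff_closed quot_map_P(3) e)
  qed
  finally show ?thesis .
qed

lemma QB_act [simp]:
  assumes [simp]: "\<alpha> \<in> labels B" "x \<in> carrier B" shows "act QB \<alpha> (cl x) = cl (act B \<alpha> x)"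
proof -
  have K: "cl (act B \<alpha> y) = cl (act B \<alpha> x)" if [simp]: "y \<in> carrier B" and e: "N +> P x = N +> P y" for y
  proof -
    let ?s = "S \<alpha> (act B \<alpha> (x \<^bold>\<union>\<^bsub>B\<^esub> y))"
    have "P y \<ominus> P x \<in> N" using e by (simp flip: N.coset_eq_iff)
    then have "?s\<^sup>\<star> \<otimes> (P y \<ominus> P x) \<otimes> ?s \<in> N" by simp
    also have "?s\<^sup>\<star> \<otimes> (P y \<ominus> P x) \<otimes> ?s = ?s\<^sup>\<star> \<otimes> P y \<otimes> ?s \<ominus> ?s\<^sup>\<star> \<otimes> P x \<otimes> ?s"
      by (simp add: mult_minus_l mult_minus_r)
    also have "?s\<^sup>\<star> \<otimes> P y \<otimes> ?s = P (act B \<alpha> y)"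
      using P_act[of \<alpha> y x] by (simp add: B.join_comm[of y x])
    also have "?s\<^sup>\<star> \<otimes> P x \<otimes> ?s = P (act B \<alpha> x)" by (rule P_act) auto
    finally show ?thesis by (simp add: cl_eq_iff2)
  qed
  have "(\<Union>u\<in>cl x. cl (act B \<alpha> u)) = cl (act B \<alpha> x)" by (rule UN_cl[OF assms(2) K])
  then show ?thesis by (simp add: quot_bds_def)
qed

lemma cl_eq_bot_iff: "x \<in> carrier B \<Longrightarrow> cl x = cl \<^bold>\<emptyset>\<^bsub>B\<^esub> \<longleftrightarrow> x \<in> H"
  by (simp add: cl_eq_iff2 H_iff)

lemma act_H: "\<lbrakk>\<alpha> \<in> labels B; x \<in> H\<rbrakk> \<Longrightarrow> act B \<alpha> x \<in> H"
proof -
  assume a: "\<alpha> \<in> labels B" "x \<in> H"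
  then have "cl (act B \<alpha> x) = act QB \<alpha> (cl x)" by simp
  also have "cl x = cl \<^bold>\<emptyset>\<^bsub>B\<^esub>" using a cl_eq_bot_iff[of x] by simp
  also have "act QB \<alpha> (cl \<^bold>\<emptyset>\<^bsub>B\<^esub>) = cl \<^bold>\<emptyset>\<^bsub>B\<^esub>" using a by (simp add: B.act_bot)
  finally show ?thesis using a cl_eq_bot_iff[of "act B \<alpha> x"] by simp
qed

lemma QB_bds: "bds QB"
proof -
  have c1: "U \<^bold>\<inter>\<^bsub>QB\<^esub> V = V \<^bold>\<inter>\<^bsub>QB\<^esub> U" and c2: "U \<^bold>\<union>\<^bsub>QB\<^esub> V = V \<^bold>\<union>\<^bsub>QB\<^esub> U"
    if UV: "U \<in> carrier QB" "V \<in> carrier QB" for U V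
  proof -
    obtain x y where "U = cl x" "V = cl y" "x \<in> carrier B" "y \<in> carrier B" using UV by auto
    then show "U \<^bold>\<inter>\<^bsub>QB\<^esub> V = V \<^bold>\<inter>\<^bsub>QB\<^esub> U" "U \<^bold>\<union>\<^bsub>QB\<^esub> V = V \<^bold>\<union>\<^bsub>QB\<^esub> U"
      by (simp_all add: B.meet_comm[of x y] B.join_comm[of x y])
  qed
  have "gba QB"
    by (unfold_locales; ((rule c1 c2; assumption) | (auto simp: B.meet_assoc B.join_assoc
      B.meet_join_absorb B.join_meet_absorb B.meet_join_distrib B.bot_least B.meet_join_diff; fail)
       | (auto simp: B.meet_meet_diff; fail)))
  moreover have "bds_axioms QB"
    by (rule bds_axioms.intro) (auto simp: B.act_meet B.act_join B.act_diff B.act_bot)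
  ultimately show ?thesis by (rule bds.intro)
qed

lemma Delta_QB: "x \<in> carrier B \<Longrightarrow> Delta QB (cl x) = quot_Delta B H x"
  by (simp add: Delta_def quot_Delta_def cl_eq_bot_iff cong: conj_cong)

lemma quot_Delta_cl: "\<lbrakk>x \<in> carrier B; y \<in> carrier B; cl x = cl y\<rbrakk> \<Longrightarrow> quot_Delta B H x = quot_Delta B H y"
  by (metis Delta_QB)

lemma quot_Delta_labels: "quot_Delta B H x \<subseteq> labels B"
  by (auto simp: quot_Delta_def)

lemma quot_Delta_subset: "\<lbrakk>x \<in> carrier B\<rbrakk> \<Longrightarrow> quot_Delta B H x \<subseteq> Delta B x"
  by (auto simp: quot_Delta_def Delta_def)

lemma quot_Delta_H: "x \<in> H \<Longrightarrow> quot_Delta B H x = {}"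
  by (auto simp: quot_Delta_def act_H)

lemma quot_Delta_meet: "\<lbrakk>x \<in> carrier B; y \<in> carrier B\<rbrakk> \<Longrightarrow> quot_Delta B H (x \<^bold>\<inter>\<^bsub>B\<^esub> y) \<subseteq> quot_Delta B H x"
  by (auto simp: quot_Delta_def B.act_meet meet_H)

lemma quot_Delta_join: "\<lbrakk>x \<in> carrier B; y \<in> carrier B\<rbrakk>
    \<Longrightarrow> quot_Delta B H (x \<^bold>\<union>\<^bsub>B\<^esub> y) = quot_Delta B H x \<union> quot_Delta B H y"
  by (auto simp: quot_Delta_def B.act_join join_H_iff)

text \<open>Every class below that of x has a representative u \<inter> x, so regularity can be
  tested on elements of B instead of classes.\<close>

lemma quot_regs_iff:
  "x \<in> quot_regs B H \<longleftrightarrow> x \<in> carrier B \<and> (\<forall>u\<in>carrier B. u \<^bold>\<inter>\<^bsub>B\<^esub> x \<notin> H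
    \<longrightarrow> finite (quot_Delta B H (u \<^bold>\<inter>\<^bsub>B\<^esub> x)) \<and> quot_Delta B H (u \<^bold>\<inter>\<^bsub>B\<^esub> x) \<noteq> {})"
proof (cases "x \<in> carrier B")
  case x [simp]: True
  have "cl x \<in> regs QB \<longleftrightarrow> (\<forall>u\<in>carrier B. u \<notin> H \<and> cl (u \<^bold>\<inter>\<^bsub>B\<^esub> x) = cl u
      \<longrightarrow> finite (quot_Delta B H u) \<and> quot_Delta B H u \<noteq> {})"
    by (auto simp: regs_def le_b_def Delta_QB cl_eq_bot_iff card_gt_0_iff)
  also have "\<dots> \<longleftrightarrow> (\<forall>u\<in>carrier B. u \<^bold>\<inter>\<^bsub>B\<^esub> x \<notin> H
      \<longrightarrow> finite (quot_Delta B H (u \<^bold>\<inter>\<^bsub>B\<^esub> x)) \<and> quot_Delta B H (u \<^bold>\<inter>\<^bsub>B\<^esub> x) \<noteq> {})" (is "?l \<longleftrightarrow> ?r")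
  proof
    assume l: ?l
    show ?r
    proof (intro ballI impI)
      fix u assume u: "u \<in> carrier B" "u \<^bold>\<inter>\<^bsub>B\<^esub> x \<notin> H"
      have "(u \<^bold>\<inter>\<^bsub>B\<^esub> x) \<^bold>\<inter>\<^bsub>B\<^esub> x = u \<^bold>\<inter>\<^bsub>B\<^esub> x" using u by (simp add: B.meet_assoc)
      then show "finite (quot_Delta B H (u \<^bold>\<inter>\<^bsub>B\<^esub> x)) \<and> quot_Delta B H (u \<^bold>\<inter>\<^bsub>B\<^esub> x) \<noteq> {}"
        using l u by (metis B.meet_closed x)
    qed
  next
    assume r: ?r
    show ?l
    proof (intro ballI impI)
      fix u assume u: "u \<in> carrier B" "u \<notin> H \<and> cl (u \<^bold>\<inter>\<^bsub>B\<^esub> x) = cl u"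
      then have "u \<^bold>\<inter>\<^bsub>B\<^esub> x \<notin> H" using cl_eq_bot_iff[of u] cl_eq_bot_iff[of "u \<^bold>\<inter>\<^bsub>B\<^esub> x"] by simp
      then have "finite (quot_Delta B H (u \<^bold>\<inter>\<^bsub>B\<^esub> x)) \<and> quot_Delta B H (u \<^bold>\<inter>\<^bsub>B\<^esub> x) \<noteq> {}"
        using r u by blast
      then show "finite (quot_Delta B H u) \<and> quot_Delta B H u \<noteq> {}"
        using u quot_Delta_cl[of "u \<^bold>\<inter>\<^bsub>B\<^esub> x" u] by simp
    qed
  qed
  finally show ?thesis by (simp add: quot_regs_def)
qed (simp add: quot_regs_def)

lemma quot_regs_carrier: "x \<in> quot_regs B H \<Longrightarrow> x \<in> carrier B"
  by (simp add: quot_regs_def)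

lemma quot_regs_finite: assumes "x \<in> quot_regs B H" shows "finite (quot_Delta B H x)"
proof (cases "x \<in> H")
  case False
  have x: "x \<in> carrier B" using assms by (rule quot_regs_carrier)
  then have "x \<^bold>\<inter>\<^bsub>B\<^esub> x \<notin> H" using False by simp
  then show ?thesis using assms x unfolding quot_regs_iff by (metis B.meet_idem)
qed (simp add: quot_Delta_H)

lemma quot_regs_meet:
  assumes x: "x \<in> quot_regs B H" and [simp]: "y \<in> carrier B" shows "x \<^bold>\<inter>\<^bsub>B\<^esub> y \<in> quot_regs B H"
proof -
  have [simp]: "x \<in> carrier B" using x by (rule quot_regs_carrier)
  have "u \<^bold>\<inter>\<^bsub>B\<^esub> (x \<^bold>\<inter>\<^bsub>B\<^esub> y) = (u \<^bold>\<inter>\<^bsub>B\<^esub> y) \<^bold>\<inter>\<^bsub>B\<^esub> x" if "u \<in> carrier B" for u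
    using that by (simp add: B.meet_assoc B.meet_comm[of x y])
  then show ?thesis using x unfolding quot_regs_iff by auto
qed

lemma quot_regs_join:
  assumes x: "x \<in> quot_regs B H" and y: "y \<in> quot_regs B H" shows "x \<^bold>\<union>\<^bsub>B\<^esub> y \<in> quot_regs B H"
proof -
  have [simp]: "x \<in> carrier B" "y \<in> carrier B" using x y by (simp_all add: quot_regs_carrier)
  have "finite (quot_Delta B H (u \<^bold>\<inter>\<^bsub>B\<^esub> (x \<^bold>\<union>\<^bsub>B\<^esub> y))) \<and> quot_Delta B H (u \<^bold>\<inter>\<^bsub>B\<^esub> (x \<^bold>\<union>\<^bsub>B\<^esub> y)) \<noteq> {}"
    if [simp]: "u \<in> carrier B" and n: "u \<^bold>\<inter>\<^bsub>B\<^esub> (x \<^bold>\<union>\<^bsub>B\<^esub> y) \<notin> H" for u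
  proof -
    have e: "u \<^bold>\<inter>\<^bsub>B\<^esub> (x \<^bold>\<union>\<^bsub>B\<^esub> y) = (u \<^bold>\<inter>\<^bsub>B\<^esub> x) \<^bold>\<union>\<^bsub>B\<^esub> (u \<^bold>\<inter>\<^bsub>B\<^esub> y)" by (simp add: B.meet_join_distrib)
    have f: "finite (quot_Delta B H (u \<^bold>\<inter>\<^bsub>B\<^esub> x))" "finite (quot_Delta B H (u \<^bold>\<inter>\<^bsub>B\<^esub> y))"
      using quot_regs_finite[OF quot_regs_meet[OF x, of u]] quot_regs_finite[OF quot_regs_meet[OF y, of u]]
      by (simp_all add: B.meet_comm[of u x] B.meet_comm[of u y])
    have "u \<^bold>\<inter>\<^bsub>B\<^esub> x \<notin> H \<or> u \<^bold>\<inter>\<^bsub>B\<^esub> y \<notin> H" using n unfolding e by (simp add: join_H_iff)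
    then have "quot_Delta B H (u \<^bold>\<inter>\<^bsub>B\<^esub> x) \<noteq> {} \<or> quot_Delta B H (u \<^bold>\<inter>\<^bsub>B\<^esub> y) \<noteq> {}"
      using x y that(1) unfolding quot_regs_iff by blast
    then show ?thesis unfolding e using f by (simp add: quot_Delta_join)
  qed
  then show ?thesis unfolding quot_regs_iff by simp
qed

lemma gap_proj_eq: "gap_proj B A P S H x = gap (quot_Delta B H x) x"
  by (simp add: gap_proj_def gap_def rproj_def)

lemma rproj_N: assumes "\<alpha> \<in> labels B" "x \<in> carrier B" "act B \<alpha> x \<in> H" shows "rproj \<alpha> x \<in> N"
proof -
  have "S \<alpha> (act B \<alpha> x) \<otimes> P (act B \<alpha> x) \<in> N" using assms by (simp add: H_iff)
  then show ?thesis using assms by (simp add: S_restrict rproj_def)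
qed

text \<open>Labels outside \<open>quot_Delta B H x\<close> contribute range projections that lie in
  N. Modulo N the gap is the same for every finite F containing \<open>quot_Delta B H x\<close>,
  which lets several elements share one F.\<close>

lemma gap_N_iff:
  assumes F: "finite F" "F \<subseteq> labels B" "quot_Delta B H x \<subseteq> F" and [simp]: "x \<in> carrier B"
  shows "gap F x \<in> N \<longleftrightarrow> gap_proj B A P S H x \<in> N"
proof -
  let ?D = "quot_Delta B H x"
  have rc [simp]: "\<alpha> \<in> F \<Longrightarrow> rproj \<alpha> x \<in> carrier A" "\<alpha> \<in> ?D \<Longrightarrow> rproj \<alpha> x \<in> carrier A" for \<alpha>
    using F by auto
  have "finsum A (\<lambda>\<alpha>. rproj \<alpha> x) (?D \<union> (F - ?D)) = (\<Oplus>\<alpha>\<in>?D. rproj \<alpha> x) \<oplus> (\<Oplus>\<alpha>\<in>F - ?D. rproj \<alpha> x)"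
    using F finite_subset by (intro M.finsum_Un_disjoint) auto
  moreover have "?D \<union> (F - ?D) = F" using F by blast
  moreover have n: "(\<Oplus>\<alpha>\<in>F - ?D. rproj \<alpha> x) \<in> N"
  proof -
    have "finite T \<Longrightarrow> T \<subseteq> F - ?D \<Longrightarrow> (\<Oplus>\<alpha>\<in>T. rproj \<alpha> x) \<in> N" for T
    proof (induction T rule: finite_induct)
      case (insert \<alpha> T)
      have "rproj \<alpha> x \<in> N" using insert F by (intro rproj_N) (auto simp: quot_Delta_def)
      moreover have "(\<Oplus>\<alpha>\<in>insert \<alpha> T. rproj \<alpha> x) = rproj \<alpha> x \<oplus> (\<Oplus>\<alpha>\<in>T. rproj \<alpha> x)"
        using insert by (intro M.finsum_insert) auto
      ultimately show ?case using insert by simp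
    qed simp
    then show ?thesis using F by simp
  qed
  ultimately have e: "gap F x = P x \<ominus> ((\<Oplus>\<alpha>\<in>?D. rproj \<alpha> x) \<oplus> (\<Oplus>\<alpha>\<in>F - ?D. rproj \<alpha> x))"
    by (simp add: gap_def)
  define r d where "r = (\<Oplus>\<alpha>\<in>F - ?D. rproj \<alpha> x)" and "d = (\<Oplus>\<alpha>\<in>?D. rproj \<alpha> x)"
  have [simp]: "r \<in> N" "d \<in> carrier A" using n by (auto simp: r_def d_def)
  have g: "gap_proj B A P S H x = P x \<ominus> d" by (simp add: gap_proj_eq gap_def d_def)
  have e: "gap F x = P x \<ominus> (d \<oplus> r)" using e by (simp add: r_def d_def)
  have "P x \<ominus> (d \<oplus> r) = (P x \<ominus> d) \<ominus> r" "P x \<ominus> d = (P x \<ominus> (d \<oplus> r)) \<oplus> r"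
    by (rule lin_eqI, (rule lin_rules | (rule lin_atom, simp; fail))+, simp add: algebra_simps)+
  then show ?thesis unfolding e g by (metis N.I_minus N.a_closed \<open>r \<in> N\<close>)
qed

abbreviation "SN \<equiv> S_of B A P S N"

lemma SN_iff: "x \<in> SN \<longleftrightarrow> x \<in> quot_regs B H \<and> gap_proj B A P S H x \<in> N"
  by (simp add: S_of_def)

lemma SN_carrier [simp]: "x \<in> SN \<Longrightarrow> x \<in> carrier B"
  by (simp add: SN_iff quot_regs_carrier)

lemma SN_meet: assumes x: "x \<in> SN" and [simp]: "y \<in> carrier B" shows "x \<^bold>\<inter>\<^bsub>B\<^esub> y \<in> SN"
proof -
  note [simp] = SN_carrier[OF x]
  have r: "x \<in> quot_regs B H" and g: "gap (quot_Delta B H x) x \<in> N" using x by (auto simp: SN_iff gap_proj_eq)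
  note F = quot_regs_finite[OF r] quot_Delta_labels[of x]
  have "gap (quot_Delta B H x) (x \<^bold>\<inter>\<^bsub>B\<^esub> y) \<in> N"
    using P_gap[OF F, of y x] g by (metis B.meet_comm N.I_mult_l P_closed \<open>x \<in> carrier B\<close> assms(2))
  then have "gap_proj B A P S H (x \<^bold>\<inter>\<^bsub>B\<^esub> y) \<in> N"
    using gap_N_iff[OF F quot_Delta_meet] by simp
  then show ?thesis using quot_regs_meet[OF r] by (simp add: SN_iff)
qed

text \<open>Relative to a common F the gap of a join is computed by inclusion and exclusion, since
  gaps are multiplied by projections as the elements are met.\<close>

lemma SN_join: assumes x: "x \<in> SN" and y: "y \<in> SN" shows "x \<^bold>\<union>\<^bsub>B\<^esub> y \<in> SN"
proof -
  note [simp] = SN_carrier[OF x] SN_carrier[OF y]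
  have r: "x \<in> quot_regs B H" "y \<in> quot_regs B H" using x y by (auto simp: SN_iff)
  let ?F = "quot_Delta B H x \<union> quot_Delta B H y"
  have F: "finite ?F" "?F \<subseteq> labels B" using quot_regs_finite r quot_Delta_labels by auto
  note [simp] = gap_closed[OF F]
  have gx: "gap ?F x \<in> N" using gap_N_iff[OF F] x by (auto simp: SN_iff)
  have gy: "gap ?F y \<in> N" using gap_N_iff[OF F] y by (auto simp: SN_iff)
  have gxy: "gap ?F (x \<^bold>\<inter>\<^bsub>B\<^esub> y) \<in> N"
    using gap_N_iff[OF F, of "x \<^bold>\<inter>\<^bsub>B\<^esub> y"] quot_Delta_meet[of x y] SN_meet[OF x, of y] by (auto simp: SN_iff)
  have "gap ?F (x \<^bold>\<union>\<^bsub>B\<^esub> y) = P (x \<^bold>\<union>\<^bsub>B\<^esub> y) \<otimes> gap ?F (x \<^bold>\<union>\<^bsub>B\<^esub> y)" using P_gap[OF F] by simp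
  also have "\<dots> = P x \<otimes> gap ?F (x \<^bold>\<union>\<^bsub>B\<^esub> y) \<oplus> P y \<otimes> gap ?F (x \<^bold>\<union>\<^bsub>B\<^esub> y)
      \<ominus> P (x \<^bold>\<inter>\<^bsub>B\<^esub> y) \<otimes> gap ?F (x \<^bold>\<union>\<^bsub>B\<^esub> y)"
    by (simp only: P_join \<open>x \<in> carrier B\<close> \<open>y \<in> carrier B\<close>)
      (rule lin_eqI, (rule lin_rules | (rule lin_atom, simp; fail))+, simp)
  also have "\<dots> = gap ?F x \<oplus> gap ?F y \<ominus> gap ?F (x \<^bold>\<inter>\<^bsub>B\<^esub> y)"
  proof -
    have "y \<^bold>\<inter>\<^bsub>B\<^esub> (x \<^bold>\<union>\<^bsub>B\<^esub> y) = y" using B.meet_join_absorb[of y x] by (simp add: B.join_comm)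
    moreover have "(x \<^bold>\<inter>\<^bsub>B\<^esub> y) \<^bold>\<inter>\<^bsub>B\<^esub> (x \<^bold>\<union>\<^bsub>B\<^esub> y) = x \<^bold>\<inter>\<^bsub>B\<^esub> y" using calculation by (simp add: B.meet_assoc)
    ultimately show ?thesis using P_gap[OF F] by (simp add: B.meet_join_absorb)
  qed
  also have "\<dots> \<in> N" using gx gy gxy by simp
  finally have "gap_proj B A P S H (x \<^bold>\<union>\<^bsub>B\<^esub> y) \<in> N"
    using gap_N_iff[OF F, of "x \<^bold>\<union>\<^bsub>B\<^esub> y"] by (simp add: quot_Delta_join)
  then show ?thesis using quot_regs_join[OF r] by (simp add: SN_iff)
qed

text \<open>No label survives in the quotient for x in H, so nothing is subtracted. In particular
  the ideal generated by the gaps contains the projections of all elements of H.\<close>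

lemma H_SN: assumes "x \<in> H" shows "x \<in> SN" and "gap_proj B A P S H x = P x"
proof -
  show g: "gap_proj B A P S H x = P x" using assms by (simp add: gap_proj_eq gap_def quot_Delta_H)
  have "u \<^bold>\<inter>\<^bsub>B\<^esub> x \<in> H" if "u \<in> carrier B" for u using that assms meet_H2 by blast
  moreover have "x \<in> carrier B" "gap_proj B A P S H x \<in> N" using assms unfolding g H_iff by auto
  ultimately show "x \<in> SN" unfolding SN_iff quot_regs_iff by blast
qed

lemma regs_meet: assumes "x \<in> regs B" "y \<in> carrier B" shows "y \<^bold>\<inter>\<^bsub>B\<^esub> x \<in> regs B"
  unfolding regs_def
proof (intro CollectI conjI ballI)
  have x: "x \<in> carrier B" using assms by (simp add: regs_def)
  then show "y \<^bold>\<inter>\<^bsub>B\<^esub> x \<in> carrier B" using assms by simp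
  fix u assume u: "u \<in> carrier B"
  show "u \<noteq> \<^bold>\<emptyset>\<^bsub>B\<^esub> \<and> u \<^bold>\<subseteq>\<^bsub>B\<^esub> y \<^bold>\<inter>\<^bsub>B\<^esub> x \<longrightarrow> finite (Delta B u) \<and> 0 < card (Delta B u)"
  proof
    assume n: "u \<noteq> \<^bold>\<emptyset>\<^bsub>B\<^esub> \<and> u \<^bold>\<subseteq>\<^bsub>B\<^esub> y \<^bold>\<inter>\<^bsub>B\<^esub> x"
    then have e: "u \<^bold>\<inter>\<^bsub>B\<^esub> (y \<^bold>\<inter>\<^bsub>B\<^esub> x) = u" by (simp add: le_b_def)
    have "(u \<^bold>\<inter>\<^bsub>B\<^esub> (y \<^bold>\<inter>\<^bsub>B\<^esub> x)) \<^bold>\<inter>\<^bsub>B\<^esub> x = u \<^bold>\<inter>\<^bsub>B\<^esub> (y \<^bold>\<inter>\<^bsub>B\<^esub> x)"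
      using u x assms by (simp add: B.meet_assoc)
    then have "u \<^bold>\<subseteq>\<^bsub>B\<^esub> x" unfolding e by (simp add: le_b_def)
    then show "finite (Delta B u) \<and> 0 < card (Delta B u)" using assms(1) n u unfolding regs_def by blast
  qed
qed

text \<open>The ideal \<J> absorbs only regular elements. An arbitrary y is first cut down to y
  \<inter> x, which is regular because it lies below x.\<close>

lemma J_meet:
  assumes x: "x \<in> \<J>" and y: "y \<in> carrier B" shows "y \<^bold>\<inter>\<^bsub>B\<^esub> x \<in> \<J>"
proof -
  have J: "\<J> \<subseteq> regs B" "\<And>x y. \<lbrakk>x \<in> \<J>; y \<in> regs B\<rbrakk> \<Longrightarrow> x \<^bold>\<inter>\<^bsub>B\<^esub> y \<in> \<J>"
    using sys by (auto simp: rel_gbds_def gba_ideal_def)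
  have xr: "x \<in> regs B" "x \<in> carrier B" using J x by (auto simp: regs_def)
  have "x \<^bold>\<inter>\<^bsub>B\<^esub> (y \<^bold>\<inter>\<^bsub>B\<^esub> x) \<in> \<J>" using J(2)[OF x regs_meet[OF xr(1) y]] .
  also have "x \<^bold>\<inter>\<^bsub>B\<^esub> (y \<^bold>\<inter>\<^bsub>B\<^esub> x) = y \<^bold>\<inter>\<^bsub>B\<^esub> x"
    using xr y by (metis B.meet_comm B.meet_self_left)
  finally show ?thesis .
qed

lemma J_facts: assumes x: "x \<in> \<J>"
  shows "x \<in> carrier B" "finite (Delta B x)" "gap (Delta B x) x = \<zero>"
proof -
  have r: "x \<in> regs B" using sys x by (auto simp: rel_gbds_def gba_ideal_def)
  then show c: "x \<in> carrier B" by (simp add: regs_def)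
  show "finite (Delta B x)"
  proof (cases "x = \<^bold>\<emptyset>\<^bsub>B\<^esub>")
    case True
    then have "Delta B x = {}" using B.act_bot by (auto simp: Delta_def)
    then show ?thesis by simp
  next
    case False
    have "x \<^bold>\<subseteq>\<^bsub>B\<^esub> x" using c by (simp add: le_b_def)
    then show ?thesis using r False c unfolding regs_def by blast
  qed
  have "(\<Oplus>\<alpha>\<in>Delta B x. rproj \<alpha> x) = P x" using P_sum[OF x] by (simp flip: rproj_def)
  then show "gap (Delta B x) x = \<zero>" using c by (simp add: gap_def)
qed

lemma J_gap_proj: assumes x: "x \<in> \<J>" shows "gap_proj B A P S H x \<in> N"
  using gap_N_iff[OF J_facts(2)[OF x] _ quot_Delta_subset J_facts(1)[OF x]] J_facts[OF x]
  by (auto simp: Delta_def)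

text \<open>This contains the \<J>-saturation of H: if v = u \<inter> x sees no label in the
  quotient, its gap is P v, which lies in N by relation (iv), so v belongs to H.\<close>

lemma J_SN: assumes x: "x \<in> \<J>" shows "x \<in> SN"
proof -
  have "finite (quot_Delta B H (u \<^bold>\<inter>\<^bsub>B\<^esub> x)) \<and> quot_Delta B H (u \<^bold>\<inter>\<^bsub>B\<^esub> x) \<noteq> {}"
    if u: "u \<in> carrier B" "u \<^bold>\<inter>\<^bsub>B\<^esub> x \<notin> H" for u
  proof -
    have v: "u \<^bold>\<inter>\<^bsub>B\<^esub> x \<in> \<J>" using J_meet[OF x u(1)] .
    have "quot_Delta B H (u \<^bold>\<inter>\<^bsub>B\<^esub> x) \<noteq> {}"
    proof
      assume e: "quot_Delta B H (u \<^bold>\<inter>\<^bsub>B\<^esub> x) = {}"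
      have "gap_proj B A P S H (u \<^bold>\<inter>\<^bsub>B\<^esub> x) = P (u \<^bold>\<inter>\<^bsub>B\<^esub> x)"
        using J_facts(1)[OF v] by (simp add: gap_proj_eq gap_def e)
      then show False using J_gap_proj[OF v] u J_facts(1)[OF v] by (simp add: H_iff)
    qed
    then show ?thesis
      using J_facts[OF v] quot_Delta_subset finite_subset by blast
  qed
  then show ?thesis using J_facts(1)[OF x] J_gap_proj[OF x] unfolding SN_iff quot_regs_iff by blast
qed

lemma QB_sys: "rel_gbds QB (\<lambda>\<alpha>. cl ` \<I> \<alpha>) (cl ` SN)"
  unfolding rel_gbds_def
proof (intro conjI ballI QB_bds)
  fix \<alpha> assume "\<alpha> \<in> labels QB"
  then have [simp]: "\<alpha> \<in> labels B" by simp
  have Ic [simp]: "x \<in> carrier B" if "x \<in> \<I> \<alpha>" for x using I_carrier[of \<alpha>] that by simp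
  show "gba_ideal (cl ` \<I> \<alpha>) QB"
    using I_nonempty[of \<alpha>] I_join[of \<alpha>] I_meet[of \<alpha>] by (auto simp: gba_ideal_def)
  show "act_range QB \<alpha> \<subseteq> cl ` \<I> \<alpha>"
  proof
    fix U assume "U \<in> act_range QB \<alpha>"
    then obtain x y where xy [simp]: "x \<in> carrier B" "y \<in> carrier B" and U: "U = cl x"
      and le: "cl (x \<^bold>\<inter>\<^bsub>B\<^esub> act B \<alpha> y) = cl x" by (auto simp: act_range_def le_b_def)
    have "act B \<alpha> y \<^bold>\<inter>\<^bsub>B\<^esub> x \<in> \<I> \<alpha>" by (intro I_meet) auto
    then show "U \<in> cl ` \<I> \<alpha>" using le U by (metis B.act_closed B.meet_comm \<open>\<alpha> \<in> labels B\<close> imageI xy)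
  qed
next
  have r: "cl x \<in> regs QB" if "x \<in> SN" for x using that unfolding SN_iff quot_regs_def by blast
  have "SN \<noteq> {}" using H_SN(1)[OF bot_H] by blast
  moreover have "cl x \<^bold>\<inter>\<^bsub>QB\<^esub> V \<in> cl ` SN" if x: "x \<in> SN" and V: "V \<in> regs QB" for x V
  proof -
    obtain y where "y \<in> carrier B" "V = cl y" using V by (auto simp: regs_def)
    then show ?thesis using x SN_meet by auto
  qed
  moreover have "cl x \<^bold>\<union>\<^bsub>QB\<^esub> cl y \<in> cl ` SN" if "x \<in> SN" "y \<in> SN" for x y
    using that SN_join by auto
  ultimately show "gba_ideal (cl ` SN) (QB\<lparr>carrier := regs QB\<rparr>)"
    using r by (auto simp: gba_ideal_def)
qed

end

section \<open>Passing representations between the system and its quotient\<close>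

section \<open>Representations of the quotient system\<close>

context representation_ideal
begin

text \<open>The classes come from N, whereas the target is the quotient by another ideal M.
  Containing the projections of H and the gaps of \<open>SN\<close> is all that M must satisfy,
  which makes the lemma applicable to the ideal they generate.\<close>

lemma quotient_representation:
  assumes M: "closed_ideal A M" and MH: "\<And>x. x \<in> H \<Longrightarrow> P x \<in> M"
    and MS: "\<And>x. x \<in> SN \<Longrightarrow> gap_proj B A P S H x \<in> M"
  obtains P' S' where "bds_rep QB (\<lambda>\<alpha>. cl ` \<I> \<alpha>) (cl ` SN) (cstar_quot A M) P' S'"
    "\<And>x. x \<in> carrier B \<Longrightarrow> P' (cl x) = M +> P x"
    "\<And>\<alpha> y. \<lbrakk>\<alpha> \<in> labels B; y \<in> \<I> \<alpha>\<rbrakk> \<Longrightarrow> S' \<alpha> (cl y) = M +> S \<alpha> y"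
proof -
  interpret M: closed_ideal A M by (rule M)
  let ?C = "cstar_quot A M"
  interpret m: star_hom A ?C "(+>) M" by (rule M.quot_map_hom)
  \<comment> \<open>Equivalence is known modulo N only. It puts the two differences of x and y into
    H, whose projections do lie in M, and P x - P y is the difference of these projections.\<close>
  have diff: "P x \<ominus> P y \<in> M" if [simp]: "x \<in> carrier B" "y \<in> carrier B" and e: "cl x = cl y" for x y
  proof -
    have n: "P x \<ominus> P y \<in> N" using e by (simp add: cl_eq_iff2)
    have "P x \<otimes> (P x \<ominus> P y) \<in> N" using n by simp
    then have "x \<^bold>-\<^bsub>B\<^esub> y \<in> H" by (simp add: H_iff P_diff flip: mult_minus_r)
    moreover have "P y \<ominus> P y \<otimes> P x = (-1) \<odot> (P y \<otimes> (P x \<ominus> P y))"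
      by (simp flip: mult_minus_r) (rule lin_eqI, (rule lin_rules | (rule lin_atom, simp; fail))+, simp)
    then have "y \<^bold>-\<^bsub>B\<^esub> x \<in> H" using n by (simp add: H_iff P_diff)
    ultimately have "P (x \<^bold>-\<^bsub>B\<^esub> y) \<ominus> P (y \<^bold>-\<^bsub>B\<^esub> x) \<in> M" by (intro M.I_minus MH)
    also have "P (x \<^bold>-\<^bsub>B\<^esub> y) \<ominus> P (y \<^bold>-\<^bsub>B\<^esub> x) = P x \<ominus> P y"
      using P_commute[of x y]
      by (simp add: P_diff) (rule lin_eqI, (rule lin_rules | (rule lin_atom, simp; fail))+, simp)
    finally show ?thesis .
  qed
  define P' where "P' U = M +> P (SOME x. x \<in> carrier B \<and> cl x = U)" for U
  define S' where "S' \<alpha> V = M +> S \<alpha> (SOME y. y \<in> \<I> \<alpha> \<and> cl y = V)" for \<alpha> V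
  have P': "P' (cl x) = M +> P x" if x: "x \<in> carrier B" for x
  proof -
    have "\<exists>u. u \<in> carrier B \<and> cl u = cl x" using x by blast
    from someI_ex[OF this] have "(SOME u. u \<in> carrier B \<and> cl u = cl x) \<in> carrier B"
      "cl (SOME u. u \<in> carrier B \<and> cl u = cl x) = cl x" by auto
    then show ?thesis using x diff by (simp add: P'_def M.coset_eq_iff)
  qed
  have S': "S' \<alpha> (cl y) = M +> S \<alpha> y" if \<alpha> [simp]: "\<alpha> \<in> labels B" and y [simp]: "y \<in> \<I> \<alpha>" for \<alpha> y
  proof -
    define z where "z = (SOME z. z \<in> \<I> \<alpha> \<and> cl z = cl y)"
    have "\<exists>z. z \<in> \<I> \<alpha> \<and> cl z = cl y" using y by blast
    from someI_ex[OF this] have [simp]: "z \<in> \<I> \<alpha>" and e: "cl z = cl y" by (auto simp: z_def)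
    have [simp]: "y \<in> carrier B" "z \<in> carrier B" using I_carrier[OF \<alpha>] by auto
    have [simp]: "z \<^bold>\<union>\<^bsub>B\<^esub> y \<in> \<I> \<alpha>" by (intro I_join) auto
    \<comment> \<open>The two candidates are restrictions of one partial isometry indexed by the
      join, so their difference is that isometry times P z - P y.\<close>
    have "S \<alpha> (z \<^bold>\<union>\<^bsub>B\<^esub> y) \<otimes> (P z \<ominus> P y) \<in> M" using diff[OF _ _ e] by simp
    then have "S \<alpha> z \<ominus> S \<alpha> y \<in> M"
      by (simp add: S_restrict B.join_meet_self B.join_meet_self2 flip: mult_minus_r)
    then show ?thesis by (simp add: S'_def M.coset_eq_iff flip: z_def)
  qed
  have 1: "\<forall>U\<in>carrier QB. P' U \<in> carrier ?C \<and> (P' U)\<^sup>\<star>\<^bsub>?C\<^esub> = P' U \<and> P' U \<otimes>\<^bsub>?C\<^esub> P' U = P' U"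
    by (auto simp: P')
  have K2: "S' \<alpha> (cl y) \<in> carrier ?C \<and> S' \<alpha> (cl y) \<otimes>\<^bsub>?C\<^esub> (S' \<alpha> (cl y))\<^sup>\<star>\<^bsub>?C\<^esub> \<otimes>\<^bsub>?C\<^esub> S' \<alpha> (cl y) = S' \<alpha> (cl y)"
    if "\<alpha> \<in> labels B" "y \<in> \<I> \<alpha>" for \<alpha> y
    using that I_carrier[OF that] by (simp add: S' mult_assoc S_S S_restrict)
  have 2: "\<forall>\<alpha>\<in>labels QB. \<forall>V\<in>cl ` \<I> \<alpha>. S' \<alpha> V \<in> carrier ?C
      \<and> S' \<alpha> V \<otimes>\<^bsub>?C\<^esub> (S' \<alpha> V)\<^sup>\<star>\<^bsub>?C\<^esub> \<otimes>\<^bsub>?C\<^esub> S' \<alpha> V = S' \<alpha> V"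
    unfolding QB_simps by (intro ballI; elim imageE; simp only: K2)
  have 3: "P' (bot_b QB) = \<zero>\<^bsub>?C\<^esub>" by (simp add: P')
  have 4: "\<forall>U\<in>carrier QB. \<forall>V\<in>carrier QB. P' (U \<^bold>\<inter>\<^bsub>QB\<^esub> V) = P' U \<otimes>\<^bsub>?C\<^esub> P' V"
    by (auto simp: P' P_meet)
  have 5: "\<forall>U\<in>carrier QB. \<forall>V\<in>carrier QB.
      P' (U \<^bold>\<union>\<^bsub>QB\<^esub> V) = P' U \<oplus>\<^bsub>?C\<^esub> P' V \<ominus>\<^bsub>?C\<^esub> P' (U \<^bold>\<inter>\<^bsub>QB\<^esub> V)"
    by (auto simp: P' P_join)
  have K6: "P' (cl x) \<otimes>\<^bsub>?C\<^esub> S' \<alpha> (cl y) = S' \<alpha> (cl y) \<otimes>\<^bsub>?C\<^esub> P' (act QB \<alpha> (cl x))"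
    if "x \<in> carrier B" "\<alpha> \<in> labels B" "y \<in> \<I> \<alpha>" for x \<alpha> y
    using that by (simp add: P' S' P_S)
  have 6: "\<forall>U\<in>carrier QB. \<forall>\<alpha>\<in>labels QB. \<forall>V\<in>cl ` \<I> \<alpha>.
      P' U \<otimes>\<^bsub>?C\<^esub> S' \<alpha> V = S' \<alpha> V \<otimes>\<^bsub>?C\<^esub> P' (act QB \<alpha> U)"
    unfolding QB_simps by (intro ballI; elim imageE; simp only: K6)
  have K7: "(S' \<alpha> (cl x))\<^sup>\<star>\<^bsub>?C\<^esub> \<otimes>\<^bsub>?C\<^esub> S' \<beta> (cl y) = (if \<alpha> = \<beta> then P' (cl x \<^bold>\<inter>\<^bsub>QB\<^esub> cl y) else \<zero>\<^bsub>?C\<^esub>)"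
    if "\<alpha> \<in> labels B" "x \<in> \<I> \<alpha>" "\<beta> \<in> labels B" "y \<in> \<I> \<beta>" for \<alpha> x \<beta> y
    using that I_carrier[OF that(1,2)] I_carrier[OF that(3,4)] by (simp add: P' S' S_S)
  have 7: "\<forall>\<alpha>\<in>labels QB. \<forall>U\<in>cl ` \<I> \<alpha>. \<forall>\<beta>\<in>labels QB. \<forall>V\<in>cl ` \<I> \<beta>.
      (S' \<alpha> U)\<^sup>\<star>\<^bsub>?C\<^esub> \<otimes>\<^bsub>?C\<^esub> S' \<beta> V = (if \<alpha> = \<beta> then P' (U \<^bold>\<inter>\<^bsub>QB\<^esub> V) else \<zero>\<^bsub>?C\<^esub>)"
    unfolding QB_simps by (intro ballI; elim imageE; simp only: K7)
  have 8: "P' U = (\<Oplus>\<^bsub>?C\<^esub>\<alpha>\<in>Delta QB U. S' \<alpha> (act QB \<alpha> U) \<otimes>\<^bsub>?C\<^esub> (S' \<alpha> (act QB \<alpha> U))\<^sup>\<star>\<^bsub>?C\<^esub>)"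
    if US: "U \<in> cl ` SN" for U
  proof -
    obtain x where x: "x \<in> SN" and U: "U = cl x" using US by blast
    have [simp]: "x \<in> carrier B" using x by (rule SN_carrier)
    have fin: "finite (quot_Delta B H x)" using x quot_regs_finite unfolding SN_iff by blast
    have lab: "\<alpha> \<in> labels B" if "\<alpha> \<in> quot_Delta B H x" for \<alpha> using that quot_Delta_labels by blast
    have "(\<Oplus>\<^bsub>?C\<^esub>\<alpha>\<in>Delta QB U. S' \<alpha> (act QB \<alpha> U) \<otimes>\<^bsub>?C\<^esub> (S' \<alpha> (act QB \<alpha> U))\<^sup>\<star>\<^bsub>?C\<^esub>)
        = (\<Oplus>\<^bsub>?C\<^esub>\<alpha>\<in>quot_Delta B H x. M +> rproj \<alpha> x)"
      unfolding U Delta_QB[OF \<open>x \<in> carrier B\<close>]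
      by (rule m.C.finsum_eqI) (auto simp: S' rproj_def lab)
    also have "\<dots> = M +> (\<Oplus>\<alpha>\<in>quot_Delta B H x. rproj \<alpha> x)"
      using fin lab by (intro m.hom_finsum[symmetric]) auto
    also have "\<dots> = P' U"
    proof -
      have c: "(\<Oplus>\<alpha>\<in>quot_Delta B H x. rproj \<alpha> x) \<in> carrier A" using lab by (intro finsum_in) auto
      have "P x \<ominus> (\<Oplus>\<alpha>\<in>quot_Delta B H x. rproj \<alpha> x) \<in> M"
        using MS[OF x] by (simp add: gap_proj_eq gap_def)
      then show ?thesis using c by (simp add: U P' M.coset_eq_iff[symmetric])
    qed
    finally show ?thesis by simp
  qed
  have "bds_rep QB (\<lambda>\<alpha>. cl ` \<I> \<alpha>) (cl ` SN) ?C P' S'"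
    unfolding bds_rep_def by (intro conjI 1 2 3 4 5 6 7 ballI 8)
  then show thesis using P' S' that by blast
qed

text \<open>Only relation (iv) asks for an argument, as x may see more labels than its class. The
  additional ones send x into H, and their partial isometries vanish in D.\<close>

lemma pullback_representation:
  assumes D: "cstar_algebra D" and r: "bds_rep QB (\<lambda>\<alpha>. cl ` \<I> \<alpha>) (cl ` SN) D q t"
  shows "bds_rep B \<I> \<J> D (\<lambda>x. q (cl x)) (\<lambda>\<alpha> y. t \<alpha> (cl y))"
proof -
  interpret D: bds_representation D QB "\<lambda>\<alpha>. cl ` \<I> \<alpha>" "cl ` SN" q t
    using QB_bds QB_sys D r by (intro bds_representation.intro bds_representation_axioms.intro)
  have 1: "\<forall>x\<in>carrier B. q (cl x) \<in> carrier D \<and> (q (cl x))\<^sup>\<star>\<^bsub>D\<^esub> = q (cl x) \<and> q (cl x) \<otimes>\<^bsub>D\<^esub> q (cl x) = q (cl x)"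
    by simp
  have 2: "\<forall>\<alpha>\<in>labels B. \<forall>y\<in>\<I> \<alpha>. t \<alpha> (cl y) \<in> carrier D
      \<and> t \<alpha> (cl y) \<otimes>\<^bsub>D\<^esub> (t \<alpha> (cl y))\<^sup>\<star>\<^bsub>D\<^esub> \<otimes>\<^bsub>D\<^esub> t \<alpha> (cl y) = t \<alpha> (cl y)"
    using r unfolding bds_rep_def by simp
  have 3: "q (cl \<^bold>\<emptyset>\<^bsub>B\<^esub>) = \<zero>\<^bsub>D\<^esub>" using D.P_bot by simp
  have "q (cl (x \<^bold>\<inter>\<^bsub>B\<^esub> y)) = q (cl x) \<otimes>\<^bsub>D\<^esub> q (cl y)" if "x \<in> carrier B" "y \<in> carrier B" for x y
    using D.P_meet[of "cl x" "cl y"] that by simp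
  then have 4: "\<forall>x\<in>carrier B. \<forall>y\<in>carrier B. q (cl (x \<^bold>\<inter>\<^bsub>B\<^esub> y)) = q (cl x) \<otimes>\<^bsub>D\<^esub> q (cl y)" by blast
  have "q (cl (x \<^bold>\<union>\<^bsub>B\<^esub> y)) = q (cl x) \<oplus>\<^bsub>D\<^esub> q (cl y) \<ominus>\<^bsub>D\<^esub> q (cl (x \<^bold>\<inter>\<^bsub>B\<^esub> y))"
    if "x \<in> carrier B" "y \<in> carrier B" for x y
    using D.P_join[of "cl x" "cl y"] that by simp
  then have 5: "\<forall>x\<in>carrier B. \<forall>y\<in>carrier B.
      q (cl (x \<^bold>\<union>\<^bsub>B\<^esub> y)) = q (cl x) \<oplus>\<^bsub>D\<^esub> q (cl y) \<ominus>\<^bsub>D\<^esub> q (cl (x \<^bold>\<inter>\<^bsub>B\<^esub> y))" by blast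
  have "q (cl x) \<otimes>\<^bsub>D\<^esub> t \<alpha> (cl y) = t \<alpha> (cl y) \<otimes>\<^bsub>D\<^esub> q (cl (act B \<alpha> x))"
    if "x \<in> carrier B" "\<alpha> \<in> labels B" "y \<in> \<I> \<alpha>" for x \<alpha> y
    using D.P_S[of "cl x" \<alpha> "cl y"] that by simp
  then have 6: "\<forall>x\<in>carrier B. \<forall>\<alpha>\<in>labels B. \<forall>y\<in>\<I> \<alpha>.
      q (cl x) \<otimes>\<^bsub>D\<^esub> t \<alpha> (cl y) = t \<alpha> (cl y) \<otimes>\<^bsub>D\<^esub> q (cl (act B \<alpha> x))" by blast
  have "(t \<alpha> (cl x))\<^sup>\<star>\<^bsub>D\<^esub> \<otimes>\<^bsub>D\<^esub> t \<beta> (cl y) = (if \<alpha> = \<beta> then q (cl (x \<^bold>\<inter>\<^bsub>B\<^esub> y)) else \<zero>\<^bsub>D\<^esub>)"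
    if "\<alpha> \<in> labels B" "x \<in> \<I> \<alpha>" "\<beta> \<in> labels B" "y \<in> \<I> \<beta>" for \<alpha> x \<beta> y
    using D.S_S[of \<alpha> "cl x" \<beta> "cl y"] that I_carrier[OF that(1,2)] I_carrier[OF that(3,4)] by simp
  then have 7: "\<forall>\<alpha>\<in>labels B. \<forall>x\<in>\<I> \<alpha>. \<forall>\<beta>\<in>labels B. \<forall>y\<in>\<I> \<beta>.
      (t \<alpha> (cl x))\<^sup>\<star>\<^bsub>D\<^esub> \<otimes>\<^bsub>D\<^esub> t \<beta> (cl y) = (if \<alpha> = \<beta> then q (cl (x \<^bold>\<inter>\<^bsub>B\<^esub> y)) else \<zero>\<^bsub>D\<^esub>)" by blast
  have 8: "q (cl x) = (\<Oplus>\<^bsub>D\<^esub>\<alpha>\<in>Delta B x. t \<alpha> (cl (act B \<alpha> x)) \<otimes>\<^bsub>D\<^esub> (t \<alpha> (cl (act B \<alpha> x)))\<^sup>\<star>\<^bsub>D\<^esub>)"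
    if x: "x \<in> \<J>" for x
  proof -
    note [simp] = J_facts(1)[OF x]
    have lab: "\<alpha> \<in> labels B" if "\<alpha> \<in> Delta B x" for \<alpha> using that by (simp add: Delta_def)
    have c: "t \<alpha> (cl (act B \<alpha> x)) \<in> carrier D" if "\<alpha> \<in> labels B" for \<alpha> using that by simp
    have "q (cl x) = (\<Oplus>\<^bsub>D\<^esub>\<alpha>\<in>quot_Delta B H x. t \<alpha> (act QB \<alpha> (cl x)) \<otimes>\<^bsub>D\<^esub> (t \<alpha> (act QB \<alpha> (cl x)))\<^sup>\<star>\<^bsub>D\<^esub>)"
      using D.P_sum[of "cl x"] J_SN[OF x] by (simp add: Delta_QB)
    also have "\<dots> = (\<Oplus>\<^bsub>D\<^esub>\<alpha>\<in>quot_Delta B H x. t \<alpha> (cl (act B \<alpha> x)) \<otimes>\<^bsub>D\<^esub> (t \<alpha> (cl (act B \<alpha> x)))\<^sup>\<star>\<^bsub>D\<^esub>)"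
      using quot_Delta_labels[of x] by (intro D.finsum_eqI) (auto simp: subset_iff c)
    also have "\<dots> = (\<Oplus>\<^bsub>D\<^esub>\<alpha>\<in>Delta B x. t \<alpha> (cl (act B \<alpha> x)) \<otimes>\<^bsub>D\<^esub> (t \<alpha> (cl (act B \<alpha> x)))\<^sup>\<star>\<^bsub>D\<^esub>)"
    proof (rule D.finsum_mono_neutral[OF J_facts(2)[OF x] quot_Delta_subset])
      fix \<alpha> assume a: "\<alpha> \<in> Delta B x - quot_Delta B H x"
      then have [simp]: "\<alpha> \<in> labels B" and h: "act B \<alpha> x \<in> H" by (auto simp: Delta_def quot_Delta_def)
      have "cl (act B \<alpha> x) = cl \<^bold>\<emptyset>\<^bsub>B\<^esub>" using h cl_eq_bot_iff[of "act B \<alpha> x"] by simp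
      then have "q (cl (act B \<alpha> x)) = \<zero>\<^bsub>D\<^esub>" using 3 by simp
      then have "t \<alpha> (cl (act B \<alpha> x)) = \<zero>\<^bsub>D\<^esub>" by (intro D.S_zero) auto
      then show "t \<alpha> (cl (act B \<alpha> x)) \<otimes>\<^bsub>D\<^esub> (t \<alpha> (cl (act B \<alpha> x)))\<^sup>\<star>\<^bsub>D\<^esub> = \<zero>\<^bsub>D\<^esub>" by simp
    qed (use c in \<open>auto simp: quot_Delta_def\<close>)
    finally show ?thesis .
  qed
  show ?thesis unfolding bds_rep_def by (intro conjI 1 2 3 4 5 6 7 ballI 8)
qed

text \<open>The gap of x is carried to the defect of relation (iv) at the class of x. This links the
  generators of K, and membership in \<open>SN\<close>, to the quotient system.\<close>

lemma hom_gap_proj: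
  assumes h: "star_hom A D \<psi>" and x: "x \<in> quot_regs B H"
    and P: "\<And>x. x \<in> carrier B \<Longrightarrow> \<psi> (P x) = q (cl x)"
    and S: "\<And>\<alpha> y. \<lbrakk>\<alpha> \<in> labels B; y \<in> \<I> \<alpha>\<rbrakk> \<Longrightarrow> \<psi> (S \<alpha> y) = t \<alpha> (cl y)"
  shows "\<psi> (gap_proj B A P S H x) = q (cl x) \<ominus>\<^bsub>D\<^esub>
    (\<Oplus>\<^bsub>D\<^esub>\<alpha>\<in>Delta QB (cl x). t \<alpha> (act QB \<alpha> (cl x)) \<otimes>\<^bsub>D\<^esub> (t \<alpha> (act QB \<alpha> (cl x)))\<^sup>\<star>\<^bsub>D\<^esub>)"
proof -
  interpret h: star_hom A D \<psi> by (rule h)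
  have [simp]: "x \<in> carrier B" using x by (rule quot_regs_carrier)
  have lab: "\<alpha> \<in> labels B" if "\<alpha> \<in> quot_Delta B H x" for \<alpha> using that quot_Delta_labels by blast
  have c: "(\<Oplus>\<alpha>\<in>quot_Delta B H x. rproj \<alpha> x) \<in> carrier A" using lab by (intro finsum_in) auto
  have "\<psi> (\<Oplus>\<alpha>\<in>quot_Delta B H x. rproj \<alpha> x) = (\<Oplus>\<^bsub>D\<^esub>\<alpha>\<in>quot_Delta B H x. \<psi> (rproj \<alpha> x))"
    using quot_regs_finite[OF x] lab by (intro h.hom_finsum) auto
  also have "\<dots> = (\<Oplus>\<^bsub>D\<^esub>\<alpha>\<in>Delta QB (cl x). t \<alpha> (act QB \<alpha> (cl x)) \<otimes>\<^bsub>D\<^esub> (t \<alpha> (act QB \<alpha> (cl x)))\<^sup>\<star>\<^bsub>D\<^esub>)"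
    unfolding Delta_QB[OF \<open>x \<in> carrier B\<close>]
    by (rule h.C.finsum_eqI[symmetric]) (use lab in \<open>auto simp: rproj_def h.hom_mult h.hom_adj simp flip: S\<close>)
  finally show ?thesis using c by (simp add: gap_proj_eq gap_def h.hom_minus P)
qed

end

section \<open>Homomorphisms and ideals controlled by generators\<close>

lemma rep_gens_hom_eq:
  assumes U: "cstar_gen A (rep_gens B \<I> P S) = carrier A" and r: "bds_rep B \<I> \<J> A P S"
    and f: "star_hom A C \<phi>" and g: "star_hom A C \<psi>"
    and P: "\<And>x. x \<in> carrier B \<Longrightarrow> \<phi> (P x) = \<psi> (P x)"
    and S: "\<And>\<alpha> y. \<lbrakk>\<alpha> \<in> labels B; y \<in> \<I> \<alpha>\<rbrakk> \<Longrightarrow> \<phi> (S \<alpha> y) = \<psi> (S \<alpha> y)"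
    and x: "x \<in> carrier A"
  shows "\<phi> x = \<psi> x"
  by (rule star_hom_eq_on_gens[OF f g U _ _ x])
    (use P S r in \<open>auto simp: rep_gens_def bds_rep_def\<close>)

lemma star_hom_comp:
  assumes "star_hom A C \<phi>" "star_hom C D \<psi>" shows "star_hom A D (\<lambda>x. \<psi> (\<phi> x))"
proof -
  interpret f: star_hom A C \<phi> by fact
  interpret g: star_hom C D \<psi> by fact
  show ?thesis using cstar_hom_comp[OF f.hom g.hom] by unfold_locales
qed

lemma cstar_ideal_vimage:
  assumes "star_hom A C \<phi>" "cstar_ideal M C" shows "cstar_ideal {x \<in> carrier A. \<phi> x \<in> M} A"
proof -
  interpret h: star_hom A C \<phi> by fact
  interpret M: closed_ideal C M using assms(2) by unfold_locales
  show ?thesis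
  proof (rule cstar_idealI[OF h.A.cstar_algebra_axioms])
    show "closedin (ctop A) {x \<in> carrier A. \<phi> x \<in> M}"
      unfolding h.A.closedin_approx_iff
    proof (intro conjI ballI impI)
      fix x assume [simp]: "x \<in> carrier A" and ap: "\<forall>\<epsilon>>0. \<exists>d\<in>{x \<in> carrier A. \<phi> x \<in> M}. nrm A (x \<ominus>\<^bsub>A\<^esub> d) < \<epsilon>"
      have "\<phi> x \<in> M"
      proof (rule M.I_approx)
        fix \<epsilon> :: real assume "\<epsilon> > 0"
        then obtain d where d: "d \<in> carrier A" "\<phi> d \<in> M" "nrm A (x \<ominus>\<^bsub>A\<^esub> d) < \<epsilon>" using ap by blast
        then have "nrm C (\<phi> x \<ominus>\<^bsub>C\<^esub> \<phi> d) < \<epsilon>"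
          using h.nrm_le[of "x \<ominus>\<^bsub>A\<^esub> d"] by (simp add: h.hom_minus)
        then show "\<exists>d\<in>M. nrm C (\<phi> x \<ominus>\<^bsub>C\<^esub> d) < \<epsilon>" using d by blast
      qed simp
      then show "x \<in> {x \<in> carrier A. \<phi> x \<in> M}" by simp
    qed auto
  qed (auto simp: h.hom_add h.hom_smult h.hom_mult)
qed

text \<open>Together with \<open>cstar_ideal_vimage\<close> this makes kernels closed
  ideals.\<close>

lemma (in cstar_algebra) zero_ideal: "cstar_ideal {\<zero>} A"
proof (rule cstar_idealI[OF cstar_algebra_axioms])
  show "closedin (ctop A) {\<zero>}"
    unfolding closedin_approx_iff
  proof (intro conjI ballI impI)
    fix x assume x: "x \<in> carrier A" and ap: "\<forall>\<epsilon>>0. \<exists>d\<in>{\<zero>}. nrm A (x \<ominus> d) < \<epsilon>"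
    have "nrm A x \<le> 0"
    proof (rule dense_ge)
      fix \<epsilon> :: real assume "0 < \<epsilon>" then show "nrm A x \<le> \<epsilon>" using ap x by (auto intro: less_imp_le)
    qed
    then show "x \<in> {\<zero>}" using x nrm_nonneg[OF x] by (simp add: nrm_eq_0 flip: order.eq_iff)
  qed auto
qed auto

lemma cstar_ideal_gen_ideal:
  assumes A: "cstar_algebra A" and U: "U \<subseteq> carrier A"
  shows "cstar_ideal (cstar_ideal_gen A U) A"
proof -
  interpret cstar_algebra A by (rule A)
  let ?F = "{I. cstar_ideal I A \<and> U \<subseteq> I}"
  have "cstar_ideal (carrier A) A"
    by (rule cstar_idealI[OF A]) (auto simp: closedin_approx_iff)
  then have ne: "carrier A \<in> ?F" using U by simp
  show ?thesis unfolding cstar_ideal_gen_def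
  proof (rule cstar_idealI[OF A])
    show "closedin (ctop A) (\<Inter>?F)"
      using ne by (intro closedin_Inter) (auto simp: cstar_ideal_def)
    have F: "additive_subgroup I A" "cstar_ideal I A" if "I \<in> ?F" for I
      using that by (auto simp: cstar_ideal_def)
    show "\<zero>\<^bsub>A\<^esub> \<in> \<Inter>?F" using F(1) by (intro InterI additive_subgroup.zero_closed)
    show "x \<oplus>\<^bsub>A\<^esub> y \<in> \<Inter>?F" if x: "x \<in> \<Inter>?F" "y \<in> \<Inter>?F" for x y
      using F(1) InterD[OF x(1)] InterD[OF x(2)] by (intro InterI additive_subgroup.a_closed)
    show "c \<odot>\<^bsub>A\<^esub> x \<in> \<Inter>?F" if x: "x \<in> \<Inter>?F" for c x
    proof (rule InterI)
      fix I assume I: "I \<in> ?F"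
      show "c \<odot>\<^bsub>A\<^esub> x \<in> I" using F(2)[OF I] InterD[OF x I] unfolding cstar_ideal_def by blast
    qed
    have "x \<otimes>\<^bsub>A\<^esub> a \<in> I \<and> a \<otimes>\<^bsub>A\<^esub> x \<in> I" if x: "x \<in> \<Inter>?F" and a: "a \<in> carrier A" and I: "I \<in> ?F" for x a I
      using F(2)[OF I] InterD[OF x I] a unfolding cstar_ideal_def by blast
    then show "x \<otimes>\<^bsub>A\<^esub> a \<in> \<Inter>?F" "a \<otimes>\<^bsub>A\<^esub> x \<in> \<Inter>?F" if "x \<in> \<Inter>?F" "a \<in> carrier A" for x a
      using that by (intro InterI; simp)+
  qed
qed

lemma cstar_ideal_gen_superset: "U \<subseteq> cstar_ideal_gen A U"
  by (auto simp: cstar_ideal_gen_def)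

lemma cstar_ideal_gen_least: "\<lbrakk>cstar_ideal I A; U \<subseteq> I\<rbrakk> \<Longrightarrow> cstar_ideal_gen A U \<subseteq> I"
  by (auto simp: cstar_ideal_gen_def)

section \<open>Comparison of Q with the quotients of A by K and by I\<close>

text \<open>One map, the composite of Q -> A / K and A / K -> A / I, serves for existence and for
  the equivalences. Conditions (1), (2) and (3) are each compared with its injectivity.\<close>

theorem proposition7p3:
  fixes B :: "('b, 'l) bds" and \<I> :: "'l \<Rightarrow> 'b set" and \<J> :: "'b set"
    and A :: "'a cstar_alg" and p :: "'b \<Rightarrow> 'a" and s :: "'l \<Rightarrow> 'b \<Rightarrow> 'a"
    and \<gamma> :: "complex \<Rightarrow> 'a \<Rightarrow> 'a" and I :: "'a set"
    and Q :: "'q cstar_alg" and q :: "'b set \<Rightarrow> 'q" and t :: "'l \<Rightarrow> 'b set \<Rightarrow> 'q"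
  assumes "rel_gbds B \<I> \<J>"
    and "universal_rep B \<I> \<J> A p s"
    and "gauge_action B \<I> A p s \<gamma>"
    and "cstar_ideal I A"
    and "universal_rep (quot_bds B (H_of B p I))
           (\<lambda>\<alpha>. qclass B (H_of B p I) ` \<I> \<alpha>)
           (qclass B (H_of B p I) ` S_of B A p s I) Q q t"
  shows "\<exists>\<phi>. cstar_hom Q (cstar_quot A I) \<phi>
    \<and> \<phi> ` carrier Q = carrier (cstar_quot A I)
    \<and> (\<forall>x\<in>carrier B. \<phi> (q (qclass B (H_of B p I) x)) = I +>\<^bsub>A\<^esub> p x)
    \<and> (\<forall>\<alpha>\<in>labels B. \<forall>y\<in>\<I> \<alpha>. \<phi> (t \<alpha> (qclass B (H_of B p I) y)) = I +>\<^bsub>A\<^esub> s \<alpha> y)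
    \<and> (gauge_invariant \<gamma> I \<longleftrightarrow> cstar_iso Q (cstar_quot A I) \<phi>)
    \<and> (cstar_iso Q (cstar_quot A I) \<phi> \<longleftrightarrow>
         I = ideal_of_pair B A p s (H_of B p I) (S_of B A p s I))"
proof -
  let ?H = "H_of B p I" and ?S = "S_of B A p s I"
  let ?K = "ideal_of_pair B A p s ?H ?S"
  let ?QB = "quot_bds B ?H" and ?cl = "qclass B ?H"
  have A: "cstar_algebra A" and rep: "bds_rep B \<I> \<J> A p s"
    and genA: "cstar_gen A (rep_gens B \<I> p s) = carrier A"
    using assms(2) by (auto simp: universal_rep_def)
  have Q: "cstar_algebra Q" and repQ: "bds_rep ?QB (\<lambda>\<alpha>. ?cl ` \<I> \<alpha>) (?cl ` ?S) Q q t"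
    and genQ: "cstar_gen Q (rep_gens ?QB (\<lambda>\<alpha>. ?cl ` \<I> \<alpha>) q t) = carrier Q"
    using assms(5) by (auto simp: universal_rep_def)
  have B: "bds B" using assms(1) by (simp add: rel_gbds_def)
  interpret R: representation_ideal A B \<I> \<J> p s I
    using A B assms(1,4) rep
    by (intro representation_ideal.intro bds_representation.intro bds_representation_axioms.intro
      closed_ideal.intro closed_ideal_axioms.intro)
  have sysQ: "rel_gbds ?QB (\<lambda>\<alpha>. ?cl ` \<I> \<alpha>) (?cl ` ?S)" by (rule R.QB_sys)
  interpret D: bds_representation Q ?QB "\<lambda>\<alpha>. ?cl ` \<I> \<alpha>" "?cl ` ?S" q t
    using R.QB_bds sysQ Q repQ by (intro bds_representation.intro bds_representation_axioms.intro)
  define G where "G = gap_proj B A p s ?H ` ?S"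
  have K_def: "?K = cstar_ideal_gen A G" by (simp add: ideal_of_pair_def G_def)
  have GI: "G \<subseteq> I" by (auto simp: G_def R.SN_iff)
  then have GA: "G \<subseteq> carrier A" by auto
  have Kid: "cstar_ideal ?K A" unfolding K_def by (rule cstar_ideal_gen_ideal[OF A GA])
  have KI: "?K \<subseteq> I" unfolding K_def using assms(4) GI by (rule cstar_ideal_gen_least)
  have GK: "G \<subseteq> ?K" unfolding K_def by (rule cstar_ideal_gen_superset)
  interpret K: closed_ideal A ?K using Kid by unfold_locales
  have KH: "p x \<in> ?K" if "x \<in> ?H" for x
    using R.H_SN[OF that] GK unfolding G_def by (metis imageI subsetD)
  have KS: "gap_proj B A p s ?H x \<in> ?K" if "x \<in> ?S" for x using that GK by (auto simp: G_def)
  obtain P' S' where "bds_rep ?QB (\<lambda>\<alpha>. ?cl ` \<I> \<alpha>) (?cl ` ?S) (cstar_quot A ?K) P' S'"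
    and P': "\<And>x. x \<in> carrier B \<Longrightarrow> P' (?cl x) = ?K +>\<^bsub>A\<^esub> p x"
    and S': "\<And>\<alpha> y. \<lbrakk>\<alpha> \<in> labels B; y \<in> \<I> \<alpha>\<rbrakk> \<Longrightarrow> S' \<alpha> (?cl y) = ?K +>\<^bsub>A\<^esub> s \<alpha> y"
    using R.quotient_representation[OF K.closed_ideal_axioms KH KS] by blast
  \<comment> \<open>The target is the quotient by K, because there an inverse can be built: the map
    \<psi> below, from A to Q, will factor through A / K.\<close>
  from universal_rep_lift[OF sysQ assms(5) K.quot_cstar_algebra this(1)] obtain \<phi>K
    where "cstar_hom Q (cstar_quot A ?K) \<phi>K"
    and \<phi>K: "\<And>U. U \<in> carrier ?QB \<Longrightarrow> \<phi>K (q U) = P' U"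
      "\<And>\<alpha> V. \<lbrakk>\<alpha> \<in> labels ?QB; V \<in> ?cl ` \<I> \<alpha>\<rbrakk> \<Longrightarrow> \<phi>K (t \<alpha> V) = S' \<alpha> V" by blast
  then interpret \<phi>K: star_hom Q "cstar_quot A ?K" \<phi>K
    using Q K.quot_cstar_algebra by (intro star_hom.intro star_hom_axioms.intro)
  have \<phi>Kp: "\<phi>K (q (?cl x)) = ?K +>\<^bsub>A\<^esub> p x" if "x \<in> carrier B" for x
    using that \<phi>K(1) P' by simp
  have \<phi>Ks: "\<phi>K (t \<alpha> (?cl y)) = ?K +>\<^bsub>A\<^esub> s \<alpha> y" if "\<alpha> \<in> labels B" "y \<in> \<I> \<alpha>" for \<alpha> y
    using that \<phi>K(2)[of \<alpha> "?cl y"] S' by simp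
  from universal_rep_lift[OF assms(1,2) Q R.pullback_representation[OF Q repQ]] obtain \<psi>
    where "cstar_hom A Q \<psi>" and \<psi>p: "\<And>x. x \<in> carrier B \<Longrightarrow> \<psi> (p x) = q (?cl x)"
      and \<psi>s: "\<And>\<alpha> y. \<lbrakk>\<alpha> \<in> labels B; y \<in> \<I> \<alpha>\<rbrakk> \<Longrightarrow> \<psi> (s \<alpha> y) = t \<alpha> (?cl y)" by blast
  then interpret \<psi>: star_hom A Q \<psi> using A Q by (intro star_hom.intro star_hom_axioms.intro)
  have \<psi>K: "\<psi> x = \<zero>\<^bsub>Q\<^esub>" if "x \<in> ?K" for x
  proof -
    have "\<psi> (gap_proj B A p s ?H x) = \<zero>\<^bsub>Q\<^esub>" if x: "x \<in> ?S" for x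
    proof -
      have "x \<in> quot_regs B ?H" using x by (simp only: R.SN_iff)
      from R.hom_gap_proj[OF \<psi>.star_hom_axioms this \<psi>p \<psi>s]
      have "\<psi> (gap_proj B A p s ?H x) = q (?cl x) \<ominus>\<^bsub>Q\<^esub> (\<Oplus>\<^bsub>Q\<^esub>\<alpha>\<in>Delta ?QB (?cl x).
          t \<alpha> (act ?QB \<alpha> (?cl x)) \<otimes>\<^bsub>Q\<^esub> (t \<alpha> (act ?QB \<alpha> (?cl x)))\<^sup>\<star>\<^bsub>Q\<^esub>)" .
      \<comment> \<open>The class of x belongs to the ideal at which relation (iv) is imposed in
        Q.\<close>
      also have "(\<Oplus>\<^bsub>Q\<^esub>\<alpha>\<in>Delta ?QB (?cl x).
          t \<alpha> (act ?QB \<alpha> (?cl x)) \<otimes>\<^bsub>Q\<^esub> (t \<alpha> (act ?QB \<alpha> (?cl x)))\<^sup>\<star>\<^bsub>Q\<^esub>) = q (?cl x)"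
        using D.P_sum[of "?cl x"] x by simp
      finally show ?thesis using R.SN_carrier[OF x] by simp
    qed
    then have "G \<subseteq> {x \<in> carrier A. \<psi> x \<in> {\<zero>\<^bsub>Q\<^esub>}}" using GA by (auto simp: G_def)
    \<comment> \<open>The kernel of \<psi> is a closed ideal containing the generators, hence
      contains K.\<close>
    then have "?K \<subseteq> {x \<in> carrier A. \<psi> x \<in> {\<zero>\<^bsub>Q\<^esub>}}" unfolding K_def
      by (intro cstar_ideal_gen_least cstar_ideal_vimage[OF \<psi>.star_hom_axioms] cstar_algebra.zero_ideal[OF Q])
    then show ?thesis using that by blast
  qed
  obtain \<eta> where "star_hom (cstar_quot A ?K) Q \<eta>" and \<eta>: "\<And>x. x \<in> carrier A \<Longrightarrow> \<eta> (?K +>\<^bsub>A\<^esub> x) = \<psi> x"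
    using K.hom_factor[OF \<psi>.star_hom_axioms \<psi>K] by blast
  have pc: "p x \<in> carrier A" if "x \<in> carrier B" for x using that by simp
  have \<phi>\<psi>: "\<phi>K (\<psi> x) = ?K +>\<^bsub>A\<^esub> x" if "x \<in> carrier A" for x
    by (rule rep_gens_hom_eq[OF genA rep star_hom_comp[OF \<psi>.star_hom_axioms \<phi>K.star_hom_axioms]
        K.quot_map_hom _ _ that]) (simp_all add: \<psi>p \<psi>s \<phi>Kp \<phi>Ks)
  have id: "star_hom Q Q (\<lambda>u. u)"
    using Q by (intro star_hom.intro star_hom_axioms.intro) (auto simp: cstar_hom_def)
  \<comment> \<open>On generators \<phi>K goes to cosets of the generators of A and \<eta> returns
    them through \<psi>; agreement on generators makes the composite the identity.\<close>
  have \<eta>\<phi>: "\<eta> (\<phi>K u) = u" if "u \<in> carrier Q" for u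
  proof (rule rep_gens_hom_eq[OF genQ repQ star_hom_comp[OF \<phi>K.star_hom_axioms \<open>star_hom _ Q \<eta>\<close>] id _ _ that])
    show "\<eta> (\<phi>K (q U)) = q U" if U: "U \<in> carrier ?QB" for U
    proof -
      obtain x where x: "x \<in> carrier B" "U = ?cl x" using U by auto
      then show ?thesis using \<eta>[OF pc[OF x(1)]] by (simp add: \<phi>Kp \<psi>p)
    qed
    show "\<eta> (\<phi>K (t \<alpha> V)) = t \<alpha> V" if V: "\<alpha> \<in> labels ?QB" "V \<in> ?cl ` \<I> \<alpha>" for \<alpha> V
    proof -
      obtain y where y: "\<alpha> \<in> labels B" "y \<in> \<I> \<alpha>" "V = ?cl y" using V by auto
      then show ?thesis using \<eta>[OF R.S_closed[OF y(1,2)]] by (simp add: \<phi>Ks \<psi>s)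
    qed
  qed
  have KI': "I +>\<^bsub>A\<^esub> x = \<zero>\<^bsub>cstar_quot A I\<^esub>" if "x \<in> ?K" for x
    using that KI R.N.quot_eq_zero_iff[of x] by (simp add: subset_iff)
  obtain \<theta> where "star_hom (cstar_quot A ?K) (cstar_quot A I) \<theta>"
    and \<theta>: "\<And>x. x \<in> carrier A \<Longrightarrow> \<theta> (?K +>\<^bsub>A\<^esub> x) = I +>\<^bsub>A\<^esub> x"
    using K.hom_factor[OF R.N.quot_map_hom KI'] by blast
  define \<phi> where "\<phi> u = \<theta> (\<phi>K u)" for u
  interpret \<phi>: star_hom Q "cstar_quot A I" \<phi>
    unfolding \<phi>_def by (rule star_hom_comp[OF \<phi>K.star_hom_axioms \<open>star_hom _ _ \<theta>\<close>])
  have \<phi>p: "\<phi> (q (?cl x)) = I +>\<^bsub>A\<^esub> p x" if "x \<in> carrier B" for x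
    using that \<theta>[OF pc[OF that]] by (simp add: \<phi>_def \<phi>Kp)
  have \<phi>s: "\<phi> (t \<alpha> (?cl y)) = I +>\<^bsub>A\<^esub> s \<alpha> y" if "\<alpha> \<in> labels B" "y \<in> \<I> \<alpha>" for \<alpha> y
    using \<theta>[OF R.S_closed[OF that]] \<phi>Ks[OF that] by (simp add: \<phi>_def)
  have \<phi>\<psi>I: "\<phi> (\<psi> x) = I +>\<^bsub>A\<^esub> x" if "x \<in> carrier A" for x
    using that by (simp add: \<phi>_def \<phi>\<psi> \<theta>)
  have surj: "\<phi> ` carrier Q = carrier (cstar_quot A I)"
  proof
    show "carrier (cstar_quot A I) \<subseteq> \<phi> ` carrier Q"
    proof
      fix U assume "U \<in> carrier (cstar_quot A I)"
      then obtain x where x: "x \<in> carrier A" "U = I +>\<^bsub>A\<^esub> x" by auto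
      then have "U = \<phi> (\<psi> x)" by (simp add: \<phi>\<psi>I)
      then show "U \<in> \<phi> ` carrier Q" using x by simp
    qed
  qed (use \<phi>.hom_closed in blast)
  have iso_iff: "cstar_iso Q (cstar_quot A I) \<phi> \<longleftrightarrow> inj_on \<phi> (carrier Q)"
    unfolding cstar_iso_def bij_betw_def using \<phi>.hom surj by blast
  have inj_K: "inj_on \<phi> (carrier Q) \<longleftrightarrow> I = ?K"
  proof
    assume inj: "inj_on \<phi> (carrier Q)"
    have "x \<in> ?K" if x: "x \<in> I" for x
    proof -
      have xc: "x \<in> carrier A" using x by simp
      have "\<phi> (\<psi> x) = \<phi> \<zero>\<^bsub>Q\<^esub>" using x xc by (simp add: \<phi>\<psi>I R.N.quot_eq_zero_iff)
      then have "\<psi> x = \<zero>\<^bsub>Q\<^esub>" using inj_onD[OF inj, of "\<psi> x" "\<zero>\<^bsub>Q\<^esub>"] xc by simp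
      then have "?K +>\<^bsub>A\<^esub> x = \<zero>\<^bsub>cstar_quot A ?K\<^esub>" using \<phi>\<psi>[OF xc] by simp
      then show ?thesis using xc K.quot_eq_zero_iff by simp
    qed
    then show "I = ?K" using KI by blast
  next
    assume IK: "I = ?K"
    show "inj_on \<phi> (carrier Q)"
    proof (rule inj_on_inverseI)
      fix u assume u: "u \<in> carrier Q"
      then obtain x where x: "x \<in> carrier A" "\<phi>K u = ?K +>\<^bsub>A\<^esub> x" using \<phi>K.hom_closed[OF u] by auto
      \<comment> \<open>For I = K the map \<theta> fixes every coset, so \<phi> agrees with \<phi>K
        at u and \<eta> inverts it.\<close>
      then have "\<phi> u = \<phi>K u" using \<theta>[OF x(1)] IK by (simp add: \<phi>_def)
      then show "\<eta> (\<phi> u) = u" using \<eta>\<phi>[OF u] by simp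
    qed
  qed
  have \<gamma>hom: "star_hom A A (\<gamma> z)" if "z \<in> sphere 0 1" for z
    using assms(3) that A
    by (intro star_hom.intro star_hom_axioms.intro) (auto simp: gauge_action_def cstar_iso_def)
  have \<gamma>p: "\<gamma> z (p x) = p x" if "z \<in> sphere 0 1" "x \<in> carrier B" for z x
    using assms(3) that by (simp add: gauge_action_def)
  have \<gamma>s: "\<gamma> z (s \<alpha> y) = z \<odot>\<^bsub>A\<^esub> s \<alpha> y" if "z \<in> sphere 0 1" "\<alpha> \<in> labels B" "y \<in> \<I> \<alpha>" for z \<alpha> y
    using assms(3) that by (simp add: gauge_action_def)
  have gauge_K: "gauge_invariant \<gamma> I" if IK: "I = ?K"
    unfolding gauge_invariant_def
  proof
    fix z :: complex assume z: "z \<in> sphere 0 1"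
    interpret g: star_hom A A "\<gamma> z" by (rule \<gamma>hom[OF z])
    have zz: "cnj z * z = 1" using z complex_norm_square[of z] by (simp add: mult.commute)
    have "\<gamma> z (gap_proj B A p s ?H x) = gap_proj B A p s ?H x" if x: "x \<in> ?S" for x
    proof -
      have xr: "x \<in> quot_regs B ?H" using x by (simp only: R.SN_iff)
      have xc: "x \<in> carrier B" using xr by (rule R.quot_regs_carrier)
      have lab: "\<alpha> \<in> labels B" if "\<alpha> \<in> quot_Delta B ?H x" for \<alpha> using that R.quot_Delta_labels by blast
      \<comment> \<open>A partial isometry picks up z and its adjoint picks up the conjugate of z,
        so their product is fixed.\<close>
      have r: "\<gamma> z (R.rproj \<alpha> x) = R.rproj \<alpha> x" if \<alpha>: "\<alpha> \<in> labels B" for \<alpha>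
        using \<gamma>s[OF z \<alpha> R.act_I[OF \<alpha> xc]] \<alpha> xc zz
        by (simp add: R.rproj_def g.hom_mult g.hom_adj R.adj_smult R.smult_mult_l R.smult_mult_r mult.commute
          flip: R.smult_mult_c)
      have "\<gamma> z (\<Oplus>\<^bsub>A\<^esub>\<alpha>\<in>quot_Delta B ?H x. R.rproj \<alpha> x) = (\<Oplus>\<^bsub>A\<^esub>\<alpha>\<in>quot_Delta B ?H x. \<gamma> z (R.rproj \<alpha> x))"
        using R.quot_regs_finite[OF xr] lab xc by (intro g.hom_finsum) auto
      also have "\<dots> = (\<Oplus>\<^bsub>A\<^esub>\<alpha>\<in>quot_Delta B ?H x. R.rproj \<alpha> x)"
        using lab xc r by (intro R.finsum_eqI) auto
      finally have e: "\<gamma> z (\<Oplus>\<^bsub>A\<^esub>\<alpha>\<in>quot_Delta B ?H x. R.rproj \<alpha> x) = (\<Oplus>\<^bsub>A\<^esub>\<alpha>\<in>quot_Delta B ?H x. R.rproj \<alpha> x)" .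
      have c: "(\<Oplus>\<^bsub>A\<^esub>\<alpha>\<in>quot_Delta B ?H x. R.rproj \<alpha> x) \<in> carrier A" using lab xc by (intro R.finsum_in) auto
      show ?thesis using c xc e \<gamma>p[OF z xc] by (simp add: R.gap_proj_eq R.gap_def g.hom_minus)
    qed
    \<comment> \<open>The preimage of K under \<gamma> z is a closed ideal, so containing the
      generators suffices.\<close>
    then have "G \<subseteq> {x \<in> carrier A. \<gamma> z x \<in> ?K}" using GA GK by (auto simp: G_def)
    then have "?K \<subseteq> {x \<in> carrier A. \<gamma> z x \<in> ?K}"
      unfolding K_def[symmetric] using cstar_ideal_gen_least[OF cstar_ideal_vimage[OF g.star_hom_axioms Kid]]
      by (simp add: K_def)
    then show "\<gamma> z ` I \<subseteq> I" using IK by blast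
  qed
  have inj_gauge: "inj_on \<phi> (carrier Q)" if inv: "gauge_invariant \<gamma> I"
  proof -
    have "\<exists>\<delta>. star_hom (cstar_quot A I) (cstar_quot A I) \<delta>
        \<and> (\<forall>x\<in>carrier A. \<delta> (I +>\<^bsub>A\<^esub> x) = I +>\<^bsub>A\<^esub> \<gamma> z x)" if z: "z \<in> sphere 0 1" for z
    proof -
      interpret g: star_hom A A "\<gamma> z" by (rule \<gamma>hom[OF z])
      have "I +>\<^bsub>A\<^esub> \<gamma> z x = \<zero>\<^bsub>cstar_quot A I\<^esub>" if x: "x \<in> I" for x
      proof -
        have "\<gamma> z x \<in> I" using inv z x unfolding gauge_invariant_def by blast
        then show ?thesis using R.N.quot_eq_zero_iff[of "\<gamma> z x"] by simp
      qed
      then obtain \<delta> where d: "star_hom (cstar_quot A I) (cstar_quot A I) \<delta>"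
        and e: "\<And>x. x \<in> carrier A \<Longrightarrow> \<delta> (I +>\<^bsub>A\<^esub> x) = I +>\<^bsub>A\<^esub> \<gamma> z x"
        using R.N.hom_factor[OF star_hom_comp[OF g.star_hom_axioms R.N.quot_map_hom]] by metis
      show ?thesis using e by (intro exI[of _ \<delta>] conjI d ballI)
    qed
    then obtain \<delta> where \<delta>: "\<And>z. z \<in> sphere 0 1 \<Longrightarrow> star_hom (cstar_quot A I) (cstar_quot A I) (\<delta> z)"
      "\<And>z x. \<lbrakk>z \<in> sphere 0 1; x \<in> carrier A\<rbrakk> \<Longrightarrow> \<delta> z (I +>\<^bsub>A\<^esub> x) = I +>\<^bsub>A\<^esub> \<gamma> z x" by metis
    \<comment> \<open>The uniqueness argument is run for \<phi> itself, with Q as source and the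
      descended gauge maps on A / I.\<close>
    interpret W: gauge_representation Q ?QB "\<lambda>\<alpha>. ?cl ` \<I> \<alpha>" "?cl ` ?S" q t "cstar_quot A I" \<phi> \<delta>
    proof (intro gauge_representation.intro gauge_representation_axioms.intro)
      show "\<delta> z (\<phi> (q U)) = \<phi> (q U)" if z: "z \<in> sphere 0 1" and U: "U \<in> carrier ?QB" for z U
      proof -
        obtain x where x: "x \<in> carrier B" "U = ?cl x" using U by auto
        then show ?thesis using \<delta>(2)[OF z pc[OF x(1)]] \<gamma>p[OF z] by (simp add: \<phi>p)
      qed
      show "\<delta> z (\<phi> (t \<alpha> V)) = z \<odot>\<^bsub>cstar_quot A I\<^esub> \<phi> (t \<alpha> V)"
        if z: "z \<in> sphere 0 1" and V: "\<alpha> \<in> labels ?QB" "V \<in> ?cl ` \<I> \<alpha>" for z \<alpha> V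
      proof -
        obtain y where y: "\<alpha> \<in> labels B" "y \<in> \<I> \<alpha>" "V = ?cl y" using V by auto
        then show ?thesis using \<delta>(2)[OF z R.S_closed[OF y(1,2)]] \<gamma>s[OF z y(1,2)] by (simp add: \<phi>s)
      qed
      \<comment> \<open>By definition H consists of the elements whose projections lie in I, and its
        classes are the bottom class.\<close>
      show "U = bot_b ?QB" if U: "U \<in> carrier ?QB" and z: "\<phi> (q U) = \<zero>\<^bsub>cstar_quot A I\<^esub>" for U
      proof -
        obtain x where x: "x \<in> carrier B" "U = ?cl x" using U by auto
        then have "p x \<in> I" using z R.N.quot_eq_zero_iff[OF pc[OF x(1)]] by (simp add: \<phi>p)
        then show ?thesis using x R.cl_eq_bot_iff[OF x(1)] by (simp add: R.H_iff)
      qed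
      show "U \<in> ?cl ` ?S" if U: "U \<in> regs ?QB" and z: "\<phi> (D.gap (Delta ?QB U) U) = \<zero>\<^bsub>cstar_quot A I\<^esub>" for U
      proof -
        obtain x where xc: "x \<in> carrier B" and Ux: "U = ?cl x" using U by (auto simp: regs_def)
        have xr: "x \<in> quot_regs B ?H" using xc U by (simp add: quot_regs_def Ux)
        have gc: "gap_proj B A p s ?H x \<in> carrier A"
          using R.gap_closed[OF R.quot_regs_finite[OF xr] R.quot_Delta_labels xc] by (simp add: R.gap_proj_eq)
        \<comment> \<open>The gap in Q comes from a gap in A. Its vanishing under \<phi> puts the
          latter into I, which is the defining condition for x to lie in S.\<close>
        have "\<psi> (gap_proj B A p s ?H x) = D.gap (Delta ?QB U) U"
          using R.hom_gap_proj[OF \<psi>.star_hom_axioms xr \<psi>p \<psi>s] by (simp add: D.gap_def D.rproj_def Ux)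
        then have "I +>\<^bsub>A\<^esub> gap_proj B A p s ?H x = \<zero>\<^bsub>cstar_quot A I\<^esub>" using z \<phi>\<psi>I[OF gc] by simp
        then have "gap_proj B A p s ?H x \<in> I" using R.N.quot_eq_zero_iff[OF gc] by simp
        then show ?thesis using xr Ux unfolding S_of_def by blast
      qed
    qed (use \<delta> genQ D.bds_representation_axioms \<phi>.star_hom_axioms in auto)
    show ?thesis
    proof (rule inj_onI)
      fix u v assume uv: "u \<in> carrier Q" "v \<in> carrier Q" "\<phi> u = \<phi> v"
      have "\<phi> (u \<ominus>\<^bsub>Q\<^esub> v) = \<phi> v \<ominus>\<^bsub>cstar_quot A I\<^esub> \<phi> v" using uv by (simp add: \<phi>.hom_minus)
      also have "\<dots> = \<zero>\<^bsub>cstar_quot A I\<^esub>"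
        by (rule cstar_algebra.minus_self[OF R.N.quot_cstar_algebra \<phi>.hom_closed[OF uv(2)]])
      finally have "\<phi> (u \<ominus>\<^bsub>Q\<^esub> v) = \<zero>\<^bsub>cstar_quot A I\<^esub>" .
      then have "nrm Q (u \<ominus>\<^bsub>Q\<^esub> v) \<le> 0" using W.isometric[of "u \<ominus>\<^bsub>Q\<^esub> v"] uv by simp
      then have "nrm Q (u \<ominus>\<^bsub>Q\<^esub> v) = 0" using uv by (intro antisym) auto
      then show "u = v" using uv by (simp add: D.nrm_eq_0 D.minus_eq_zero_iff)
    qed
  qed
  have "gauge_invariant \<gamma> I \<longleftrightarrow> cstar_iso Q (cstar_quot A I) \<phi>"
    using iso_iff inj_K gauge_K inj_gauge by blast
  moreover have "cstar_iso Q (cstar_quot A I) \<phi> \<longleftrightarrow> I = ?K" using iso_iff inj_K by blast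
  ultimately show ?thesis using \<phi>.hom surj by (intro exI[of _ \<phi>] conjI ballI \<phi>p \<phi>s)
qed

end
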